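(* Let $K$ be a field, $E$ a directed graph and $P$ an ideal of $L_K(E)$. The following conditions are equivalent. (1) The ideal $P$ is primitive. (2) Exactly one of the following holds. (a) $P=I(H,B_H)+\langle f(c)\rangle$ where $c$ is an exclusive cycle, $E^0-H=R(c^0)$, and $f$ is an irreducible polynomial in $K[x,x^{-1}]$. (b) Exactly one of the following conditions holds: (b1) $P=I(H,B_H)$ where $H=E^0-R(\alpha^0)$ for a strictly decreasing infinite path $\alpha$ such that $R(v)\subsetneq R(\alpha^0)$ for all $v\in E^0-H$; (b2) $P=I(H,B_H)$ where $H=E^0-R(v)$ for a vertex $v$ which emits no edges to $E^0-H$; (b3) $P=I(H,S)$ where $H=E^0-R(v)$ for a vertex $v$ which is on a cycle extreme in $E^0-H$, and $S=B_H$ or $S=B_H-\{u\}$ for some $u\in B_H$ which is on the same cycle as $v$; (b4) $P=I(H,S)$ where $H=E^0-R(v)$ for a vertex $v$ which is on an exclusive cycle, and $S=B_H-\{u\}$ for some $u\in B_H$ which is on the same cycle as $v$.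
   Context: Graphs. A directed graph $E$ has vertex set $E^0$, edge set $E^1$ and source and range maps $\mathbf s,\mathbf r:E^1\to E^0$ (arbitrary cardinalities). A sink emits no edges; an infinite emitter emits infinitely many edges; a vertex is regular if it is neither. A path is a vertex (length $0$) or a finite sequence $e_1\cdots e_n$ of edges with $\mathbf r(e_i)=\mathbf s(e_{i+1})$; $p^0$ is the set of vertices on $p$. A cycle is a path of positive length with equal source and range such that different edges in it have different sources (cycles differing by the choice of the starting vertex are identified). An exit of a cycle is an edge outside of the cycle emitted by a vertex of the cycle. A cycle $c$ is exclusive if no vertex of $c$ is on a cycle distinct from $c$. For $V\subseteq E^0$, a cycle $c$ is extreme in $V$ if $c^0\subseteq V$, $c$ has an exit with range in $V$, and for every path $p$ with $\mathbf s(p)\in c^0$ and $p^0\subseteq V$ there is a path $q$ with $q^0\subseteq V$, $\mathbf s(q)=\mathbf r(p)$, $\mathbf r(q)\in c^0$. Write $u\ge v$ if there is a path from $u$ to $v$, and $u\gneq v$ if $u\ge v$ but not $v\ge u$. $R(V)=\{u\in E^0\mid u\ge v\text{ for some }v\in V\}$ and $R(v)=R(\{v\})$. An infinite path is a sequence $\alpha=e_1e_2\cdots$ of edges with $\mathbf r(e_n)=\mathbf s(e_{n+1})$; $\alpha^0$ is its vertex set; $\alpha$ is strictly decreasing if $\alpha=p_1p_2\cdots$ for paths $p_n$ with $\mathbf s(p_1)\gneq\mathbf s(p_2)\gneq\cdots$. Leavitt path algebra. $L_K(E)$ is the $K$-algebra generated by $E^0\cup E^1\cup\{e^*\mid e\in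 E^1\}$ with relations: $vw=\delta_{v,w}v$; $\mathbf s(e)e=e\mathbf r(e)=e$; $\mathbf r(e)e^*=e^*\mathbf s(e)=e^*$; $e^*f=\delta_{e,f}\mathbf r(e)$; $v=\sum_{e\in\mathbf s^{-1}(v)}ee^*$ for each regular $v$. "Ideal" means two-sided ideal and $\langle\cdot\rangle$ denotes the generated ideal. For a cycle $c$ considered as a closed path at a chosen $v\in c^0$ and $f=\sum_n k_nx^n\in K[x,x^{-1}]$, $f(c)=\sum_n k_nc^n$ where the zeroth power of $c$ is $v$ and $c^{-n}=(c^* )^n$ for $n>0$. Ideals $I(H,S)$. $H\subseteq E^0$ is hereditary if $u\in H$, $u\ge v$ imply $v\in H$, and saturated if $v\in H$ for every regular $v$ with $\mathbf r(\mathbf s^{-1}(v))\subseteq H$ (sets $E^0-R(V)$ are such). For such $H$, $B_H$ is the set of infinite emitters $v\in E^0-H$ such that $\mathbf s^{-1}(v)\cap\mathbf r^{-1}(E^0-H)$ is nonempty and finite; for $v\in B_H$, $v^H=v-\sum ee^*$ with the sum over $e\in\mathbf s^{-1}(v)\cap\mathbf r^{-1}(E^0-H)$. For $S\subseteq B_H$, $I(H,S)$ is the ideal generated by $H\cup\{v^H\mid v\in S\}$. A ring $R$ is left primitive if it has a simple left module $M$ (with $RM\neq0$) with zero annihilator; right primitive is defined similarly; primitive means left and right primitive. An ideal $P$ is primitive if the ring $L_K(E)/P$ is primitive.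
   Formalization: H is explicitly required to be hereditary and saturated; this matters only in (b2), where it excludes regular v: for the graph v→w, H=E^0-R(v)={w} is not saturated and I(H,B_H) would be all of L_K(E), which is not primitive. *)

theory Defs
  imports
    "HOL-Algebra.QuotRing"
    "HOL-Algebra.Module"
    "HOL-Library.Poly_Mapping"
    "HOL-Computational_Algebra.Factorial_Ring"
    "Graph_Theory.Arc_Walk"
begin

hide_const (open) Multiset.mult  \<comment> \<open>shadows the record field of HOL-Algebra\<close>

text \<open>
  Graphs are the digraphs \<^typ>\<open>('v, 'e) pre_digraph\<close> of \<^theory>\<open>Graph_Theory.Digraph\<close> subject to
  \<^locale>\<open>wf_digraph\<close>; \<^const>\<open>tail\<close> is the source map and \<^const>\<open>head\<close> the range map.
  A path from \<open>u\<close> to \<open>v\<close> is an arc walk \<open>pre_digraph.awalk E u p v\<close>, the empty list being the path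
  of length 0, and its set of vertices is \<open>set (pre_digraph.awalk_verts E u p)\<close>.
  A cycle is a list \<open>c\<close> with \<open>pre_digraph.cycle E c\<close>.  Such a list carries a base vertex
  \<open>tail E (hd c)\<close>; cycles differing only by the base vertex are rotations of each other.
\<close>

section \<open>Graphs\<close>

definition regular_vertex :: "('v, 'e) pre_digraph \<Rightarrow> 'v \<Rightarrow> bool" where
  "regular_vertex E v \<longleftrightarrow> v \<in> verts E \<and> out_arcs E v \<noteq> {} \<and> finite (out_arcs E v)"

definition infinite_emitter :: "('v, 'e) pre_digraph \<Rightarrow> 'v \<Rightarrow> bool" where
  "infinite_emitter E v \<longleftrightarrow> v \<in> verts E \<and> infinite (out_arcs E v)"

definition path_geq :: "('v, 'e) pre_digraph \<Rightarrow> 'v \<Rightarrow> 'v \<Rightarrow> bool" where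
  "path_geq E u v \<longleftrightarrow> (\<exists>p. pre_digraph.awalk E u p v)"

definition path_gt :: "('v, 'e) pre_digraph \<Rightarrow> 'v \<Rightarrow> 'v \<Rightarrow> bool" where
  "path_gt E u v \<longleftrightarrow> path_geq E u v \<and> \<not> path_geq E v u"

definition root_set :: "('v, 'e) pre_digraph \<Rightarrow> 'v set \<Rightarrow> 'v set" where
  "root_set E V = {u \<in> verts E. \<exists>v\<in>V. path_geq E u v}"

definition cycle_verts :: "('v, 'e) pre_digraph \<Rightarrow> 'e list \<Rightarrow> 'v set" where
  "cycle_verts E c = set (pre_digraph.awalk_verts E (tail E (hd c)) c)"

definition exclusive_cycle :: "('v, 'e) pre_digraph \<Rightarrow> 'e list \<Rightarrow> bool" where
  "exclusive_cycle E c \<longleftrightarrow> pre_digraph.cycle E c \<and>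
     (\<forall>d. pre_digraph.cycle E d \<and> cycle_verts E c \<inter> cycle_verts E d \<noteq> {} \<longrightarrow> (\<exists>n. d = rotate n c))"

definition exit_of :: "('v, 'e) pre_digraph \<Rightarrow> 'e list \<Rightarrow> 'e \<Rightarrow> bool" where
  "exit_of E c e \<longleftrightarrow> e \<in> arcs E \<and> e \<notin> set c \<and> tail E e \<in> cycle_verts E c"

definition extreme_cycle :: "('v, 'e) pre_digraph \<Rightarrow> 'v set \<Rightarrow> 'e list \<Rightarrow> bool" where
  "extreme_cycle E V c \<longleftrightarrow> pre_digraph.cycle E c \<and> cycle_verts E c \<subseteq> V \<and>
     (\<exists>e. exit_of E c e \<and> head E e \<in> V) \<and>
     (\<forall>u p w. u \<in> cycle_verts E c \<and> pre_digraph.awalk E u p w \<and>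
          set (pre_digraph.awalk_verts E u p) \<subseteq> V \<longrightarrow>
        (\<exists>q x. pre_digraph.awalk E w q x \<and> set (pre_digraph.awalk_verts E w q) \<subseteq> V \<and>
           x \<in> cycle_verts E c))"

definition infinite_path :: "('v, 'e) pre_digraph \<Rightarrow> (nat \<Rightarrow> 'e) \<Rightarrow> bool" where
  "infinite_path E \<alpha> \<longleftrightarrow> (\<forall>n. \<alpha> n \<in> arcs E \<and> head E (\<alpha> n) = tail E (\<alpha> (Suc n)))"

text \<open>The range of each edge is the source of the next, so the sources exhaust the vertices.\<close>

definition infinite_path_verts :: "('v, 'e) pre_digraph \<Rightarrow> (nat \<Rightarrow> 'e) \<Rightarrow> 'v set" where
  "infinite_path_verts E \<alpha> = range (\<lambda>n. tail E (\<alpha> n))"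

text \<open>
  A factorisation \<open>\<alpha> = p\<^sub>0 p\<^sub>1 \<dots>\<close> is given by the positions \<open>k 0 = 0 < k 1 < \<dots>\<close> at which the
  factors start.  Factors of length 0 cannot occur, as consecutive sources must differ.
\<close>

definition strictly_decreasing :: "('v, 'e) pre_digraph \<Rightarrow> (nat \<Rightarrow> 'e) \<Rightarrow> bool" where
  "strictly_decreasing E \<alpha> \<longleftrightarrow> (\<exists>k :: nat \<Rightarrow> nat. strict_mono k \<and> k 0 = 0 \<and>
     (\<forall>n. path_gt E (tail E (\<alpha> (k n))) (tail E (\<alpha> (k (Suc n))))))"

definition hereditary :: "('v, 'e) pre_digraph \<Rightarrow> 'v set \<Rightarrow> bool" where
  "hereditary E H \<longleftrightarrow> H \<subseteq> verts E \<and> (\<forall>u v. u \<in> H \<and> path_geq E u v \<longrightarrow> v \<in> H)"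

definition saturated :: "('v, 'e) pre_digraph \<Rightarrow> 'v set \<Rightarrow> bool" where
  "saturated E H \<longleftrightarrow> H \<subseteq> verts E \<and> (\<forall>v. regular_vertex E v \<and> head E ` out_arcs E v \<subseteq> H \<longrightarrow> v \<in> H)"

text \<open>
  The complement of \<open>root_set E V\<close> is always hereditary, but not always saturated: if \<open>v\<close> is regular,
  emits edges only outside of \<open>root_set E {v}\<close> and \<open>V = {v}\<close>, then saturation forces \<open>v\<close> itself in.
  The ideals \<open>I(H, S)\<close> are only considered for \<open>H\<close> which is both.
\<close>

definition arcs_outside :: "('v, 'e) pre_digraph \<Rightarrow> 'v set \<Rightarrow> 'v \<Rightarrow> 'e set" where
  "arcs_outside E H v = {e \<in> out_arcs E v. head E e \<in> verts E - H}"

definition breaking_vertices :: "('v, 'e) pre_digraph \<Rightarrow> 'v set \<Rightarrow> 'v set" where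
  "breaking_vertices E H = {v \<in> verts E - H. infinite_emitter E v \<and>
     arcs_outside E H v \<noteq> {} \<and> finite (arcs_outside E H v)}"


section \<open>Rings without unit, ideals and primitivity\<close>

text \<open>
  Leavitt path algebras of graphs with infinitely many vertices have no unit, so the locales
  \<^locale>\<open>ring\<close> and \<^locale>\<open>ideal\<close> do not apply.  We use the records and the quotient
  \<^const>\<open>FactRing\<close> of HOL-Algebra; their \<^const>\<open>one\<close> field is never used.
\<close>

definition two_sided_ideal :: "'a set \<Rightarrow> ('a, 'm) ring_scheme \<Rightarrow> bool" where
  "two_sided_ideal I R \<longleftrightarrow> additive_subgroup I R \<and>
     (\<forall>a\<in>I. \<forall>x\<in>carrier R. x \<otimes>\<^bsub>R\<^esub> a \<in> I \<and> a \<otimes>\<^bsub>R\<^esub> x \<in> I)"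

definition ideal_gen :: "('a, 'm) ring_scheme \<Rightarrow> 'a set \<Rightarrow> 'a set" where
  "ideal_gen R S = \<Inter>{I. two_sided_ideal I R \<and> S \<subseteq> I}"

lemma two_sided_ideal_iff_ideal:
  assumes "ring R"
  shows "two_sided_ideal I R \<longleftrightarrow> ideal I R"
  using assms unfolding two_sided_ideal_def ideal_def ideal_axioms_def by auto

text \<open>The multiplication of \<open>M\<close> plays no role in the following.\<close>

definition left_module :: "('r, 'a) ring_scheme \<Rightarrow> ('r, 'm, 'b) module_scheme \<Rightarrow> bool" where
  "left_module R M \<longleftrightarrow> abelian_group M \<and>
     (\<forall>r\<in>carrier R. \<forall>x\<in>carrier M. r \<odot>\<^bsub>M\<^esub> x \<in> carrier M) \<and>
     (\<forall>r\<in>carrier R. \<forall>s\<in>carrier R. \<forall>x\<in>carrier M.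
        (r \<oplus>\<^bsub>R\<^esub> s) \<odot>\<^bsub>M\<^esub> x = r \<odot>\<^bsub>M\<^esub> x \<oplus>\<^bsub>M\<^esub> s \<odot>\<^bsub>M\<^esub> x) \<and>
     (\<forall>r\<in>carrier R. \<forall>x\<in>carrier M. \<forall>y\<in>carrier M.
        r \<odot>\<^bsub>M\<^esub> (x \<oplus>\<^bsub>M\<^esub> y) = r \<odot>\<^bsub>M\<^esub> x \<oplus>\<^bsub>M\<^esub> r \<odot>\<^bsub>M\<^esub> y) \<and>
     (\<forall>r\<in>carrier R. \<forall>s\<in>carrier R. \<forall>x\<in>carrier M.
        (r \<otimes>\<^bsub>R\<^esub> s) \<odot>\<^bsub>M\<^esub> x = r \<odot>\<^bsub>M\<^esub> (s \<odot>\<^bsub>M\<^esub> x))"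

definition simple_left_module :: "('r, 'a) ring_scheme \<Rightarrow> ('r, 'm, 'b) module_scheme \<Rightarrow> bool" where
  "simple_left_module R M \<longleftrightarrow> left_module R M \<and>
     (\<exists>r\<in>carrier R. \<exists>x\<in>carrier M. r \<odot>\<^bsub>M\<^esub> x \<noteq> \<zero>\<^bsub>M\<^esub>) \<and>
     (\<forall>N. submodule N R M \<longrightarrow> N = {\<zero>\<^bsub>M\<^esub>} \<or> N = carrier M)"

definition left_annihilator :: "('r, 'a) ring_scheme \<Rightarrow> ('r, 'm, 'b) module_scheme \<Rightarrow> 'r set" where
  "left_annihilator R M = {r \<in> carrier R. \<forall>x\<in>carrier M. r \<odot>\<^bsub>M\<^esub> x = \<zero>\<^bsub>M\<^esub>}"

text \<open>
  The existential quantifier can range over one type only.  Choosing \<^typ>\<open>'r set\<close> loses nothing: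
  a simple module is isomorphic to a quotient of \<open>R\<close> by a left ideal.
  Lemma \<open>left_primitive_if_simple_faithful\<close> below proves this.
\<close>

definition left_primitive :: "('r, 'a) ring_scheme \<Rightarrow> bool" where
  "left_primitive R \<longleftrightarrow> (\<exists>M :: ('r, 'r set) module.
     simple_left_module R M \<and> left_annihilator R M = {\<zero>\<^bsub>R\<^esub>})"

lemma left_primitive_if_simple_faithful:
  fixes R :: "('r, 'a) ring_scheme" and M :: "('r, 'm, 'b) module_scheme"
  assumes R: "abelian_group R" "\<And>r s. r \<in> carrier R \<Longrightarrow> s \<in> carrier R \<Longrightarrow> r \<otimes>\<^bsub>R\<^esub> s \<in> carrier R"
    and M: "simple_left_module R M" "left_annihilator R M = {\<zero>\<^bsub>R\<^esub>}"
  shows "left_primitive R"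
proof -
  have lm: "left_module R M" using M(1) by (simp add: simple_left_module_def)
  interpret R: abelian_group R by fact
  interpret M: abelian_group M using lm by (simp add: left_module_def)
  have cl: "\<And>r x. r \<in> carrier R \<Longrightarrow> x \<in> carrier M \<Longrightarrow> r \<odot>\<^bsub>M\<^esub> x \<in> carrier M"
    and d1: "\<And>r s x. r \<in> carrier R \<Longrightarrow> s \<in> carrier R \<Longrightarrow> x \<in> carrier M \<Longrightarrow>
        (r \<oplus>\<^bsub>R\<^esub> s) \<odot>\<^bsub>M\<^esub> x = r \<odot>\<^bsub>M\<^esub> x \<oplus>\<^bsub>M\<^esub> s \<odot>\<^bsub>M\<^esub> x"
    and d2: "\<And>r x y. r \<in> carrier R \<Longrightarrow> x \<in> carrier M \<Longrightarrow> y \<in> carrier M \<Longrightarrow>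
        r \<odot>\<^bsub>M\<^esub> (x \<oplus>\<^bsub>M\<^esub> y) = r \<odot>\<^bsub>M\<^esub> x \<oplus>\<^bsub>M\<^esub> r \<odot>\<^bsub>M\<^esub> y"
    and as: "\<And>r s x. r \<in> carrier R \<Longrightarrow> s \<in> carrier R \<Longrightarrow> x \<in> carrier M \<Longrightarrow>
        (r \<otimes>\<^bsub>R\<^esub> s) \<odot>\<^bsub>M\<^esub> x = r \<odot>\<^bsub>M\<^esub> (s \<odot>\<^bsub>M\<^esub> x)"
    using lm by (simp_all add: left_module_def)
  have sub: "\<And>N. submodule N R M \<Longrightarrow> N = {\<zero>\<^bsub>M\<^esub>} \<or> N = carrier M"
    using M(1) by (simp add: simple_left_module_def)
  obtain r0 m where r0: "r0 \<in> carrier R" and m: "m \<in> carrier M" and ne: "r0 \<odot>\<^bsub>M\<^esub> m \<noteq> \<zero>\<^bsub>M\<^esub>"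
    using M(1) by (auto simp: simple_left_module_def)
  have z: "\<zero>\<^bsub>R\<^esub> \<odot>\<^bsub>M\<^esub> x = \<zero>\<^bsub>M\<^esub>" if "x \<in> carrier M" for x
    using M(2) that unfolding left_annihilator_def by blast
  have neg: "\<ominus>\<^bsub>M\<^esub> (r \<odot>\<^bsub>M\<^esub> x) = (\<ominus>\<^bsub>R\<^esub> r) \<odot>\<^bsub>M\<^esub> x" if "r \<in> carrier R" "x \<in> carrier M" for r x
    using d1[of "\<ominus>\<^bsub>R\<^esub> r" r x] that z cl by (simp add: R.l_neg M.minus_equality)
  have "submodule ((\<lambda>r. r \<odot>\<^bsub>M\<^esub> m) ` carrier R) R M"
  proof (unfold_locales, goal_cases)
    case 1 then show ?case using cl m by auto
  next
    case (2 x y) then show ?case using m d1[symmetric] by auto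
  next
    case 3 then show ?case using z[OF m] R.zero_closed by (auto intro!: image_eqI[of _ _ "\<zero>\<^bsub>R\<^esub>"])
  next
    case (4 x) then show ?case using neg m by (auto simp flip: a_inv_def)
  next
    case (5 a x)
    then obtain r where "r \<in> carrier R" "x = r \<odot>\<^bsub>M\<^esub> m" by auto
    then show ?case using 5 as R(2) m by (auto intro!: image_eqI[of _ _ "a \<otimes>\<^bsub>R\<^esub> r"])
  qed
  from sub[OF this] have surj: "(\<lambda>r. r \<odot>\<^bsub>M\<^esub> m) ` carrier R = carrier M"
    using r0 ne by blast
  define \<phi> where "\<phi> x = {r \<in> carrier R. r \<odot>\<^bsub>M\<^esub> m = x}" for x
  have inj: "inj_on \<phi> (carrier M)"
  proof (rule inj_onI)
    fix x y assume xy: "x \<in> carrier M" "\<phi> x = \<phi> y"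
    then have "x \<in> (\<lambda>r. r \<odot>\<^bsub>M\<^esub> m) ` carrier R" by (simp add: surj)
    then obtain r where "r \<in> carrier R" "r \<odot>\<^bsub>M\<^esub> m = x" by auto
    then have "r \<in> \<phi> y" using xy(2) by (auto simp: \<phi>_def)
    then show "x = y" using \<open>r \<odot>\<^bsub>M\<^esub> m = x\<close> by (simp add: \<phi>_def)
  qed
  define \<psi> where "\<psi> = inv_into (carrier M) \<phi>"
  have \<psi>[simp]: "\<psi> (\<phi> x) = x" if "x \<in> carrier M" for x
    using inj that unfolding \<psi>_def by simp
  define N :: "('r, 'r set) module" where "N = \<lparr>carrier = \<phi> ` carrier M, mult = undefined,
    one = undefined, zero = \<phi> \<zero>\<^bsub>M\<^esub>, add = (\<lambda>A B. \<phi> (\<psi> A \<oplus>\<^bsub>M\<^esub> \<psi> B)), smult = (\<lambda>r A. \<phi> (r \<odot>\<^bsub>M\<^esub> \<psi> A))\<rparr>"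
  have N: "carrier N = \<phi> ` carrier M" "\<zero>\<^bsub>N\<^esub> = \<phi> \<zero>\<^bsub>M\<^esub>"
    "\<And>x y. x \<in> carrier M \<Longrightarrow> y \<in> carrier M \<Longrightarrow> \<phi> x \<oplus>\<^bsub>N\<^esub> \<phi> y = \<phi> (x \<oplus>\<^bsub>M\<^esub> y)"
    "\<And>r x. x \<in> carrier M \<Longrightarrow> r \<odot>\<^bsub>N\<^esub> \<phi> x = \<phi> (r \<odot>\<^bsub>M\<^esub> x)"
    by (simp_all add: N_def)
  have eq: "\<phi> x = \<phi> y \<longleftrightarrow> x = y" if "x \<in> carrier M" "y \<in> carrier M" for x y
    using inj that by (auto simp: inj_on_def)
  have grp: "abelian_group N"
  proof (rule abelian_groupI, goal_cases)
    case (6 x)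
    then obtain y where "x = \<phi> y" "y \<in> carrier M" by (auto simp: N)
    then show ?case by (auto simp: N M.l_neg intro!: bexI[of _ "\<ominus>\<^bsub>M\<^esub> y"])
  qed (auto simp: N M.a_ac)
  interpret N: abelian_group N by (rule grp)
  have mod: "left_module R N"
    unfolding left_module_def using grp by (auto simp: N cl d1 d2 as R(2))
  have "K = {\<zero>\<^bsub>N\<^esub>} \<or> K = carrier N" if K: "submodule K R N" for K
  proof -
    interpret K: submodule K R N by fact
    have Ks: "K \<subseteq> \<phi> ` carrier M" using K.subset by (simp add: N)
    have kadd: "\<And>x y. x \<in> K \<Longrightarrow> y \<in> K \<Longrightarrow> x \<oplus>\<^bsub>N\<^esub> y \<in> K" using K.m_closed by simp
    have k0: "\<phi> \<zero>\<^bsub>M\<^esub> \<in> K" using K.one_closed by (simp add: N)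
    have ksm: "\<And>r x. r \<in> carrier R \<Longrightarrow> x \<in> K \<Longrightarrow> r \<odot>\<^bsub>N\<^esub> x \<in> K" by (rule K.smult_closed)
    have kneg: "\<phi> (\<ominus>\<^bsub>M\<^esub> x) \<in> K" if "\<phi> x \<in> K" "x \<in> carrier M" for x
    proof -
      have "\<phi> (\<ominus>\<^bsub>M\<^esub> x) \<oplus>\<^bsub>N\<^esub> \<phi> x = \<zero>\<^bsub>N\<^esub>" using that by (simp add: N M.l_neg)
      then have "\<ominus>\<^bsub>N\<^esub> \<phi> x = \<phi> (\<ominus>\<^bsub>M\<^esub> x)"
        using that by (intro N.minus_equality) (auto simp: N)
      then show ?thesis using K.m_inv_closed[of "\<phi> x"] that by (simp add: a_inv_def)
    qed
    define L where "L = {x \<in> carrier M. \<phi> x \<in> K}"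
    have "submodule L R M"
    proof (unfold_locales, goal_cases)
      case (2 x y) then show ?case using kadd[of "\<phi> x" "\<phi> y"] by (auto simp: L_def N)
    next
      case (4 x) then show ?case using kneg by (auto simp: L_def simp flip: a_inv_def)
    next
      case (5 a x) then show ?case using ksm[of a "\<phi> x"] cl by (auto simp: L_def N)
    qed (auto simp: L_def k0)
    from sub[OF this] have "L = {\<zero>\<^bsub>M\<^esub>} \<or> L = carrier M" .
    moreover have "K = \<phi> ` L" using Ks by (auto simp: L_def)
    ultimately show ?thesis by (auto simp: N)
  qed
  then have "simple_left_module R N"
    unfolding simple_left_module_def using mod r0 m ne cl by (auto simp: N eq)
  moreover have "left_annihilator R N = left_annihilator R M"
    unfolding left_annihilator_def using cl by (auto simp: N eq)
  ultimately show ?thesis unfolding left_primitive_def using M(2) by metis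
qed

definition opposite_ring :: "('r, 'a) ring_scheme \<Rightarrow> ('r, 'a) ring_scheme" where
  "opposite_ring R = R\<lparr>mult := (\<lambda>x y. y \<otimes>\<^bsub>R\<^esub> x)\<rparr>"

definition right_primitive :: "('r, 'a) ring_scheme \<Rightarrow> bool" where
  "right_primitive R \<longleftrightarrow> left_primitive (opposite_ring R)"

definition primitive_ring :: "('r, 'a) ring_scheme \<Rightarrow> bool" where
  "primitive_ring R \<longleftrightarrow> left_primitive R \<and> right_primitive R"

definition primitive_ideal :: "'r set \<Rightarrow> ('r, 'a) ring_scheme \<Rightarrow> bool" where
  "primitive_ideal P R \<longleftrightarrow> two_sided_ideal P R \<and> primitive_ring (R Quot P)"


section \<open>Leavitt path algebras\<close>

datatype 'a free_monoid = Word (letters: "'a list")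

instantiation free_monoid :: (type) monoid_add
begin

definition zero_free_monoid :: "'a free_monoid" where
  "zero_free_monoid = Word []"

definition plus_free_monoid :: "'a free_monoid \<Rightarrow> 'a free_monoid \<Rightarrow> 'a free_monoid" where
  "plus_free_monoid u v = Word (letters u @ letters v)"

instance
  by standard (simp_all add: zero_free_monoid_def plus_free_monoid_def)

end

text \<open>\<open>('a, 'k) free_poly\<close> is the monoid ring of the free monoid, i.e. noncommutative polynomials.\<close>

type_synonym ('a, 'k) free_poly = "'a free_monoid \<Rightarrow>\<^sub>0 'k"

definition indet :: "'a \<Rightarrow> ('a, 'k::field) free_poly" where
  "indet a = Poly_Mapping.single (Word [a]) 1"

text \<open>
  The free non-unital associative algebra on \<open>X\<close>: polynomials in the indeterminates from \<open>X\<close> without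
  constant term.  (The value of the \<^const>\<open>one\<close> field lies outside the carrier.)
\<close>

definition free_algebra :: "'a set \<Rightarrow> ('k::field, ('a, 'k) free_poly) module" where
  "free_algebra X =
     \<lparr>carrier = {p. \<forall>w\<in>Poly_Mapping.keys p. letters w \<noteq> [] \<and> set (letters w) \<subseteq> X},
      mult = (*), one = 1, zero = 0, add = (+),
      smult = (\<lambda>k. Poly_Mapping.map (\<lambda>a. k * a))\<rparr>"

definition algebra_ideal_gen :: "('k, 'a, 'm) module_scheme \<Rightarrow> 'a set \<Rightarrow> 'a set" where
  "algebra_ideal_gen A S =
     \<Inter>{I. two_sided_ideal I A \<and> (\<forall>k. \<forall>a\<in>I. k \<odot>\<^bsub>A\<^esub> a \<in> I) \<and> S \<subseteq> I}"

definition algebra_quotient :: "('k, 'a, 'm) module_scheme \<Rightarrow> 'a set \<Rightarrow> ('k, 'a set) module" where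
  "algebra_quotient A I = ring.extend (A Quot I)
     (module.fields (\<lambda>k X. \<Union>x\<in>X. I +>\<^bsub>A\<^esub> (k \<odot>\<^bsub>A\<^esub> x)))"

datatype ('v, 'e) lpa_gen = Vert 'v | Edge 'e | Ghost 'e

definition lpa_gens :: "('v, 'e) pre_digraph \<Rightarrow> ('v, 'e) lpa_gen set" where
  "lpa_gens E = Vert ` verts E \<union> Edge ` arcs E \<union> Ghost ` arcs E"

definition lpa_relations :: "('v, 'e) pre_digraph \<Rightarrow> (('v, 'e) lpa_gen, 'k::field) free_poly set" where
  "lpa_relations E =
     {indet (Vert v) * indet (Vert w) - (if v = w then indet (Vert v) else 0) | v w.
        v \<in> verts E \<and> w \<in> verts E} \<union>
     {indet (Vert (tail E e)) * indet (Edge e) - indet (Edge e) | e. e \<in> arcs E} \<union>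
     {indet (Edge e) * indet (Vert (head E e)) - indet (Edge e) | e. e \<in> arcs E} \<union>
     {indet (Vert (head E e)) * indet (Ghost e) - indet (Ghost e) | e. e \<in> arcs E} \<union>
     {indet (Ghost e) * indet (Vert (tail E e)) - indet (Ghost e) | e. e \<in> arcs E} \<union>
     {indet (Ghost e) * indet (Edge f) - (if e = f then indet (Vert (head E e)) else 0) | e f.
        e \<in> arcs E \<and> f \<in> arcs E} \<union>
     {indet (Vert v) - (\<Sum>e\<in>out_arcs E v. indet (Edge e) * indet (Ghost e)) | v.
        regular_vertex E v}"

definition lpa_relation_ideal :: "('v, 'e) pre_digraph \<Rightarrow> (('v, 'e) lpa_gen, 'k::field) free_poly set" where
  "lpa_relation_ideal E = algebra_ideal_gen (free_algebra (lpa_gens E)) (lpa_relations E)"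

text \<open>The elements of \<open>L\<^sub>K(E)\<close> are cosets in the free algebra.\<close>

type_synonym ('v, 'e, 'k) lpa_elem = "(('v, 'e) lpa_gen, 'k) free_poly set"

definition lpa :: "('v, 'e) pre_digraph \<Rightarrow> ('k::field, ('v, 'e, 'k) lpa_elem) module" where
  "lpa E = algebra_quotient (free_algebra (lpa_gens E)) (lpa_relation_ideal E)"

definition lpa_class :: "('v, 'e) pre_digraph \<Rightarrow> ('v, 'e) lpa_gen \<Rightarrow> ('v, 'e, 'k::field) lpa_elem" where
  "lpa_class E x = lpa_relation_ideal E +>\<^bsub>free_algebra (lpa_gens E)\<^esub> indet x"

abbreviation lpa_vert :: "('v, 'e) pre_digraph \<Rightarrow> 'v \<Rightarrow> ('v, 'e, 'k::field) lpa_elem" where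
  "lpa_vert E v \<equiv> lpa_class E (Vert v)"

abbreviation lpa_edge :: "('v, 'e) pre_digraph \<Rightarrow> 'e \<Rightarrow> ('v, 'e, 'k::field) lpa_elem" where
  "lpa_edge E e \<equiv> lpa_class E (Edge e)"

abbreviation lpa_ghost :: "('v, 'e) pre_digraph \<Rightarrow> 'e \<Rightarrow> ('v, 'e, 'k::field) lpa_elem" where
  "lpa_ghost E e \<equiv> lpa_class E (Ghost e)"


subsection \<open>Laurent polynomials evaluated at a cycle\<close>

text \<open>
  \<open>K[x, x\<^sup>-\<^sup>1]\<close> is the group ring of the integers, i.e. \<^typ>\<open>int \<Rightarrow>\<^sub>0 'k\<close> with the
  convolution product.
\<close>

type_synonym 'k laurent_poly = "int \<Rightarrow>\<^sub>0 'k"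

text \<open>
  For a cycle \<open>c = e\<^sub>1 \<dots> e\<^sub>n\<close> based at \<open>v\<close> these are the elements \<open>e\<^sub>1 \<dots> e\<^sub>n v\<close> and
  \<open>e\<^sub>n\<^sup>* \<dots> e\<^sub>1\<^sup>* v\<close>; the final factor \<open>v\<close> is redundant.
\<close>

definition lpa_cycle :: "('v, 'e) pre_digraph \<Rightarrow> 'e list \<Rightarrow> ('v, 'e, 'k::field) lpa_elem" where
  "lpa_cycle E c = foldr (\<lambda>e x. lpa_edge E e \<otimes>\<^bsub>lpa E\<^esub> x) c (lpa_vert E (tail E (hd c)))"

definition lpa_cycle_star :: "('v, 'e) pre_digraph \<Rightarrow> 'e list \<Rightarrow> ('v, 'e, 'k::field) lpa_elem" where
  "lpa_cycle_star E c = foldr (\<lambda>e x. lpa_ghost E e \<otimes>\<^bsub>lpa E\<^esub> x) (rev c) (lpa_vert E (tail E (hd c)))"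

definition lpa_cycle_power :: "('v, 'e) pre_digraph \<Rightarrow> 'e list \<Rightarrow> int \<Rightarrow> ('v, 'e, 'k::field) lpa_elem" where
  "lpa_cycle_power E c n =
     (if n \<ge> 0 then ((\<lambda>x. lpa_cycle E c \<otimes>\<^bsub>lpa E\<^esub> x) ^^ nat n) (lpa_vert E (tail E (hd c)))
      else ((\<lambda>x. lpa_cycle_star E c \<otimes>\<^bsub>lpa E\<^esub> x) ^^ nat (- n)) (lpa_vert E (tail E (hd c))))"

definition laurent_eval ::
    "('v, 'e) pre_digraph \<Rightarrow> 'k::field laurent_poly \<Rightarrow> 'e list \<Rightarrow> ('v, 'e, 'k) lpa_elem" where
  "laurent_eval E f c =
     (\<Oplus>\<^bsub>lpa E\<^esub>n\<in>Poly_Mapping.keys f. Poly_Mapping.lookup f n \<odot>\<^bsub>lpa E\<^esub> lpa_cycle_power E c n)"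


subsection \<open>The ideals \<open>I(H, S)\<close>\<close>

definition breaking_elem :: "('v, 'e) pre_digraph \<Rightarrow> 'v set \<Rightarrow> 'v \<Rightarrow> ('v, 'e, 'k::field) lpa_elem" where
  "breaking_elem E H v = lpa_vert E v \<ominus>\<^bsub>lpa E\<^esub>
     (\<Oplus>\<^bsub>lpa E\<^esub>e\<in>arcs_outside E H v. lpa_edge E e \<otimes>\<^bsub>lpa E\<^esub> lpa_ghost E e)"

definition graded_ideal :: "('v, 'e) pre_digraph \<Rightarrow> 'v set \<Rightarrow> 'v set \<Rightarrow> ('v, 'e, 'k::field) lpa_elem set" where
  "graded_ideal E H S = ideal_gen (lpa E) (lpa_vert E ` H \<union> breaking_elem E H ` S)"


section \<open>Exactly one of several conditions\<close>

definition exactly_one :: "bool list \<Rightarrow> bool" where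
  "exactly_one Ps \<longleftrightarrow> length (filter (\<lambda>b. b) Ps) = 1"

end

theory Submission
  imports Defs "HOL-Computational_Algebra.Polynomial"
begin

text \<open>
  Let \<open>P\<close> be the annihilator of a simple module and \<open>H\<close> the set of vertices in \<open>P\<close>.  As \<open>P\<close> is prime,
  the vertices outside of \<open>H\<close> are downward directed, and as the module is cyclic, countably many of
  them are such that every vertex outside of \<open>H\<close> reaches one of these.  Hence \<open>E\<^sup>0 - H\<close> is the root set of a
  descending path, of a vertex without edges to \<open>E\<^sup>0 - H\<close>, or of a cycle.

  An induction on the number of ghost edges shows that an ideal is determined by its vertices, its
  elements \<open>v\<^sup>H\<close>, and its elements \<open>k w + y\<close> with \<open>k \<noteq> 0\<close> and \<open>y\<close> a combination of closed paths at \<open>w\<close>, where all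
  paths from \<open>w\<close> outside of \<open>H\<close> run into one cycle without exits.  Without the last kind \<open>P\<close> is graded, and
  primeness allows at most one \<open>v\<^sup>H\<close> to be missing, namely for a \<open>v\<close> below all other vertices.  Otherwise the
  corner of \<open>L\<^sub>K(E)/I(H, B\<^sub>H)\<close> at a vertex of the cycle is \<open>K[x, x\<^sup>-\<^sup>1]\<close>, and \<open>P\<close> comes from a prime ideal of it.

  Conversely, \<open>L\<^sub>K(E)\<close> acts on the span of the infinite paths with the same tail as a given one, or of the
  finite paths ending in a given vertex that is not regular, and for an exclusive cycle \<open>c\<close> on the former with
  coefficients in \<open>K[x, x\<^sup>-\<^sup>1]/(f)\<close>, one edge of \<open>c\<close> being twisted by \<open>x\<close>.  Finitely many paths are separated by
  their initial segments, so these modules are simple; the induction above identifies their annihilators.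
  The involution of \<open>L\<^sub>K(E)\<close> preserves each of the five conditions, so left and right primitivity agree.
\<close>

text \<open>Neither a normal form nor the grading of \<open>L_K(E)\<close> is used; comparison
  replaces them. The induction takes ideals J \<subseteq> P, where J already contains the vertices
  of P and its elements v^H, and turns an element of P - J into some k w + y that is still in P - J.
  With J the ideal of the list this identifies P in both directions, P being a given annihilator or
  that of a constructed module. The argument only multiplies paths, so it holds for any elements
  that satisfy the relations. That \<open>L_K(E)\<close> is universal among these matters for the
  involution and for the modules; the modules show that vertices outside of H do not vanish.
  Countability comes from a generator of the module: unless one vertex lies below all others, only
  finitely many ghost paths of each length do not kill it, and their ranges are the vertices looked
  for. The five cases exclude each other because H and S can be read off from P; what remains is a
  comparison within the graph.\<close>

definition noexit :: "('v, 'e) pre_digraph \<Rightarrow> 'v set \<Rightarrow> 'v \<Rightarrow> bool" where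
  "noexit E H w \<longleftrightarrow> w \<in> verts E - H \<and> (\<exists>p. pre_digraph.awalk E w p w \<and> p \<noteq> []) \<and>
     (\<forall>q x. pre_digraph.awalk E w q x \<and> x \<notin> H \<longrightarrow> (\<exists>!e. e \<in> arcs_outside E H x))"

text \<open>The relations of \<open>L\<^sub>K(E)\<close> for elements of a ring with unit; \<open>\<kappa>\<close> embeds the scalars.
  Nothing forces the subalgebra \<open>alg\<close> generated by them to be free on these relations.\<close>

locale leavitt_family = wf_digraph E for E :: "('v, 'e) pre_digraph" +
  fixes \<kappa> :: "'k::field \<Rightarrow> 'q::ring_1" and vt :: "'v \<Rightarrow> 'q" and ed gh :: "'e \<Rightarrow> 'q"
  assumes \<kappa>_add: "\<kappa> (a + b) = \<kappa> a + \<kappa> b"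
    and \<kappa>_mult: "\<kappa> (a * b) = \<kappa> a * \<kappa> b"
    and \<kappa>_one [simp]: "\<kappa> 1 = 1"
    and \<kappa>_comm: "x * \<kappa> a = \<kappa> a * x"
    and vt_vt: "v \<in> verts E \<Longrightarrow> w \<in> verts E \<Longrightarrow> vt v * vt w = (if v = w then vt v else 0)"
    and vt_ed: "e \<in> arcs E \<Longrightarrow> vt (tail E e) * ed e = ed e"
    and ed_vt: "e \<in> arcs E \<Longrightarrow> ed e * vt (head E e) = ed e"
    and vt_gh: "e \<in> arcs E \<Longrightarrow> vt (head E e) * gh e = gh e"
    and gh_vt: "e \<in> arcs E \<Longrightarrow> gh e * vt (tail E e) = gh e"
    and gh_ed: "e \<in> arcs E \<Longrightarrow> f \<in> arcs E \<Longrightarrow> gh e * ed f = (if e = f then vt (head E e) else 0)"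
    and ck2: "regular_vertex E v \<Longrightarrow> vt v = (\<Sum>e\<in>out_arcs E v. ed e * gh e)"
begin

lemma \<kappa>_zero [simp]: "\<kappa> 0 = 0"
  using \<kappa>_add[of 0 0] by simp

lemma \<kappa>_minus: "\<kappa> (- a) = - \<kappa> a"
  using \<kappa>_add[of a "- a"] by (simp add: eq_neg_iff_add_eq_0 add.commute)

lemma \<kappa>_left_comm: "x * (\<kappa> a * y) = \<kappa> a * (x * y)"
  by (metis \<kappa>_comm mult.assoc)

lemma \<kappa>_inverse: "k \<noteq> 0 \<Longrightarrow> \<kappa> (inverse k) * (\<kappa> k * x) = x"
  by (metis \<kappa>_mult \<kappa>_one left_inverse mult.assoc mult_1)

section \<open>Products of paths and ghost paths\<close>

lemma awalk_split: "awalk u (p @ q) w \<Longrightarrow> \<exists>v. awalk u p v \<and> awalk v q w"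
  by auto

declare awalk_append_iff [simp del]

lemmas awalk_cat = awalk_appendI

text \<open>The starting vertex is an argument because an empty list of edges does not remember
  it.\<close>

primrec pe :: "'v \<Rightarrow> 'e list \<Rightarrow> 'q" where
  "pe v [] = vt v"
| "pe v (e # p) = ed e * pe (head E e) p"

primrec ge :: "'v \<Rightarrow> 'e list \<Rightarrow> 'q" where
  "ge v [] = vt v"
| "ge v (e # p) = ge (head E e) p * gh e"

lemma vt_idem: "v \<in> verts E \<Longrightarrow> vt v * vt v = vt v"
  by (simp add: vt_vt)

lemma vt_pe: "awalk v p w \<Longrightarrow> vt v * pe v p = pe v p"
  by (cases p) (auto simp: awalk_simps vt_vt mult.assoc[symmetric] vt_ed)

lemma pe_vt: "awalk v p w \<Longrightarrow> pe v p * vt w = pe v p"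
  by (induction p arbitrary: v) (auto simp: awalk_simps vt_vt mult.assoc)

lemma ge_vt: "awalk v p w \<Longrightarrow> ge v p * vt v = ge v p"
  by (cases p) (auto simp: awalk_simps vt_vt mult.assoc gh_vt)

lemma vt_ge: "awalk v p w \<Longrightarrow> vt w * ge v p = ge v p"
  by (induction p arbitrary: v) (auto simp: awalk_simps vt_vt mult.assoc[symmetric])

lemma pe_append: "awalk v p w \<Longrightarrow> awalk w q x \<Longrightarrow> pe v (p @ q) = pe v p * pe w q"
  by (induction p arbitrary: v) (auto simp: awalk_simps vt_pe mult.assoc)

lemma ge_append: "awalk v p w \<Longrightarrow> awalk w q x \<Longrightarrow> ge v (p @ q) = ge w q * ge v p"
  by (induction p arbitrary: v) (auto simp: awalk_simps ge_vt mult.assoc)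

lemma pe_single: "e \<in> arcs E \<Longrightarrow> pe v [e] = ed e"
  by (simp add: ed_vt)

lemma ge_single: "e \<in> arcs E \<Longrightarrow> ge v [e] = gh e"
  by (simp add: vt_gh)

lemma ge_pe_Cons: "e \<in> arcs E \<Longrightarrow> f \<in> arcs E \<Longrightarrow> awalk (head E e) p w \<Longrightarrow> awalk (head E f) q x \<Longrightarrow>
    ge v (e # p) * pe v' (f # q) = (if e = f then ge (head E e) p * pe (head E e) q else 0)"
proof -
  assume a: "e \<in> arcs E" "f \<in> arcs E" "awalk (head E e) p w" "awalk (head E f) q x"
  have "ge v (e # p) * pe v' (f # q) = ge (head E e) p * (gh e * ed f) * pe (head E f) q"
    by (simp add: mult.assoc)
  then show ?thesis using a by (auto simp: gh_ed ge_vt)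
qed

text \<open>Common initial edges cancel by e* f = \<delta>, so p* q is what remains of the longer
  path, or 0 at the first difference. The case \<open>zero\<close> records that neither path extends
  the other, so the lists alone decide the product.\<close>

lemma ge_pe_cases:
  assumes "awalk v p w" "awalk v q x"
  obtains (longer) r where "q = p @ r" "awalk w r x" "ge v p * pe v q = pe w r"
  | (shorter) r where "p = q @ r" "awalk x r w" "ge v p * pe v q = ge x r"
  | (zero) "ge v p * pe v q = 0" "\<And>r. q \<noteq> p @ r" "\<And>r. p \<noteq> q @ r"
  using assms
proof (induction p arbitrary: v q thesis)
  case Nil
  then show ?case by (auto simp: awalk_simps vt_pe)
next
  case (Cons e p)
  show ?case
  proof (cases q)
    case Nil
    then show ?thesis using Cons.prems by (auto simp: ge_vt mult.assoc gh_vt awalk_simps)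
  next
    case (Cons f q')
    have ar: "e \<in> arcs E" "f \<in> arcs E" and w: "awalk (head E e) p w" "awalk (head E f) q' x"
      using Cons.prems Cons by (auto simp: awalk_simps)
    show ?thesis
    proof (cases "e = f")
      case True
      have eq: "ge v (e # p) * pe v (f # q') = ge (head E e) p * pe (head E e) q'"
        using ge_pe_Cons[OF ar w] True by simp
      show ?thesis
        by (rule Cons.IH[OF _ _ _ w(1) w(2)[folded True]])
          (use Cons.prems(1-3) eq \<open>e = f\<close> \<open>q = f # q'\<close> in auto)
    next
      case False
      then show ?thesis using Cons.prems(3) ge_pe_Cons[OF ar w, of v v] \<open>q = f # q'\<close> by simp
    qed
  qed
qed

lemma ge_pe_same: "awalk v p w \<Longrightarrow> ge v p * pe v p = vt w"
  by (induction p arbitrary: v)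
    (auto simp: awalk_simps vt_vt ge_pe_Cons simp del: pe.simps(2) ge.simps(2))

lemma ge_pe_diff: "awalk v p w \<Longrightarrow> awalk v' q x \<Longrightarrow> v \<noteq> v' \<Longrightarrow> ge v p * pe v' q = 0"
proof -
  assume a: "awalk v p w" "awalk v' q x" "v \<noteq> v'"
  have "ge v p * pe v' q = ge v p * (vt v * vt v') * pe v' q"
    using a by (metis ge_vt vt_pe mult.assoc)
  moreover have "v \<in> verts E" "v' \<in> verts E" using a by auto
  ultimately show ?thesis using a by (simp add: vt_vt)
qed

section \<open>Linear spans and the algebra\<close>

text \<open>As an inductive set a span comes with an induction that adds one scaled generator at a
  time; coefficients are never chosen, as the generators may be dependent.\<close>

inductive_set lspan :: "'q set \<Rightarrow> 'q set" for X where
  lspan_zero [intro, simp]: "0 \<in> lspan X"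
| lspan_step: "x \<in> X \<Longrightarrow> y \<in> lspan X \<Longrightarrow> \<kappa> k * x + y \<in> lspan X"

lemma lspan_base: "x \<in> X \<Longrightarrow> x \<in> lspan X"
  using lspan_step[of x X 0 1] by simp

lemma lspan_add: "x \<in> lspan X \<Longrightarrow> y \<in> lspan X \<Longrightarrow> x + y \<in> lspan X"
  by (induction rule: lspan.induct) (auto simp: add.assoc intro: lspan_step)

lemma lspan_scale: "x \<in> lspan X \<Longrightarrow> \<kappa> k * x \<in> lspan X"
  by (induction rule: lspan.induct)
    (auto simp: distrib_left mult.assoc[symmetric] \<kappa>_mult[symmetric] intro: lspan_step)

lemma lspan_minus: "x \<in> lspan X \<Longrightarrow> - x \<in> lspan X"
  using lspan_scale[of x X "- 1"] by (simp add: \<kappa>_minus)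

lemma lspan_diff: "x \<in> lspan X \<Longrightarrow> y \<in> lspan X \<Longrightarrow> x - y \<in> lspan X"
  using lspan_add[OF _ lspan_minus] by fastforce

lemma lspan_sum: "(\<And>i. i \<in> I \<Longrightarrow> f i \<in> lspan X) \<Longrightarrow> sum f I \<in> lspan X"
  by (induction I rule: infinite_finite_induct) (auto intro: lspan_add)

lemma lspan_linear:
  assumes "z \<in> lspan X" "\<And>x. x \<in> X \<Longrightarrow> f x \<in> lspan Y"
    and "\<And>x y. f (x + y) = f x + f y" "\<And>k x. f (\<kappa> k * x) = \<kappa> k * f x"
  shows "f z \<in> lspan Y"
  using assms(1)
proof induction
  case lspan_zero
  have "f 0 = 0" using assms(4)[of 0 0] by simp
  then show ?case by simp
next
  case (lspan_step x y k)
  then show ?case by (auto simp: assms(3,4) intro: lspan_add lspan_scale assms(2))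
qed

lemma lspan_mult_left: "z \<in> lspan X \<Longrightarrow> (\<And>x. x \<in> X \<Longrightarrow> a * x \<in> lspan Y) \<Longrightarrow> a * z \<in> lspan Y"
  by (erule lspan_linear[where f = "\<lambda>x. a * x"]) (auto simp: distrib_left \<kappa>_left_comm)

lemma lspan_mult_right: "z \<in> lspan X \<Longrightarrow> (\<And>x. x \<in> X \<Longrightarrow> x * a \<in> lspan Y) \<Longrightarrow> z * a \<in> lspan Y"
  by (erule lspan_linear[where f = "\<lambda>x. x * a"]) (auto simp: distrib_right mult.assoc)

lemma lspan_subset: "X \<subseteq> lspan Y \<Longrightarrow> lspan X \<subseteq> lspan Y"
  using lspan_linear[where f = "\<lambda>x. x"] by blast

lemma lspan_mono: "X \<subseteq> Y \<Longrightarrow> lspan X \<subseteq> lspan Y"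
  by (meson lspan_base lspan_subset subset_iff)

text \<open>This passes from a combination of closed paths to a finite set of them, whose size
  drives an induction.\<close>

lemma lspan_finite_support: "z \<in> lspan X \<Longrightarrow> \<exists>Y. finite Y \<and> Y \<subseteq> X \<and> z \<in> lspan Y"
proof (induction rule: lspan.induct)
  case lspan_zero then show ?case by (intro exI[of _ "{}"]) auto
next
  case (lspan_step x y k)
  then obtain Y where Y: "finite Y" "Y \<subseteq> X" "y \<in> lspan Y" by blast
  then have "\<kappa> k * x + y \<in> lspan (insert x Y)"
    by (intro lspan.lspan_step) (auto intro: subsetD[OF lspan_mono[of Y]])
  then show ?case using Y lspan_step by (intro exI[of _ "insert x Y"]) auto
qed

definition mons :: "'q set" where
  "mons = {pe u p * ge v q | u p v q w. awalk u p w \<and> awalk v q w}"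

definition alg :: "'q set" where
  "alg = lspan mons"

lemma monsI: "awalk u p w \<Longrightarrow> awalk v q w \<Longrightarrow> pe u p * ge v q \<in> mons"
  unfolding mons_def by blast

lemma alg_monoI: "awalk u p w \<Longrightarrow> awalk v q w \<Longrightarrow> pe u p * ge v q \<in> alg"
  unfolding alg_def by (intro lspan_base monsI)

lemma pe_alg: "awalk u p w \<Longrightarrow> pe u p \<in> alg"
  using alg_monoI[of u p w w "[]"] by (auto simp: awalk_simps pe_vt)

lemma ge_alg: "awalk u p w \<Longrightarrow> ge u p \<in> alg"
  using alg_monoI[of w "[]" w u p] by (auto simp: awalk_simps vt_ge)

lemma vt_alg: "v \<in> verts E \<Longrightarrow> vt v \<in> alg"
  using pe_alg[of v "[]" v] by (simp add: awalk_simps)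

lemma ed_alg: "e \<in> arcs E \<Longrightarrow> ed e \<in> alg"
  using pe_alg[of "tail E e" "[e]" "head E e"] by (simp add: arc_implies_awalk ed_vt)

lemma gh_alg: "e \<in> arcs E \<Longrightarrow> gh e \<in> alg"
  using ge_alg[of "tail E e" "[e]" "head E e"] by (simp add: arc_implies_awalk vt_gh)

lemma alg_zero [simp]: "0 \<in> alg"
  by (simp add: alg_def)

lemma alg_add: "x \<in> alg \<Longrightarrow> y \<in> alg \<Longrightarrow> x + y \<in> alg"
  unfolding alg_def by (rule lspan_add)

lemma alg_scale: "x \<in> alg \<Longrightarrow> \<kappa> k * x \<in> alg"
  unfolding alg_def by (rule lspan_scale)

lemma alg_minus: "x \<in> alg \<Longrightarrow> - x \<in> alg"
  unfolding alg_def by (rule lspan_minus)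

lemma alg_diff: "x \<in> alg \<Longrightarrow> y \<in> alg \<Longrightarrow> x - y \<in> alg"
  unfolding alg_def by (rule lspan_diff)

lemma alg_sum: "(\<And>i. i \<in> I \<Longrightarrow> f i \<in> alg) \<Longrightarrow> sum f I \<in> alg"
  unfolding alg_def by (rule lspan_sum)

lemma mons_mult:
  assumes "x \<in> mons" "y \<in> mons"
  shows "x * y \<in> alg"
proof -
  obtain u p v q w where x: "x = pe u p * ge v q" "awalk u p w" "awalk v q w"
    using assms(1) unfolding mons_def by blast
  obtain u' p' v' q' w' where y: "y = pe u' p' * ge v' q'" "awalk u' p' w'" "awalk v' q' w'"
    using assms(2) unfolding mons_def by blast
  have eq: "x * y = pe u p * (ge v q * pe u' p') * ge v' q'"
    by (simp add: x y mult.assoc)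
  show ?thesis
  proof (cases "v = u'")
    case False
    then show ?thesis using ge_pe_diff[OF x(3) y(2)] eq by simp
  next
    case True
    from x(3) y(2)[folded True] show ?thesis
    proof (cases rule: ge_pe_cases)
      case (longer r)
      then have "x * y = pe u (p @ r) * ge v' q'"
        using eq True x by (simp add: pe_append)
      then show ?thesis using awalk_cat[OF x(2) longer(2)] y(3) alg_monoI by metis
    next
      case (shorter r)
      then have "x * y = pe u p * ge v' (q' @ r)"
        using eq True y(3) by (simp add: ge_append mult.assoc)
      then show ?thesis using awalk_cat[OF y(3) shorter(2)] x(2) alg_monoI by metis
    next
      case zero
      then show ?thesis using eq True by simp
    qed
  qed
qed

lemma alg_mult:
  assumes "x \<in> alg" "y \<in> alg"
  shows "x * y \<in> alg"
proof -
  have *: "m * y \<in> lspan mons" if "m \<in> mons" for m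
    using assms(2) unfolding alg_def
    by (rule lspan_mult_left) (use that mons_mult in \<open>auto simp: alg_def\<close>)
  show ?thesis using assms(1) unfolding alg_def by (rule lspan_mult_right) (rule *)
qed

lemma sum_vt_mult:
  assumes "finite F" "F \<subseteq> verts E" "v \<in> F"
  shows "(\<Sum>u\<in>F. vt u) * vt v = vt v" "vt v * (\<Sum>u\<in>F. vt u) = vt v"
proof -
  have "(\<Sum>u\<in>F. vt u * vt v) = (\<Sum>u\<in>F. if u = v then vt v else 0)"
    using assms by (intro sum.cong) (auto simp: vt_vt subset_iff)
  then show "(\<Sum>u\<in>F. vt u) * vt v = vt v" using assms by (simp add: sum_distrib_right)
  have "(\<Sum>u\<in>F. vt v * vt u) = (\<Sum>u\<in>F. if u = v then vt v else 0)"
    using assms by (intro sum.cong) (auto simp: vt_vt subset_iff)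
  then show "vt v * (\<Sum>u\<in>F. vt u) = vt v" using assms by (simp add: sum_distrib_left)
qed

lemma local_unit:
  assumes "x \<in> alg"
  obtains F where "finite F" "F \<subseteq> verts E" "(\<Sum>v\<in>F. vt v) * x = x" "x * (\<Sum>v\<in>F. vt v) = x"
proof -
  \<comment> \<open>The claim for all larger finite sets makes the induction work: a sum needs one
    set that serves both summands.\<close>
  have "\<exists>F0. finite F0 \<and> F0 \<subseteq> verts E \<and> (\<forall>F. finite F \<and> F \<subseteq> verts E \<and> F0 \<subseteq> F \<longrightarrow>
      (\<Sum>v\<in>F. vt v) * x = x \<and> x * (\<Sum>v\<in>F. vt v) = x)"
    using assms unfolding alg_def
  proof induction
    case lspan_zero then show ?case by (intro exI[of _ "{}"]) auto
  next
    case (lspan_step x y k)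
    from lspan_step(3) obtain F0 where "finite F0 \<and> F0 \<subseteq> verts E \<and>
        (\<forall>F. finite F \<and> F \<subseteq> verts E \<and> F0 \<subseteq> F \<longrightarrow>
          (\<Sum>v\<in>F. vt v) * y = y \<and> y * (\<Sum>v\<in>F. vt v) = y)" by (rule exE)
    then have F0: "finite F0" "F0 \<subseteq> verts E"
      "\<And>F. finite F \<Longrightarrow> F \<subseteq> verts E \<Longrightarrow> F0 \<subseteq> F \<Longrightarrow> (\<Sum>v\<in>F. vt v) * y = y \<and> y * (\<Sum>v\<in>F. vt v) = y"
      by simp_all
    obtain u p v q w where x: "x = pe u p * ge v q" "awalk u p w" "awalk v q w"
      using lspan_step(1) unfolding mons_def by blast
    have uv: "u \<in> verts E" "v \<in> verts E" using x by auto
    have "(\<Sum>v\<in>F. vt v) * x = x \<and> x * (\<Sum>v\<in>F. vt v) = x"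
      if F: "finite F" "F \<subseteq> verts E" "insert u (insert v F0) \<subseteq> F" for F
    proof -
      have "(\<Sum>v\<in>F. vt v) * x = (\<Sum>v\<in>F. vt v) * vt u * x"
        unfolding x(1) mult.assoc mult.assoc[symmetric, of "vt u" "pe u p"] vt_pe[OF x(2)] ..
      also have "\<dots> = vt u * x" using F sum_vt_mult(1)[of F u] by simp
      also have "\<dots> = x" unfolding x(1) mult.assoc[symmetric] vt_pe[OF x(2)] ..
      finally have 1: "(\<Sum>v\<in>F. vt v) * x = x" .
      have "x * (\<Sum>v\<in>F. vt v) = x * (vt v * (\<Sum>v\<in>F. vt v))"
        unfolding x(1) mult.assoc[symmetric] mult.assoc[of "pe u p" "ge v q" "vt v"] ge_vt[OF x(3)] ..
      also have "\<dots> = x * vt v" using F sum_vt_mult(2)[of F v] by simp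
      also have "\<dots> = x" unfolding x(1) mult.assoc ge_vt[OF x(3)] ..
      finally show ?thesis using 1 by simp
    qed
    then have "\<And>F. finite F \<Longrightarrow> F \<subseteq> verts E \<Longrightarrow> insert u (insert v F0) \<subseteq> F \<Longrightarrow>
       (\<Sum>v\<in>F. vt v) * (\<kappa> k * x + y) = \<kappa> k * x + y \<and> (\<kappa> k * x + y) * (\<Sum>v\<in>F. vt v) = \<kappa> k * x + y"
      using F0(3) by (simp add: distrib_left distrib_right \<kappa>_left_comm mult.assoc)
    then show ?case using F0 uv by (intro exI[of _ "insert u (insert v F0)"]) auto
  qed
  then show ?thesis using that by blast
qed

section \<open>Ideals of \<open>alg\<close>\<close>

definition aideal :: "'q set \<Rightarrow> bool" where
  "aideal J \<longleftrightarrow> J \<subseteq> alg \<and> 0 \<in> J \<and> (\<forall>x\<in>J. \<forall>y\<in>J. x + y \<in> J) \<and>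
     (\<forall>a\<in>alg. \<forall>x\<in>J. a * x \<in> J \<and> x * a \<in> J)"

context
  fixes J assumes J: "aideal J"
begin

lemma aideal_sub: "x \<in> J \<Longrightarrow> x \<in> alg"
  and aideal_zero [simp]: "0 \<in> J"
  and aideal_add: "x \<in> J \<Longrightarrow> y \<in> J \<Longrightarrow> x + y \<in> J"
  and aideal_left: "a \<in> alg \<Longrightarrow> x \<in> J \<Longrightarrow> a * x \<in> J"
  and aideal_right: "a \<in> alg \<Longrightarrow> x \<in> J \<Longrightarrow> x * a \<in> J"
  using J unfolding aideal_def by auto

text \<open>A scalar multiple of a local unit lies in \<open>alg\<close>, so ring ideals are closed
  under scalars although 1 may lie outside of \<open>alg\<close>.\<close>

lemma aideal_scale: assumes "x \<in> J" shows "\<kappa> k * x \<in> J"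
proof -
  obtain F where F: "finite F" "F \<subseteq> verts E" "(\<Sum>v\<in>F. vt v) * x = x" "x * (\<Sum>v\<in>F. vt v) = x"
    by (rule local_unit[OF aideal_sub[OF assms]])
  have "\<kappa> k * (\<Sum>v\<in>F. vt v) \<in> alg" using F by (intro alg_scale alg_sum vt_alg) auto
  from aideal_left[OF this assms] show ?thesis by (simp add: mult.assoc F)
qed

lemma aideal_minus: "x \<in> J \<Longrightarrow> - x \<in> J"
  using aideal_scale[of x "- 1"] by (simp add: \<kappa>_minus)

lemma aideal_diff: "x \<in> J \<Longrightarrow> y \<in> J \<Longrightarrow> x - y \<in> J"
  using aideal_add[OF _ aideal_minus] by fastforce

lemma aideal_sum: "(\<And>i. i \<in> I \<Longrightarrow> f i \<in> J) \<Longrightarrow> sum f I \<in> J"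
  by (induction I rule: infinite_finite_induct) (auto intro: aideal_add)

lemma aideal_unscale: "\<kappa> k * x \<in> J \<Longrightarrow> k \<noteq> 0 \<Longrightarrow> x \<in> J"
  using aideal_scale[of "\<kappa> k * x" "inverse k"] by (simp add: \<kappa>_inverse)

lemma aideal_cong: "x - y \<in> J \<Longrightarrow> x \<in> J \<longleftrightarrow> y \<in> J"
  using aideal_add[of "x - y" y] aideal_diff[of x "x - y"] by auto

text \<open>For a path p from v to w one has w = p* v p.\<close>

lemma aideal_head:
  assumes "vt v \<in> J" "awalk v p w"
  shows "vt w \<in> J"
proof -
  have "ge v p * vt v * pe v p \<in> J"
    using assms by (intro aideal_left aideal_right pe_alg ge_alg)
  then show ?thesis using assms by (simp add: ge_vt ge_pe_same)
qed

lemma aideal_pe: "awalk v p w \<Longrightarrow> vt w \<in> J \<Longrightarrow> pe v p \<in> J"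
  using aideal_left[OF pe_alg, of v p w "vt w"] by (simp add: pe_vt)

lemma aideal_ed: "e \<in> arcs E \<Longrightarrow> vt (head E e) \<in> J \<Longrightarrow> ed e \<in> J"
  using aideal_left[OF ed_alg, of e "vt (head E e)"] by (simp add: ed_vt)

lemma aideal_gh: "e \<in> arcs E \<Longrightarrow> vt (head E e) \<in> J \<Longrightarrow> gh e \<in> J"
  using aideal_right[OF gh_alg, of e "vt (head E e)"] by (simp add: vt_gh)

end

text \<open>This is u^H for a breaking vertex u. If infinitely many edges lead outside of H, the sum
  takes the value 0 and the element is the vertex itself.\<close>

definition bel :: "'v set \<Rightarrow> 'v \<Rightarrow> 'q" where
  "bel H u = vt u - (\<Sum>e\<in>arcs_outside E H u. ed e * gh e)"

definition reals :: "'v \<Rightarrow> 'q set" where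
  "reals v = lspan {pe u p | u p. awalk u p v}"

definition loops :: "'v \<Rightarrow> 'q set" where
  "loops v = lspan {pe v p | p. awalk v p v \<and> p \<noteq> []}"

lemma aideal_alg_outer:
  "aideal J \<Longrightarrow> x \<in> J \<Longrightarrow> a \<in> alg \<Longrightarrow> b \<in> alg \<Longrightarrow> a * x * b \<in> J"
  by (intro aideal_left aideal_right) auto

lemma bel_alg: "u \<in> verts E \<Longrightarrow> finite (arcs_outside E H u) \<Longrightarrow> bel H u \<in> alg"
  unfolding bel_def
  by (intro alg_diff vt_alg alg_sum alg_mult ed_alg gh_alg) (auto simp: arcs_outside_def)

lemma vt_bel:
  assumes "u \<in> verts E"
  shows "vt u * bel H u = bel H u" "bel H u * vt u = bel H u"
proof -
  have "vt u * (ed e * gh e) = ed e * gh e" "ed e * gh e * vt u = ed e * gh e"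
    if "e \<in> arcs_outside E H u" for e
    using that vt_ed[of e] gh_vt[of e] by (auto simp: arcs_outside_def mult.assoc[symmetric])
      (simp add: mult.assoc)
  then show "vt u * bel H u = bel H u" "bel H u * vt u = bel H u"
    unfolding bel_def right_diff_distrib left_diff_distrib sum_distrib_left sum_distrib_right
    using assms by (auto simp: vt_vt intro!: sum.cong)
qed

lemma bel_ed:
  assumes "finite (arcs_outside E H u)" "e \<in> out_arcs E u"
  shows "bel H u * ed e = (if e \<in> arcs_outside E H u then 0 else ed e)"
proof -
  have "(\<Sum>f\<in>arcs_outside E H u. ed f * gh f * ed e) =
      (\<Sum>f\<in>arcs_outside E H u. if f = e then ed e else 0)"
    using assms by (intro sum.cong) (auto simp: arcs_outside_def mult.assoc gh_ed ed_vt)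
  then show ?thesis using assms vt_ed[of e]
    by (auto simp: bel_def left_diff_distrib sum_distrib_right)
qed

lemma gh_bel:
  assumes "finite (arcs_outside E H u)" "e \<in> out_arcs E u"
  shows "gh e * bel H u = (if e \<in> arcs_outside E H u then 0 else gh e)"
proof -
  have "(\<Sum>f\<in>arcs_outside E H u. gh e * (ed f * gh f)) =
      (\<Sum>f\<in>arcs_outside E H u. if f = e then gh e else 0)"
    using assms by (intro sum.cong) (auto simp: arcs_outside_def mult.assoc[symmetric] gh_ed vt_gh)
  then show ?thesis using assms gh_vt[of e]
    by (auto simp: bel_def right_diff_distrib sum_distrib_left)
qed

section \<open>Vertices of an ideal, and closed paths conjugated by a path\<close>

definition vanish :: "'q set \<Rightarrow> 'v set" where
  "vanish P = {v \<in> verts E. vt v \<in> P}"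

lemma vanish_hereditary:
  assumes "aideal P"
  shows "hereditary E (vanish P)"
  using aideal_head[OF assms] unfolding hereditary_def vanish_def path_geq_def by auto

lemma awalk_outside:
  assumes "hereditary E H" "awalk u p v" "v \<notin> H"
  shows "u \<notin> H" "\<And>x. x \<in> set (awalk_verts u p) \<Longrightarrow> x \<notin> H"
proof -
  show *: "x \<notin> H" if "x \<in> set (awalk_verts u p)" for x
    using assms awalk_decomp[OF assms(2) that] unfolding hereditary_def path_geq_def by blast
  show "u \<notin> H" using *[of u] hd_in_awalk_verts(1)[OF assms(2)] by simp
qed

lemma awalk_Cons_outside:
  assumes "hereditary E H" "awalk u (e # p) v" "v \<notin> H"
  shows "e \<in> arcs_outside E H u"
proof -
  have "awalk (head E e) p v" "e \<in> arcs E" "tail E e = u" using assms(2) by (auto simp: awalk_Cons_iff)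
  moreover from awalk_outside(1)[OF assms(1) this(1) assms(3)] have "head E e \<notin> H" .
  ultimately show ?thesis by (auto simp: arcs_outside_def)
qed

text \<open>A closed path at a vertex outside of the hereditary set H never enters H, so its first
  edge is one of those that v^H kills from the left.\<close>

lemma loops_mult_pe: "bel H v * y = 0"
  if "y \<in> loops v" "hereditary E H" "v \<in> verts E - H" "finite (arcs_outside E H v)"
proof -
  have "bel H v * y \<in> lspan {0}"
    using that(1) unfolding loops_def
  proof (rule lspan_mult_left)
    fix x assume "x \<in> {pe v p |p. awalk v p v \<and> p \<noteq> []}"
    then obtain e p where x: "x = pe v (e # p)" "awalk v (e # p) v" by (auto simp: neq_Nil_conv)
    have e: "e \<in> arcs_outside E H v" using awalk_Cons_outside[OF that(2) x(2)] that(3) by simp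
    then have "bel H v * ed e = 0" using that(4) bel_ed[of H v e] by (auto simp: arcs_outside_def)
    then have "bel H v * x = 0" by (simp add: x mult.assoc[symmetric])
    then show "bel H v * x \<in> lspan {0}" by simp
  qed
  moreover have "z = 0" if "z \<in> lspan {0}" for z using that by induction auto
  ultimately show ?thesis by blast
qed

text \<open>Conjugation by q slides a closed path p along q: the result is the closed path s with pq
  = qs if there is one, and 0 otherwise. No ghost path can remain, because pq is longer than
  q.\<close>

lemma conj_loop:
  assumes "awalk w p w" "p \<noteq> []" "awalk w q x"
  obtains (move) s where "p @ q = q @ s" "awalk x s x" "s \<noteq> []" "ge w q * pe w p * pe w q = pe x s"
  | (kill) "\<And>s. p @ q \<noteq> q @ s" "ge w q * pe w p * pe w q = 0"
proof -
  have eq: "ge w q * pe w p * pe w q = ge w q * pe w (p @ q)"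
    using assms by (simp add: pe_append mult.assoc)
  have pq: "awalk w (p @ q) x" using assms awalk_cat by blast
  from assms(3) pq show ?thesis
  proof (cases rule: ge_pe_cases)
    case (longer r)
    moreover have "r \<noteq> []" using longer(1) assms(2) by auto
    ultimately show ?thesis using that(1)[of r] eq by auto
  next
    case (shorter r)
    then have "length q = length p + length q + length r" by (metis length_append)
    then show ?thesis using assms(2) by simp
  next
    case zero
    then show ?thesis using that(2) eq by auto
  qed
qed

lemma conj_loops:
  assumes "y \<in> loops w" "awalk w q x"
  shows "ge w q * y * pe w q \<in> loops x"
  using assms(1) unfolding loops_def
proof (rule lspan_linear[where f = "\<lambda>y. ge w q * y * pe w q"])
  fix z assume "z \<in> {pe w p |p. awalk w p w \<and> p \<noteq> []}"
  then obtain p where p: "z = pe w p" "awalk w p w" "p \<noteq> []" by blast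
  from p(2,3) assms(2) show "ge w q * z * pe w q \<in> lspan {pe x p |p. awalk x p x \<and> p \<noteq> []}"
    by (cases rule: conj_loop) (auto simp: p(1) intro!: lspan_base)
qed (simp_all add: distrib_left distrib_right \<kappa>_left_comm mult.assoc)

lemma conj_const:
  assumes "awalk w q x"
  shows "ge w q * (\<kappa> k * vt w + y) * pe w q = \<kappa> k * vt x + ge w q * y * pe w q"
  using assms by (simp add: distrib_left distrib_right \<kappa>_left_comm mult.assoc vt_pe ge_pe_same)

text \<open>If pq = qs, then p and s consist of the same edges, so s, a closed path at x, passes
  through the source w of the first edge of p. Without a way back from x to w every closed path is
  therefore killed.\<close>

lemma conj_loops_kill:
  assumes "y \<in> loops w" "awalk w q x" "\<And>r. \<not> awalk x r w"
  shows "ge w q * y * pe w q = 0"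
proof -
  have "ge w q * y * pe w q \<in> lspan {0}"
    using assms(1) unfolding loops_def
  proof (rule lspan_linear[where f = "\<lambda>y. ge w q * y * pe w q"])
    fix z assume "z \<in> {pe w p |p. awalk w p w \<and> p \<noteq> []}"
    then obtain p where z: "z = pe w p" "awalk w p w" "p \<noteq> []" by blast
    from z(2,3) assms(2) show "ge w q * z * pe w q \<in> lspan {0}"
    proof (cases rule: conj_loop)
      case (move s)
      have "mset (p @ q) = mset (q @ s)" using move(1) by simp
      then have "set p = set s" by (metis mset_append add.commute add_left_cancel set_mset_mset)
      moreover obtain e p' where p: "p = e # p'" using z(3) by (cases p) auto
      ultimately have "e \<in> set s" "tail E e = w" using z(2) by (auto simp: awalk_Cons_iff)
      then have "w \<in> set (awalk_verts x s)" using move(2) by (auto simp: set_awalk_verts)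
      then show ?thesis using awalk_decomp[OF move(2)] assms(3) by blast
    qed (simp add: z)
  qed (simp_all add: distrib_left distrib_right \<kappa>_left_comm mult.assoc)
  moreover have "z = 0" if "z \<in> lspan {0}" for z using that by induction auto
  ultimately show ?thesis by blast
qed

text \<open>If a vertex reached from w has two edges to the outside of H, the closed paths of y can
  be removed one by one. For p in the support, pqg starts with qg for at most one of the two edges
  g; conjugation by q and the other edge kills p, shrinks the support, and moves the constant term k
  to the range of that edge. Once no closed path is left, a vertex outside of H would lie in
  P.\<close>

lemma conj_loops_two_exits:
  assumes "aideal P" "hereditary E (vanish P)"
    and "finite Q" "\<And>p. p \<in> Q \<Longrightarrow> awalk w p w \<and> p \<noteq> []"
    and "k \<noteq> 0" "y \<in> lspan (pe w ` Q)" "\<kappa> k * vt w + y \<in> P"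
    and "\<And>q x. awalk w q x \<Longrightarrow> x \<notin> vanish P \<Longrightarrow> \<exists>r. awalk x r w"
    and "awalk w q x" "e \<in> arcs_outside E (vanish P) x" "f \<in> arcs_outside E (vanish P) x" "e \<noteq> f"
    and "w \<in> verts E"
  shows "vt w \<in> P"
  using assms(3-)
proof (induction "card Q" arbitrary: Q w y q rule: less_induct)
  case less
  show ?case
  proof (rule ccontr)
    assume nw: "vt w \<notin> P"
    have "Q \<noteq> {}"
    proof
      assume "Q = {}"
      then have "y = 0" using less.prems(4) by (auto elim: lspan.cases)
      then show False using less.prems nw aideal_unscale[OF assms(1), of k "vt w"] by simp
    qed
    then obtain p where p: "p \<in> Q" by blast
    \<comment> \<open>As p is not empty, \<open>p @ q\<close> alone fixes the edge in position
      \<open>length q\<close>; it cannot be both e and f.\<close>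
    have "\<exists>g\<in>{e, f}. \<forall>s. p @ q @ [g] \<noteq> (q @ [g]) @ s"
    proof (rule ccontr)
      assume "\<not> ?thesis"
      then obtain s s' where s: "p @ q @ [e] = (q @ [e]) @ s" "p @ q @ [f] = (q @ [f]) @ s'" by auto
      have "take (Suc (length q)) (p @ q @ [g]) = take (Suc (length q)) (p @ q)" for g
        using less.prems(2)[OF p] by (cases p) auto
      then have "take (Suc (length q)) ((q @ [e]) @ s) = take (Suc (length q)) ((q @ [f]) @ s')"
        using s by metis
      then show False using less.prems(10) by simp
    qed
    then obtain g where g: "g \<in> {e, f}" "\<And>s. p @ q @ [g] \<noteq> (q @ [g]) @ s" by blast
    define q' x' where "q' = q @ [g]" and "x' = head E g"
    have gx: "g \<in> arcs E" "tail E g = x" "x' \<notin> vanish P" "x' \<in> verts E"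
      using g(1) less.prems(8,9) by (auto simp: arcs_outside_def x'_def)
    have q': "awalk w q' x'"
      using awalk_cat[OF less.prems(7), of "[g]" x'] gx by (simp add: q'_def awalk_simps x'_def)
    \<comment> \<open>The closed paths that survive the conjugation, slid along q'.\<close>
    define Q' where "Q' = (\<lambda>p. drop (length q') (p @ q')) ` {p \<in> Q. \<exists>s. p @ q' = q' @ s}"
    define y' where "y' = ge w q' * y * pe w q'"
    have "y' \<in> lspan (pe x' ` Q')"
      unfolding y'_def using less.prems(4)
    proof (rule lspan_linear[where f = "\<lambda>y. ge w q' * y * pe w q'"])
      fix z assume "z \<in> pe w ` Q"
      then obtain p where z: "z = pe w p" "p \<in> Q" by blast
      then have "awalk w p w" "p \<noteq> []" using less.prems(2) by auto
      from this q' show "ge w q' * z * pe w q' \<in> lspan (pe x' ` Q')"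
      proof (cases rule: conj_loop)
        case (move s)
        have "s = drop (length q') (p @ q')" by (simp only: move(1)) simp
        then have "s \<in> Q'" unfolding Q'_def using move(1) z(2) by blast
        then show ?thesis using move z by (auto intro: lspan_base)
      qed (simp add: z)
    qed (simp_all add: distrib_left distrib_right \<kappa>_left_comm mult.assoc)
    moreover have "\<kappa> k * vt x' + y' \<in> P"
      using aideal_alg_outer[OF assms(1) less.prems(5) ge_alg[OF q'] pe_alg[OF q']]
      by (simp only: conj_const[OF q'] y'_def)
    moreover have fQ: "finite Q'" unfolding Q'_def using less.prems(1) by auto
    moreover have "card Q' < card Q"
    proof -
      have "card Q' \<le> card {p \<in> Q. \<exists>s. p @ q' = q' @ s}"
        unfolding Q'_def using less.prems(1) by (intro card_image_le) auto
      also have "\<dots> < card Q"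
        using p g(2) less.prems(1) by (intro psubset_card_mono) (auto simp: q'_def)
      finally show ?thesis .
    qed
    moreover have "awalk x' s x' \<and> s \<noteq> []" if "s \<in> Q'" for s
    proof -
      obtain p t where pt: "p \<in> Q" "p @ q' = q' @ t" "s = drop (length q') (p @ q')"
        using \<open>s \<in> Q'\<close> unfolding Q'_def by blast
      have "s = t" unfolding pt(3) pt(2) by simp
      with pt have p: "p \<in> Q" "p @ q' = q' @ s" by auto
      then have "awalk w p w" "p \<noteq> []" using less.prems(2) by auto
      from this q' show ?thesis by (cases rule: conj_loop) (use p(2) in auto)
    qed
    moreover have bck: "\<exists>r. awalk x'' r x'" if "awalk x' q'' x''" "x'' \<notin> vanish P" for q'' x''
      using less.prems(6)[OF awalk_cat[OF q' that(1)] that(2)] awalk_cat q' by blast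
    \<comment> \<open>From x' one returns to w and from there to the branching vertex x, so x'
      satisfies the hypotheses again.\<close>
    moreover obtain r where "awalk x' r w" using less.prems(6)[OF q' gx(3)] by blast
    then have "awalk x' (r @ q) x" using less.prems(7) awalk_cat by blast
    ultimately have "vt x' \<in> P"
      using less.hyps[of Q' x' y' "r @ q"] less.prems(3,8-10) gx(4) by blast
    then show False using gx by (simp add: vanish_def)
  qed
qed

text \<open>If some x below w had no way back to w, conjugation would leave only the constant term
  and put x into P. Two edges to the outside of H at the same x are excluded by
  \<open>conj_loops_two_exits\<close>. So every walk from w outside of H is forced.\<close>

lemma noexit_if_loop_poly:
  assumes "aideal P" "k \<noteq> 0" "y \<in> loops w" "\<kappa> k * vt w + y \<in> P" "w \<in> verts E" "vt w \<notin> P"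
  shows "noexit E (vanish P) w"
proof -
  have her: "hereditary E (vanish P)" by (rule vanish_hereditary[OF assms(1)])
  have w: "w \<notin> vanish P" using assms(6) by (simp add: vanish_def)
  from lspan_finite_support[OF assms(3)[unfolded loops_def]]
  obtain Y where Y: "finite Y" "Y \<subseteq> {pe w p |p. awalk w p w \<and> p \<noteq> []}" "y \<in> lspan Y"
    by (elim exE conjE)
  have "Y \<subseteq> pe w ` {p. awalk w p w \<and> p \<noteq> []}" using Y(2) by blast
  from finite_subset_image[OF Y(1) this]
  obtain Q where Q: "finite Q" "Q \<subseteq> {p. awalk w p w \<and> p \<noteq> []}" "Y = pe w ` Q" by auto
  have bck: "\<exists>r. awalk x r w" if "awalk w q x" "x \<notin> vanish P" for q x
  proof (rule ccontr)
    assume "\<not> ?thesis"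
    then have "\<kappa> k * vt x \<in> P"
      using aideal_alg_outer[OF assms(1,4) ge_alg[OF that(1)] pe_alg[OF that(1)]]
        conj_const[OF that(1), of k y] conj_loops_kill[OF assms(3) that(1)] by auto
    then show False using that assms(2) aideal_unscale[OF assms(1)] by (auto simp: vanish_def)
  qed
  have "Q \<noteq> {}"
  proof
    assume "Q = {}"
    then have "y = 0" using Y(3) Q(3) by (auto elim: lspan.cases)
    then show False using assms(2,4,6) aideal_unscale[OF assms(1)] by auto
  qed
  then obtain p where p: "awalk w p w" "p \<noteq> []" using Q(2) by blast
  have "\<exists>!e. e \<in> arcs_outside E (vanish P) x" if qx: "awalk w q x" "x \<notin> vanish P" for q x
  proof -
    obtain r where r: "awalk x r w" using bck[OF qx] by blast
    have "\<exists>s. awalk x s w \<and> s \<noteq> []"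
      using awalk_cat[OF r p(1)] p(2) by blast
    then obtain e s where "awalk x (e # s) w" by (auto simp: neq_Nil_conv)
    then have ex: "e \<in> arcs_outside E (vanish P) x" using awalk_Cons_outside[OF her _ w] by blast
    have "f = g" if "f \<in> arcs_outside E (vanish P) x" "g \<in> arcs_outside E (vanish P) x" for f g
    proof (rule ccontr)
      assume "f \<noteq> g"
      have "vt w \<in> P"
      proof (rule conj_loops_two_exits[OF assms(1) her Q(1) _ assms(2) _ assms(4) _ qx(1) that \<open>f \<noteq> g\<close> assms(5)])
        show "y \<in> lspan (pe w ` Q)" using Y(3) Q(3) by simp
        show "\<And>p. p \<in> Q \<Longrightarrow> awalk w p w \<and> p \<noteq> []" using Q(2) by blast
      qed (rule bck)
      then show False using assms(6) by simp
    qed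
    then show ?thesis using ex by blast
  qed
  then show ?thesis using p w assms(5) unfolding noexit_def by blast
qed

section \<open>Lowering the number of edges and of ghost edges\<close>

definition reals_le :: "nat \<Rightarrow> 'v \<Rightarrow> 'q set" where
  "reals_le n v = lspan {pe u p | u p. awalk u p v \<and> length p \<le> n}"

text \<open>The paths are sorted by their first edge. The family y is total and 0 off G, so that
  sums over different sets G can be merged; that G is empty for n = 0 lets the recursion on n
  end.\<close>

lemma reals_le_decomp:
  assumes "a \<in> reals_le n v" "v \<in> verts E"
  shows "\<exists>c G y. finite G \<and> G \<subseteq> arcs E \<and> (n = 0 \<longrightarrow> G = {}) \<and>
    (\<forall>e. y e \<in> reals_le (n - 1) v) \<and> (\<forall>e\<in>arcs E. vt (head E e) * y e = y e) \<and> (\<forall>e. e \<notin> G \<longrightarrow> y e = 0) \<and>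
    a = \<kappa> c * vt v + (\<Sum>e\<in>G. ed e * y e)"
  using assms(1) unfolding reals_le_def
  proof induction
    case lspan_zero
    show ?case by (rule exI[of _ 0], rule exI[of _ "{}"], rule exI[of _ "\<lambda>_. 0"]) simp
  next
    case (lspan_step x a k)
    then obtain c G y where IH: "finite G" "G \<subseteq> arcs E" "n = 0 \<longrightarrow> G = {}"
      "\<forall>e. y e \<in> lspan {pe u p | u p. awalk u p v \<and> length p \<le> n - 1}"
      "\<forall>e\<in>arcs E. vt (head E e) * y e = y e" "\<forall>e. e \<notin> G \<longrightarrow> y e = 0"
      "a = \<kappa> c * vt v + (\<Sum>e\<in>G. ed e * y e)" by (elim exE conjE)
    obtain u p where x: "x = pe u p" "awalk u p v" "length p \<le> n" using lspan_step(1) by blast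
    show ?case
    proof (cases p)
      case Nil
      then have "\<kappa> k * x + a = \<kappa> (k + c) * vt v + (\<Sum>e\<in>G. ed e * y e)"
        using x IH(7) by (simp add: awalk_simps \<kappa>_add distrib_right add.assoc)
      then show ?thesis using IH by (intro exI[of _ "k + c"] exI[of _ G] exI[of _ y]) simp
    next
      case (Cons f p')
      define y' where "y' e = y e + (if e = f then \<kappa> k * pe (head E f) p' else 0)" for e
      have f: "f \<in> arcs E" "awalk (head E f) p' v" "length p' \<le> n - 1" "n \<noteq> 0"
        using x Cons by (auto simp: awalk_simps)
      have "(\<Sum>e\<in>insert f G. ed e * y' e) =
          (\<Sum>e\<in>insert f G. ed e * y e) + (\<Sum>e\<in>insert f G. if e = f then \<kappa> k * x else 0)"
        unfolding sum.distrib[symmetric] y'_def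
        by (intro sum.cong) (auto simp: distrib_left x(1) Cons \<kappa>_left_comm)
      also have "(\<Sum>e\<in>insert f G. ed e * y e) = (\<Sum>e\<in>G. ed e * y e)"
        using IH(1,6) by (intro sum.mono_neutral_right) auto
      finally have "\<kappa> k * x + a = \<kappa> c * vt v + (\<Sum>e\<in>insert f G. ed e * y' e)"
        using IH(1,7) by (simp add: add_ac)
      moreover have "y' e \<in> lspan {pe u p | u p. awalk u p v \<and> length p \<le> n - 1}" for e
      proof -
        have "pe (head E f) p' \<in> lspan {pe u p | u p. awalk u p v \<and> length p \<le> n - 1}"
          using f by (intro lspan_base) blast
        then show ?thesis unfolding y'_def using IH(4) by (auto intro!: lspan_add lspan_scale)
      qed
      moreover have "\<forall>e\<in>arcs E. vt (head E e) * y' e = y' e"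
        using IH(5) f by (auto simp: y'_def distrib_left \<kappa>_left_comm vt_pe)
      moreover have "\<forall>e. e \<notin> insert f G \<longrightarrow> y' e = 0" using IH(6) by (auto simp: y'_def)
      ultimately show ?thesis using IH(1,2) f
        by (intro exI[of _ c] exI[of _ "insert f G"] exI[of _ y']) simp
    qed
  qed

lemma loops_alg: "a \<in> loops v \<Longrightarrow> a \<in> alg"
  unfolding loops_def alg_def
  by (erule lspan_linear[where f = "\<lambda>x. x"]) (auto simp: pe_alg[unfolded alg_def])

lemma ed_reals_loops:
  assumes "e \<in> arcs E" "tail E e = v" "a \<in> reals_le n v"
  shows "ed e * (vt (head E e) * a) \<in> loops v"
  unfolding loops_def using assms(3) unfolding reals_le_def
proof (rule lspan_linear[where f = "\<lambda>a. ed e * (vt (head E e) * a)"])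
  fix x assume "x \<in> {pe u p |u p. awalk u p v \<and> length p \<le> n}"
  then obtain u p where x: "x = pe u p" "awalk u p v" by blast
  have uv: "u \<in> verts E" "head E e \<in> verts E" using x assms(1) by auto
  show "ed e * (vt (head E e) * x) \<in> lspan {pe v p |p. awalk v p v \<and> p \<noteq> []}"
  proof (cases "u = head E e")
    case True
    then have "ed e * (vt (head E e) * x) = pe v (e # p)" using x by (simp add: vt_pe)
    moreover have "awalk v (e # p) v" using x assms True by (simp add: awalk_simps)
    then have "pe v (e # p) \<in> lspan {pe v p |p. awalk v p v \<and> p \<noteq> []}"
      by (intro lspan_base) blast
    ultimately show ?thesis by simp
  next
    case False
    have "vt (head E e) * x = vt (head E e) * vt u * x" using x by (simp add: mult.assoc vt_pe)
    then show ?thesis using uv False by (auto simp: vt_vt)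
  qed
qed (simp_all add: distrib_left \<kappa>_left_comm)

lemma loops_vt: "y \<in> loops v \<Longrightarrow> y * vt v = y"
  unfolding loops_def by (induction rule: lspan.induct) (auto simp: distrib_right mult.assoc pe_vt)

lemma vt_loops: "y \<in> loops v \<Longrightarrow> vt v * y = y"
  unfolding loops_def by (induction rule: lspan.induct) (auto simp: distrib_left \<kappa>_left_comm vt_pe)

lemma reals_le_vt: "y \<in> reals_le n v \<Longrightarrow> y * vt v = y"
  unfolding reals_le_def by (induction rule: lspan.induct) (auto simp: distrib_right mult.assoc pe_vt)

lemma exists_vt_notin:
  assumes "aideal J" "x \<in> alg" "x \<notin> J"
  shows "\<exists>v\<in>verts E. vt v * x \<notin> J" "\<exists>v\<in>verts E. x * vt v \<notin> J"
proof -
  obtain F where F: "finite F" "F \<subseteq> verts E" "(\<Sum>v\<in>F. vt v) * x = x" "x * (\<Sum>v\<in>F. vt v) = x"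
    by (rule local_unit[OF assms(2)])
  have "\<exists>v\<in>F. vt v * x \<notin> J"
    using aideal_sum[OF assms(1), of F "\<lambda>v. vt v * x"] F(3) assms(3) by (auto simp: sum_distrib_right)
  then show "\<exists>v\<in>verts E. vt v * x \<notin> J" using F(2) by blast
  have "\<exists>v\<in>F. x * vt v \<notin> J"
    using aideal_sum[OF assms(1), of F "\<lambda>v. x * vt v"] F(4) assms(3) by (auto simp: sum_distrib_left)
  then show "\<exists>v\<in>verts E. x * vt v \<notin> J" using F(2) by blast
qed

text \<open>A vertex u on the left keeps the element outside of J. If the constant term survives,
  all remaining paths run from v to v and the form is reached; otherwise some e* strips a first edge
  and n drops. The factor z is carried along because only the product a z is known to lie in
  P.\<close>

lemma left_reduction:
  assumes "aideal P" "aideal J" "v \<in> verts E" "z \<in> alg"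
    and "a \<in> reals_le n v" "a * z \<in> P" "a * z \<notin> J"
  shows "\<exists>k y. k \<noteq> 0 \<and> y \<in> loops v \<and> (\<kappa> k * vt v + y) * z \<in> P - J"
  using assms(5-)
proof (induction n arbitrary: a rule: less_induct)
  case (less n)
  from reals_le_decomp[OF less.prems(1) assms(3)]
  obtain c G y where G: "finite G" "G \<subseteq> arcs E" "n = 0 \<longrightarrow> G = {}"
    and y': "\<forall>e. y e \<in> reals_le (n - 1) v" "\<forall>e\<in>arcs E. vt (head E e) * y e = y e"
    and a: "a = \<kappa> c * vt v + (\<Sum>e\<in>G. ed e * y e)"
    by (elim exE conjE)
  from y' have y: "\<And>e. y e \<in> reals_le (n - 1) v" "\<And>e. e \<in> arcs E \<Longrightarrow> vt (head E e) * y e = y e"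
    by simp_all
  have az: "a * z \<in> alg" using less.prems(2) assms(1) by (rule aideal_sub[rotated])
  obtain u where u: "u \<in> verts E" "vt u * (a * z) \<notin> J"
    using exists_vt_notin(1)[OF assms(2) az less.prems(3)] by blast
  have vta: "vt u * a = (if u = v then \<kappa> c * vt v else 0) + (\<Sum>e\<in>{e\<in>G. tail E e = u}. ed e * y e)"
  proof -
    have "vt u * (ed e * y e) = (if tail E e = u then ed e * y e else 0)" if "e \<in> G" for e
    proof -
      have e: "e \<in> arcs E" using that G(2) by blast
      then have "vt u * (ed e * y e) = vt u * vt (tail E e) * (ed e * y e)"
        by (simp add: mult.assoc) (simp add: mult.assoc[symmetric] vt_ed)
      also have "\<dots> = (if tail E e = u then vt (tail E e) * ed e * y e else 0)"
        using u(1) e by (auto simp: vt_vt mult.assoc)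
      finally show ?thesis unfolding vt_ed[OF e] .
    qed
    then have "(\<Sum>e\<in>G. vt u * (ed e * y e)) = (\<Sum>e\<in>{e\<in>G. tail E e = u}. ed e * y e)"
      using G(1) by (simp add: sum.If_cases Int_def cong: sum.cong)
    then show ?thesis
      unfolding a by (simp add: distrib_left sum_distrib_left \<kappa>_left_comm vt_vt[OF u(1) assms(3)])
  qed
  show ?case
  proof (cases "u = v \<and> c \<noteq> 0")
    case True
    define b where "b = (\<Sum>e\<in>{e\<in>G. tail E e = u}. ed e * y e)"
    have "b \<in> loops v"
      unfolding b_def loops_def
    proof (rule lspan_sum)
      fix e assume "e \<in> {e \<in> G. tail E e = u}"
      then have e: "e \<in> arcs E" "tail E e = v" using G(2) True by auto
      show "ed e * y e \<in> lspan {pe v p |p. awalk v p v \<and> p \<noteq> []}"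
        using ed_reals_loops[OF e y(1)[of e]] by (simp add: y(2)[OF e(1)] loops_def)
    qed
    moreover have "(\<kappa> c * vt v + b) * z = vt u * (a * z)"
      using vta True by (simp add: b_def mult.assoc[symmetric])
    ultimately show ?thesis using True u(2) aideal_left[OF assms(1) vt_alg[OF u(1)] less.prems(2)]
      by (intro exI[of _ c] exI[of _ b]) auto
  next
    case False
    then have vta': "vt u * a = (\<Sum>e\<in>{e\<in>G. tail E e = u}. ed e * y e)" using vta by auto
    \<comment> \<open>If all summands were in J, so would be their sum; the edge found here is the
      one to be stripped.\<close>
    have "\<exists>e\<in>{e\<in>G. tail E e = u}. ed e * y e * z \<notin> J"
    proof (rule ccontr)
      assume "\<not> ?thesis"
      then have "(\<Sum>e\<in>{e\<in>G. tail E e = u}. ed e * y e * z) \<in> J"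
        by (intro aideal_sum[OF assms(2)]) auto
      then show False using u(2) vta' by (simp add: mult.assoc[symmetric] sum_distrib_right)
    qed
    then obtain e where e: "e \<in> G" "tail E e = u" "ed e * y e * z \<notin> J" by blast
    have ea: "e \<in> arcs E" using e G by blast
    have "y e * z \<notin> J" using e(3) aideal_left[OF assms(2) ed_alg[OF ea]] by (auto simp: mult.assoc)
    moreover have "gh e * (vt u * a) = y e"
    proof -
      have "gh e * (ed f * y f) = (if e = f then y e else 0)" if "f \<in> {e\<in>G. tail E e = u}" for f
      proof -
        have f: "f \<in> arcs E" using that G(2) by blast
        have "gh e * (ed f * y f) = gh e * ed f * y f" by (simp add: mult.assoc)
        then show ?thesis using ea f y(2) by (simp add: gh_ed)
      qed
      then have "(\<Sum>f\<in>{e\<in>G. tail E e = u}. gh e * (ed f * y f)) =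
          (\<Sum>f\<in>{e\<in>G. tail E e = u}. if e = f then y e else 0)"
        by (intro sum.cong refl)
      also have "\<dots> = y e" using e G(1) by simp
      finally have "(\<Sum>f\<in>{e\<in>G. tail E e = u}. gh e * (ed f * y f)) = y e" .
      then show ?thesis by (simp add: vta' sum_distrib_left)
    qed
    then have "y e * z = gh e * (vt u * (a * z))" by (metis mult.assoc)
    then have "y e * z \<in> P"
      using aideal_left[OF assms(1) gh_alg[OF ea] aideal_left[OF assms(1) vt_alg[OF u(1)] less.prems(2)]] by simp
    moreover have "n - 1 < n" using G(3) e(1) by auto
    ultimately show ?thesis using less.IH[OF _ y(1)[of e]] by blast
  qed
qed

lemma reals_le_mono: "m \<le> n \<Longrightarrow> reals_le m v \<subseteq> reals_le n v"
  unfolding reals_le_def by (rule lspan_mono) (blast intro: le_trans)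

lemma reals_in_reals_le: "a \<in> reals v \<Longrightarrow> \<exists>n. a \<in> reals_le n v"
  unfolding reals_def
proof (induction rule: lspan.induct)
  case lspan_zero then show ?case by (auto simp: reals_le_def)
next
  case (lspan_step x y k)
  then obtain u p n where *: "x = pe u p" "awalk u p v" "y \<in> reals_le n v" by blast
  have "x \<in> reals_le (max n (length p)) v"
    using * max.cobounded2 unfolding reals_le_def by (intro lspan_base) blast
  moreover have "y \<in> reals_le (max n (length p)) v"
    using *(3) reals_le_mono[of n "max n (length p)" v] by auto
  ultimately show ?case unfolding reals_le_def by (blast intro: lspan_add lspan_scale)
qed

definition ghosts_le :: "nat \<Rightarrow> 'v \<Rightarrow> 'q set" where
  "ghosts_le n v = lspan {pe u p * ge v q | u p q w. awalk u p w \<and> awalk v q w \<and> length q \<le> n}"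

lemma ghosts_le_vt: "x \<in> ghosts_le n v \<Longrightarrow> x * vt v = x"
  unfolding ghosts_le_def
  by (induction rule: lspan.induct) (auto simp: distrib_right mult.assoc ge_vt)

lemma reals_mult_ghosts_le:
  assumes "a \<in> reals v" "awalk v p w"
  shows "a * pe v p \<in> ghosts_le n w"
  using assms(1) unfolding reals_def ghosts_le_def
proof (rule lspan_mult_right)
  fix x assume "x \<in> {pe u p |u p. awalk u p v}"
  then obtain u q where x: "x = pe u q" "awalk u q v" by blast
  have w: "w \<in> verts E" using assms(2) by auto
  have qp: "awalk u (q @ p) w" using x(2) assms(2) by (rule awalk_cat)
  have "x * pe v p = pe u (q @ p) * ge w []"
    using x assms(2) qp by (simp add: pe_append pe_vt mult.assoc)
  moreover have "awalk w [] w" using w by (simp add: awalk_simps)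
  ultimately show "x * pe v p \<in> lspan {pe u p * ge w q |u p q x. awalk u p x \<and> awalk w q x \<and> length q \<le> n}"
    using qp by (intro lspan_base CollectI exI[of _ u] exI[of _ "q @ p"] exI[of _ "[]"] exI[of _ w]) simp
qed

text \<open>The monomials p q* are sorted by their rightmost ghost edge, which belongs to the first
  edge of q; right multiplication by this edge removes it.\<close>

lemma ghosts_le_decomp:
  assumes "x \<in> ghosts_le n v" "v \<in> verts E"
  shows "\<exists>a F y. a \<in> reals v \<and> finite F \<and> F \<subseteq> out_arcs E v \<and> (n = 0 \<longrightarrow> F = {}) \<and>
    (\<forall>e. y e \<in> ghosts_le (n - 1) (head E e)) \<and> (\<forall>e. e \<notin> F \<longrightarrow> y e = 0) \<and>
    x = a + (\<Sum>e\<in>F. y e * gh e)"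
  using assms(1) unfolding ghosts_le_def
proof induction
  case lspan_zero
  show ?case
    by (rule exI[of _ 0], rule exI[of _ "{}"], rule exI[of _ "\<lambda>_. 0"]) (simp add: reals_def)
next
  case (lspan_step x x' k)
  then obtain a F y where IH: "a \<in> reals v" "finite F" "F \<subseteq> out_arcs E v" "n = 0 \<longrightarrow> F = {}"
    "\<forall>e. y e \<in> lspan {pe u p * ge (head E e) q | u p q w. awalk u p w \<and> awalk (head E e) q w \<and> length q \<le> n - 1}"
    "\<forall>e. e \<notin> F \<longrightarrow> y e = 0" "x' = a + (\<Sum>e\<in>F. y e * gh e)" by (elim exE conjE)
  obtain u p q w where x: "x = pe u p * ge v q" "awalk u p w" "awalk v q w" "length q \<le> n"
    using lspan_step(1) by blast
  show ?case
  proof (cases q)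
    case Nil
    then have xu: "x = pe u p" "awalk u p v" using x by (auto simp: awalk_simps pe_vt)
    have "\<kappa> k * x + a \<in> reals v"
      using lspan.lspan_step[OF _ IH(1)[unfolded reals_def], of x k] xu unfolding reals_def by blast
    moreover have "\<kappa> k * x + x' = (\<kappa> k * x + a) + (\<Sum>e\<in>F. y e * gh e)"
      using IH(7) by (simp add: add.assoc)
    ultimately show ?thesis using IH(2-6)
      by (intro exI[of _ "\<kappa> k * x + a"] exI[of _ F] exI[of _ y]) simp
  next
    case (Cons f q')
    define y' where "y' e = y e + (if e = f then \<kappa> k * (pe u p * ge (head E f) q') else 0)" for e
    have f: "f \<in> out_arcs E v" "awalk (head E f) q' w" "length q' \<le> n - 1" "n \<noteq> 0"
      using x Cons by (auto simp: awalk_simps)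
    have "(\<Sum>e\<in>insert f F. y' e * gh e) =
        (\<Sum>e\<in>insert f F. y e * gh e) + (\<Sum>e\<in>insert f F. if e = f then \<kappa> k * x else 0)"
      unfolding sum.distrib[symmetric] y'_def
      by (intro sum.cong) (auto simp: distrib_right x(1) Cons mult.assoc)
    also have "(\<Sum>e\<in>insert f F. y e * gh e) = (\<Sum>e\<in>F. y e * gh e)"
      using IH(2,6) by (intro sum.mono_neutral_right) auto
    finally have "\<kappa> k * x + x' = a + (\<Sum>e\<in>insert f F. y' e * gh e)"
      using IH(2,7) by (simp add: add_ac)
    moreover have "y' e \<in> lspan {pe u p * ge (head E e) q | u p q w. awalk u p w \<and> awalk (head E e) q w \<and> length q \<le> n - 1}" for e
    proof -
      have "pe u p * ge (head E f) q' \<in> lspan {pe u p * ge (head E f) q | u p q w. awalk u p w \<and> awalk (head E f) q w \<and> length q \<le> n - 1}"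
        using f x by (intro lspan_base) blast
      then show ?thesis unfolding y'_def using IH(5) by (auto intro!: lspan_add lspan_scale)
    qed
    moreover have "\<forall>e. e \<notin> insert f F \<longrightarrow> y' e = 0" using IH(6) by (auto simp: y'_def)
    ultimately show ?thesis using IH(1-3) f
      by (intro exI[of _ a] exI[of _ "insert f F"] exI[of _ y']) simp
  qed
qed

text \<open>Among infinitely many edges at v, one starts no path of y; its ghost sees only the
  constant term of k v + y.\<close>

lemma loops_first_edge_finite:
  assumes "y \<in> loops v"
  shows "\<exists>G. finite G \<and> (\<forall>f\<in>arcs E - G. gh f * y = 0)"
  using assms unfolding loops_def
proof induction
  case lspan_zero then show ?case by (intro exI[of _ "{}"]) simp
next
  case (lspan_step x y k)
  then obtain G where G: "finite G" "\<forall>f\<in>arcs E - G. gh f * y = 0" by blast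
  obtain e p where x: "x = pe v (e # p)" "awalk v (e # p) v"
    using lspan_step(1) by (auto simp: neq_Nil_conv)
  have "gh f * x = 0" if "f \<in> arcs E - insert e G" for f
    using that x by (auto simp: awalk_simps mult.assoc[symmetric] gh_ed)
  then show ?case using G
    by (intro exI[of _ "insert e G"]) (auto simp: distrib_left \<kappa>_left_comm)
qed

text \<open>This is the situation in which right multiplication by edges no longer helps: all x e
  lie in J but x does not. Then v is not regular, as x = \<Sum> x e e* would lie in J. Reducing a,
  where a z is x modulo J, gives (k v + y) z in P; this is contradictory however many edges lead
  from v to the outside of H.\<close>

lemma ghost_exclusion:
  assumes P: "aideal P" and J: "aideal J" and sub: "J \<subseteq> P"
    and van: "\<And>v. v \<in> vanish P \<Longrightarrow> vt v \<in> J"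
    and brk: "\<And>u. u \<in> breaking_vertices E (vanish P) \<Longrightarrow> bel (vanish P) u \<in> P \<Longrightarrow> bel (vanish P) u \<in> J"
    and v: "v \<in> verts E" and F: "finite F" "F \<subseteq> out_arcs E v" and a: "a \<in> reals v"
    and z: "z = vt v - (\<Sum>e\<in>F. ed e * gh e)" and az: "a * z \<in> P" "a * z \<notin> J"
    and x: "\<And>e. e \<in> out_arcs E v \<Longrightarrow> x * ed e \<in> J" "x * vt v = x" "x \<notin> J" "x \<in> alg"
  shows False
proof -
  have xeg: "x * (\<Sum>e\<in>A. ed e * gh e) \<in> J" if "A \<subseteq> out_arcs E v" for A
    unfolding sum_distrib_left mult.assoc[symmetric]
  proof (rule aideal_sum[OF J])
    fix e assume "e \<in> A"
    then show "x * ed e * gh e \<in> J" using that x(1) by (intro aideal_right[OF J gh_alg]) auto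
  qed
  have vv: "v \<notin> vanish P" using van[of v] aideal_left[OF J x(4), of "vt v"] x by auto
  have "\<not> regular_vertex E v"
    using ck2[of v] xeg[of "out_arcs E v"] x by auto
  have zalg: "z \<in> alg" unfolding z using F v
    by (intro alg_diff vt_alg alg_sum alg_mult ed_alg gh_alg) auto
  obtain n where "a \<in> reals_le n v" using reals_in_reals_le[OF a] by blast
  from left_reduction[OF P J v zalg this az]
  obtain k y where k: "k \<noteq> 0" and y: "y \<in> loops v" and b: "(\<kappa> k * vt v + y) * z \<in> P"
    by blast
  have her: "hereditary E (vanish P)" by (rule vanish_hereditary[OF P])
  consider "infinite (arcs_outside E (vanish P) v)"
    | "arcs_outside E (vanish P) v = {}"
    | "finite (arcs_outside E (vanish P) v)" "arcs_outside E (vanish P) v \<noteq> {}" by blast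
  then show False
  proof cases
    \<comment> \<open>An edge f outside of F that starts no path of y isolates the constant term: f*
      (k v + y) z f = k r(f), and r(f) is not in H.\<close>
    case 1
    obtain G where G: "finite G" "\<forall>f\<in>arcs E - G. gh f * y = 0"
      using loops_first_edge_finite[OF y] by blast
    obtain f where f: "f \<in> arcs_outside E (vanish P) v" "f \<notin> F \<union> G"
      using 1 F(1) G(1) by (meson finite_Un finite_subset subsetI)
    then have fa: "f \<in> arcs E" "tail E f = v" "head E f \<notin> vanish P" "head E f \<in> verts E"
      by (auto simp: arcs_outside_def)
    have "ed e * gh e * ed f = 0" if "e \<in> F" for e
      using that F(2) f fa by (auto simp: mult.assoc gh_ed)
    then have zf: "z * ed f = ed f"
      unfolding z using vt_ed[OF fa(1)] fa(2) by (simp add: left_diff_distrib sum_distrib_right)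
    have "gh f * ((\<kappa> k * vt v + y) * z) * ed f = gh f * (\<kappa> k * vt v + y) * (z * ed f)"
      by (simp add: mult.assoc)
    also have "\<dots> = \<kappa> k * (gh f * (vt v * ed f)) + gh f * y * ed f"
      unfolding zf by (simp add: distrib_left distrib_right mult.assoc \<kappa>_left_comm)
    also have "\<dots> = \<kappa> k * vt (head E f)"
      using G(2) f fa vt_ed[OF fa(1)] by (simp add: gh_ed)
    finally have "\<kappa> k * vt (head E f) \<in> P"
      using aideal_alg_outer[OF P b gh_alg[OF fa(1)] ed_alg[OF fa(1)]] by simp
    then show False using aideal_unscale[OF P _ k] fa by (simp add: vanish_def)
  next
    \<comment> \<open>No closed path of positive length starts at v, so y = 0 and z lies in P; the
      edges in F end in H, hence v itself lies in P.\<close>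
    case 2
    have "loops v \<subseteq> lspan {}"
      unfolding loops_def
    proof (rule lspan_mono, rule subsetI)
      fix x assume "x \<in> {pe v p |p. awalk v p v \<and> p \<noteq> []}"
      then obtain e p where "awalk v (e # p) v" by (auto simp: neq_Nil_conv)
      from awalk_Cons_outside[OF her this vv] 2 show "x \<in> {}" by blast
    qed
    then have "y = 0" using y by (auto elim: lspan.cases)
    moreover have "vt v * ed e = ed e" if "e \<in> F" for e
      using that F(2) vt_ed[of e] by auto
    then have "vt v * z = z"
      unfolding z right_diff_distrib sum_distrib_left mult.assoc[symmetric] vt_idem[OF v]
      by (intro arg_cong2[where f = minus] sum.cong refl) simp
    ultimately have "\<kappa> k * z \<in> P" using b by (simp add: mult.assoc)
    then have "z \<in> P" using aideal_unscale[OF P _ k] by blast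
    moreover have "(\<Sum>e\<in>F. ed e * gh e) \<in> P"
    proof (rule aideal_sum[OF P])
      fix e assume "e \<in> F"
      then have e: "e \<in> arcs E" "head E e \<in> vanish P"
        using F(2) 2 by (auto simp: arcs_outside_def)
      then show "ed e * gh e \<in> P"
        by (intro aideal_right[OF P] aideal_ed[OF P] gh_alg) (auto simp: vanish_def)
    qed
    ultimately have "z + (\<Sum>e\<in>F. ed e * gh e) \<in> P" by (rule aideal_add[OF P])
    then have "vt v \<in> P" by (simp add: z)
    then show False using vv v by (simp add: vanish_def)
  next
    \<comment> \<open>Now v is a breaking vertex. J misses v^H because x v^H is x modulo J, so P
      misses it by \<open>brk\<close>. But v^H kills y and absorbs z modulo P, which leaves k v^H in
      P.\<close>
    case 3
    have "infinite (out_arcs E v)"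
      using \<open>\<not> regular_vertex E v\<close> 3(2) v by (auto simp: regular_vertex_def arcs_outside_def)
    then have bv: "v \<in> breaking_vertices E (vanish P)"
      using 3 v vv by (auto simp: breaking_vertices_def infinite_emitter_def)
    let ?b = "bel (vanish P) v"
    have balg: "?b \<in> alg" using bel_alg[OF v 3(1)] .
    have "?b \<notin> J"
    proof
      assume "?b \<in> J"
      moreover have "x = x * ?b + x * (\<Sum>e\<in>arcs_outside E (vanish P) v. ed e * gh e)"
        unfolding bel_def right_diff_distrib x(2) by simp
      moreover have "x * (\<Sum>e\<in>arcs_outside E (vanish P) v. ed e * gh e) \<in> J"
        by (rule xeg) (auto simp: arcs_outside_def)
      ultimately show False using x(3,4) aideal_left[OF J x(4), of ?b] aideal_add[OF J] by metis
    qed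
    then have nb: "?b \<notin> P" using brk[OF bv] by blast
    have "z * ?b - ?b \<in> P"
    proof -
      have "z * ?b - ?b = - (\<Sum>e\<in>F. ed e * (gh e * ?b))"
        unfolding z by (simp add: left_diff_distrib sum_distrib_right vt_bel(1)[OF v] mult.assoc)
      moreover have "ed e * (gh e * ?b) \<in> P" if "e \<in> F" for e
      proof -
        have e: "e \<in> out_arcs E v" "e \<in> arcs E" using that F(2) by auto
        show ?thesis
        proof (cases "e \<in> arcs_outside E (vanish P) v")
          case True then show ?thesis using gh_bel[OF 3(1) e(1)] P by (simp add: aideal_def)
        next
          case False
          then have "vt (head E e) \<in> P" using e by (auto simp: arcs_outside_def vanish_def)
          then show ?thesis
            using aideal_left[OF P ed_alg[OF e(2)] aideal_right[OF P balg aideal_gh[OF P e(2)]]] by simp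
        qed
      qed
      ultimately show ?thesis using aideal_minus[OF P aideal_sum[OF P, of F]] by simp
    qed
    then have "?b * (\<kappa> k * vt v + y) * (z * ?b - ?b) \<in> P"
      by (intro aideal_left[OF P] alg_mult[OF balg] alg_add alg_scale vt_alg[OF v] loops_alg[OF y])
    moreover have "?b * ((\<kappa> k * vt v + y) * z) * ?b \<in> P"
      using aideal_alg_outer[OF P b balg balg] .
    ultimately have "?b * ((\<kappa> k * vt v + y) * z) * ?b - ?b * (\<kappa> k * vt v + y) * (z * ?b - ?b) \<in> P"
      by (intro aideal_diff[OF P])
    moreover have "?b * ((\<kappa> k * vt v + y) * z) * ?b - ?b * (\<kappa> k * vt v + y) * (z * ?b - ?b) =
        ?b * (\<kappa> k * vt v + y) * ?b"
      by (simp add: right_diff_distrib mult.assoc)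
    moreover have "?b * (\<kappa> k * vt v + y) * ?b = \<kappa> k * ?b"
    proof -
      have "?b * y = 0" using loops_mult_pe[OF y her _ 3(1)] v vv by simp
      then have "?b * (\<kappa> k * vt v + y) = \<kappa> k * ?b"
        by (simp add: distrib_left \<kappa>_left_comm vt_bel(2)[OF v])
      moreover have "?b * ?b = ?b"
      proof -
        have "?b * (ed e * gh e) = 0" if "e \<in> arcs_outside E (vanish P) v" for e
          using bel_ed[OF 3(1), of e] that by (auto simp: arcs_outside_def mult.assoc[symmetric])
        then show ?thesis
          by (subst (2) bel_def) (simp add: right_diff_distrib sum_distrib_left vt_bel(2)[OF v])
      qed
      ultimately show ?thesis by (simp add: mult.assoc)
    qed
    ultimately have "\<kappa> k * ?b \<in> P" by simp
    then show False using aideal_unscale[OF P _ k] nb by blast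
  qed
qed

text \<open>Right multiplication by an edge emitted by v lowers the number of ghost edges, and the
  induction continues if some product stays outside of J. Otherwise x is a z modulo J, which
  \<open>ghost_exclusion\<close> refutes.\<close>

lemma ghost_reduction:
  assumes P: "aideal P" and J: "aideal J" and sub: "J \<subseteq> P"
    and van: "\<And>v. v \<in> vanish P \<Longrightarrow> vt v \<in> J"
    and brk: "\<And>u. u \<in> breaking_vertices E (vanish P) \<Longrightarrow> bel (vanish P) u \<in> P \<Longrightarrow> bel (vanish P) u \<in> J"
    and "v \<in> verts E" "x \<in> ghosts_le n v" "x \<in> P" "x \<notin> J"
  shows "\<exists>v a. v \<in> verts E \<and> a \<in> reals v \<and> a \<in> P \<and> a \<notin> J"
  using assms(6-)
proof (induction n arbitrary: v x)
  case (0 v x)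
  then show ?case using ghosts_le_decomp[of x 0 v] by fastforce
next
  case (Suc n v x)
  have xalg: "x \<in> alg" using aideal_sub[OF P Suc.prems(3)] .
  from ghosts_le_decomp[OF Suc.prems(2,1)] obtain a F y where a: "a \<in> reals v"
    and F: "finite F" "F \<subseteq> out_arcs E v" and "Suc n = 0 \<longrightarrow> F = {}"
    and y': "\<forall>e. y e \<in> ghosts_le (Suc n - 1) (head E e)"
    and y0: "\<forall>e. e \<notin> F \<longrightarrow> y e = 0" and x: "x = a + (\<Sum>e\<in>F. y e * gh e)"
    by (elim exE conjE)
  from y' have y: "\<forall>e. y e \<in> ghosts_le n (head E e)" by simp
  have xe: "x * ed e = a * ed e + y e" if "e \<in> out_arcs E v" for e
  proof -
    have "y f * gh f * ed e = (if f = e then y e else 0)" if "f \<in> F" for f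
      using that F(2) \<open>e \<in> out_arcs E v\<close> y ghosts_le_vt[of "y e" n "head E e"]
      by (auto simp: mult.assoc gh_ed subset_iff)
    then have "(\<Sum>f\<in>F. y f * gh f * ed e) = y e" using F(1) y0 by (simp cong: sum.cong)
    then show ?thesis by (simp add: x distrib_right sum_distrib_right)
  qed
  show ?case
  proof (cases "\<exists>e\<in>out_arcs E v. x * ed e \<notin> J")
    case True
    then obtain e where e: "e \<in> out_arcs E v" "x * ed e \<notin> J" by blast
    have ea: "e \<in> arcs E" "awalk v [e] (head E e)" using e by (auto simp: awalk_simps)
    have "a * ed e \<in> ghosts_le n (head E e)"
      using reals_mult_ghosts_le[OF a ea(2)] pe_single[OF ea(1)] by simp
    then have "x * ed e \<in> ghosts_le n (head E e)"
      unfolding xe[OF e(1)] ghosts_le_def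
      by (rule lspan_add) (rule y[rule_format, unfolded ghosts_le_def])
    then show ?thesis
      using Suc.IH[of "head E e" "x * ed e"] e(2) ea aideal_right[OF P ed_alg[OF ea(1)] Suc.prems(3)]
      by auto
  next
    case False
    define z where "z = vt v - (\<Sum>e\<in>F. ed e * gh e)"
    have "a * vt v = a" using a unfolding reals_def
      by (induction rule: lspan.induct) (auto simp: distrib_right mult.assoc pe_vt)
    then have "x - a * z = (\<Sum>e\<in>F. (y e + a * ed e) * gh e)"
      by (simp add: z_def x right_diff_distrib sum_distrib_left distrib_right sum.distrib mult.assoc)
    also have "\<dots> = (\<Sum>e\<in>F. x * ed e * gh e)"
      using F(2) xe by (intro sum.cong) (auto simp: add.commute subset_iff)
    finally have "x - a * z = (\<Sum>e\<in>F. x * ed e * gh e)" .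
    moreover have "(\<Sum>e\<in>F. x * ed e * gh e) \<in> J"
    proof (rule aideal_sum[OF J])
      fix e assume "e \<in> F"
      then show "x * ed e * gh e \<in> J" using False F(2) by (intro aideal_right[OF J gh_alg]) auto
    qed
    ultimately have d: "x - a * z \<in> J" by simp
    then have "a * z \<in> P" "a * z \<notin> J"
      using aideal_cong[OF P] aideal_cong[OF J d] sub Suc.prems by blast+
    then have False
      using ghost_exclusion[OF P J sub van brk Suc.prems(1) F a z_def _ _ _ ghosts_le_vt[OF Suc.prems(2)]
        Suc.prems(4) xalg] False by blast
    then show ?thesis ..
  qed
qed

text \<open>Once the ghost edges are gone, \<open>left_reduction\<close> with z = w turns the
  combination of paths into k w + y. Every identification of an ideal below applies this result with
  J the candidate.\<close>

theorem ideal_reduction: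
  assumes P: "aideal P" and J: "aideal J" and sub: "J \<subseteq> P"
    and van: "\<And>v. v \<in> vanish P \<Longrightarrow> vt v \<in> J"
    and brk: "\<And>u. u \<in> breaking_vertices E (vanish P) \<Longrightarrow> bel (vanish P) u \<in> P \<Longrightarrow> bel (vanish P) u \<in> J"
    and "P \<noteq> J"
  obtains w k y where "noexit E (vanish P) w" "k \<noteq> 0" "y \<in> loops w"
    "\<kappa> k * vt w + y \<in> P" "\<kappa> k * vt w + y \<notin> J"
proof -
  obtain x where x: "x \<in> P" "x \<notin> J" using sub \<open>P \<noteq> J\<close> by blast
  have xalg: "x \<in> alg" by (rule aideal_sub[OF P x(1)])
  obtain v where v: "v \<in> verts E" "x * vt v \<notin> J" using exists_vt_notin(2)[OF J xalg x(2)] by blast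
  have "\<exists>n. z * vt v \<in> ghosts_le n v" if "z \<in> alg" for z
    using that unfolding alg_def
  proof induction
    case lspan_zero then show ?case by (simp add: ghosts_le_def)
  next
    case (lspan_step x y k)
    then obtain n where n: "y * vt v \<in> ghosts_le n v" by blast
    obtain u p v' q w where m: "x = pe u p * ge v' q" "awalk u p w" "awalk v' q w"
      using lspan_step(1) unfolding mons_def by blast
    have v': "v' \<in> verts E" using m by auto
    have "x * vt v = pe u p * (ge v' q * vt v' * vt v)" unfolding m(1) ge_vt[OF m(3)] mult.assoc ..
    also have "\<dots> = pe u p * (ge v' q * (vt v' * vt v))" by (simp only: mult.assoc)
    also have "\<dots> = (if v' = v then x else 0)"
      using v' v(1) ge_vt[OF m(3)] by (auto simp: vt_vt m(1))
    finally have xv: "x * vt v = (if v' = v then x else 0)" .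
    have "x * vt v \<in> ghosts_le (max n (length q)) v"
    proof (cases "v' = v")
      case True
      have "x \<in> ghosts_le (max n (length q)) v"
        using True m unfolding ghosts_le_def
        by (intro lspan_base CollectI exI[of _ u] exI[of _ p] exI[of _ q] exI[of _ w]) simp
      then show ?thesis using True xv by simp
    qed (simp add: xv ghosts_le_def)
    moreover have "ghosts_le n v \<subseteq> ghosts_le (max n (length q)) v"
      unfolding ghosts_le_def by (rule lspan_mono) (blast intro: le_trans max.cobounded1)
    ultimately have "\<kappa> k * (x * vt v) + y * vt v \<in> ghosts_le (max n (length q)) v"
      using n unfolding ghosts_le_def by (blast intro: lspan_add lspan_scale)
    then show ?case by (auto simp: distrib_right mult.assoc)
  qed
  then obtain n where n: "x * vt v \<in> ghosts_le n v" using xalg by blast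
  have "x * vt v \<in> P" using aideal_right[OF P vt_alg[OF v(1)] x(1)] .
  from ghost_reduction[OF P J sub van brk v(1) n this v(2)]
  obtain w a where w: "w \<in> verts E" "a \<in> reals w" "a \<in> P" "a \<notin> J" by blast
  obtain m where m: "a \<in> reals_le m w" using reals_in_reals_le[OF w(2)] by blast
  have aw: "a * vt w = a" by (rule reals_le_vt[OF m])
  from left_reduction[OF P J w(1) vt_alg[OF w(1)] m, unfolded aw, OF w(3,4)]
  obtain k y where k: "k \<noteq> 0" "y \<in> loops w" "(\<kappa> k * vt w + y) * vt w \<in> P - J" by blast
  have "(\<kappa> k * vt w + y) * vt w = \<kappa> k * vt w + y"
    using vt_idem[OF w(1)] loops_vt[OF k(2)] by (simp add: distrib_right mult.assoc)
  then have b: "\<kappa> k * vt w + y \<in> P" "\<kappa> k * vt w + y \<notin> J" using k(3) by auto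
  have "vt w \<notin> P"
  proof
    assume "vt w \<in> P"
    then have "vt w \<in> J" using van w(1) by (simp add: vanish_def)
    then have "(\<kappa> k * vt w + y) * vt w \<in> J"
      by (intro aideal_left[OF J] alg_add alg_scale vt_alg[OF w(1)] loops_alg[OF k(2)])
    then show False using k(3) by blast
  qed
  then show ?thesis using noexit_if_loop_poly[OF P k(1,2) b(1) w(1)] k(1,2) b that by blast
qed

end

section \<open>Annihilators of simple modules\<close>

text \<open>A simple module is \<open>A/N\<close> for a maximal left ideal \<open>N\<close>; as \<open>A\<close> has no unit, \<open>u\<close> takes over the role
  of a generator of this module.\<close>

definition left_prim :: "'q::ring set \<Rightarrow> 'q set \<Rightarrow> bool" where
  "left_prim A P \<longleftrightarrow> (\<exists>N u. N \<subseteq> A \<and> (\<forall>x\<in>N. \<forall>y\<in>N. x - y \<in> N) \<and> (\<forall>a\<in>A. \<forall>x\<in>N. a * x \<in> N) \<and>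
     u \<in> A \<and> u \<notin> N \<and> (\<forall>x\<in>A. x * u - x \<in> N) \<and>
     (\<forall>x\<in>A - N. \<forall>z\<in>A. \<exists>y\<in>A. y * x - z \<in> N) \<and> P = {x \<in> A. \<forall>y\<in>A. x * y \<in> N})"

locale leavitt_prim = leavitt_family E \<kappa> vt ed gh
  for E :: "('v, 'e) pre_digraph" and \<kappa> :: "'k::field \<Rightarrow> 'q::ring_1" and vt ed gh +
  fixes N P :: "'q set" and u :: 'q
  assumes N_sub: "N \<subseteq> alg" and N_diff: "x \<in> N \<Longrightarrow> y \<in> N \<Longrightarrow> x - y \<in> N"
    and N_left: "a \<in> alg \<Longrightarrow> x \<in> N \<Longrightarrow> a * x \<in> N"
    and u: "u \<in> alg" "u \<notin> N" and N_unit: "x \<in> alg \<Longrightarrow> x * u - x \<in> N"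
    and N_max: "x \<in> alg \<Longrightarrow> x \<notin> N \<Longrightarrow> z \<in> alg \<Longrightarrow> \<exists>y\<in>alg. y * x - z \<in> N"
    and P_def: "P = {x \<in> alg. \<forall>y\<in>alg. x * y \<in> N}"
begin

abbreviation H where "H \<equiv> vanish P"

lemma N_zero [simp]: "0 \<in> N"
  using N_diff[OF N_unit[OF u(1)] N_unit[OF u(1)]] by simp

lemma N_minus: "x \<in> N \<Longrightarrow> - x \<in> N"
  using N_diff[of 0 x] by simp

lemma N_add: "x \<in> N \<Longrightarrow> y \<in> N \<Longrightarrow> x + y \<in> N"
  using N_diff[OF _ N_minus] by fastforce

lemma N_cong: "x - y \<in> N \<Longrightarrow> x \<in> N \<longleftrightarrow> y \<in> N"
  using N_add[of "x - y" y] N_diff[of x "x - y"] by auto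

lemma N_sum: "(\<And>i. i \<in> I \<Longrightarrow> f i \<in> N) \<Longrightarrow> sum f I \<in> N"
  by (induction I rule: infinite_finite_induct) (auto intro: N_add)

lemma N_scale:
  assumes "x \<in> N" shows "\<kappa> k * x \<in> N"
proof -
  have "x \<in> alg" using assms N_sub by blast
  then obtain F where F: "finite F" "F \<subseteq> verts E" "(\<Sum>v\<in>F. vt v) * x = x" "x * (\<Sum>v\<in>F. vt v) = x"
    by (rule local_unit)
  have "\<kappa> k * (\<Sum>v\<in>F. vt v) \<in> alg" using F by (intro alg_scale alg_sum vt_alg) auto
  from N_left[OF this assms] show ?thesis by (simp add: mult.assoc F)
qed

lemma P_aideal: "aideal P"
  unfolding aideal_def P_def
  by (auto simp: distrib_right mult.assoc intro: alg_add alg_mult N_add N_left)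

lemma P_N: "x \<in> P \<Longrightarrow> y \<in> alg \<Longrightarrow> x * y \<in> N"
  by (simp add: P_def)

text \<open>If y z is not in N, it generates the simple module \<open>alg\<close>/N, so every w is t
  y z modulo N, and then x w is x t y z, which lies in N.\<close>

lemma P_prime:
  assumes "x \<in> alg" "y \<in> alg" "\<And>t. t \<in> alg \<Longrightarrow> x * t * y \<in> P"
  shows "x \<in> P \<or> y \<in> P"
proof (rule disjCI)
  assume "y \<notin> P"
  then obtain z where z: "z \<in> alg" "y * z \<notin> N" using assms(2) by (auto simp: P_def)
  have "x * w \<in> N" if w: "w \<in> alg" for w
  proof -
    obtain t where t: "t \<in> alg" "t * (y * z) - w \<in> N"
      using N_max[OF alg_mult[OF assms(2) z(1)] z(2) w] by blast
    have "x * (t * (y * z) - w) \<in> N" by (rule N_left[OF assms(1) t(2)])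
    moreover have "x * t * y * z \<in> N" by (rule P_N[OF assms(3)[OF t(1)] z(1)])
    moreover have "x * w = x * t * y * z - x * (t * (y * z) - w)"
      by (simp add: right_diff_distrib mult.assoc)
    ultimately show ?thesis using N_diff by metis
  qed
  then show "x \<in> P" using assms(1) by (simp add: P_def)
qed

text \<open>By linearity a single monomial witnesses primeness, and its middle vertex is outside of
  H, as otherwise the monomial would lie in P. This turns primeness into statements on
  paths.\<close>

lemma prime_mono:
  assumes "x \<in> alg" "y \<in> alg" "x \<notin> P" "y \<notin> P"
  obtains a p b q w where "awalk a p w" "awalk b q w" "x * (pe a p * ge b q) * y \<notin> P" "w \<notin> H"
proof -
  obtain t where t: "t \<in> alg" "x * t * y \<notin> P" using P_prime assms by blast
  have "\<exists>m\<in>mons. x * m * y \<notin> P"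
  proof (rule ccontr)
    assume *: "\<not> ?thesis"
    have "x * t * y \<in> P" using t(1) unfolding alg_def
    proof induction
      case lspan_zero then show ?case using P_aideal by (simp add: aideal_def)
    next
      case (lspan_step m s k)
      have "x * (\<kappa> k * m + s) * y = \<kappa> k * (x * m * y) + x * s * y"
        by (simp add: distrib_left distrib_right \<kappa>_left_comm mult.assoc)
      then show ?case using * lspan_step
        by (auto intro!: aideal_add[OF P_aideal] aideal_scale[OF P_aideal])
    qed
    then show False using t by blast
  qed
  then obtain a p b q w where m: "awalk a p w" "awalk b q w" "x * (pe a p * ge b q) * y \<notin> P"
    unfolding mons_def by blast
  have "w \<notin> H"
  proof
    assume "w \<in> H"
    then have "pe a p \<in> P" using aideal_pe[OF P_aideal m(1)] by (simp add: vanish_def)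
    then have "x * (pe a p * ge b q) * y \<in> P"
      using assms(1,2) ge_alg[OF m(2)]
      by (intro aideal_right[OF P_aideal] aideal_left[OF P_aideal]) auto
    then show False using m(3) by blast
  qed
  then show ?thesis using that m by blast
qed

section \<open>The vertices outside of a primitive ideal\<close>

lemma vt_pe_other: "v \<in> verts E \<Longrightarrow> awalk a p w \<Longrightarrow> v \<noteq> a \<Longrightarrow> vt v * pe a p = 0"
  using ge_pe_diff[of v "[]" v a p w] by (simp add: awalk_simps)

lemma ge_vt_other: "v \<in> verts E \<Longrightarrow> awalk a p w \<Longrightarrow> v \<noteq> a \<Longrightarrow> ge a p * vt v = 0"
  using ge_pe_diff[of a p w v "[]" v] by (simp add: awalk_simps)

lemma H_iff: "v \<in> H \<longleftrightarrow> v \<in> verts E \<and> vt v \<in> P"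
  by (simp add: vanish_def)

lemma H_compl: "v \<in> verts E - H \<longleftrightarrow> v \<in> verts E \<and> vt v \<notin> P"
  by (auto simp: vanish_def)

lemma H_hereditary: "hereditary E H"
  by (rule vanish_hereditary[OF P_aideal])

text \<open>If v p q* w is not in P, then p starts at v and q at w; their common range is the vertex
  looked for.\<close>

lemma downward_directed:
  assumes "v \<in> verts E - H" "w \<in> verts E - H"
  shows "\<exists>x\<in>verts E - H. path_geq E v x \<and> path_geq E w x"
proof -
  have vw: "v \<in> verts E" "w \<in> verts E" "vt v \<notin> P" "vt w \<notin> P" using assms by (auto simp: H_iff)
  obtain a p b q x where m: "awalk a p x" "awalk b q x" "vt v * (pe a p * ge b q) * vt w \<notin> P" "x \<notin> H"
    by (rule prime_mono[OF vt_alg[OF vw(1)] vt_alg[OF vw(2)] vw(3,4)])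
  have z: "0 \<in> P" using P_aideal by (simp add: aideal_def)
  have "v = a"
  proof (rule ccontr)
    assume "v \<noteq> a"
    from vt_pe_other[OF vw(1) m(1) this] show False using m(3) z by (simp add: mult.assoc[symmetric])
  qed
  moreover have "w = b"
  proof (rule ccontr)
    assume "w \<noteq> b"
    from ge_vt_other[OF vw(2) m(2) this] show False using m(3) z by (simp add: mult.assoc)
  qed
  ultimately have "path_geq E v x" "path_geq E w x" using m(1,2) unfolding path_geq_def by blast+
  moreover have "x \<in> verts E - H" using m(1,4) by blast
  ultimately show ?thesis by blast
qed

lemma H_proper: "verts E - H \<noteq> {}"
proof -
  obtain F where F: "finite F" "F \<subseteq> verts E" "(\<Sum>v\<in>F. vt v) * u = u" "u * (\<Sum>v\<in>F. vt v) = u"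
    by (rule local_unit[OF u(1)])
  have "\<exists>v\<in>F. vt v * u \<notin> N"
    using N_sum[of F "\<lambda>v. vt v * u"] F(3) u by (auto simp: sum_distrib_right)
  then obtain v where "v \<in> F" "vt v * u \<notin> N" by blast
  then have "v \<in> verts E" "vt v \<notin> P" using P_N u(1) F(2) by auto
  then show ?thesis using H_compl by blast
qed

section \<open>Countably many vertices below all others\<close>

definition below :: "'v \<Rightarrow> 'q set" where
  "below x = {pe a p * ge b q | a p b q w. awalk a p w \<and> awalk b q w \<and> path_geq E x w}"

text \<open>If x stands between two monomials, the ghost path before it and the path after it must
  both start at x. So the middle vertex of the product is reached from x, and the ideal generated by
  x lies in the span of \<open>below x\<close>.\<close>

lemma mult_vt_mult_below:
  assumes "x \<in> verts E" "t \<in> alg" "s \<in> alg"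
  shows "t * vt x * s \<in> lspan (below x)"
proof -
  have "m * vt x * n \<in> lspan (below x)" if mn: "m \<in> mons" "n \<in> mons" for m n
  proof -
    obtain a p b q w where m: "m = pe a p * ge b q" "awalk a p w" "awalk b q w"
      using mn(1) unfolding mons_def by blast
    obtain a' p' b' q' w' where n: "n = pe a' p' * ge b' q'" "awalk a' p' w'" "awalk b' q' w'"
      using mn(2) unfolding mons_def by blast
    have eq: "m * vt x * n = pe a p * (ge b q * vt x * pe a' p') * ge b' q'"
      by (simp add: m n mult.assoc)
    show ?thesis
    proof (cases "b = x \<and> a' = x")
      case False
      then consider "x \<noteq> b" | "x \<noteq> a'" by blast
      then have "ge b q * vt x * pe a' p' = 0"
      proof cases
        case 1 from ge_vt_other[OF assms(1) m(3) this] show ?thesis by simp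
      next
        case 2 from vt_pe_other[OF assms(1) n(2) this] show ?thesis by (simp add: mult.assoc)
      qed
      then show ?thesis by (simp add: eq)
    next
      case True
      then have q: "awalk x q w" "awalk x p' w'" using m n by auto
      have eq': "m * vt x * n = pe a p * (ge x q * pe x p') * ge b' q'"
        unfolding eq using True q(2) by (simp add: mult.assoc vt_pe)
      show ?thesis using q
      proof (cases rule: ge_pe_cases)
        case (longer r)
        then have "m * vt x * n = pe a (p @ r) * ge b' q'" using eq' m by (simp add: pe_append)
        moreover have "awalk a (p @ r) w'" "awalk b' q' w'" "path_geq E x w'"
          using awalk_cat[OF m(2) longer(2)] n q by (auto simp: path_geq_def)
        ultimately show ?thesis unfolding below_def by (intro lspan_base) blast
      next
        case (shorter r)
        then have "m * vt x * n = pe a p * ge b' (q' @ r)" using eq' n by (simp add: ge_append mult.assoc)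
        moreover have "awalk a p w" "awalk b' (q' @ r) w" "path_geq E x w"
          using awalk_cat[OF n(3) shorter(2)] m q by (auto simp: path_geq_def)
        ultimately show ?thesis unfolding below_def by (intro lspan_base) blast
      qed (simp add: eq')
    qed
  qed
  then have *: "m * vt x * s \<in> lspan (below x)" if "m \<in> mons" for m
    using that lspan_mult_left[OF assms(3)[unfolded alg_def], of "m * vt x" "below x"] by blast
  have "t * (vt x * s) \<in> lspan (below x)"
    by (rule lspan_mult_right[OF assms(2)[unfolded alg_def]]) (use * in \<open>simp add: mult.assoc\<close>)
  then show ?thesis by (simp add: mult.assoc)
qed

text \<open>As x acts nontrivially on the simple module, some element leads from m to a vector that
  x does not kill, and another one from its image under x back to m. Their product with x in between
  fixes m.\<close>

lemma below_fix:
  assumes "x \<in> verts E - H" "m \<in> alg" "m \<notin> N"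
  obtains y where "y \<in> lspan (below x)" "y * m - m \<in> N"
proof -
  have x: "x \<in> verts E" "vt x \<notin> P" using assms(1) by (auto simp: H_iff)
  then obtain z where z: "z \<in> alg" "vt x * z \<notin> N" using vt_alg by (auto simp: P_def)
  obtain s where s: "s \<in> alg" "s * m - z \<in> N" using N_max[OF assms(2,3) z(1)] by blast
  have "vt x * (s * m - z) \<in> N" by (rule N_left[OF vt_alg[OF x(1)] s(2)])
  then have "vt x * (s * m) \<notin> N" using N_cong[of "vt x * (s * m)" "vt x * z"] z(2)
    by (simp add: right_diff_distrib)
  moreover have "vt x * (s * m) \<in> alg" using x s assms by (intro alg_mult vt_alg)
  ultimately obtain t where t: "t \<in> alg" "t * (vt x * (s * m)) - m \<in> N" using N_max assms(2) by blast
  show ?thesis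
    by (rule that[OF mult_vt_mult_below[OF x(1) t(1) s(1)]]) (use t(2) in \<open>simp add: mult.assoc\<close>)
qed

lemma lspan_notin_N:
  assumes "y \<in> lspan X" "y * m \<notin> N"
  shows "\<exists>x\<in>X. x * m \<notin> N"
proof (rule ccontr)
  assume *: "\<not> ?thesis"
  have "y * m \<in> N" using assms(1)
    by induction (use * in \<open>auto simp: distrib_right mult.assoc intro!: N_add N_scale\<close>)
  then show False using assms(2) by blast
qed

text \<open>If e* y \<noteq> 0, then e is the first edge of p in some monomial p q* of y. The
  alternative, a trivial p at v, would make v the middle vertex, which x reaches.\<close>

lemma below_finite:
  assumes "y \<in> lspan (below x)" "\<not> path_geq E x v"
  shows "finite {e \<in> out_arcs E v. gh e * y \<noteq> 0}"
  using assms(1)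
proof induction
  case (lspan_step m y k)
  obtain a p b q w where m: "m = pe a p * ge b q" "awalk a p w" "awalk b q w" "path_geq E x w"
    using lspan_step(1) unfolding below_def by blast
  have "gh e * m = 0" if e: "e \<in> out_arcs E v" "p = [] \<or> e \<noteq> hd p" for e
  proof (cases p)
    case Nil
    then have "a \<noteq> v" "a \<in> verts E" using m assms(2) by (auto simp: awalk_simps)
    moreover have "gh e * vt a = gh e * (vt v * vt a)"
      using e gh_vt[of e] by (auto simp: mult.assoc[symmetric])
    ultimately have "gh e * vt a = 0" using e vt_vt[of v a] by auto
    then show ?thesis using Nil m by (simp add: mult.assoc[symmetric])
  next
    case (Cons f p')
    then show ?thesis using e m by (auto simp: awalk_simps mult.assoc[symmetric] gh_ed)
  qed
  then have "{e \<in> out_arcs E v. gh e * (\<kappa> k * m + y) \<noteq> 0} \<subseteq> insert (hd p) {e \<in> out_arcs E v. gh e * y \<noteq> 0}"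
    by (auto simp: distrib_left \<kappa>_left_comm)
  then show ?case using lspan_step(3) by (meson finite.insertI finite_subset)
qed simp

text \<open>In the module \<open>alg\<close>/N these are the ghost paths of length n that do not
  kill the generator u. They form a tree whose branching has to be bounded.\<close>

definition level :: "nat \<Rightarrow> ('v \<times> 'e list) set" where
  "level n = {(v, b). length b = n \<and> (\<exists>w. awalk v b w) \<and> ge v b * u \<notin> N}"

lemma level_end: "(v, b) \<in> level n \<Longrightarrow> awalk v b w \<Longrightarrow> w \<in> verts E - H"
proof -
  assume a: "(v, b) \<in> level n" "awalk v b w"
  have "vt w * (ge v b * u) \<notin> N" using a vt_ge[OF a(2)] by (simp add: level_def mult.assoc[symmetric])
  then have "vt w \<notin> P" using P_N[of "vt w" "ge v b * u"] alg_mult[OF ge_alg[OF a(2)] u(1)] by blast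
  then show ?thesis using a(2) by (auto simp: H_iff)
qed

text \<open>For the range w of b choose x that does not reach w, and y from the ideal of x that
  fixes b* u modulo N. If e* does not kill b* u, then e* y \<noteq> 0, which only finitely many
  edges e at w satisfy.\<close>

lemma level_finite:
  assumes sep: "\<And>v. v \<in> verts E - H \<Longrightarrow> \<exists>x\<in>verts E - H. \<not> path_geq E x v"
  shows "finite (level n)"
proof (induction n)
  case 0
  obtain F where F: "finite F" "F \<subseteq> verts E" "(\<Sum>v\<in>F. vt v) * u = u" "u * (\<Sum>v\<in>F. vt v) = u"
    by (rule local_unit[OF u(1)])
  have "v \<in> F" if "v \<in> verts E" "vt v * u \<notin> N" for v
  proof (rule ccontr)
    assume "v \<notin> F"
    then have "vt v * (\<Sum>v\<in>F. vt v) = 0"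
      using F(2) that(1) unfolding sum_distrib_left by (intro sum.neutral) (auto simp: vt_vt)
    then have "vt v * u = 0" using F(3) by (metis mult.assoc mult_zero_left)
    then show False using that by simp
  qed
  then have "level 0 \<subseteq> (\<lambda>v. (v, [])) ` F" by (auto simp: level_def awalk_simps)
  then show ?case using F(1) by (meson finite_imageI finite_subset)
next
  case (Suc n)
  define S where "S vb = {e \<in> out_arcs E (last (awalk_verts (fst vb) (snd vb))). gh e * (ge (fst vb) (snd vb) * u) \<notin> N}" for vb
  have fin: "finite (S vb)" if vb: "vb \<in> level n" for vb
  proof -
    obtain v b where vb': "vb = (v, b)" by (cases vb)
    then obtain w where w: "awalk v b w" "ge v b * u \<notin> N" using vb by (auto simp: level_def)
    have m: "ge v b * u \<in> alg" using ge_alg[OF w(1)] u(1) by (rule alg_mult)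
    have lw: "last (awalk_verts v b) = w" using w(1) by auto
    obtain x where x: "x \<in> verts E - H" "\<not> path_geq E x w" using sep level_end vb vb' w(1) by blast
    obtain y where y: "y \<in> lspan (below x)" "y * (ge v b * u) - ge v b * u \<in> N"
      by (rule below_fix[OF x(1) m w(2)])
    have "S vb \<subseteq> {e \<in> out_arcs E w. gh e * y \<noteq> 0}"
    proof
      fix e assume "e \<in> S vb"
      then have e: "e \<in> out_arcs E w" "gh e * (ge v b * u) \<notin> N" by (auto simp: S_def vb' lw)
      have "gh e * (y * (ge v b * u) - ge v b * u) \<in> N" using e(1) y(2) by (intro N_left gh_alg) auto
      then have "gh e * y * (ge v b * u) \<notin> N"
        using e(2) N_cong[of "gh e * (y * (ge v b * u))" "gh e * (ge v b * u)"]
        by (simp add: right_diff_distrib mult.assoc)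
      then show "e \<in> {e \<in> out_arcs E w. gh e * y \<noteq> 0}" using e(1) by auto
    qed
    then show ?thesis using below_finite[OF y(1) x(2)] by (rule finite_subset)
  qed
  have "level (Suc n) \<subseteq> (\<Union>vb\<in>level n. (\<lambda>e. (fst vb, snd vb @ [e])) ` S vb)"
  proof
    fix vb assume "vb \<in> level (Suc n)"
    then obtain v b w where vb: "vb = (v, b)" "length b = Suc n" "awalk v b w" "ge v b * u \<notin> N"
      by (auto simp: level_def)
    define c e where "c = butlast b" and "e = last b"
    have b: "b = c @ [e]" "length c = n" using vb(2) by (auto simp: c_def e_def) (metis append_butlast_last_id list.size(3) nat.distinct(1))
    then obtain x where x: "awalk v c x" "awalk x [e] w" using vb(3) awalk_split by blast
    have "ge v b = gh e * ge v c" using x ge_single[of e x] by (simp add: b ge_append[OF x] awalk_simps)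
    then have e: "gh e * (ge v c * u) \<notin> N" using vb(4) by (simp add: mult.assoc)
    then have "ge v c * u \<notin> N" using N_left[of "gh e"] x(2) gh_alg by (auto simp: awalk_simps)
    then have "(v, c) \<in> level n" using b x by (auto simp: level_def)
    moreover have "e \<in> S (v, c)" using x e by (auto simp: S_def awalk_simps)
    ultimately show "vb \<in> (\<Union>vb\<in>level n. (\<lambda>e. (fst vb, snd vb @ [e])) ` S vb)"
      by (auto simp: vb(1) b(1) intro!: bexI[of _ "(v, c)"])
  qed
  then show ?case using Suc.IH fin by (meson finite_UN_I finite_imageI finite_subset)
qed

text \<open>Either one vertex lies below all others, or all levels are finite and have countably
  many ranges. For given x some element of the ideal of x fixes u; one of its monomials p q* does
  not kill u, so q is in a level and its range is below x.\<close>

lemma countable_separation: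
  "\<exists>C. countable C \<and> C \<subseteq> verts E - H \<and> (\<forall>x\<in>verts E - H. \<exists>w\<in>C. path_geq E x w)"
proof (cases "\<exists>v\<in>verts E - H. \<forall>x\<in>verts E - H. path_geq E x v")
  case True
  then obtain v where "v \<in> verts E - H" "\<forall>x\<in>verts E - H. path_geq E x v" by blast
  then show ?thesis by (intro exI[of _ "{v}"]) auto
next
  case False
  define C where "C = (\<lambda>vb. last (awalk_verts (fst vb) (snd vb))) ` (\<Union>n. level n)"
  have "finite (level n)" for n by (rule level_finite) (use False in blast)
  then have "countable (\<Union>n. level n)" by (intro countable_UN) (auto intro: countable_finite)
  then have "countable C" unfolding C_def by (rule countable_image)
  moreover have "C \<subseteq> verts E - H"
  proof
    fix w assume "w \<in> C"
    then obtain v b n where vb: "(v, b) \<in> level n" "w = last (awalk_verts v b)"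
      by (auto simp: C_def)
    then obtain w' where "awalk v b w'" by (auto simp: level_def)
    then show "w \<in> verts E - H" using level_end[OF vb(1)] vb(2) by auto
  qed
  moreover have "\<exists>w\<in>C. path_geq E x w" if x: "x \<in> verts E - H" for x
  proof -
    obtain y where y: "y \<in> lspan (below x)" "y * u - u \<in> N" by (rule below_fix[OF x u])
    then have "y * u \<notin> N" using N_cong u(2) by blast
    from lspan_notin_N[OF y(1) this] obtain a p b q w where
      m: "awalk a p w" "awalk b q w" "path_geq E x w" "pe a p * ge b q * u \<notin> N"
      unfolding below_def by blast
    then have "ge b q * u \<notin> N" using N_left[OF pe_alg[OF m(1)]] by (auto simp: mult.assoc)
    then have "(b, q) \<in> level (length q)" using m(2) by (auto simp: level_def)
    then have "w \<in> C" unfolding C_def using m(2) by (intro image_eqI[of _ _ "(b, q)"]) auto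
    then show ?thesis using m(3) by blast
  qed
  ultimately show ?thesis by blast
qed

end

section \<open>Cycles\<close>

context wf_digraph
begin

text \<open>The sources of a closed walk are its ranges shifted by one place, hence the same
  multiset. So distinct ranges, which define \<open>cycle\<close>, amount to distinct
  sources.\<close>

lemma cycle_awalk:
  assumes "cycle c"
  shows "c \<noteq> []" "awalk (tail G (hd c)) c (tail G (hd c))" "distinct (map (tail G) c)"
    "cycle_verts G c = tail G ` set c" "distinct (map (head G) c)"
proof -
  obtain u where u: "awalk u c u" "distinct (tl (awalk_verts u c))" "c \<noteq> []"
    using assms unfolding cycle_def by blast
  then show "c \<noteq> []" by simp
  have tu: "tail G (hd c) = u" using u(1,3) by (cases c) (auto simp: awalk_Cons_iff)
  then show w: "awalk (tail G (hd c)) c (tail G (hd c))" using u(1) by simp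
  have 1: "awalk_verts u c = map (tail G) c @ [head G (last c)]"
    using u(3) by (simp add: awalk_verts_conv)
  have 2: "awalk_verts u c = u # map (head G) c"
    using u(1,3) tu awalk_verts_conv'[of u c u] by (auto simp: awalk_def)
  have 3: "head G (last c) = u" using u(1) 1 by (metis awlast_of_awalk awlast_if_cas awalk_def last_snoc)
  have "mset (map (tail G) c) = mset (map (head G) c)"
    using 1 2 3 by (metis add_mset_add_single add_right_cancel mset.simps(2) mset_append mset.simps(1) add_0)
  moreover show "distinct (map (head G) c)" using u(2) 2 by simp
  ultimately show "distinct (map (tail G) c)" by (metis mset_eq_imp_distinct_iff)
  have "awalk_verts (tail G (hd c)) c = map (tail G) c @ [u]" using 1 3 tu by simp
  moreover have "u \<in> tail G ` set c" using tu u(3) by (metis hd_in_set imageI)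
  ultimately show "cycle_verts G c = tail G ` set c" unfolding cycle_verts_def by auto
qed

lemma cycle_arcs: "cycle c \<Longrightarrow> set c \<subseteq> arcs G"
  using cycle_awalk(2) by blast

lemma cycle_tail_inj: "cycle c \<Longrightarrow> e \<in> set c \<Longrightarrow> f \<in> set c \<Longrightarrow> tail G e = tail G f \<Longrightarrow> e = f"
  using cycle_awalk(3)[of c] by (auto simp: distinct_map inj_on_def)

lemma cycle_head_verts: "cycle c \<Longrightarrow> e \<in> set c \<Longrightarrow> head G e \<in> cycle_verts G c"
  using awalk_verts_arc2[OF cycle_awalk(2)] by (simp add: cycle_verts_def)

lemma cycleI:
  assumes "awalk u p u" "distinct (map (head G) p)" "p \<noteq> []"
  shows "cycle p"
  using assms awalk_verts_conv'[of u p u] unfolding cycle_def by (auto simp: awalk_def)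

lemma cycle_rotate_to:
  assumes "cycle c" "x \<in> cycle_verts G c"
  obtains n where "awalk x (rotate n c) x" "cycle (rotate n c)"
proof -
  let ?u = "tail G (hd c)"
  have w: "awalk ?u c ?u" "x \<in> set (awalk_verts ?u c)"
    using assms cycle_awalk(2) by (auto simp: cycle_verts_def)
  from awalk_decomp[OF this] obtain q r where c: "c = q @ r" "awalk ?u q x" "awalk x r ?u" by blast
  then have r: "rotate (length q) c = r @ q" by (simp add: rotate_append)
  have a: "awalk x (r @ q) x" using c(2,3) by (blast intro: awalk_appendI)
  moreover have "distinct (map (head G) (r @ q))" using cycle_awalk(5)[OF assms(1)] c(1) by auto
  moreover have "r @ q \<noteq> []" using cycle_awalk(1)[OF assms(1)] c(1) by auto
  ultimately have "cycle (r @ q)" by (rule cycleI)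
  then show ?thesis using that[of "length q"] a r by simp
qed

lemma cycle_connected:
  assumes "cycle c" "x \<in> cycle_verts G c" "y \<in> cycle_verts G c"
  shows "path_geq G x y"
proof -
  obtain n where n: "awalk x (rotate n c) x" "cycle (rotate n c)" by (rule cycle_rotate_to[OF assms(1,2)])
  have "y \<in> tail G ` set (rotate n c)" using assms(3) cycle_awalk(4)[OF assms(1)] by simp
  then have "y \<in> set (awalk_verts x (rotate n c))" using awalk_verts_arc1 by fastforce
  then show ?thesis using awalk_decomp[OF n(1)] unfolding path_geq_def by blast
qed

lemma path_geq_trans: "path_geq G x y \<Longrightarrow> path_geq G y z \<Longrightarrow> path_geq G x z"
  unfolding path_geq_def by (blast intro: awalk_appendI)

lemma path_geq_refl: "x \<in> verts G \<Longrightarrow> path_geq G x x"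
  unfolding path_geq_def by (auto intro!: exI[of _ "[]"] simp: awalk_Nil_iff)

lemma path_geq_verts: "path_geq G x y \<Longrightarrow> x \<in> verts G" "path_geq G x y \<Longrightarrow> y \<in> verts G"
  unfolding path_geq_def by auto

lemma path_geq_arc: "e \<in> arcs G \<Longrightarrow> path_geq G (tail G e) (head G e)"
  unfolding path_geq_def by (auto intro: arc_implies_awalk)

text \<open>The walk back is shortened to one without repeated vertices and closed by e.\<close>

lemma cycle_through_arc:
  assumes "e \<in> arcs G" "path_geq G (head G e) (tail G e)"
  obtains d where "cycle (e # d)"
proof -
  obtain q where "awalk (head G e) q (tail G e)" using assms(2) unfolding path_geq_def by blast
  then have p: "apath (head G e) (awalk_to_apath q) (tail G e)" by (rule apath_awalk_to_apath)
  have "awalk (tail G e) (e # awalk_to_apath q) (tail G e)"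
    using assms(1) p by (simp add: awalk_Cons_iff awalkI_apath)
  moreover have "awalk_verts (tail G e) (e # awalk_to_apath q) =
      tail G e # awalk_verts (head G e) (awalk_to_apath q)" by simp
  ultimately have "cycle (e # awalk_to_apath q)" using p unfolding cycle_def apath_def
    by (intro exI[of _ "tail G e"]) auto
  then show ?thesis by (rule that)
qed

text \<open>An edge from c that can return closes to a cycle meeting c, which must be a rotation of
  c.\<close>

lemma exclusive_cycle_arc:
  assumes "exclusive_cycle G c" "e \<in> arcs G" "tail G e \<in> cycle_verts G c"
    and "path_geq G (head G e) (tail G e)"
  shows "e \<in> set c"
proof -
  obtain d where d: "cycle (e # d)" by (rule cycle_through_arc[OF assms(2,4)])
  have "tail G e \<in> cycle_verts G (e # d)" using cycle_awalk(4)[OF d] by simp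
  then obtain n where "e # d = rotate n c"
    using assms(1,3) d unfolding exclusive_cycle_def by blast
  then show ?thesis by (metis list.set_intros(1) set_rotate)
qed

lemma rotate_inverse: "\<exists>m. rotate m (rotate n xs) = xs"
proof (cases "xs = []")
  case False
  have "rotate ((length xs - n mod length xs) + n mod length xs) xs = xs"
    using False by simp
  then have "rotate (length xs - n mod length xs) (rotate n xs) = xs"
    by (metis rotate_conv_mod rotate_rotate)
  then show ?thesis by blast
qed simp

text \<open>Let d be another cycle through a vertex x of c. If all edges of d emitted on c belonged
  to c, then d would follow c from x on and be a rotation of it. So some edge of d leaves c, and d
  leads back from its range.\<close>

lemma not_exclusive_exit:
  assumes "cycle c" "\<not> exclusive_cycle G c"
  obtains e where "exit_of G c e" "\<And>x. x \<in> cycle_verts G c \<Longrightarrow> path_geq G (head G e) x"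
proof (rule ccontr)
  assume no: "\<not> thesis"
  note main = that
  obtain d x where d: "cycle d" "x \<in> cycle_verts G c" "x \<in> cycle_verts G d" "\<And>n. d \<noteq> rotate n c"
    using assms unfolding exclusive_cycle_def by blast
  have in_c: "e \<in> set c" if "e \<in> set d" "tail G e \<in> cycle_verts G c" for e
  proof (rule ccontr)
    assume "e \<notin> set c"
    then have "exit_of G c e" using that cycle_arcs[OF d(1)] by (auto simp: exit_of_def)
    moreover have "path_geq G (head G e) y" if "y \<in> cycle_verts G c" for y
      using cycle_connected[OF d(1) cycle_head_verts[OF d(1) \<open>e \<in> set d\<close>] d(3)]
        cycle_connected[OF assms(1) d(2) that] path_geq_trans by blast
    ultimately show False using no main by blast
  qed
  obtain i where i: "awalk x (rotate i c) x" "cycle (rotate i c)" by (rule cycle_rotate_to[OF assms(1) d(2)])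
  obtain j where j: "awalk x (rotate j d) x" "cycle (rotate j d)" by (rule cycle_rotate_to[OF d(1,3)])
  \<comment> \<open>On c the source determines the edge, so a walk along c and a walk along d agree
    until one of them ends.\<close>
  have "(\<exists>r. q = p @ r) \<or> (\<exists>r. p = q @ r)"
    if "awalk y p w" "awalk y q z" "set p \<subseteq> set c" "set q \<subseteq> set d" "y \<in> cycle_verts G c" for y p q w z
    using that
  proof (induction p arbitrary: y q)
    case (Cons e p)
    show ?case
    proof (cases q)
      case (Cons f q')
      have "f \<in> set c" using in_c Cons.prems Cons by (auto simp: awalk_Cons_iff)
      then have "e = f"
        using cycle_tail_inj[OF assms(1)] Cons.prems Cons by (auto simp: awalk_Cons_iff)
      moreover have "head G e \<in> cycle_verts G c" using cycle_head_verts[OF assms(1)] Cons.prems by auto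
      ultimately show ?thesis using Cons.IH[of "head G e" q'] Cons.prems Cons by (auto simp: awalk_Cons_iff)
    qed simp
  qed simp
  from this[OF i(1) j(1) _ _ d(2)]
  have "(\<exists>r. rotate j d = rotate i c @ r) \<or> (\<exists>r. rotate i c = rotate j d @ r)" by simp
  \<comment> \<open>A cycle passes its base vertex only once, so no cycle at x properly extends
    another one at x.\<close>
  moreover have "r = []" if pr: "cycle (p @ r)" "cycle p" "awalk x p x" "awalk x (p @ r) x" for p r
  proof (rule ccontr)
    assume "r \<noteq> []"
    moreover obtain e p' where p: "p = e # p'" using cycle_awalk(1)[OF pr(2)] by (cases p) auto
    moreover have "awalk x r x" using pr(3,4) by auto
    ultimately have "tail G (hd r) = tail G e" using pr(3) by (cases r) (auto simp: awalk_Cons_iff)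
    then show False using cycle_awalk(3)[OF pr(1)] p \<open>r \<noteq> []\<close> by (cases r) auto
  qed
  ultimately have "rotate j d = rotate i c" using i j by (metis append_Nil2)
  moreover obtain m where "rotate m (rotate j d) = d" using rotate_inverse by blast
  ultimately have "d = rotate (m + i) c" by (metis rotate_rotate)
  then show False using d(4) by blast
qed

end

section \<open>Laurent polynomials\<close>

lemma poly_mapping_induct_add [case_names zero single add]:
  assumes "P 0" "\<And>n k. P (Poly_Mapping.single n k)" "\<And>f g. P f \<Longrightarrow> P g \<Longrightarrow> P (f + g)"
  shows "P (f :: 'a \<Rightarrow>\<^sub>0 'b::monoid_add)"
proof (induction f rule: update_induct)
  case (update f a b)
  have "Poly_Mapping.update a b f = f + Poly_Mapping.single a b"
    using update(1) by (intro poly_mapping_eqI) (auto simp: lookup_update lookup_add lookup_single when_def in_keys_iff)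
  then show ?case using assms update by simp
qed (rule assms)

lemma lookup_mult_single:
  "Poly_Mapping.lookup (f * Poly_Mapping.single n k) m = Poly_Mapping.lookup f (m - n) * k"
  for f :: "'k::field laurent_poly"
proof (induction f rule: poly_mapping_induct_add)
  case (single i a)
  then show ?case by (auto simp: mult_single lookup_single when_def)
qed (simp_all add: distrib_right lookup_add)

text \<open>The product with 1 + x keeps the lowest coefficient of h and moves the highest one up a
  degree, so it is not constant. This provides a nonzero element that is not a unit, over every
  field.\<close>

lemma one_plus_x_not_unit:
  "h * (1 + Poly_Mapping.single 1 1) \<noteq> (1 :: 'k::field laurent_poly)"
proof
  assume eq: "h * (1 + Poly_Mapping.single 1 1) = 1"
  have l: "Poly_Mapping.lookup h m + Poly_Mapping.lookup h (m - 1) = (if m = 0 then 1 else 0)" for m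
    using arg_cong[OF eq, of "\<lambda>f. Poly_Mapping.lookup f m"]
    by (simp add: distrib_left lookup_add lookup_mult_single lookup_one when_def)
  have ne: "Poly_Mapping.keys h \<noteq> {}" using eq by auto
  define a b where "a = Min (Poly_Mapping.keys h)" and "b = Max (Poly_Mapping.keys h)"
  have ab: "a \<in> Poly_Mapping.keys h" "b \<in> Poly_Mapping.keys h" "a \<le> b"
    using ne by (auto simp: a_def b_def)
  have "a - 1 \<notin> Poly_Mapping.keys h" "b + 1 \<notin> Poly_Mapping.keys h"
    using ne Min_le[OF finite_keys, of "a - 1" h] Max_ge[OF finite_keys, of "b + 1" h]
    by (auto simp: a_def[symmetric] b_def[symmetric])
  then have "a = 0" "b + 1 = 0" using l[of a] l[of "b + 1"] ab by (auto simp: in_keys_iff split: if_splits)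
  then show False using ab by simp
qed

definition laurent_of_poly :: "'k::field poly \<Rightarrow> 'k laurent_poly" where
  "laurent_of_poly p = (\<Sum>i\<le>degree p. Poly_Mapping.single (int i) (coeff p i))"

lemma lookup_laurent_of_poly:
  "Poly_Mapping.lookup (laurent_of_poly p) m = (if m \<ge> 0 then coeff p (nat m) else 0)"
proof (cases "m \<ge> 0")
  case True
  have "Poly_Mapping.lookup (laurent_of_poly p) m = (\<Sum>i\<le>degree p. if i = nat m then coeff p i else 0)"
    unfolding laurent_of_poly_def lookup_sum lookup_single when_def using True by (intro sum.cong) auto
  also have "\<dots> = coeff p (nat m)" by (auto simp: not_le coeff_eq_0)
  finally show ?thesis using True by simp
next
  case False
  then show ?thesis unfolding laurent_of_poly_def lookup_sum lookup_single when_def by (auto intro!: sum.neutral)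
qed

lemma laurent_of_poly_add: "laurent_of_poly (p + q) = laurent_of_poly p + laurent_of_poly q"
  by (rule poly_mapping_eqI) (simp add: lookup_laurent_of_poly lookup_add)

lemma laurent_of_poly_pCons:
  "laurent_of_poly (pCons a p) = Poly_Mapping.single 0 a + Poly_Mapping.single 1 1 * laurent_of_poly p"
proof (rule poly_mapping_eqI)
  fix m
  have c: "Poly_Mapping.single 1 1 * laurent_of_poly p = laurent_of_poly p * Poly_Mapping.single 1 1"
    by (rule mult.commute)
  have "nat m = Suc (nat (m - 1))" if "m > 0" using that by simp
  then show "Poly_Mapping.lookup (laurent_of_poly (pCons a p)) m =
      Poly_Mapping.lookup (Poly_Mapping.single 0 a + Poly_Mapping.single 1 1 * laurent_of_poly p) m"
    by (auto simp: c lookup_add lookup_mult_single lookup_laurent_of_poly lookup_single when_def coeff_pCons split: nat.split)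
qed

lemma laurent_of_poly_0 [simp]: "laurent_of_poly 0 = 0"
  by (rule poly_mapping_eqI) (simp add: lookup_laurent_of_poly)

lemma laurent_of_poly_smult: "laurent_of_poly (smult a p) = Poly_Mapping.single 0 a * laurent_of_poly p"
  by (rule poly_mapping_eqI)
    (simp add: mult.commute[of "Poly_Mapping.single 0 a"] lookup_mult_single lookup_laurent_of_poly mult.commute)

lemma laurent_of_poly_mult: "laurent_of_poly (p * q) = laurent_of_poly p * laurent_of_poly q"
  by (induction p)
    (auto simp: laurent_of_poly_add laurent_of_poly_pCons laurent_of_poly_smult distrib_right mult.assoc)

text \<open>A power of x clears the negative exponents. Since it is a unit, questions on ideals of
  the Laurent ring move to polynomials.\<close>

lemma laurent_shift_poly: "\<exists>n::nat. \<exists>p. Poly_Mapping.single (int n) 1 * g = laurent_of_poly (p :: 'k::field poly)"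
proof (induction g rule: poly_mapping_induct_add)
  case zero
  show ?case by (intro exI[of _ 0] exI[of _ 0]) simp
next
  case (single i a)
  have "Poly_Mapping.single (int (nat (- i))) 1 * Poly_Mapping.single i a = laurent_of_poly (monom a (nat (int (nat (- i)) + i)))"
    by (rule poly_mapping_eqI) (auto simp: mult_single lookup_single lookup_laurent_of_poly when_def)
  then show ?case by blast
next
  case (add f g)
  then obtain n p m q where fg: "Poly_Mapping.single (int n) 1 * f = laurent_of_poly p"
    "Poly_Mapping.single (int m) 1 * g = laurent_of_poly q" by blast
  have X: "Poly_Mapping.single (int i) (1::'k) = laurent_of_poly (monom 1 i)" for i
    by (rule poly_mapping_eqI) (auto simp: lookup_single lookup_laurent_of_poly when_def)
  have "Poly_Mapping.single (int (n + m)) 1 * (f + g) =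
      Poly_Mapping.single (int m) 1 * (Poly_Mapping.single (int n) 1 * f) +
      Poly_Mapping.single (int n) 1 * (Poly_Mapping.single (int m) 1 * g)"
    by (simp add: distrib_left mult.assoc[symmetric] mult_single add.commute)
  also have "\<dots> = laurent_of_poly (monom 1 m * p + monom 1 n * q)"
    unfolding fg unfolding X by (simp add: laurent_of_poly_mult laurent_of_poly_add)
  finally show ?case by blast
qed

text \<open>Shifted by a power of x, every member of I becomes a polynomial in I. Division with
  remainder shows that a nonzero polynomial in I of least degree divides the others.\<close>

lemma laurent_principal:
  fixes I :: "'k::field laurent_poly set"
  assumes add: "\<And>f g. f \<in> I \<Longrightarrow> g \<in> I \<Longrightarrow> f + g \<in> I" and mult: "\<And>f h. f \<in> I \<Longrightarrow> h * f \<in> I"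
    and ne: "g \<in> I" "g \<noteq> 0"
  shows "\<exists>f. f \<in> I \<and> f \<noteq> 0 \<and> (\<forall>h\<in>I. f dvd h)"
proof -
  have shift: "\<exists>p n. laurent_of_poly p \<in> I \<and> h = Poly_Mapping.single (- int n) 1 * laurent_of_poly p"
    if "h \<in> I" for h
  proof -
    obtain n p where np: "Poly_Mapping.single (int n) 1 * h = laurent_of_poly p" using laurent_shift_poly by blast
    have "Poly_Mapping.single (- int n) 1 * laurent_of_poly p = h"
      unfolding np[symmetric] by (simp add: mult.assoc[symmetric] mult_single)
    moreover have "laurent_of_poly p \<in> I" unfolding np[symmetric] using that by (rule mult)
    ultimately show ?thesis by metis
  qed
  define D where "D n \<longleftrightarrow> (\<exists>p. laurent_of_poly p \<in> I \<and> p \<noteq> 0 \<and> degree p = n)" for n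
  have "\<exists>n. D n"
  proof -
    obtain p n where "laurent_of_poly p \<in> I" "g = Poly_Mapping.single (- int n) 1 * laurent_of_poly p"
      using shift[OF ne(1)] by blast
    then show ?thesis using ne(2) unfolding D_def by (metis laurent_of_poly_0 mult_zero_right)
  qed
  then have "D (LEAST n. D n)" by (rule LeastI_ex)
  then obtain d where d: "laurent_of_poly d \<in> I" "d \<noteq> 0" "degree d = (LEAST n. D n)" by (auto simp: D_def)
  have "laurent_of_poly d dvd h" if h: "h \<in> I" for h
  proof -
    obtain p n where p: "laurent_of_poly p \<in> I" "h = Poly_Mapping.single (- int n) 1 * laurent_of_poly p"
      using shift[OF h] by blast
    have "p mod d = p + (- (p div d)) * d" by (simp add: minus_div_mult_eq_mod[symmetric])
    then have "laurent_of_poly (p mod d) = laurent_of_poly p + laurent_of_poly (- (p div d)) * laurent_of_poly d"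
      by (simp only: laurent_of_poly_add laurent_of_poly_mult)
    then have "laurent_of_poly (p mod d) \<in> I" using add[OF p(1) mult[OF d(1)]] by metis
    moreover have "degree (p mod d) < degree d" if "p mod d \<noteq> 0"
      using degree_mod_less[OF d(2), of p] that by simp
    ultimately have "p mod d = 0" using not_less_Least[of "degree (p mod d)" D] d(3) unfolding D_def by metis
    then have "p = (p div d) * d" by (metis div_mult_mod_eq add_0_right)
    then have "laurent_of_poly p = laurent_of_poly (p div d) * laurent_of_poly d" by (metis laurent_of_poly_mult)
    then show ?thesis unfolding p(2) by simp
  qed
  moreover have "laurent_of_poly d \<noteq> 0"
  proof
    assume "laurent_of_poly d = 0"
    then have "coeff d (degree d) = 0" using lookup_laurent_of_poly[of d "int (degree d)"] by simp
    then show False using d(2) by simp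
  qed
  ultimately show ?thesis using d(1) by blast
qed

text \<open>If the generator factors as f = ab, primeness puts a or b into I; if a is in I, then f
  divides a and b is a unit.\<close>

lemma laurent_prime_generator:
  fixes I :: "'k::field laurent_poly set"
  assumes add: "\<And>f g. f \<in> I \<Longrightarrow> g \<in> I \<Longrightarrow> f + g \<in> I" and mult: "\<And>f h. f \<in> I \<Longrightarrow> h * f \<in> I"
    and ne: "g \<in> I" "g \<noteq> 0" and one: "1 \<notin> I"
    and prime: "\<And>f g. f * g \<in> I \<Longrightarrow> f \<in> I \<or> g \<in> I"
  shows "\<exists>f. f \<in> I \<and> Factorial_Ring.irreducible f \<and> (\<forall>h\<in>I. f dvd h)"
proof -
  from laurent_principal[of I g, OF add mult ne]
  obtain f where "f \<in> I \<and> f \<noteq> 0 \<and> (\<forall>h\<in>I. f dvd h)" by (rule exE)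
  then have f: "f \<in> I" "f \<noteq> 0" "\<And>h. h \<in> I \<Longrightarrow> f dvd h" by simp_all
  have unit: "b dvd 1" if ab: "f = a * b" "a \<in> I" for a b
  proof -
    obtain k where "a = f * k" using f(3)[OF ab(2)] by (elim dvdE)
    then have "f * 1 = f * (k * b)" using ab(1) by (metis mult.assoc mult_1_right)
    then show ?thesis using f(2) by (metis dvd_triv_right mult_left_cancel)
  qed
  have "Factorial_Ring.irreducible f"
  proof (rule irreducibleI)
    show "\<not> f dvd 1"
    proof
      assume "f dvd 1"
      then obtain k where "1 = f * k" by (elim dvdE)
      then show False using mult[OF f(1), of k] one by (simp add: mult.commute)
    qed
    show "a dvd 1 \<or> b dvd 1" if "f = a * b" for a b
      using prime[of a b] f(1) that unit[of a b] unit[of b a] by (auto simp: mult.commute)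
  qed (rule f(2))
  then show ?thesis using f by blast
qed

text \<open>A generator d of the ideal (f, g) divides f, so it is a unit or associated to f; in the
  second case f would divide g.\<close>

lemma laurent_irreducible_maximal:
  fixes f g :: "'k::field laurent_poly"
  assumes "Factorial_Ring.irreducible f" "\<not> f dvd g"
  shows "\<exists>h. f dvd h * g - 1"
proof -
  define I where "I = {a * f + b * g | a b. True}"
  have "\<exists>d. d \<in> I \<and> d \<noteq> 0 \<and> (\<forall>h\<in>I. d dvd h)"
  proof -
    have 1: "x + y \<in> I" if xy: "x \<in> I" "y \<in> I" for x y
    proof -
      obtain a b a' b' where "x = a * f + b * g" "y = a' * f + b' * g" using xy by (auto simp: I_def)
      then have "x + y = (a + a') * f + (b + b') * g" by (simp add: algebra_simps)
      then show ?thesis unfolding I_def by blast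
    qed
    have 2: "h * x \<in> I" if "x \<in> I" for x h
    proof -
      obtain a b where "x = a * f + b * g" using \<open>x \<in> I\<close> by (auto simp: I_def)
      then have "h * x = (h * a) * f + (h * b) * g" by (simp add: algebra_simps)
      then show ?thesis unfolding I_def by blast
    qed
    have 3: "f \<in> I" unfolding I_def by (rule CollectI, rule exI[of _ 1], rule exI[of _ 0]) simp
    have 4: "f \<noteq> 0" using assms(1) by auto
    show ?thesis by (rule laurent_principal[of I f, OF 1 2 3 4])
  qed
  then obtain d where d: "d \<in> I" "\<forall>h\<in>I. d dvd h" by blast
  have "f \<in> I" unfolding I_def by (rule CollectI, rule exI[of _ 1], rule exI[of _ 0]) simp
  then obtain k where k: "f = d * k" using d by (meson dvdE)
  have "g \<in> I" unfolding I_def by (rule CollectI, rule exI[of _ 0], rule exI[of _ 1]) simp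
  then have dg: "d dvd g" using d by blast
  have "d dvd 1 \<or> k dvd 1" using irreducibleD[OF assms(1) k] .
  then have "d dvd 1"
  proof
    assume "k dvd 1"
    then obtain k' where "1 = k * k'" by (elim dvdE)
    then have "d = f * k'" using k by (simp add: mult.assoc)
    then have "f dvd g" using dg by (metis dvd_trans dvd_triv_left)
    then show ?thesis using assms(2) by blast
  qed
  then obtain e where e: "1 = d * e" by (elim dvdE)
  obtain a b where "d = a * f + b * g" using d(1) by (auto simp: I_def)
  then have "e * b * g - d * e = f * (- (e * a))" by (simp only: algebra_simps) simp
  then have "f dvd e * b * g - d * e" by (rule dvdI)
  then have "f dvd e * b * g - 1" using e by metis
  then show ?thesis by blast
qed

section \<open>Walks determined by their length\<close>

context leavitt_family
begin

text \<open>Outside of H each vertex on the way has one continuation, so two walks from w agree as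
  long as both last.\<close>

lemma unique_walk:
  assumes "hereditary E H" "\<And>q y. awalk w q y \<Longrightarrow> y \<notin> H \<Longrightarrow> \<exists>!e. e \<in> arcs_outside E H y"
    and "awalk w p x" "x \<notin> H" "awalk w q y" "y \<notin> H" "length p \<le> length q"
  obtains r where "q = p @ r" "awalk x r y"
proof -
  have "\<exists>r. q = p @ r \<and> awalk x r y"
    using assms(2-)
  proof (induction p arbitrary: w q)
    case Nil
    then show ?case by (auto simp: awalk_simps)
  next
    case (Cons e p)
    then obtain f q' where q: "q = f # q'" by (cases q) auto
    have wH: "w \<notin> H" by (rule awalk_outside(1)[OF assms(1) Cons.prems(2,3)])
    have "w \<in> verts E" using Cons.prems(2) by auto
    then have "\<exists>!e. e \<in> arcs_outside E H w" using Cons.prems(1)[of "[]" w] wH by (simp add: awalk_simps)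
    moreover have "e \<in> arcs_outside E H w" by (rule awalk_Cons_outside[OF assms(1) Cons.prems(2,3)])
    moreover have "f \<in> arcs_outside E H w"
      by (rule awalk_Cons_outside[OF assms(1) _ Cons.prems(5)]) (use Cons.prems(4) q in simp)
    ultimately have "e = f" by blast
    have wk: "awalk (head E e) p x" "awalk (head E e) q' y" "awalk w [e] (head E e)"
      using Cons.prems(2,4) q \<open>e = f\<close> by (auto simp: awalk_simps)
    have "\<exists>!e. e \<in> arcs_outside E H y" if "awalk (head E e) q y" "y \<notin> H" for q y
      using Cons.prems(1)[OF awalk_cat[OF wk(3) that(1)] that(2)] .
    from Cons.IH[OF this wk(1) Cons.prems(3) wk(2) Cons.prems(5)]
    show ?case using Cons.prems(6) q \<open>e = f\<close> by auto
  qed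
  then show ?thesis using that by blast
qed

lemma awalk_power: "awalk w c w \<Longrightarrow> awalk w (concat (replicate n c)) w"
  by (induction n) (auto simp: awalk_simps intro: awalk_cat)

lemma length_concat_replicate: "length (concat (replicate n c)) = n * length c"
  by (induction n) auto

lemma noexitD:
  assumes "noexit E H w"
  shows "w \<in> verts E" "w \<notin> H" "\<And>q x. awalk w q x \<Longrightarrow> x \<notin> H \<Longrightarrow> \<exists>!e. e \<in> arcs_outside E H x"
  using assms unfolding noexit_def by blast+

text \<open>A closed walk at w, repeated often enough, is at least as long as q and so extends it;
  the rest leads back to w.\<close>

lemma noexit_return:
  assumes "hereditary E H" "noexit E H w" "awalk w q x" "x \<notin> H"
  shows "\<exists>r. awalk x r w"
proof -
  obtain p where p: "awalk w p w" "p \<noteq> []" using assms(2) unfolding noexit_def by blast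
  have l: "length q \<le> length (concat (replicate (length q) p))"
    using p(2) by (cases p) (auto simp: length_concat_replicate)
  obtain r where "concat (replicate (length q) p) = q @ r" "awalk x r w"
    by (rule unique_walk[OF assms(1) noexitD(3)[OF assms(2)] assms(3,4) awalk_power[OF p(1)]
          noexitD(2)[OF assms(2)] l])
  then show ?thesis by blast
qed

section \<open>Evaluation of Laurent polynomials at a closed path\<close>

text \<open>The trailing vertex gives the zeroth power the value v, in agreement with
  \<open>lpa_cycle_power\<close>.\<close>

definition cpow :: "'e list \<Rightarrow> int \<Rightarrow> 'q" where
  "cpow c n = (if n \<ge> 0 then pe (tail E (hd c)) c ^ nat n else ge (tail E (hd c)) c ^ nat (- n)) * vt (tail E (hd c))"

definition lev :: "'e list \<Rightarrow> 'k laurent_poly \<Rightarrow> 'q" where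
  "lev c f = (\<Sum>n\<in>Poly_Mapping.keys f. \<kappa> (Poly_Mapping.lookup f n) * cpow c n)"

lemma lev_superset:
  assumes "finite S" "Poly_Mapping.keys f \<subseteq> S"
  shows "lev c f = (\<Sum>n\<in>S. \<kappa> (Poly_Mapping.lookup f n) * cpow c n)"
  unfolding lev_def using assms by (intro sum.mono_neutral_left) (auto simp: in_keys_iff)

lemma lev_add: "lev c (f + g) = lev c f + lev c g"
proof -
  let ?S = "Poly_Mapping.keys f \<union> Poly_Mapping.keys g"
  have "lev c (f + g) = (\<Sum>n\<in>?S. \<kappa> (Poly_Mapping.lookup (f + g) n) * cpow c n)"
    using keys_add[of f g] by (intro lev_superset) auto
  also have "\<dots> = lev c f + lev c g"
    using lev_superset[of ?S f c] lev_superset[of ?S g c]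
    by (simp add: lookup_add \<kappa>_add distrib_right sum.distrib)
  finally show ?thesis .
qed

lemma lev_single: "lev c (Poly_Mapping.single n k) = \<kappa> k * cpow c n"
  by (cases "k = 0") (simp_all add: lev_def)

lemma \<kappa>_prod: "(\<kappa> a * x) * (\<kappa> b * y) = \<kappa> (a * b) * (x * y)"
  unfolding mult.assoc \<kappa>_mult \<kappa>_left_comm[of x b y] ..

lemma lev_zero [simp]: "lev c 0 = 0"
  by (simp add: lev_def)

lemma lev_uminus: "lev c (- f) = - lev c f"
  using lev_add[of c f "- f"] by (simp add: eq_neg_iff_add_eq_0 add.commute)

lemma lev_diff: "lev c (f - g) = lev c f - lev c g"
  using lev_add[of c f "- g"] by (simp add: lev_uminus)

context
  fixes c v
  assumes cv: "awalk v c v" "c \<noteq> []"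
begin

lemma tail_hd: "tail E (hd c) = v"
  using cv by (cases c) (auto simp: awalk_Cons_iff)

lemma v_in: "v \<in> verts E"
  using cv by auto

lemma cpow_nat: "cpow c (int n) = pe v c ^ n * vt v"
  by (simp add: cpow_def tail_hd)

lemma cpow_neg: "cpow c (- int n) = ge v c ^ n * vt v"
  by (cases n) (auto simp: cpow_def tail_hd simp del: of_nat_Suc)

lemma cpow_nat_pe: "cpow c (int n) = pe v (concat (replicate n c))"
proof (induction n)
  case 0 then show ?case by (simp add: cpow_def tail_hd)
next
  case (Suc n)
  have "pe v (c @ concat (replicate n c)) = pe v c * pe v (concat (replicate n c))"
    by (rule pe_append[OF cv(1) awalk_power[OF cv(1)]])
  then show ?case using Suc by (simp add: cpow_nat[of "Suc n", simplified] cpow_nat mult.assoc)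
qed

lemma cpow_neg_ge: "cpow c (- int n) = ge v (concat (replicate n c))"
proof (induction n)
  case 0 then show ?case by (simp add: cpow_def tail_hd)
next
  case (Suc n)
  have "concat (replicate (Suc n) c) = concat (replicate n c) @ c"
    by (induction n) auto
  then have "ge v (concat (replicate (Suc n) c)) = ge v c * ge v (concat (replicate n c))"
    using ge_append[OF awalk_power[OF cv(1)] cv(1)] by simp
  then show ?case using Suc unfolding cpow_neg by (simp add: mult.assoc)
qed

lemma cpow_alg: "cpow c n \<in> alg"
proof (cases "n \<ge> 0")
  case True
  then show ?thesis using cpow_nat_pe[of "nat n"] pe_alg[OF awalk_power[OF cv(1)]] by simp
next
  case False
  then show ?thesis using cpow_neg_ge[of "nat (- n)"] ge_alg[OF awalk_power[OF cv(1)]] by simp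
qed

lemma lev_alg: "lev c f \<in> alg"
  unfolding lev_def by (intro alg_sum alg_scale cpow_alg)

lemma cpow_0 [simp]: "cpow c 0 = vt v"
  by (simp add: cpow_def tail_hd)

lemma pe_power_vt: "vt v * (pe v c ^ n * vt v) = pe v c ^ n * vt v"
  by (cases n) (auto simp: vt_idem[OF v_in] mult.assoc[symmetric] vt_pe[OF cv(1)])

lemma ge_power_vt: "vt v * (ge v c ^ n * vt v) = ge v c ^ n * vt v"
  by (cases n) (auto simp: vt_idem[OF v_in] mult.assoc[symmetric] vt_ge[OF cv(1)])

lemma vt_cpow: "vt v * cpow c n = cpow c n"
  unfolding cpow_def tail_hd using pe_power_vt ge_power_vt by auto

lemma cpow_vt: "cpow c n * vt v = cpow c n"
  unfolding cpow_def tail_hd by (simp add: mult.assoc vt_idem[OF v_in])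

text \<open>Multiplication by c on the right and by c* on the left shifts exponents exactly, since
  both rest on c* c = v. The other two products involve c c* and are controlled only modulo an ideal
  that makes c a cycle without exits.\<close>

lemma cpow_mult_pe: "cpow c n * pe v c = cpow c (n + 1)"
proof (cases "n \<ge> 0")
  case True
  then obtain m where m: "n = int m" by (metis nonneg_int_cases)
  have "cpow c (int m) * pe v c = pe v c ^ Suc m"
    unfolding cpow_nat by (simp add: mult.assoc vt_pe[OF cv(1)] power_commutes)
  also have "\<dots> = cpow c (int (Suc m))"
    unfolding cpow_nat power_Suc2 by (simp add: mult.assoc pe_vt[OF cv(1)])
  finally show ?thesis using m by (simp add: add.commute)
next
  case False
  then have "n = - int (Suc (nat (- n) - 1))" by simp
  then obtain m where m: "n = - int (Suc m)" by blast
  have "cpow c n * pe v c = ge v c ^ m * (ge v c * pe v c)"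
    unfolding m cpow_neg power_Suc2 by (simp add: mult.assoc vt_pe[OF cv(1)])
  also have "\<dots> = cpow c (- int m)" unfolding cpow_neg by (simp add: ge_pe_same[OF cv(1)])
  finally show ?thesis using m by simp
qed

lemma ge_mult_cpow: "ge v c * cpow c n = cpow c (n - 1)"
proof (cases "n > 0")
  case True
  then have "n = int (Suc (nat n - 1))" by simp
  then obtain m where m: "n = int (Suc m)" by blast
  have "ge v c * cpow c n = vt v * (pe v c ^ m * vt v)"
    unfolding m cpow_nat power_Suc by (simp only: mult.assoc[symmetric] ge_pe_same[OF cv(1)])
  then show ?thesis using m pe_power_vt cpow_nat by simp
next
  case False
  then have m: "n = - int (nat (- n))" by simp
  define m where "m = nat (- n)"
  have m: "n = - int m" using m by (simp add: m_def)
  have "ge v c * cpow c n = cpow c (- int (Suc m))" unfolding m cpow_neg by (simp add: mult.assoc)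
  moreover have "n - 1 = - int (Suc m)" using m by simp
  ultimately show ?thesis by (simp only:)
qed

lemma lev_mult_pe: "lev c f * pe v c = lev c (Poly_Mapping.single 1 1 * f)"
  by (induction f rule: poly_mapping_induct_add)
    (simp_all add: lev_add lev_single mult_single distrib_left distrib_right mult.assoc cpow_mult_pe add.commute)

lemma ge_mult_lev: "ge v c * lev c f = lev c (Poly_Mapping.single (- 1) 1 * f)"
  by (induction f rule: poly_mapping_induct_add)
    (simp_all add: lev_add lev_single mult_single distrib_left \<kappa>_left_comm ge_mult_cpow)

lemma lev_scale: "\<kappa> k * lev c f = lev c (Poly_Mapping.single 0 k * f)"
  by (induction f rule: poly_mapping_induct_add)
    (simp_all add: lev_add lev_single mult_single distrib_left mult.assoc[symmetric] \<kappa>_mult)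

text \<open>On Laurent elements x acts by c on the right and its inverse by c* on the left. Both
  identities are exact in \<open>alg\<close>, so every ideal is closed under Laurent
  multiples.\<close>

lemma lev_ideal:
  assumes J: "aideal J" and "lev c f \<in> J"
  shows "lev c (h * f) \<in> J"
proof -
  have pos: "lev c (Poly_Mapping.single (int n) 1 * f) \<in> J" for n
  proof (induction n)
    case 0 then show ?case using assms by simp
  next
    case (Suc n)
    have "Poly_Mapping.single (int (Suc n)) 1 * f = Poly_Mapping.single 1 1 * (Poly_Mapping.single (int n) 1 * f)"
      by (simp add: mult.assoc[symmetric] mult_single)
    then show ?case using aideal_right[OF J pe_alg[OF cv(1)] Suc] by (simp only: lev_mult_pe)
  qed
  have neg: "lev c (Poly_Mapping.single (- int n) 1 * f) \<in> J" for n
  proof (induction n)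
    case 0 then show ?case using assms by simp
  next
    case (Suc n)
    have "Poly_Mapping.single (- int (Suc n)) 1 * f = Poly_Mapping.single (- 1) 1 * (Poly_Mapping.single (- int n) 1 * f)"
      by (simp add: mult.assoc[symmetric] mult_single)
    then show ?case using aideal_left[OF J ge_alg[OF cv(1)] Suc] by (simp only: ge_mult_lev)
  qed
  show ?thesis
  proof (induction h rule: poly_mapping_induct_add)
    case zero then show ?case using J by (simp add: aideal_def)
  next
    case (single n k)
    have "lev c (Poly_Mapping.single n 1 * f) \<in> J"
      using pos[of "nat n"] neg[of "nat (- n)"] by (cases "n \<ge> 0") auto
    moreover have "Poly_Mapping.single n k * f = Poly_Mapping.single 0 k * (Poly_Mapping.single n 1 * f)"
      by (simp add: mult.assoc[symmetric] mult_single)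
    ultimately show ?case using aideal_scale[OF J] by (simp only: lev_scale[symmetric])
  next
    case (add f g)
    then show ?case using J by (simp add: distrib_right lev_add aideal_def)
  qed
qed

lemma lev_one: "lev c 1 = vt v"
  using lev_single[of c 0 1] by simp

end

end

text \<open>An exclusive cycle \<open>c\<close> to which all vertices outside of \<open>H\<close> connect; \<open>P\<close> is any ideal
  containing the relations that make \<open>c\<close> a cycle without exits.\<close>

locale leavitt_excl = leavitt_family E \<kappa> vt ed gh
  for E :: "('v, 'e) pre_digraph" and \<kappa> :: "'k::field \<Rightarrow> 'q::ring_1" and vt ed gh +
  fixes H :: "'v set" and c :: "'e list" and P :: "'q set"
  assumes hered: "hereditary E H" and excl: "exclusive_cycle E c"
    and root: "verts E - H = root_set E (cycle_verts E c)"
    and P: "aideal P" and HP: "v \<in> H \<Longrightarrow> vt v \<in> P"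
    and BP: "u \<in> breaking_vertices E H \<Longrightarrow> bel H u \<in> P"
begin

definition base :: 'v where "base = tail E (hd c)"

lemma c_cycle: "cycle c"
  using excl by (simp add: exclusive_cycle_def)

lemma c_walk: "awalk base c base" "c \<noteq> []"
  using cycle_awalk[OF c_cycle] by (simp_all add: base_def)

lemma base_verts: "base \<in> verts E"
  using c_walk by auto

lemma base_cycle: "base \<in> cycle_verts E c"
  using cycle_awalk(1,4)[OF c_cycle] by (auto simp: base_def)

lemma c_outside: "x \<in> cycle_verts E c \<Longrightarrow> x \<in> verts E \<and> x \<notin> H"
proof -
  assume x: "x \<in> cycle_verts E c"
  then have "x \<in> verts E" using path_geq_verts cycle_connected[OF c_cycle x x] by blast
  then have "x \<in> root_set E (cycle_verts E c)" using x path_geq_refl by (auto simp: root_set_def)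
  then show ?thesis using root by blast
qed

lemma reach_base: "x \<in> verts E \<Longrightarrow> x \<notin> H \<Longrightarrow> y \<in> cycle_verts E c \<Longrightarrow> path_geq E x y"
proof -
  assume x: "x \<in> verts E" "x \<notin> H" and y: "y \<in> cycle_verts E c"
  then have "x \<in> root_set E (cycle_verts E c)" using root by blast
  then obtain z where "z \<in> cycle_verts E c" "path_geq E x z" by (auto simp: root_set_def)
  then show ?thesis using cycle_connected[OF c_cycle _ y] path_geq_trans by blast
qed

text \<open>An edge from c to a vertex outside of H can return, because all these vertices reach c;
  exclusiveness then puts it on c. So c has no exit to the outside of H.\<close>

lemma c_arc: "e \<in> arcs_outside E H y \<Longrightarrow> y \<in> cycle_verts E c \<Longrightarrow> e \<in> set c"
  using exclusive_cycle_arc[OF excl, of e] reach_base[of "head E e" y]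
  by (auto simp: arcs_outside_def)

lemma c_unique: "y \<in> cycle_verts E c \<Longrightarrow> \<exists>!e. e \<in> arcs_outside E H y"
proof -
  assume y: "y \<in> cycle_verts E c"
  then obtain e where e: "e \<in> set c" "tail E e = y" using cycle_awalk(4)[OF c_cycle] by auto
  then have "e \<in> arcs_outside E H y"
    using cycle_arcs[OF c_cycle] c_outside[OF cycle_head_verts[OF c_cycle e(1)]] by (auto simp: arcs_outside_def)
  moreover have "f = e" if "f \<in> arcs_outside E H y" for f
    using c_arc[OF that y] cycle_tail_inj[OF c_cycle _ e(1)] e(2) that by (auto simp: arcs_outside_def)
  ultimately show ?thesis by blast
qed

lemma c_closed: "w \<in> cycle_verts E c \<Longrightarrow> awalk w q x \<Longrightarrow> x \<notin> H \<Longrightarrow> x \<in> cycle_verts E c"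
proof (induction q arbitrary: w)
  case (Cons e q)
  have "e \<in> set c" by (rule c_arc[OF awalk_Cons_outside[OF hered Cons.prems(2,3)] Cons.prems(1)])
  then show ?case using Cons cycle_head_verts[OF c_cycle] by (auto simp: awalk_Cons_iff)
qed (simp add: awalk_simps)

lemma c_unique_walk: "awalk base q y \<Longrightarrow> y \<notin> H \<Longrightarrow> \<exists>!e. e \<in> arcs_outside E H y"
  using c_unique c_closed base_cycle by blast

text \<open>Walks from the base are forced, so copies of c split off until less than c is left. A
  nonempty proper initial part of c does not return to the base, since the sources on c are
  distinct.\<close>

lemma closed_walk_power:
  assumes "awalk base p base"
  shows "\<exists>n. p = concat (replicate n c)"
  using assms
proof (induction "length p" arbitrary: p rule: less_induct)
  case less
  have bH: "base \<notin> H" using c_outside base_cycle by blast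
  show ?case
  proof (cases "p = []")
    case True then show ?thesis by (intro exI[of _ 0]) simp
  next
    case False
    show ?thesis
    proof (cases "length c \<le> length p")
      case True
      obtain r where r: "p = c @ r" "awalk base r base"
        by (rule unique_walk[OF hered c_unique_walk c_walk(1) bH less.prems bH True])
      then obtain n where "r = concat (replicate n c)" using less.hyps[of r] c_walk(2) by auto
      then show ?thesis using r by (intro exI[of _ "Suc n"]) simp
    next
      case False
      then have l: "length p \<le> length c" by simp
      obtain r where r: "c = p @ r" "awalk base r base"
        by (rule unique_walk[OF hered c_unique_walk less.prems bH c_walk(1) bH l])
      then have "r \<noteq> []" using False by auto
      then have "tail E (hd r) = tail E (hd p)"
        using r(2) less.prems \<open>p \<noteq> []\<close> by (cases r; cases p) (auto simp: awalk_Cons_iff)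
      then show ?thesis using cycle_awalk(3)[OF c_cycle] r(1) \<open>r \<noteq> []\<close> \<open>p \<noteq> []\<close> by (cases p; cases r) auto
    qed
  qed
qed

lemma P_zero: "0 \<in> P"
  using P by (simp add: aideal_def)

text \<open>At a vertex w of c only one edge e leads outside of H, and e e* is w modulo P: at a
  regular vertex because the other summands of w = \<Sum> f f* end in H, at an infinite emitter
  because w^H lies in P.\<close>

lemma path_range_proj:
  assumes "w \<in> cycle_verts E c" "awalk w p x" "x \<notin> H"
  shows "pe w p * ge w p - vt w \<in> P"
  using assms
proof (induction p arbitrary: w)
  case Nil
  then show ?case using vt_idem[of w] P_zero by (auto simp: awalk_simps)
next
  case (Cons e p)
  have e: "e \<in> arcs E" "tail E e = w" "awalk (head E e) p x" using Cons.prems by (auto simp: awalk_Cons_iff)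
  have eo: "e \<in> arcs_outside E H w" by (rule awalk_Cons_outside[OF hered Cons.prems(2,3)])
  then have ao: "arcs_outside E H w = {e}" using c_unique[OF Cons.prems(1)] by blast
  have "head E e \<in> cycle_verts E c" using c_arc[OF eo Cons.prems(1)] cycle_head_verts[OF c_cycle] by blast
  from Cons.IH[OF this e(3) Cons.prems(3)]
  have "ed e * (pe (head E e) p * ge (head E e) p - vt (head E e)) * gh e \<in> P"
    by (rule aideal_alg_outer[OF P _ ed_alg[OF e(1)] gh_alg[OF e(1)]])
  then have 1: "pe w (e # p) * ge w (e # p) - ed e * gh e \<in> P"
    using ed_vt[OF e(1)] by (simp add: right_diff_distrib left_diff_distrib mult.assoc)
  have "ed e * gh e - vt w \<in> P"
  proof (cases "finite (out_arcs E w)")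
    case True
    then have "regular_vertex E w" using e c_outside[OF Cons.prems(1)] by (auto simp: regular_vertex_def)
    then have "vt w = (\<Sum>f\<in>out_arcs E w. ed f * gh f)" by (rule ck2)
    also have "\<dots> = ed e * gh e + (\<Sum>f\<in>out_arcs E w - {e}. ed f * gh f)"
      using True e by (intro sum.remove) auto
    finally have "ed e * gh e - vt w = - (\<Sum>f\<in>out_arcs E w - {e}. ed f * gh f)" by simp
    moreover have "ed f * gh f \<in> P" if "f \<in> out_arcs E w - {e}" for f
    proof -
      have "f \<notin> arcs_outside E H w" using that ao by blast
      then have "head E f \<in> H" "f \<in> arcs E" using that by (auto simp: arcs_outside_def)
      then show ?thesis by (intro aideal_right[OF P] aideal_ed[OF P] gh_alg HP)
    qed
    ultimately show ?thesis using aideal_minus[OF P aideal_sum[OF P, of "out_arcs E w - {e}"]] by simp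
  next
    case False
    then have "w \<in> breaking_vertices E H"
      using ao c_outside[OF Cons.prems(1)] by (auto simp: breaking_vertices_def infinite_emitter_def)
    from aideal_minus[OF P BP[OF this]] show ?thesis by (simp add: bel_def ao)
  qed
  from aideal_add[OF P 1 this] show ?case by simp
qed

lemma pe_ge_c: "pe base c * ge base c - vt base \<in> P"
  by (rule path_range_proj[OF base_cycle c_walk(1)]) (use c_outside base_cycle in blast)

text \<open>Only for negative n does c c* enter, and modulo P it is the vertex.\<close>

lemma pe_mult_cpow: "pe base c * cpow c n - cpow c (n + 1) \<in> P"
proof (cases "n \<ge> 0")
  case True
  then obtain m where m: "n = int m" by (metis nonneg_int_cases)
  have "pe base c * cpow c n = cpow c (int (Suc m))"
    unfolding m cpow_nat[OF c_walk] by (simp add: mult.assoc)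
  then show ?thesis using m P_zero by (simp add: add.commute)
next
  case False
  have "ge base c * cpow c (n + 1) = cpow c n" using ge_mult_cpow[OF c_walk, of "n + 1"] by simp
  then have "pe base c * cpow c n - cpow c (n + 1) = (pe base c * ge base c - vt base) * cpow c (n + 1)"
    using vt_cpow[OF c_walk, of "n + 1"] by (simp add: left_diff_distrib mult.assoc)
  then show ?thesis using aideal_right[OF P cpow_alg[OF c_walk] pe_ge_c] by simp
qed

lemma cpow_add: "cpow c m * cpow c n - cpow c (m + n) \<in> P"
proof (cases "m \<ge> 0")
  case True
  then obtain k where k: "m = int k" by (metis nonneg_int_cases)
  have "cpow c (int k) * cpow c n - cpow c (int k + n) \<in> P"
  proof (induction k)
    case 0 then show ?case using vt_cpow[OF c_walk] P_zero by (simp add: cpow_0[OF c_walk])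
  next
    case (Suc k)
    have "cpow c (int (Suc k)) = pe base c * cpow c (int k)"
      unfolding cpow_nat[OF c_walk] by (simp add: mult.assoc)
    then have "cpow c (int (Suc k)) * cpow c n - cpow c (int (Suc k) + n) =
        pe base c * (cpow c (int k) * cpow c n - cpow c (int k + n)) +
        (pe base c * cpow c (int k + n) - cpow c ((int k + n) + 1))"
      by (simp add: right_diff_distrib mult.assoc add_ac)
    then show ?case
      using aideal_add[OF P aideal_left[OF P pe_alg[OF c_walk(1)] Suc] pe_mult_cpow] by simp
  qed
  then show ?thesis using k by simp
next
  case False
  then have "m = - int (nat (- m))" by simp
  then obtain k where k: "m = - int k" by blast
  have "cpow c (- int k) * cpow c n = cpow c (- int k + n)"
  proof (induction k)
    case 0 then show ?case using vt_cpow[OF c_walk] by (simp add: cpow_0[OF c_walk])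
  next
    case (Suc k)
    have "cpow c (- int (Suc k)) = ge base c * cpow c (- int k)"
      unfolding cpow_neg[OF c_walk] by (simp add: mult.assoc)
    then have "cpow c (- int (Suc k)) * cpow c n = ge base c * cpow c (- int k + n)"
      by (simp add: mult.assoc Suc)
    then show ?case using ge_mult_cpow[OF c_walk] by (simp add: algebra_simps)
  qed
  then show ?thesis using k P_zero by simp
qed

lemma lev_mult: "lev c f * lev c g - lev c (f * g) \<in> P"
proof (induction f rule: poly_mapping_induct_add)
  case (single n a)
  show ?case
  proof (induction g rule: poly_mapping_induct_add)
    case (single m b)
    have "lev c (Poly_Mapping.single n a) * lev c (Poly_Mapping.single m b) -
        lev c (Poly_Mapping.single n a * Poly_Mapping.single m b) =
        \<kappa> (a * b) * (cpow c n * cpow c m - cpow c (n + m))"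
      unfolding lev_single mult_single \<kappa>_prod right_diff_distrib ..
    then show ?case using aideal_scale[OF P cpow_add] by simp
  next
    case (add f g)
    from aideal_add[OF P this] show ?case by (simp add: lev_add distrib_left algebra_simps)
  qed (simp add: P_zero)
next
  case (add f h)
  from aideal_add[OF P this] show ?case by (simp add: lev_add distrib_right algebra_simps)
qed (simp add: P_zero)

text \<open>To turn a monomial p q* of the corner into powers of c, continue p and q by a walk r
  from their common range back to the base: modulo P the monomial is p r r* q*, and pr and qr are
  powers of c.\<close>

lemma corner_lev:
  assumes "t \<in> alg"
  shows "\<exists>h. vt base * t * vt base - lev c h \<in> P"
  using assms unfolding alg_def
proof induction
  case lspan_zero
  show ?case by (intro exI[of _ 0]) (simp add: P_zero)
next
  case (lspan_step m t k)
  then obtain h where h: "vt base * t * vt base - lev c h \<in> P" by blast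
  obtain a p b q w where m: "m = pe a p * ge b q" "awalk a p w" "awalk b q w"
    using lspan_step(1) unfolding mons_def by blast
  have "\<exists>g. vt base * m * vt base - lev c g \<in> P"
  proof (cases "a = base \<and> b = base \<and> w \<notin> H")
    case True
    then have m': "m = pe base p * ge base q" "awalk base p w" "awalk base q w" "w \<notin> H" using m by auto
    have wc: "w \<in> cycle_verts E c" using c_closed[OF base_cycle m'(2,4)] .
    then obtain r where r: "awalk w r base"
      using cycle_connected[OF c_cycle _ base_cycle] unfolding path_geq_def by blast
    obtain i where i: "p @ r = concat (replicate i c)" using closed_walk_power awalk_cat[OF m'(2) r] by blast
    obtain j where j: "q @ r = concat (replicate j c)" using closed_walk_power awalk_cat[OF m'(3) r] by blast
    have "cpow c (int i) = pe base p * pe w r" "cpow c (- int j) = ge w r * ge base q"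
      unfolding cpow_nat_pe[OF c_walk] cpow_neg_ge[OF c_walk] i[symmetric] j[symmetric]
      by (simp_all add: pe_append[OF m'(2) r] ge_append[OF m'(3) r])
    then have "pe base p * (pe w r * ge w r - vt w) * ge base q = cpow c (int i) * cpow c (- int j) - m"
      using m' by (simp add: right_diff_distrib left_diff_distrib mult.assoc vt_ge)
    moreover have "pe base p * (pe w r * ge w r - vt w) * ge base q \<in> P"
      by (rule aideal_alg_outer[OF P path_range_proj[OF wc r] pe_alg[OF m'(2)] ge_alg[OF m'(3)]])
        (use c_outside base_cycle in blast)
    ultimately have "cpow c (int i) * cpow c (- int j) - m \<in> P" by simp
    from aideal_diff[OF P cpow_add[of "int i" "- int j"] this]
    have "m - cpow c (int i + - int j) \<in> P" by simp
    moreover have "vt base * m * vt base = (vt base * pe base p) * (ge base q * vt base)"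
      unfolding m'(1) by (simp only: mult.assoc)
    then have "vt base * m * vt base = m" unfolding vt_pe[OF m'(2)] ge_vt[OF m'(3)] m'(1) .
    ultimately show ?thesis
      by (intro exI[of _ "Poly_Mapping.single (int i + - int j) 1"]) (simp add: lev_single)
  next
    case False
    have "vt base * m * vt base \<in> P"
    proof (cases "a = base \<and> b = base")
      case True
      then have "w \<in> H" using False by blast
      then have "pe a p \<in> P" using aideal_pe[OF P m(2)] HP by blast
      then show ?thesis unfolding m(1)
        using ge_alg[OF m(3)] base_verts vt_alg by (intro aideal_right[OF P] aideal_left[OF P]) auto
    next
      case False
      have av: "a \<in> verts E" "b \<in> verts E" using m by auto
      have "vt base * m * vt base = vt base * (vt a * pe a p) * (ge b q * vt b) * vt base"
        unfolding m(1) vt_pe[OF m(2)] ge_vt[OF m(3)] mult.assoc ..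
      also have "\<dots> = (vt base * vt a) * m * (vt b * vt base)"
        unfolding m(1) by (simp only: mult.assoc)
      also have "\<dots> = 0" using False av base_verts by (auto simp: vt_vt)
      finally show ?thesis using P_zero by simp
    qed
    then show ?thesis by (intro exI[of _ 0]) simp
  qed
  then obtain g where "vt base * m * vt base - lev c g \<in> P" by blast
  from aideal_add[OF P aideal_scale[OF P this, of k] h]
  moreover have "vt base * (\<kappa> k * m + t) * vt base - lev c (Poly_Mapping.single 0 k * g + h) =
      \<kappa> k * (vt base * m * vt base - lev c g) + (vt base * t * vt base - lev c h)"
    unfolding lev_add lev_scale[OF c_walk, symmetric]
    by (simp add: distrib_left distrib_right right_diff_distrib mult.assoc \<kappa>_left_comm)
  ultimately have "vt base * (\<kappa> k * m + t) * vt base - lev c (Poly_Mapping.single 0 k * g + h) \<in> P"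
    by simp
  then show ?case by blast
qed

end

section \<open>Generated ideals and the five conditions\<close>

context leavitt_family
begin

text \<open>An element k w + y of P - J is carried to the base by walks r and q between the base and
  w; there it is a Laurent polynomial in c and therefore in J. It is brought back by s = qr, because
  the closed walks at w commute with s and s* s = w.\<close>

lemma excl_ideal_eq:
  assumes "leavitt_excl E \<kappa> vt ed gh H c J" "aideal P" "J \<subseteq> P" "vanish P = H"
    and "\<And>g. lev c g \<in> P \<Longrightarrow> lev c g \<in> J"
  shows "P = J"
proof (rule ccontr)
  interpret J: leavitt_excl E \<kappa> vt ed gh H c J by fact
  assume "P \<noteq> J"
  from ideal_reduction[OF assms(2) J.P assms(3) _ _ this]
  obtain w k y where w: "noexit E H w" and k: "k \<noteq> 0" and y: "y \<in> loops w"
    and b: "\<kappa> k * vt w + y \<in> P" "\<kappa> k * vt w + y \<notin> J"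
    unfolding assms(4) using J.HP J.BP by blast
  let ?b = "\<kappa> k * vt w + y"
  have wv: "w \<in> verts E" "w \<notin> H" using noexitD[OF w] by auto
  obtain q where q: "awalk w q J.base"
    using J.reach_base[OF wv J.base_cycle] unfolding path_geq_def by blast
  have bH: "J.base \<notin> H" using J.c_outside J.base_cycle by blast
  obtain r where r: "awalk J.base r w" using noexit_return[OF J.hered w q bH] by blast
  let ?X = "{pe w p | p. awalk w p w}"
  have bX: "?b \<in> lspan ?X"
  proof -
    have "vt w \<in> ?X" using wv by (auto simp: awalk_simps intro!: exI[of _ "[]"])
    moreover have "y \<in> lspan ?X" using y lspan_mono[of "{pe w p |p. awalk w p w \<and> p \<noteq> []}" ?X]
      unfolding loops_def by blast
    ultimately show ?thesis by (intro lspan_step)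
  qed
  have "\<exists>g. pe J.base r * z * pe w q = lev c g" if "z \<in> lspan ?X" for z
    using that
  proof induction
    case lspan_zero show ?case by (intro exI[of _ 0]) simp
  next
    case (lspan_step x z k)
    then obtain g where g: "pe J.base r * z * pe w q = lev c g" by blast
    obtain p where p: "x = pe w p" "awalk w p w" using lspan_step(1) by blast
    have "awalk J.base (r @ p @ q) J.base" using r p q awalk_cat by blast
    then obtain n where n: "r @ p @ q = concat (replicate n c)" using J.closed_walk_power by blast
    have "pe J.base r * x * pe w q = pe J.base (r @ p @ q)"
      using r p q awalk_cat[OF p(2) q] by (simp add: pe_append mult.assoc)
    also have "\<dots> = cpow c (int n)" unfolding n cpow_nat_pe[OF J.c_walk] ..
    finally have "pe J.base r * (\<kappa> k * x + z) * pe w q = lev c (Poly_Mapping.single (int n) k + g)"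
      using g by (simp add: lev_add lev_single distrib_left distrib_right mult.assoc \<kappa>_left_comm)
    then show ?case by blast
  qed
  then obtain g where g: "pe J.base r * ?b * pe w q = lev c g" using bX by blast
  have "lev c g \<in> P" unfolding g[symmetric]
    by (rule aideal_alg_outer[OF assms(2) b(1) pe_alg[OF r] pe_alg[OF q]])
  then have gJ: "pe J.base r * ?b * pe w q \<in> J" using assms(5) g by simp
  define s where "s = q @ r"
  have s: "awalk w s w" "pe w s = pe w q * pe J.base r"
    using q r awalk_cat by (auto simp: s_def pe_append)
  have "pe w q * (pe J.base r * ?b * pe w q) * pe J.base r \<in> J"
    by (rule aideal_alg_outer[OF J.P gJ pe_alg[OF q] pe_alg[OF r]])
  then have sJ: "pe w s * ?b * pe w s \<in> J" by (simp add: s(2) mult.assoc)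
  \<comment> \<open>\<open>p @ s\<close> and \<open>s @ p\<close> are walks from w of the same
    length, hence equal.\<close>
  have comm: "z * pe w s = pe w s * z" if "z \<in> lspan ?X" for z
    using that
  proof induction
    case (lspan_step x z k)
    obtain p where p: "x = pe w p" "awalk w p w" using lspan_step(1) by blast
    have ps: "awalk w (p @ s) w" "awalk w (s @ p) w" using p(2) s(1) awalk_cat by blast+
    have l: "length (p @ s) \<le> length (s @ p)" by simp
    obtain r where r: "s @ p = (p @ s) @ r" "awalk w r w"
      by (rule unique_walk[OF J.hered noexitD(3)[OF w] ps(1) wv(2) ps(2) wv(2) l])
    have "r = []" using arg_cong[OF r(1), of length] by simp
    then have "s @ p = p @ s" using r(1) by simp
    then have "x * pe w s = pe w s * x" using pe_append[OF p(2) s(1)] pe_append[OF s(1) p(2)] p(1) by simp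
    then show ?case using lspan_step by (simp add: distrib_left distrib_right mult.assoc \<kappa>_left_comm)
  qed simp
  have "ge w s * (ge w s * (pe w s * ?b * pe w s)) \<in> J"
    by (intro aideal_left[OF J.P] ge_alg[OF s(1)] sJ)
  moreover have "ge w s * (ge w s * (pe w s * ?b * pe w s)) = ?b"
  proof -
    have vb: "vt w * ?b = ?b" using vt_loops[OF y] vt_idem[OF wv(1)] by (simp add: distrib_left \<kappa>_left_comm)
    have "pe w s * ?b * pe w s = pe w s * (pe w s * ?b)" using comm[OF bX] by (simp only: mult.assoc)
    then have "ge w s * (pe w s * ?b * pe w s) = (ge w s * pe w s) * (pe w s * ?b)" by (simp only: mult.assoc)
    also have "\<dots> = pe w s * ?b" by (simp only: ge_pe_same[OF s(1)] mult.assoc[symmetric] vt_pe[OF s(1)])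
    finally have "ge w s * (ge w s * (pe w s * ?b * pe w s)) = (ge w s * pe w s) * ?b" by (simp only: mult.assoc)
    then show ?thesis by (simp only: ge_pe_same[OF s(1)] vb)
  qed
  ultimately show False using b(2) by simp
qed

definition idl :: "'q set \<Rightarrow> 'q set" where
  "idl X = \<Inter>{J. aideal J \<and> X \<subseteq> J}"

lemma alg_aideal: "aideal alg"
  unfolding aideal_def by (auto intro: alg_add alg_mult)

lemma idl_base: "X \<subseteq> idl X"
  unfolding idl_def by blast

lemma idl_least: "aideal J \<Longrightarrow> X \<subseteq> J \<Longrightarrow> idl X \<subseteq> J"
  unfolding idl_def by blast

lemma idl_aideal: "X \<subseteq> alg \<Longrightarrow> aideal (idl X)"
proof -
  assume X: "X \<subseteq> alg"
  have "idl X \<subseteq> alg" by (rule idl_least[OF alg_aideal X])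
  moreover have "0 \<in> idl X" unfolding idl_def aideal_def by blast
  moreover have "x + y \<in> idl X" if "x \<in> idl X" "y \<in> idl X" for x y
    using that unfolding idl_def by (auto intro: aideal_add)
  moreover have "a * x \<in> idl X \<and> x * a \<in> idl X" if "a \<in> alg" "x \<in> idl X" for a x
    using that unfolding idl_def by (auto intro: aideal_left aideal_right)
  ultimately show ?thesis unfolding aideal_def by blast
qed

definition gidl :: "'v set \<Rightarrow> 'v set \<Rightarrow> 'q set" where
  "gidl H S = idl (vt ` H \<union> bel H ` S)"

definition cidl :: "'v set \<Rightarrow> 'e list \<Rightarrow> 'k laurent_poly \<Rightarrow> 'q set" where
  "cidl H c f = idl (vt ` H \<union> bel H ` breaking_vertices E H \<union> {lev c f})"

definition case_a where
  "case_a P \<longleftrightarrow> (\<exists>H c f. hereditary E H \<and> saturated E H \<and> exclusive_cycle E c \<and>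
     verts E - H = root_set E (cycle_verts E c) \<and> Factorial_Ring.irreducible f \<and> P = cidl H c f)"

definition case_b1 where
  "case_b1 P \<longleftrightarrow> (\<exists>H \<alpha>. hereditary E H \<and> saturated E H \<and>
     infinite_path E \<alpha> \<and> strictly_decreasing E \<alpha> \<and> H = verts E - root_set E (infinite_path_verts E \<alpha>) \<and>
     (\<forall>v\<in>verts E - H. root_set E {v} \<subset> root_set E (infinite_path_verts E \<alpha>)) \<and>
     P = gidl H (breaking_vertices E H))"

definition case_b2 where
  "case_b2 P \<longleftrightarrow> (\<exists>H v. hereditary E H \<and> saturated E H \<and>
     v \<in> verts E \<and> H = verts E - root_set E {v} \<and>
     (\<forall>e\<in>out_arcs E v. head E e \<notin> verts E - H) \<and> P = gidl H (breaking_vertices E H))"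

definition case_b3 where
  "case_b3 P \<longleftrightarrow> (\<exists>H S v c. hereditary E H \<and> saturated E H \<and>
     v \<in> verts E \<and> H = verts E - root_set E {v} \<and>
     extreme_cycle E (verts E - H) c \<and> v \<in> cycle_verts E c \<and>
     (S = breaking_vertices E H \<or>
      (\<exists>u\<in>breaking_vertices E H. u \<in> cycle_verts E c \<and> S = breaking_vertices E H - {u})) \<and>
     P = gidl H S)"

definition case_b4 where
  "case_b4 P \<longleftrightarrow> (\<exists>H S v c. hereditary E H \<and> saturated E H \<and>
     v \<in> verts E \<and> H = verts E - root_set E {v} \<and>
     exclusive_cycle E c \<and> v \<in> cycle_verts E c \<and>
     (\<exists>u\<in>breaking_vertices E H. u \<in> cycle_verts E c \<and> S = breaking_vertices E H - {u}) \<and>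
     P = gidl H S)"

lemma gidl_gens_alg:
  assumes "H \<subseteq> verts E" "S \<subseteq> breaking_vertices E H"
  shows "vt ` H \<union> bel H ` S \<subseteq> alg"
  using assms bel_alg[of _ H] vt_alg unfolding breaking_vertices_def by auto

lemma gidl_aideal: "H \<subseteq> verts E \<Longrightarrow> S \<subseteq> breaking_vertices E H \<Longrightarrow> aideal (gidl H S)"
  unfolding gidl_def by (intro idl_aideal gidl_gens_alg)

text \<open>All vertices outside of H lead to v, so returning to c is automatic; the second cycle
  provides the exit.\<close>

lemma not_exclusive_extreme:
  assumes "cycle c" "\<not> exclusive_cycle E c" "v \<in> cycle_verts E c"
    and "hereditary E H" "verts E - H = root_set E {v}"
  shows "extreme_cycle E (verts E - H) c"
proof -
  have cV: "cycle_verts E c \<subseteq> verts E - H"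
    unfolding assms(5) root_set_def
    using cycle_connected[OF assms(1) _ assms(3)] path_geq_verts by blast
  obtain e where e: "exit_of E c e" "path_geq E (head E e) v"
    by (rule not_exclusive_exit[OF assms(1,2)]) (use assms(3) in blast)
  then have "head E e \<in> verts E - H"
    unfolding assms(5) root_set_def by (auto simp: exit_of_def)
  moreover have "\<exists>q x. awalk w q x \<and> set (awalk_verts w q) \<subseteq> verts E - H \<and> x \<in> cycle_verts E c"
    if "awalk u p w" "set (awalk_verts u p) \<subseteq> verts E - H" for u p w
  proof -
    have "w \<in> set (awalk_verts u p)" using that(1) by (metis awalk_verts_non_Nil awlast_of_awalk last_in_set NOMATCH_def awalkE')
    then have "w \<in> root_set E {v}" using that(2) assms(5) by blast
    then obtain q where q: "awalk w q v" by (auto simp: root_set_def path_geq_def)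
    have "v \<notin> H" using cV assms(3) by blast
    then have "set (awalk_verts w q) \<subseteq> verts E - H"
      using awalk_outside(2)[OF assms(4) q] q by auto
    then show ?thesis using q assms(3) by blast
  qed
  ultimately show ?thesis using assms(1) cV e(1) unfolding extreme_cycle_def by blast
qed

lemma cycle_through:
  assumes "e \<in> arcs_outside E H v" "verts E - H = root_set E {v}"
  obtains c where "cycle c" "v \<in> cycle_verts E c"
proof -
  have "e \<in> arcs E" "tail E e = v" "path_geq E (head E e) v"
    using assms unfolding arcs_outside_def by (auto simp: root_set_def)
  then obtain d where d: "cycle (e # d)" using cycle_through_arc[of e] by auto
  then show ?thesis using that[OF d] cycle_awalk(4)[OF d] \<open>tail E e = v\<close> by auto
qed

end

section \<open>The elements v^H and Laurent polynomials in a primitive ideal\<close>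

context leavitt_prim
begin

lemma vt_vanish: "v \<in> H \<Longrightarrow> vt v \<in> P"
  by (simp add: vanish_def)

lemma H_saturated: "saturated E H"
  unfolding saturated_def
proof (intro conjI allI impI)
  fix v assume v: "regular_vertex E v \<and> head E ` out_arcs E v \<subseteq> H"
  have "(\<Sum>e\<in>out_arcs E v. ed e * gh e) \<in> P"
  proof (rule aideal_sum[OF P_aideal])
    fix e assume "e \<in> out_arcs E v"
    then have "e \<in> arcs E" "head E e \<in> H" using v by auto
    then show "ed e * gh e \<in> P"
      by (intro aideal_right[OF P_aideal] aideal_ed[OF P_aideal] gh_alg vt_vanish)
  qed
  then show "v \<in> H" using v ck2[of v] by (simp add: vanish_def regular_vertex_def)
qed (auto simp: vanish_def)

lemma breaking_alg: "x \<in> breaking_vertices E H \<Longrightarrow> x \<in> verts E \<and> finite (arcs_outside E H x) \<and> bel H x \<in> alg"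
  using bel_alg[of x H] by (auto simp: breaking_vertices_def)

text \<open>A nonempty q starting at u' begins with an edge to the outside of H, whose ghost is
  killed by \<open>bel H u'\<close>. If q starts elsewhere, the product is 0 because
  \<open>bel H u'\<close> absorbs u'.\<close>

lemma ge_bel_nonzero:
  assumes "u' \<in> breaking_vertices E H" "awalk b q w" "w \<notin> H" "x * ge b q * bel H u' \<notin> P"
  shows "b = u' \<and> q = [] \<and> w = u'"
proof -
  have z: "0 \<in> P" using P_aideal by (simp add: aideal_def)
  note u' = breaking_alg[OF assms(1)]
  have b: "b = u'"
  proof (rule ccontr)
    assume "b \<noteq> u'"
    then have "ge b q * vt u' = 0" using ge_vt_other[of u' b q w] u' assms(2) by blast
    then have "ge b q * bel H u' = 0" using vt_bel(1)[of u' H] u' by (metis mult.assoc mult_zero_left)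
    then show False using assms(4) z by (simp add: mult.assoc)
  qed
  moreover have "q = []"
  proof (cases q)
    case (Cons e q')
    have e: "e \<in> arcs_outside E H u'" using awalk_Cons_outside[OF H_hereditary] assms(2,3) Cons b by blast
    then have "gh e * bel H u' = 0" using gh_bel[of H u' e] u' by (auto simp: arcs_outside_def)
    then have "ge b q * bel H u' = 0" by (simp add: Cons mult.assoc)
    then show ?thesis using assms(4) z by (simp add: mult.assoc)
  qed
  ultimately show ?thesis using assms(2) by (auto simp: awalk_simps)
qed

lemma bel_pe_nonzero:
  assumes "u' \<in> breaking_vertices E H" "awalk b q w" "w \<notin> H" "bel H u' * pe b q * x \<notin> P"
  shows "b = u' \<and> q = []"
proof -
  have z: "0 \<in> P" using P_aideal by (simp add: aideal_def)
  note u' = breaking_alg[OF assms(1)]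
  have b: "b = u'"
  proof (rule ccontr)
    assume "b \<noteq> u'"
    then have "vt u' * pe b q = 0" using vt_pe_other[of u' b q w] u' assms(2) by blast
    then have "bel H u' * pe b q = 0" using vt_bel(2)[of u' H] u' by (metis mult.assoc mult_zero_right)
    then show False using assms(4) z by simp
  qed
  moreover have "q = []"
  proof (cases q)
    case (Cons e q')
    have e: "e \<in> arcs_outside E H u'" using awalk_Cons_outside[OF H_hereditary] assms(2,3) Cons b by blast
    then have "bel H u' * ed e = 0" using bel_ed[of H u' e] u' by (auto simp: arcs_outside_def)
    then have "bel H u' * pe b q = 0" by (simp add: Cons mult.assoc[symmetric])
    then show ?thesis using assms(4) z by simp
  qed
  ultimately show ?thesis by blast
qed

text \<open>Primeness for w and the missing element at u' gives a monomial between them. Its ghost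
  part is trivial at u', so its real part leads from w to u'.\<close>

lemma breaking_sep:
  assumes "u' \<in> breaking_vertices E H" "bel H u' \<notin> P" "w \<in> verts E - H"
  shows "path_geq E w u'"
proof -
  have w: "w \<in> verts E" "vt w \<notin> P" using assms(3) by (auto simp: vanish_def)
  obtain a p b q x where m: "awalk a p x" "awalk b q x" "vt w * (pe a p * ge b q) * bel H u' \<notin> P" "x \<notin> H"
    by (rule prime_mono[OF vt_alg[OF w(1)] _ w(2) assms(2)]) (use breaking_alg[OF assms(1)] in blast)
  have "x = u'"
    using ge_bel_nonzero[OF assms(1) m(2,4), of "vt w * pe a p"] m(3) by (simp add: mult.assoc)
  moreover have "w = a"
  proof (rule ccontr)
    assume "w \<noteq> a"
    from vt_pe_other[OF w(1) m(1) this] show False using m(3) P_aideal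
      by (simp add: mult.assoc[symmetric] aideal_def)
  qed
  ultimately show ?thesis using m(1) unfolding path_geq_def by blast
qed

text \<open>Between two missing elements the monomial given by primeness is trivial on both sides,
  so both belong to the same vertex.\<close>

lemma breaking_unique:
  assumes "u1 \<in> breaking_vertices E H" "bel H u1 \<notin> P" "u2 \<in> breaking_vertices E H" "bel H u2 \<notin> P"
  shows "u1 = u2"
proof -
  obtain a p b q x where m: "awalk a p x" "awalk b q x" "bel H u1 * (pe a p * ge b q) * bel H u2 \<notin> P" "x \<notin> H"
    by (rule prime_mono[OF _ _ assms(2,4)]) (use breaking_alg assms in blast)+
  have "x = u2"
    using ge_bel_nonzero[OF assms(3) m(2,4), of "bel H u1 * pe a p"] m(3) by (simp add: mult.assoc)
  moreover have "a = u1 \<and> p = []"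
    using bel_pe_nonzero[OF assms(1) m(1,4), of "ge b q * bel H u2"] m(3) by (simp add: mult.assoc)
  ultimately show ?thesis using m(1) by (simp add: awalk_simps)
qed

lemma graded_eq:
  assumes "S = {u \<in> breaking_vertices E H. bel H u \<in> P}"
    and "\<And>w k y. noexit E H w \<Longrightarrow> k \<noteq> 0 \<Longrightarrow> y \<in> loops w \<Longrightarrow> \<kappa> k * vt w + y \<in> P \<Longrightarrow> False"
  shows "P = gidl H S"
proof (rule ccontr)
  assume ne: "P \<noteq> gidl H S"
  have J: "aideal (gidl H S)" by (rule gidl_aideal) (auto simp: vanish_def assms(1))
  have sub: "gidl H S \<subseteq> P" unfolding gidl_def
    by (rule idl_least[OF P_aideal]) (auto simp: assms(1) vanish_def)
  have gens: "vt ` H \<union> bel H ` S \<subseteq> gidl H S" unfolding gidl_def by (rule idl_base)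
  show False
    by (rule ideal_reduction[OF P_aideal J sub _ _ ne]) (use gens assms in auto)
qed

text \<open>Modulo P the corner at the base is a quotient of K[x, x^-1], and the part of the simple
  module at the base is simple over it. For a nonzero vector m there, either 1 + x kills m, or it
  can be undone on m by some h, so that h (1 + x) - 1 kills m. By commutativity a Laurent polynomial
  that kills m lies in P.\<close>

lemma exclusive_contains_poly:
  assumes "exclusive_cycle E c" "verts E - H = root_set E (cycle_verts E c)"
    and "\<And>u. u \<in> breaking_vertices E H \<Longrightarrow> bel H u \<in> P"
  shows "\<exists>g. g \<noteq> 0 \<and> lev c g \<in> P"
proof -
  interpret X: leavitt_excl E \<kappa> vt ed gh H c P
    using assms H_hereditary P_aideal vt_vanish by unfold_locales auto
  let ?b = X.base
  have bv: "?b \<in> verts E" "vt ?b \<notin> P"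
    using X.c_outside[OF X.base_cycle] by (auto simp: vanish_def)
  then obtain z where z: "z \<in> alg" "vt ?b * z \<notin> N" using vt_alg by (auto simp: P_def)
  define m where "m = vt ?b * z"
  have m: "m \<in> alg" "m \<notin> N" "vt ?b * m = m"
    using z bv vt_alg alg_mult vt_idem by (auto simp: m_def mult.assoc[symmetric])
  note la = lev_alg[OF X.c_walk]
  have hom: "lev c (f * g) * x \<in> N \<longleftrightarrow> lev c f * (lev c g * x) \<in> N" if "x \<in> alg" for f g x
  proof -
    have "(lev c f * lev c g - lev c (f * g)) * x \<in> N" by (rule P_N[OF X.lev_mult that])
    then show ?thesis using N_cong by (simp add: left_diff_distrib mult.assoc)
  qed
  \<comment> \<open>An element of \<open>alg\<close> that maps a vector at the base to one at the
    base acts on it like a Laurent polynomial in c.\<close>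
  have red: "\<exists>h. t * x - lev c h * x \<in> N" if t: "t \<in> alg" and x: "x \<in> alg" "vt ?b * x = x" and tx: "vt ?b * (t * x) = t * x" for t x
  proof -
    obtain h where "vt ?b * t * vt ?b - lev c h \<in> P" using X.corner_lev[OF t] by blast
    then have "(vt ?b * t * vt ?b - lev c h) * x \<in> N" using x(1) by (rule P_N)
    then show ?thesis using x(2) tx by (auto simp: left_diff_distrib mult.assoc)
  qed
  have vlev: "vt ?b * lev c h = lev c h" for h
    unfolding lev_def sum_distrib_left by (intro sum.cong refl) (simp add: \<kappa>_left_comm vt_cpow[OF X.c_walk])
  \<comment> \<open>Modulo N every vector at the base is h(c) m for some h, and there g(c) and h(c)
    commute.\<close>
  have kill: "lev c g \<in> P" if g: "lev c g * m \<in> N" for g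
  proof -
    have "lev c g * w \<in> N" if w: "w \<in> alg" for w
    proof -
      obtain t where t: "t \<in> alg" "t * m - w \<in> N" using N_max[OF m(1,2) w] by blast
      have vt1: "vt ?b * t \<in> alg" "vt ?b * (vt ?b * t * m) = vt ?b * t * m"
        using t bv vt_alg alg_mult vt_idem by (auto simp: mult.assoc[symmetric])
      obtain h where h: "vt ?b * t * m - lev c h * m \<in> N" using red[OF vt1(1) m(1,3) vt1(2)] by blast
      have "lev c h * (lev c g * m) \<in> N" by (rule N_left[OF la g])
      then have "lev c (h * g) * m \<in> N" using hom[OF m(1)] by blast
      then have "lev c (g * h) * m \<in> N" by (simp only: mult.commute)
      then have "lev c g * (lev c h * m) \<in> N" using hom[OF m(1)] by blast
      moreover have "lev c g * (vt ?b * t * m - lev c h * m) \<in> N" by (rule N_left[OF la h])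
      ultimately have "lev c g * (vt ?b * t * m) \<in> N" using N_cong by (simp add: right_diff_distrib)
      moreover have gv: "lev c g * vt ?b = lev c g"
        unfolding lev_def sum_distrib_right by (intro sum.cong refl) (simp add: mult.assoc cpow_vt[OF X.c_walk])
      have "lev c g * (vt ?b * t * m) = lev c g * vt ?b * (t * m)" by (simp only: mult.assoc)
      ultimately have "lev c g * (t * m) \<in> N" unfolding gv by simp
      moreover have "lev c g * (t * m - w) \<in> N" by (rule N_left[OF la t(2)])
      ultimately show ?thesis using N_cong by (simp add: right_diff_distrib)
    qed
    then show ?thesis using la by (simp add: P_def)
  qed
  let ?x = "1 + Poly_Mapping.single 1 1 :: 'k laurent_poly"
  show ?thesis
  proof (cases "lev c ?x * m \<in> N")
    case True
    have "Poly_Mapping.lookup ?x 0 = 1" by (simp add: lookup_add lookup_single)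
    then have "?x \<noteq> 0" by (metis lookup_zero zero_neq_one)
    then show ?thesis using kill[OF True] by blast
  next
    case False
    have xm: "lev c ?x * m \<in> alg" "vt ?b * (lev c ?x * m) = lev c ?x * m"
      using la m alg_mult vlev by (auto simp: mult.assoc[symmetric])
    obtain t where t: "t \<in> alg" "t * (lev c ?x * m) - m \<in> N" using N_max[OF xm(1) False m(1)] by blast
    have vt1: "vt ?b * t \<in> alg" "vt ?b * (vt ?b * t * (lev c ?x * m)) = vt ?b * t * (lev c ?x * m)"
      using t bv vt_alg alg_mult vt_idem by (auto simp: mult.assoc[symmetric])
    obtain h where h: "vt ?b * t * (lev c ?x * m) - lev c h * (lev c ?x * m) \<in> N"
      using red[OF vt1(1) xm vt1(2)] by blast
    have "vt ?b * (t * (lev c ?x * m) - m) \<in> N" using bv vt_alg t(2) N_left by blast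
    then have "vt ?b * t * (lev c ?x * m) - m \<in> N" using m(3) by (simp add: right_diff_distrib mult.assoc)
    from N_diff[OF this h] have "lev c h * (lev c ?x * m) - m \<in> N" by (simp add: algebra_simps)
    moreover have "(lev c h * lev c ?x - lev c (h * ?x)) * m \<in> N" by (rule P_N[OF X.lev_mult m(1)])
    ultimately have "lev c h * (lev c ?x * m) - m - (lev c h * lev c ?x - lev c (h * ?x)) * m \<in> N"
      by (rule N_diff)
    then have "lev c (h * ?x - 1) * m \<in> N"
      by (simp add: lev_diff lev_one[OF X.c_walk] left_diff_distrib m(3) mult.assoc del: mult_1)
    then have "lev c (h * ?x - 1) \<in> P" by (rule kill)
    moreover have "h * ?x - 1 \<noteq> 0" using one_plus_x_not_unit[of h] by simp
    ultimately show ?thesis by blast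
  qed
qed

text \<open>The Laurent polynomials g with g(c) in P form a prime ideal: in f(c) t g(c) the element
  t may be replaced by its corner, which is a Laurent polynomial modulo P. The generator f of this
  ideal makes \<open>cidl H c f\<close> contain the same Laurent elements as P.\<close>

lemma exclusive_case_a:
  assumes "exclusive_cycle E c" "verts E - H = root_set E (cycle_verts E c)"
    and "\<And>u. u \<in> breaking_vertices E H \<Longrightarrow> bel H u \<in> P"
  shows "case_a P"
proof -
  interpret X: leavitt_excl E \<kappa> vt ed gh H c P
    using assms H_hereditary P_aideal vt_vanish by unfold_locales auto
  let ?I = "{g. lev c g \<in> P}"
  obtain g where g: "g \<noteq> 0" "lev c g \<in> P" using exclusive_contains_poly[OF assms] by blast
  have "\<exists>f. f \<in> ?I \<and> Factorial_Ring.irreducible f \<and> (\<forall>h\<in>?I. f dvd h)"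
  proof (rule laurent_prime_generator[of ?I g])
    show "f + g \<in> ?I" if "f \<in> ?I" "g \<in> ?I" for f g
      using that aideal_add[OF P_aideal] by (simp add: lev_add)
    show "h * f \<in> ?I" if "f \<in> ?I" for f h
      using that lev_ideal[OF X.c_walk P_aideal] by simp
    show "1 \<notin> ?I" using X.c_outside[OF X.base_cycle] by (simp add: lev_one[OF X.c_walk] vanish_def)
    show "f \<in> ?I \<or> g \<in> ?I" if fg: "f * g \<in> ?I" for f g
    proof -
      have "lev c f * t * lev c g \<in> P" if t: "t \<in> alg" for t
      proof -
        obtain h where h: "vt X.base * t * vt X.base - lev c h \<in> P" using X.corner_lev[OF t] by blast
        have v: "vt X.base * lev c h = lev c h" "lev c h * vt X.base = lev c h" for h
          unfolding lev_def sum_distrib_left sum_distrib_right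
          by (intro sum.cong refl, simp add: \<kappa>_left_comm vt_cpow[OF X.c_walk] mult.assoc cpow_vt[OF X.c_walk])+
        have "lev c f * (vt X.base * t * vt X.base) * lev c g =
            (lev c f * vt X.base) * t * (vt X.base * lev c g)" by (simp only: mult.assoc)
        then have "lev c f * t * lev c g = lev c f * (vt X.base * t * vt X.base) * lev c g"
          unfolding v by simp
        moreover have "lev c f * (vt X.base * t * vt X.base - lev c h) * lev c g \<in> P"
          by (rule aideal_alg_outer[OF P_aideal h lev_alg[OF X.c_walk] lev_alg[OF X.c_walk]])
        moreover have "lev c f * lev c h * lev c g \<in> P"
        proof -
          have "lev c (h * (f * g)) \<in> P" using fg lev_ideal[OF X.c_walk P_aideal] by simp
          moreover have "h * (f * g) = f * h * g" by (simp only: mult_ac)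
          ultimately have "lev c (f * h * g) \<in> P" by simp
          moreover have "lev c (f * h) * lev c g - lev c (f * h * g) \<in> P" by (rule X.lev_mult)
          ultimately have "lev c (f * h) * lev c g \<in> P"
            using aideal_cong[OF P_aideal] by blast
          moreover have "(lev c f * lev c h - lev c (f * h)) * lev c g \<in> P"
            by (rule aideal_right[OF P_aideal lev_alg[OF X.c_walk] X.lev_mult])
          ultimately show ?thesis using aideal_cong[OF P_aideal] by (simp add: left_diff_distrib)
        qed
        ultimately show ?thesis using aideal_cong[OF P_aideal]
          by (simp add: left_diff_distrib right_diff_distrib)
      qed
      then show ?thesis using P_prime[OF lev_alg[OF X.c_walk] lev_alg[OF X.c_walk]] by auto
    qed
  qed (use g in auto)
  then obtain f where f: "lev c f \<in> P" "Factorial_Ring.irreducible f" "\<forall>h\<in>?I. f dvd h" by blast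
  let ?X = "vt ` H \<union> bel H ` breaking_vertices E H \<union> {lev c f}"
  have XP: "?X \<subseteq> P" using f(1) vt_vanish assms(3) by auto
  then have J: "aideal (cidl H c f)"
    unfolding cidl_def using P_aideal by (intro idl_aideal) (auto simp: aideal_def)
  have sub: "cidl H c f \<subseteq> P" unfolding cidl_def by (rule idl_least[OF P_aideal XP])
  have gens: "?X \<subseteq> cidl H c f" unfolding cidl_def by (rule idl_base)
  have "leavitt_excl E \<kappa> vt ed gh H c (cidl H c f)"
    using assms(1,2) H_hereditary J gens by unfold_locales auto
  moreover have "lev c h \<in> cidl H c f" if hP: "lev c h \<in> P" for h
  proof -
    have "f dvd h" using f(3) hP by blast
    then obtain k where "h = f * k" by (elim dvdE)
    then have "h = k * f" by (simp only: mult.commute)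
    moreover have "lev c f \<in> cidl H c f" using gens by blast
    ultimately show ?thesis using lev_ideal[OF X.c_walk J] by blast
  qed
  ultimately have "P = cidl H c f"
    using excl_ideal_eq[OF _ P_aideal sub refl] by blast
  then show ?thesis using assms(1,2) f(2) H_hereditary H_saturated unfolding case_a_def by blast
qed

end

section \<open>Infinite paths from chains of vertices\<close>

context wf_digraph
begin

lemma cas_nth: "cas u p v \<Longrightarrow> Suc i < length p \<Longrightarrow> head G (p ! i) = tail G (p ! Suc i)"
proof (induction p arbitrary: u i)
  case (Cons e p)
  then show ?case by (cases i; cases p) auto
qed simp

text \<open>Entry i of \<alpha> is read off from the first i + 1 factors. No factor is empty, so
  these have at least i + 1 edges, and further factors do not change the entry.\<close>

lemma chain_path:
  assumes p: "\<And>n. awalk (v n) (p n) (v (Suc n))" "\<And>n. p n \<noteq> []"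
  shows "\<exists>\<alpha> k. infinite_path G \<alpha> \<and> strict_mono k \<and> k 0 = (0::nat) \<and> (\<forall>n. tail G (\<alpha> (k n)) = v n) \<and>
    (\<forall>i. \<exists>n. path_geq G (tail G (\<alpha> i)) (v n))"
proof -
  define P where "P n = concat (map p [0..<n])" for n
  define \<alpha> where "\<alpha> i = P (Suc i) ! i" for i
  have PS: "P (Suc n) = P n @ p n" for n by (simp add: P_def)
  have len: "length (P n) < length (P (Suc n))" for n using p(2) by (simp add: PS)
  have len2: "n \<le> length (P n)" for n
  proof (induction n)
    case (Suc n) then show ?case using len[of n] by simp
  qed simp
  have pre: "\<exists>r. P n = P m @ r" if "m \<le> n" for m n
    using that by (induction rule: dec_induct) (auto simp: PS)
  have nth: "\<alpha> i = P n ! i" if "i < length (P n)" for i n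
  proof -
    obtain r r' where r: "P (max n (Suc i)) = P n @ r" "P (max n (Suc i)) = P (Suc i) @ r'"
      using pre[of n "max n (Suc i)"] pre[of "Suc i" "max n (Suc i)"] by auto
    have "i < length (P (Suc i))" using len2[of "Suc i"] by simp
    then show ?thesis using r that by (metis \<alpha>_def nth_append)
  qed
  have wk: "awalk (v 0) (P n) (v n)" for n
  proof (induction n)
    case 0 then show ?case using p(1)[of 0] by (auto simp: P_def awalk_Nil_iff)
  next
    case (Suc n) then show ?case unfolding PS using p(1) by (rule awalk_appendI)
  qed
  have arc: "\<alpha> i \<in> set (P (Suc i))" for i
    using len2[of "Suc i"] by (simp add: \<alpha>_def)
  have "infinite_path G \<alpha>"
    unfolding infinite_path_def
  proof (intro allI conjI)
    fix i
    show "\<alpha> i \<in> arcs G" using arc[of i] wk[of "Suc i"] by auto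
    have l: "Suc i < length (P (Suc (Suc i)))" using len2[of "Suc (Suc i)"] by simp
    then show "head G (\<alpha> i) = tail G (\<alpha> (Suc i))"
      using cas_nth[OF _ l] wk[of "Suc (Suc i)"] nth[of i "Suc (Suc i)"] nth[OF l] by (auto simp: awalk_def)
  qed
  moreover have "strict_mono (\<lambda>n. length (P n))" using len by (simp add: strict_mono_Suc_iff)
  moreover have "tail G (\<alpha> (length (P n))) = v n" for n
  proof -
    have "\<alpha> (length (P n)) = hd (p n)"
      using nth[OF len[of n]] p(2)[of n] by (simp add: PS nth_append hd_conv_nth)
    then show ?thesis using p[of n] by (cases "p n") (auto simp: awalk_Cons_iff)
  qed
  moreover have "\<exists>n. path_geq G (tail G (\<alpha> i)) (v n)" for i
  proof -
    have "tail G (\<alpha> i) \<in> set (awalk_verts (v 0) (P (Suc i)))" using awalk_verts_arc1[OF arc] .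
    from awalk_decomp[OF wk this] show ?thesis unfolding path_geq_def by blast
  qed
  moreover have "length (P 0) = 0" by (simp add: P_def)
  ultimately show ?thesis by (intro exI[of _ \<alpha>] exI[of _ "\<lambda>n. length (P n)"]) blast
qed

end

section \<open>Necessity of the five cases\<close>

context leavitt_prim
begin

lemma sep_root:
  assumes "v \<in> verts E - H" "\<forall>x\<in>verts E - H. path_geq E x v"
  shows "verts E - H = root_set E {v}" "H = verts E - root_set E {v}"
proof -
  show "verts E - H = root_set E {v}"
    using assms H_hereditary unfolding root_set_def hereditary_def by blast
  moreover have "H \<subseteq> verts E" by (auto simp: vanish_def)
  ultimately show "H = verts E - root_set E {v}" by blast
qed

lemma sep_noexit:
  assumes "\<forall>x\<in>verts E - H. path_geq E x v" "noexit E H w" "awalk v r x" "x \<notin> H"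
  shows "\<exists>!e. e \<in> arcs_outside E H x"
proof -
  have "w \<in> verts E - H" using assms(2) noexitD by blast
  then obtain q where "awalk w q v" using assms(1) unfolding path_geq_def by blast
  then show ?thesis using noexitD(3)[OF assms(2) awalk_cat[OF _ assms(3)] assms(4)] by blast
qed

text \<open>The vertex u' of the missing element is below all others. If P contained some k w + y,
  conjugation would move it to u', where the missing element kills the closed paths; k times this
  element would then be in P. So P is graded, and whether a cycle through u' is exclusive decides
  between (b4) and (b3).\<close>

lemma prim_case_breaking:
  assumes u': "u' \<in> breaking_vertices E H" "bel H u' \<notin> P"
  shows "case_b3 P \<or> case_b4 P"
proof -
  let ?S = "breaking_vertices E H - {u'}"
  have sep: "u' \<in> verts E - H" "\<forall>x\<in>verts E - H. path_geq E x u'"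
    using breaking_sep[OF assms] u' by (auto simp: breaking_vertices_def)
  note root = sep_root[OF sep]
  have S: "?S = {x \<in> breaking_vertices E H. bel H x \<in> P}"
    using breaking_unique[OF assms] u' by blast
  have P: "P = gidl H ?S"
  proof (rule graded_eq[OF S])
    fix w k y assume w: "noexit E H w" "k \<noteq> 0" "y \<in> loops w" "\<kappa> k * vt w + y \<in> P"
    have "path_geq E w u'" using sep(2) w(1) noexitD by blast
    then obtain q where q: "awalk w q u'" unfolding path_geq_def by blast
    have "ge w q * (\<kappa> k * vt w + y) * pe w q \<in> P"
      by (rule aideal_alg_outer[OF P_aideal w(4) ge_alg[OF q] pe_alg[OF q]])
    then have "bel H u' * (\<kappa> k * vt u' + ge w q * y * pe w q) \<in> P"
      using aideal_left[OF P_aideal] breaking_alg[OF u'(1)] unfolding conj_const[OF q] by blast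
    moreover have "bel H u' * (ge w q * y * pe w q) = 0"
      using loops_mult_pe[OF conj_loops[OF w(3) q] H_hereditary sep(1)] breaking_alg[OF u'(1)] by blast
    moreover have "bel H u' * vt u' = bel H u'" using vt_bel(2) breaking_alg[OF u'(1)] by blast
    ultimately have "\<kappa> k * bel H u' \<in> P" by (simp add: distrib_left \<kappa>_left_comm)
    then show False using aideal_unscale[OF P_aideal _ w(2)] u'(2) by blast
  qed
  obtain e where "e \<in> arcs_outside E H u'" using u'(1) by (auto simp: breaking_vertices_def)
  then obtain c where c: "cycle c" "u' \<in> cycle_verts E c" by (rule cycle_through[OF _ root(1)])
  show ?thesis
  proof (cases "exclusive_cycle E c")
    case True
    have "case_b4 P" unfolding case_b4_def
      by (rule exI[of _ H], rule exI[of _ ?S], rule exI[of _ u'], rule exI[of _ c])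
        (use True c u' sep(1) root(2) P H_hereditary H_saturated in blast)
    then show ?thesis ..
  next
    case False
    have ext: "extreme_cycle E (verts E - H) c"
      by (rule not_exclusive_extreme[OF c(1) False c(2) H_hereditary root(1)])
    have "case_b3 P" unfolding case_b3_def
      by (rule exI[of _ H], rule exI[of _ ?S], rule exI[of _ u'], rule exI[of _ c])
        (use ext c u' sep(1) root(2) P H_hereditary H_saturated in blast)
    then show ?thesis ..
  qed
qed

text \<open>If v emits no edge to the outside of H, (b2) holds; otherwise v is on a cycle c. If c is
  not exclusive, its exit and the edge of c at the same vertex are two edges that no vertex
  satisfying \<open>noexit\<close> can lead to, so P is graded.\<close>

lemma prim_case_sep:
  assumes v: "v \<in> verts E - H" "\<forall>x\<in>verts E - H. path_geq E x v"
    and B: "\<And>x. x \<in> breaking_vertices E H \<Longrightarrow> bel H x \<in> P"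
  shows "case_a P \<or> case_b2 P \<or> case_b3 P"
proof -
  note root = sep_root[OF v]
  have S: "breaking_vertices E H = {x \<in> breaking_vertices E H. bel H x \<in> P}" using B by blast
  have vH: "v \<notin> H" using v by blast
  show ?thesis
  proof (cases "arcs_outside E H v = {}")
    case True
    have "P = gidl H (breaking_vertices E H)"
    proof (rule graded_eq[OF S])
      fix w k y assume "noexit E H w"
      from sep_noexit[OF v(2) this, of "[]" v] show False using True v by (auto simp: awalk_simps)
    qed
    moreover have "\<forall>e\<in>out_arcs E v. head E e \<notin> verts E - H" using True by (auto simp: arcs_outside_def)
    ultimately have "case_b2 P" unfolding case_b2_def
      using v root(2) H_hereditary H_saturated by (intro exI[of _ H] exI[of _ v]) blast
    then show ?thesis by blast
  next
    case False
    then obtain e where "e \<in> arcs_outside E H v" by blast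
    then obtain c where c: "cycle c" "v \<in> cycle_verts E c" by (rule cycle_through[OF _ root(1)])
    show ?thesis
    proof (cases "exclusive_cycle E c")
      case True
      have "verts E - H = root_set E (cycle_verts E c)"
        unfolding root(1) using cycle_connected[OF c(1) _ c(2)] path_geq_trans c(2)
        unfolding root_set_def by blast
      then show ?thesis using exclusive_case_a[OF True _ B] by blast
    next
      case ne: False
      have ext: "extreme_cycle E (verts E - H) c"
        by (rule not_exclusive_extreme[OF c(1) ne c(2) H_hereditary root(1)])
      have "P = gidl H (breaking_vertices E H)"
      proof (rule graded_eq[OF S])
        fix w k y assume "noexit E H w"
        note * = sep_noexit[OF v(2) this]
        obtain f where f: "exit_of E c f" "head E f \<in> verts E - H" using ext by (auto simp: extreme_cycle_def)
        have tf: "tail E f \<in> cycle_verts E c" "f \<in> arcs E" "f \<notin> set c" using f(1) by (auto simp: exit_of_def)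
        obtain g where g: "g \<in> set c" "tail E g = tail E f" using tf(1) cycle_awalk(4)[OF c(1)] by auto
        have cV: "cycle_verts E c \<subseteq> verts E - H" using ext by (auto simp: extreme_cycle_def)
        have "f \<in> arcs_outside E H (tail E f)" using f tf by (auto simp: arcs_outside_def)
        moreover have "g \<in> arcs_outside E H (tail E f)"
          using g cycle_arcs[OF c(1)] cycle_head_verts[OF c(1) g(1)] cV by (auto simp: arcs_outside_def)
        moreover obtain r where "awalk v r (tail E f)"
          using cycle_connected[OF c(1,2) tf(1)] unfolding path_geq_def by blast
        ultimately show False using *[of r "tail E f"] tf g(1) cV by blast
      qed
      note Pg = this
      have "case_b3 P" unfolding case_b3_def
        by (rule exI[of _ H], rule exI[of _ "breaking_vertices E H"], rule exI[of _ v], rule exI[of _ c])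
          (use ext c v root(2) H_hereditary H_saturated Pg in blast)
      then show ?thesis by blast
    qed
  qed
qed

text \<open>The path is built from lower bounds. The vertex after \<open>v n\<close> is chosen below
  \<open>v n\<close>, below the next member of the countable set, and below some z that does not
  reach \<open>v n\<close>; the last choice makes the step strict.\<close>

lemma prim_case_path:
  assumes nosep: "\<And>v. v \<in> verts E - H \<Longrightarrow> \<exists>x\<in>verts E - H. \<not> path_geq E x v"
    and B: "\<And>x. x \<in> breaking_vertices E H \<Longrightarrow> bel H x \<in> P"
  shows "case_b1 P"
proof -
  obtain C where C: "countable C" "C \<subseteq> verts E - H" "\<And>x. x \<in> verts E - H \<Longrightarrow> \<exists>w\<in>C. path_geq E x w"
    using countable_separation by blast
  have Cne: "C \<noteq> {}" using H_proper C(3) by blast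
  define w where "w = from_nat_into C"
  have w: "w n \<in> C" "range w = C" for n
    using from_nat_into[OF Cne] range_from_nat_into[OF Cne C(1)] by (auto simp: w_def)
  have step: "\<exists>y. (y \<in> verts E - H \<and> path_geq E (w (Suc n)) y) \<and> (path_geq E x y \<and> \<not> path_geq E y x)"
    if "x \<in> verts E - H \<and> path_geq E (w n) x" for x n
  proof -
    have x: "x \<in> verts E - H" using \<open>x \<in> _ \<and> _\<close> by blast
    obtain z where z: "z \<in> verts E - H" "\<not> path_geq E z x" using nosep[OF x] by blast
    from downward_directed[OF x z(1)]
    obtain y1 where y1: "y1 \<in> verts E - H" "path_geq E x y1" "path_geq E z y1" by blast
    have "w (Suc n) \<in> verts E - H" using w(1) C(2) by blast
    from downward_directed[OF this y1(1)]
    obtain y where y: "y \<in> verts E - H" "path_geq E (w (Suc n)) y" "path_geq E y1 y" by blast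
    have "\<not> path_geq E y x" using z(2) path_geq_trans[OF y1(3) path_geq_trans[OF y(3)]] by blast
    then show ?thesis using y(1,2) path_geq_trans[OF y1(2) y(3)] by blast
  qed
  have "\<exists>v. \<forall>n. (v n \<in> verts E - H \<and> path_geq E (w n) (v n)) \<and>
      (path_geq E (v n) (v (Suc n)) \<and> \<not> path_geq E (v (Suc n)) (v n))"
  proof (rule dependent_nat_choice)
    have "w 0 \<in> verts E - H" using w(1) C(2) by blast
    then show "\<exists>x. x \<in> verts E - H \<and> path_geq E (w 0) x" using path_geq_refl by blast
  qed (rule step)
  then obtain v where v: "\<And>n. v n \<in> verts E - H" "\<And>n. path_geq E (w n) (v n)"
    "\<And>n. path_geq E (v n) (v (Suc n))" "\<And>n. \<not> path_geq E (v (Suc n)) (v n)" by blast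
  obtain p where p: "\<And>n. awalk (v n) (p n) (v (Suc n))" using v(3) unfolding path_geq_def by metis
  have pne: "p n \<noteq> []" for n
  proof
    assume "p n = []"
    then have "v n = v (Suc n)" using p[of n] by (simp add: awalk_simps)
    then show False using v(3,4)[of n] by simp
  qed
  from chain_path[of v p, OF p pne] obtain \<alpha> k where \<alpha>: "infinite_path E \<alpha>" "strict_mono k" "k 0 = (0::nat)"
    "\<And>n. tail E (\<alpha> (k n)) = v n" "\<And>i. \<exists>n. path_geq E (tail E (\<alpha> i)) (v n)" by blast
  have sd: "strictly_decreasing E \<alpha>"
    unfolding strictly_decreasing_def path_gt_def using \<alpha>(2-4) v(3,4) by (intro exI[of _ k]) auto
  have va: "v n \<in> infinite_path_verts E \<alpha>" for n
    unfolding infinite_path_verts_def \<alpha>(4)[symmetric] by blast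
  have root: "verts E - H = root_set E (infinite_path_verts E \<alpha>)"
  proof (intro equalityI subsetI)
    fix x assume x: "x \<in> verts E - H"
    then obtain n where "path_geq E x (w n)" using C(3) w(2) by blast
    then have "path_geq E x (v n)" using v(2) path_geq_trans by blast
    then show "x \<in> root_set E (infinite_path_verts E \<alpha>)" using x va by (auto simp: root_set_def)
  next
    fix x assume "x \<in> root_set E (infinite_path_verts E \<alpha>)"
    then obtain i where "x \<in> verts E" "path_geq E x (tail E (\<alpha> i))"
      by (auto simp: root_set_def infinite_path_verts_def)
    moreover obtain n where "path_geq E (tail E (\<alpha> i)) (v n)" using \<alpha>(5) by blast
    ultimately have "x \<in> verts E" "path_geq E x (v n)" using path_geq_trans by blast+
    then show "x \<in> verts E - H" using v(1)[of n] H_hereditary unfolding hereditary_def by blast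
  qed
  have P: "P = gidl H (breaking_vertices E H)"
  proof (rule graded_eq)
    show "breaking_vertices E H = {x \<in> breaking_vertices E H. bel H x \<in> P}" using B by blast
    fix y k z assume y: "noexit E H y"
    then have yv: "y \<in> verts E - H" using noexitD by blast
    \<comment> \<open>A vertex y satisfying \<open>noexit\<close> would be below all others: a
      common lower bound of x and y leads back to y.\<close>
    have "path_geq E x y" if x: "x \<in> verts E - H" for x
    proof -
      from downward_directed[OF x yv]
      obtain z where z: "z \<in> verts E - H" "path_geq E x z" "path_geq E y z" by blast
      then obtain q where "awalk y q z" unfolding path_geq_def by blast
      then have "path_geq E z y" using noexit_return[OF H_hereditary y] z(1) unfolding path_geq_def by blast
      then show ?thesis using z(2) path_geq_trans by blast
    qed
    then show False using nosep[OF yv] by blast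
  qed
  have "root_set E {x} \<subset> root_set E (infinite_path_verts E \<alpha>)" if x: "x \<in> verts E - H" for x
  proof -
    have "root_set E {x} \<subseteq> verts E - H"
      using x H_hereditary unfolding root_set_def hereditary_def by blast
    moreover obtain z where "z \<in> verts E - H" "\<not> path_geq E z x" using nosep[OF x] by blast
    ultimately show ?thesis unfolding root[symmetric] by (auto simp: root_set_def)
  qed
  moreover have "H = verts E - root_set E (infinite_path_verts E \<alpha>)"
    using root by (auto simp: vanish_def)
  ultimately show ?thesis unfolding case_b1_def
    using \<alpha>(1) sd P H_hereditary H_saturated by blast
qed

theorem prim_cases: "case_a P \<or> case_b1 P \<or> case_b2 P \<or> case_b3 P \<or> case_b4 P"
proof (cases "\<forall>x\<in>breaking_vertices E H. bel H x \<in> P")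
  case True
  then show ?thesis
    using prim_case_path prim_case_sep by (cases "\<exists>v\<in>verts E - H. \<forall>x\<in>verts E - H. path_geq E x v") blast+
next
  case False
  then show ?thesis using prim_case_breaking by blast
qed

end

context leavitt_family
begin

lemma left_prim_leavitt_prim:
  assumes "left_prim alg P"
  shows "\<exists>N u. leavitt_prim E \<kappa> vt ed gh N P u"
proof -
  from assms[unfolded left_prim_def] obtain N u where "N \<subseteq> alg" and
    *: "\<forall>x\<in>N. \<forall>y\<in>N. x - y \<in> N" "\<forall>a\<in>alg. \<forall>x\<in>N. a * x \<in> N" and "u \<in> alg" "u \<notin> N" and
    **: "\<forall>x\<in>alg. x * u - x \<in> N" "\<forall>x\<in>alg - N. \<forall>z\<in>alg. \<exists>y\<in>alg. y * x - z \<in> N" and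
    "P = {x \<in> alg. \<forall>y\<in>alg. x * y \<in> N}"
    by (elim exE conjE)
  then have "leavitt_prim E \<kappa> vt ed gh N P u"
    by unfold_locales (use * ** in blast)+
  then show ?thesis by blast
qed

lemma left_prim_cases:
  assumes "left_prim alg P"
  shows "case_a P \<or> case_b1 P \<or> case_b2 P \<or> case_b3 P \<or> case_b4 P"
proof -
  obtain N u where "leavitt_prim E \<kappa> vt ed gh N P u" using left_prim_leavitt_prim[OF assms] by blast
  then interpret leavitt_prim E \<kappa> vt ed gh N P u .
  show ?thesis by (rule prim_cases)
qed

end

section \<open>All quotients of a ring at once\<close>

definition ring_ideal :: "'a::ring_1 set \<Rightarrow> bool" where
  "ring_ideal I \<longleftrightarrow> 0 \<in> I \<and> (\<forall>x\<in>I. \<forall>y\<in>I. x - y \<in> I) \<and> (\<forall>r. \<forall>x\<in>I. r * x \<in> I \<and> x * r \<in> I)"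

lemma ring_ideal_zero: "ring_ideal I \<Longrightarrow> 0 \<in> I"
  and ring_ideal_diff: "ring_ideal I \<Longrightarrow> x \<in> I \<Longrightarrow> y \<in> I \<Longrightarrow> x - y \<in> I"
  and ring_ideal_left: "ring_ideal I \<Longrightarrow> x \<in> I \<Longrightarrow> r * x \<in> I"
  and ring_ideal_right: "ring_ideal I \<Longrightarrow> x \<in> I \<Longrightarrow> x * r \<in> I"
  unfolding ring_ideal_def by blast+

lemma ring_ideal_uminus: "ring_ideal I \<Longrightarrow> x \<in> I \<Longrightarrow> - x \<in> I"
  using ring_ideal_diff[of I 0 x] ring_ideal_zero[of I] by simp

lemma ring_ideal_add: "ring_ideal I \<Longrightarrow> x \<in> I \<Longrightarrow> y \<in> I \<Longrightarrow> x + y \<in> I"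
  using ring_ideal_diff[of I x "- y"] ring_ideal_uminus[of I y] by simp

text \<open>The quotient of \<open>R\<close> by an ideal depends on a term, so it is not a type.  The product of the
  quotients of \<open>R\<close> by all of its ideals is one, and every quotient is contained in it.\<close>

quotient_type (overloaded) 'a all_quotients = "'a::ring_1 set \<Rightarrow> 'a" / "\<lambda>f g. \<forall>I. ring_ideal I \<longrightarrow> f I - g I \<in> I"
proof (rule equivpI)
  show "reflp (\<lambda>f g. \<forall>I. ring_ideal I \<longrightarrow> f I - g I \<in> (I :: 'a set))"
    by (rule reflpI) (simp add: ring_ideal_zero)
  show "symp (\<lambda>f g. \<forall>I. ring_ideal I \<longrightarrow> f I - g I \<in> (I :: 'a set))"
    by (rule sympI) (metis minus_diff_eq ring_ideal_uminus)
  show "transp (\<lambda>f g. \<forall>I. ring_ideal I \<longrightarrow> f I - g I \<in> (I :: 'a set))"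
  proof (rule transpI, intro allI impI)
    fix f g h :: "'a set \<Rightarrow> 'a" and I :: "'a set"
    assume "\<forall>I. ring_ideal I \<longrightarrow> f I - g I \<in> I" "\<forall>I. ring_ideal I \<longrightarrow> g I - h I \<in> I" "ring_ideal I"
    then have "(f I - g I) + (g I - h I) \<in> I" by (intro ring_ideal_add) auto
    then show "f I - h I \<in> I" by simp
  qed
qed

instantiation all_quotients :: (ring_1) ring_1
begin

lift_definition zero_all_quotients :: "'a all_quotients" is "\<lambda>_. 0" .

lift_definition one_all_quotients :: "'a all_quotients" is "\<lambda>_. 1" .

lift_definition plus_all_quotients :: "'a all_quotients \<Rightarrow> 'a all_quotients \<Rightarrow> 'a all_quotients"
  is "\<lambda>f g I. f I + g I"
proof -
  fix f1 f2 g1 g2 :: "'a set \<Rightarrow> 'a" and I :: "'a set"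
  assume "\<And>I. ring_ideal I \<Longrightarrow> f1 I - f2 I \<in> I" "\<And>I. ring_ideal I \<Longrightarrow> g1 I - g2 I \<in> I" "ring_ideal I"
  then have "(f1 I - f2 I) + (g1 I - g2 I) \<in> I" by (intro ring_ideal_add) auto
  then show "f1 I + g1 I - (f2 I + g2 I) \<in> I" by (simp add: algebra_simps)
qed

lift_definition minus_all_quotients :: "'a all_quotients \<Rightarrow> 'a all_quotients \<Rightarrow> 'a all_quotients"
  is "\<lambda>f g I. f I - g I"
proof -
  fix f1 f2 g1 g2 :: "'a set \<Rightarrow> 'a" and I :: "'a set"
  assume *: "\<And>I. ring_ideal I \<Longrightarrow> f1 I - f2 I \<in> I" "\<And>I. ring_ideal I \<Longrightarrow> g1 I - g2 I \<in> I" "ring_ideal I"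
  have "(f1 I - f2 I) - (g1 I - g2 I) \<in> I" by (rule ring_ideal_diff[OF *(3) *(1)[OF *(3)] *(2)[OF *(3)]])
  then show "f1 I - g1 I - (f2 I - g2 I) \<in> I" by (simp add: algebra_simps)
qed

lift_definition uminus_all_quotients :: "'a all_quotients \<Rightarrow> 'a all_quotients"
  is "\<lambda>f I. - f I"
proof -
  fix f1 f2 :: "'a set \<Rightarrow> 'a" and I :: "'a set"
  assume "\<And>I. ring_ideal I \<Longrightarrow> f1 I - f2 I \<in> I" "ring_ideal I"
  then have "- (f1 I - f2 I) \<in> I" by (intro ring_ideal_uminus) auto
  then show "- f1 I - - f2 I \<in> I" by simp
qed

lift_definition times_all_quotients :: "'a all_quotients \<Rightarrow> 'a all_quotients \<Rightarrow> 'a all_quotients"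
  is "\<lambda>f g I. f I * g I"
proof -
  fix f1 f2 g1 g2 :: "'a set \<Rightarrow> 'a" and I :: "'a set"
  assume "\<And>I. ring_ideal I \<Longrightarrow> f1 I - f2 I \<in> I" "\<And>I. ring_ideal I \<Longrightarrow> g1 I - g2 I \<in> I" "ring_ideal I"
  then have "(f1 I - f2 I) * g1 I + f2 I * (g1 I - g2 I) \<in> I"
    by (intro ring_ideal_add ring_ideal_left ring_ideal_right) auto
  then show "f1 I * g1 I - f2 I * g2 I \<in> I" by (simp add: algebra_simps)
qed

instance
proof
  show "(0 :: 'a all_quotients) \<noteq> 1"
  proof
    assume "(0 :: 'a all_quotients) = 1"
    then have "\<forall>I. ring_ideal I \<longrightarrow> 0 - 1 \<in> (I :: 'a set)" by transfer
    moreover have "ring_ideal ({0} :: 'a set)" by (simp add: ring_ideal_def)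
    ultimately show False by fastforce
  qed
qed (transfer, simp add: algebra_simps ring_ideal_zero)+

end

text \<open>The quotient by J is embedded as one factor of the product. This respects sums and
  products but not the unit, so scalars are taken from the diagonal \<open>const_elem\<close>, where
  they are central.\<close>

lift_definition quot_elem :: "'a set \<Rightarrow> 'a::ring_1 \<Rightarrow> 'a all_quotients"
  is "\<lambda>J x I. if I = J then x else 0" .

lift_definition const_elem :: "'a::ring_1 \<Rightarrow> 'a all_quotients" is "\<lambda>x I. x" .

lemma quot_elem_eq_iff: "ring_ideal J \<Longrightarrow> quot_elem J x = quot_elem J y \<longleftrightarrow> x - y \<in> J"
  by transfer (auto simp: ring_ideal_zero)

lemma quot_elem_add: "quot_elem J (x + y) = quot_elem J x + quot_elem J y"
  by transfer (auto simp: ring_ideal_zero)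

lemma quot_elem_mult: "quot_elem J (x * y) = quot_elem J x * quot_elem J y"
  by transfer (auto simp: ring_ideal_zero)

lemma quot_elem_zero: "quot_elem J 0 = 0"
  by transfer (auto simp: ring_ideal_zero)

lemma quot_elem_sum: "quot_elem J (sum f A) = (\<Sum>i\<in>A. quot_elem J (f i))"
  by (induction A rule: infinite_finite_induct) (auto simp: quot_elem_zero quot_elem_add)

lemma const_elem_add: "const_elem (x + y) = const_elem x + const_elem y"
  by transfer (auto simp: ring_ideal_zero)

lemma const_elem_mult: "const_elem (x * y) = const_elem x * const_elem y"
  by transfer (auto simp: ring_ideal_zero)

lemma const_elem_one: "const_elem 1 = 1"
  by transfer (auto simp: ring_ideal_zero)

lemma const_mult_quot_elem: "const_elem x * quot_elem J y = quot_elem J (x * y)"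
  by transfer (auto simp: ring_ideal_zero)

lemma const_elem_central: "(\<And>y. y * x = x * y) \<Longrightarrow> z * const_elem x = const_elem x * z"
  by transfer (auto simp: ring_ideal_zero)

section \<open>The Leavitt path algebra inside a unital ring\<close>

lemma letters_zero [simp]: "letters (0 :: 'a free_monoid) = []"
  by (simp add: zero_free_monoid_def)

lemma letters_add [simp]: "letters (u + w) = letters u @ letters w"
  by (simp add: plus_free_monoid_def)

lemma free_scalar_central: "p * Poly_Mapping.single 0 k = Poly_Mapping.single 0 k * (p :: ('a, 'k::field) free_poly)"
  by (induction p rule: poly_mapping_induct_add)
    (auto simp: mult_single distrib_left distrib_right mult.commute)

text \<open>The ring homomorphism that sets all letters outside of X to 0.\<close>

lift_definition restrict_letters :: "'a set \<Rightarrow> ('a, 'k::field) free_poly \<Rightarrow> ('a, 'k) free_poly"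
  is "\<lambda>X f w. if set (letters w) \<subseteq> X then f w else 0"
  by (rule finite_subset[rotated]) auto

lemma restrict_add: "restrict_letters X (p + q) = restrict_letters X p + restrict_letters X q"
  by transfer auto

lemma restrict_zero [simp]: "restrict_letters X 0 = 0"
  by transfer auto

lemma restrict_diff: "restrict_letters X (p - q) = restrict_letters X p - restrict_letters X q"
  by transfer auto

lemma restrict_single:
  "restrict_letters X (Poly_Mapping.single w k) = (if set (letters w) \<subseteq> X then Poly_Mapping.single w k else 0)"
  by (rule poly_mapping_eqI) (auto simp: restrict_letters.rep_eq lookup_single when_def)

lemma restrict_mult: "restrict_letters X (p * q) = restrict_letters X p * restrict_letters X q"
proof (induction p rule: poly_mapping_induct_add)
  case (single w k)
  show ?case
    by (induction q rule: poly_mapping_induct_add)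
      (auto simp: restrict_single mult_single restrict_add distrib_left)
qed (auto simp: restrict_add distrib_right)

lemma free_algebra_simps [simp]:
  "carrier (free_algebra X) = {p. \<forall>w\<in>Poly_Mapping.keys p. letters w \<noteq> [] \<and> set (letters w) \<subseteq> X}"
  "p \<otimes>\<^bsub>free_algebra X\<^esub> q = p * q" "\<zero>\<^bsub>free_algebra X\<^esub> = 0" "p \<oplus>\<^bsub>free_algebra X\<^esub> q = p + q"
  "k \<odot>\<^bsub>free_algebra X\<^esub> p = Poly_Mapping.single 0 k * p"
  by (simp_all add: free_algebra_def mult_map_scale_conv_mult)

definition fcar :: "'a set \<Rightarrow> ('a, 'k::field) free_poly set" where
  "fcar X = {p. \<forall>w\<in>Poly_Mapping.keys p. letters w \<noteq> [] \<and> set (letters w) \<subseteq> X}"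

lemma fcar_carrier: "carrier (free_algebra X) = fcar X"
  by (simp add: fcar_def)

lemma fcar_zero [simp]: "0 \<in> fcar X"
  by (simp add: fcar_def)

lemma fcar_add: "p \<in> fcar X \<Longrightarrow> q \<in> fcar X \<Longrightarrow> p + q \<in> fcar X"
  using keys_add[of p q] unfolding fcar_def by blast

lemma fcar_minus: "p \<in> fcar X \<Longrightarrow> - p \<in> fcar X"
  by (simp add: fcar_def in_keys_iff)

lemma fcar_diff: "p \<in> fcar X \<Longrightarrow> q \<in> fcar X \<Longrightarrow> p - q \<in> fcar X"
  using fcar_add[OF _ fcar_minus] by fastforce

lemma fcar_single: "letters w \<noteq> [] \<Longrightarrow> set (letters w) \<subseteq> X \<Longrightarrow> Poly_Mapping.single w k \<in> fcar X"
  by (auto simp: fcar_def)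

lemma fcar_mult_left:
  assumes "p \<in> fcar X" "\<And>w. w \<in> Poly_Mapping.keys q \<Longrightarrow> set (letters w) \<subseteq> X"
  shows "q * p \<in> fcar X" "p * q \<in> fcar X"
proof -
  have "letters (a + b) \<noteq> [] \<and> set (letters (a + b)) \<subseteq> X \<and> letters (b + a) \<noteq> [] \<and> set (letters (b + a)) \<subseteq> X"
    if "a \<in> Poly_Mapping.keys q" "b \<in> Poly_Mapping.keys p" for a b
    using assms that unfolding fcar_def by simp
  then show "q * p \<in> fcar X" "p * q \<in> fcar X"
    using keys_mult[of q p] keys_mult[of p q] unfolding fcar_def by blast+
qed

lemma fcar_mult: "p \<in> fcar X \<Longrightarrow> q \<in> fcar X \<Longrightarrow> p * q \<in> fcar X"
  by (rule fcar_mult_left) (auto simp: fcar_def)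

lemma fcar_scale: "p \<in> fcar X \<Longrightarrow> Poly_Mapping.single 0 k * p \<in> fcar X"
  by (rule fcar_mult_left) (auto split: if_splits)

lemma fcar_sum: "(\<And>i. i \<in> I \<Longrightarrow> f i \<in> fcar X) \<Longrightarrow> sum f I \<in> fcar X"
  by (induction I rule: infinite_finite_induct) (auto intro: fcar_add)

lemma fcar_indet: "a \<in> X \<Longrightarrow> indet a \<in> fcar X"
  unfolding indet_def by (rule fcar_single) auto

lemma restrict_fcar: "p \<in> fcar X \<Longrightarrow> restrict_letters X p = p"
  by (rule poly_mapping_eqI) (auto simp: restrict_letters.rep_eq fcar_def in_keys_iff)

lemma free_algebra_group: "abelian_group (free_algebra X)"
proof (rule abelian_groupI)
  fix x :: "('a, 'b) free_poly" assume "x \<in> carrier (free_algebra X)"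
  then have "- x \<in> fcar X" using fcar_minus[of x X] by (simp only: fcar_carrier)
  then show "\<exists>y\<in>carrier (free_algebra X). y \<oplus>\<^bsub>free_algebra X\<^esub> x = \<zero>\<^bsub>free_algebra X\<^esub>"
    unfolding fcar_carrier by (intro bexI[of _ "- x"]) auto
qed (auto simp del: free_algebra_simps(1) simp: fcar_carrier fcar_add add_ac)

lemma free_algebra_a_inv: "p \<in> fcar X \<Longrightarrow> \<ominus>\<^bsub>free_algebra X\<^esub> p = - p"
proof -
  interpret abelian_group "free_algebra X" by (rule free_algebra_group)
  assume p: "p \<in> fcar X"
  show ?thesis by (rule minus_equality) (use p fcar_minus[of p X] fcar_carrier[of X] in auto)
qed

definition alg_ideal_of :: "'a set \<Rightarrow> ('a, 'k::field) free_poly set \<Rightarrow> bool" where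
  "alg_ideal_of X I \<longleftrightarrow> I \<subseteq> fcar X \<and> 0 \<in> I \<and> (\<forall>p\<in>I. \<forall>q\<in>I. p + q \<in> I) \<and> (\<forall>p\<in>I. - p \<in> I) \<and>
     (\<forall>p\<in>I. \<forall>q\<in>fcar X. q * p \<in> I \<and> p * q \<in> I) \<and> (\<forall>p\<in>I. \<forall>k. Poly_Mapping.single 0 k * p \<in> I)"

lemma alg_ideal_of_iff:
  "two_sided_ideal I (free_algebra X) \<and> (\<forall>k. \<forall>a\<in>I. k \<odot>\<^bsub>free_algebra X\<^esub> a \<in> I) \<longleftrightarrow> alg_ideal_of X I"
proof
  assume a: "two_sided_ideal I (free_algebra X) \<and> (\<forall>k. \<forall>a\<in>I. k \<odot>\<^bsub>free_algebra X\<^esub> a \<in> I)"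
  then have s: "subgroup I (add_monoid (free_algebra X))"
    by (simp add: two_sided_ideal_def additive_subgroup_def)
  have sub: "I \<subseteq> fcar X" using subgroup.subset[OF s] by (simp add: fcar_def)
  have "- p \<in> I" if "p \<in> I" for p
    using subgroup.m_inv_closed[OF s that] free_algebra_a_inv[of p X] sub that by (auto simp: a_inv_def)
  then show "alg_ideal_of X I"
    using a sub subgroup.one_closed[OF s] subgroup.m_closed[OF s]
    unfolding alg_ideal_of_def two_sided_ideal_def fcar_carrier by simp
next
  assume a: "alg_ideal_of X I"
  have "subgroup I (add_monoid (free_algebra X))"
  proof
    show "inv\<^bsub>add_monoid (free_algebra X)\<^esub> x \<in> I" if "x \<in> I" for x
      using free_algebra_a_inv[of x X] a that unfolding alg_ideal_of_def a_inv_def by auto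
  qed (use a in \<open>auto simp: alg_ideal_of_def fcar_def\<close>)
  then show "two_sided_ideal I (free_algebra X) \<and> (\<forall>k. \<forall>a\<in>I. k \<odot>\<^bsub>free_algebra X\<^esub> a \<in> I)"
    using a unfolding two_sided_ideal_def additive_subgroup_def alg_ideal_of_def fcar_carrier by simp
qed

lemma fcar_alg_ideal: "alg_ideal_of X (fcar X)"
  unfolding alg_ideal_of_def by (auto intro: fcar_add fcar_minus fcar_mult fcar_scale)

lemma lpa_gens_simps [simp]:
  "Vert v \<in> lpa_gens E \<longleftrightarrow> v \<in> verts E" "Edge e \<in> lpa_gens E \<longleftrightarrow> e \<in> arcs E" "Ghost e \<in> lpa_gens E \<longleftrightarrow> e \<in> arcs E"
  by (auto simp: lpa_gens_def)

context wf_digraph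
begin

lemma relations_fcar: "lpa_relations G \<subseteq> fcar (lpa_gens G)"
  unfolding lpa_relations_def regular_vertex_def
  by (auto intro!: fcar_diff fcar_mult fcar_sum fcar_indet)

lemma relation_ideal_eq:
  "lpa_relation_ideal G = \<Inter>{I. alg_ideal_of (lpa_gens G) I \<and> lpa_relations G \<subseteq> I}"
  unfolding lpa_relation_ideal_def algebra_ideal_gen_def using alg_ideal_of_iff by blast

lemma relation_ideal: "alg_ideal_of (lpa_gens G) (lpa_relation_ideal G)"
proof -
  have "lpa_relation_ideal G \<subseteq> fcar (lpa_gens G)"
    unfolding relation_ideal_eq using fcar_alg_ideal relations_fcar by blast
  moreover have mem: "p \<in> lpa_relation_ideal G \<longleftrightarrow>
      (\<forall>I. alg_ideal_of (lpa_gens G) I \<longrightarrow> lpa_relations G \<subseteq> I \<longrightarrow> p \<in> I)"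
    for p :: "(('a, 'b) lpa_gen, 'k::field) free_poly"
    unfolding relation_ideal_eq by blast
  ultimately show ?thesis
    unfolding alg_ideal_of_def[of _ "lpa_relation_ideal G"]
    by (intro conjI ballI allI) (simp_all add: mem, simp_all add: alg_ideal_of_def)
qed

lemma relations_in: "lpa_relations G \<subseteq> lpa_relation_ideal G"
  unfolding relation_ideal_eq by blast

text \<open>The relation ideal lives in the free algebra on the generators; this preimage is an
  ideal of the ring of all polynomials, constants and foreign letters included. It meets the free
  algebra in the relation ideal, so \<open>emb\<close> distinguishes the elements of
  \<open>lpa G\<close>.\<close>

definition full_ideal :: "(('a, 'b) lpa_gen, 'k::field) free_poly set" where
  "full_ideal = {p. restrict_letters (lpa_gens G) p \<in> lpa_relation_ideal G}"

lemma full_ideal: "ring_ideal (full_ideal :: (('a, 'b) lpa_gen, 'k::field) free_poly set)"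
proof -
  let ?N = "lpa_relation_ideal G :: (('a, 'b) lpa_gen, 'k) free_poly set"
  have "alg_ideal_of (lpa_gens G) ?N" by (rule relation_ideal)
  note N = this[unfolded alg_ideal_of_def]
  have diff: "p - q \<in> ?N" if pq: "p \<in> ?N" "q \<in> ?N" for p q
  proof -
    have "p + - q \<in> ?N" using N pq by blast
    then show ?thesis by simp
  qed
  \<comment> \<open>A word without letters is a scalar, under which the relation ideal is closed;
    any other word in the generators lies in the free algebra.\<close>
  have m: "restrict_letters (lpa_gens G) r * p \<in> ?N \<and> p * restrict_letters (lpa_gens G) r \<in> ?N" if p: "p \<in> ?N" for r p
  proof (induction r rule: poly_mapping_induct_add)
    case (single w k)
    show ?case
    proof (cases "letters w = []")
      case True
      then have "w = 0" by (metis free_monoid.collapse zero_free_monoid_def)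
      then show ?thesis using N p by (simp add: restrict_single free_scalar_central)
    next
      case False
      have "Poly_Mapping.single w k \<in> fcar (lpa_gens G)" if "set (letters w) \<subseteq> lpa_gens G"
        by (rule fcar_single[OF False that])
      then show ?thesis using N p by (simp add: restrict_single)
    qed
  qed (use N in \<open>auto simp: restrict_add distrib_left distrib_right\<close>)
  show ?thesis unfolding ring_ideal_def full_ideal_def
    using N diff m by (auto simp: restrict_diff restrict_mult)
qed

definition emb :: "(('a, 'b) lpa_gen, 'k::field) free_poly \<Rightarrow> (('a, 'b) lpa_gen, 'k) free_poly all_quotients" where
  "emb p = quot_elem full_ideal p"

definition scal :: "'k::field \<Rightarrow> (('a, 'b) lpa_gen, 'k) free_poly all_quotients" where
  "scal k = const_elem (Poly_Mapping.single 0 k)"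

lemma emb_eq_iff: "p \<in> fcar (lpa_gens G) \<Longrightarrow> q \<in> fcar (lpa_gens G) \<Longrightarrow> emb p = emb q \<longleftrightarrow> p - q \<in> lpa_relation_ideal G"
  unfolding emb_def quot_elem_eq_iff[OF full_ideal] unfolding full_ideal_def
  by (simp add: restrict_fcar fcar_diff)

lemma emb_add: "emb (p + q) = emb p + emb q"
  and emb_mult: "emb (p * q) = emb p * emb q"
  and emb_zero: "emb 0 = 0"
  and emb_sum: "emb (sum f A) = (\<Sum>i\<in>A. emb (f i))"
  and emb_scale: "scal k * emb p = emb (Poly_Mapping.single 0 k * p)"
  unfolding emb_def scal_def
  by (simp_all add: quot_elem_add quot_elem_mult quot_elem_zero quot_elem_sum const_mult_quot_elem)

lemma emb_relation:
  assumes "p - q \<in> lpa_relations G" "q \<in> fcar (lpa_gens G)"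
  shows "emb p = emb q"
proof -
  have "p - q + q \<in> fcar (lpa_gens G)" using assms relations_fcar by (intro fcar_add) auto
  then show ?thesis using emb_eq_iff[of p q] assms relations_in by auto
qed

lemma leavitt_family_emb:
  "leavitt_family G (scal :: 'k::field \<Rightarrow> _) (\<lambda>v. emb (indet (Vert v))) (\<lambda>e. emb (indet (Edge e))) (\<lambda>e. emb (indet (Ghost e)))"
proof unfold_locales
  note rel = lpa_relations_def
  show "scal (a + b) = (scal a + scal b :: (('a, 'b) lpa_gen, 'k) free_poly all_quotients)" for a b
    unfolding scal_def const_elem_add[symmetric] single_add ..
  show "scal (a * b) = (scal a * scal b :: (('a, 'b) lpa_gen, 'k) free_poly all_quotients)" for a b
    unfolding scal_def const_elem_mult[symmetric] by (simp add: mult_single)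
  show "scal 1 = (1 :: (('a, 'b) lpa_gen, 'k) free_poly all_quotients)"
    unfolding scal_def by (simp add: const_elem_one)
  show "x * scal a = scal a * x" for x :: "(('a, 'b) lpa_gen, 'k) free_poly all_quotients" and a
    unfolding scal_def by (rule const_elem_central) (rule free_scalar_central)
  show "emb (indet (Vert v)) * emb (indet (Vert w)) = (if v = w then emb (indet (Vert v)) else (0 :: (_, 'k) free_poly all_quotients))"
    if vw: "v \<in> verts G" "w \<in> verts G" for v w
  proof -
    have "emb (indet (Vert v) * indet (Vert w)) = (emb (if v = w then indet (Vert v) else 0) :: (_, 'k) free_poly all_quotients)"
    proof (rule emb_relation)
      show "indet (Vert v) * indet (Vert w) - (if v = w then indet (Vert v) else (0 :: (_, 'k) free_poly)) \<in> lpa_relations G"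
        unfolding rel Un_iff mem_Collect_eq using vw by blast
    qed (use vw in \<open>auto simp: fcar_indet\<close>)
    then show ?thesis by (simp add: emb_mult emb_zero split: if_splits)
  qed
  show "emb (indet (Vert (tail G e))) * emb (indet (Edge e)) = (emb (indet (Edge e)) :: (_, 'k) free_poly all_quotients)"
    if "e \<in> arcs G" for e
    unfolding emb_mult[symmetric] by (rule emb_relation) (use that in \<open>auto simp: rel fcar_indet\<close>)
  show "emb (indet (Edge e)) * emb (indet (Vert (head G e))) = (emb (indet (Edge e)) :: (_, 'k) free_poly all_quotients)"
    if "e \<in> arcs G" for e
    unfolding emb_mult[symmetric] by (rule emb_relation) (use that in \<open>auto simp: rel fcar_indet\<close>)
  show "emb (indet (Vert (head G e))) * emb (indet (Ghost e)) = (emb (indet (Ghost e)) :: (_, 'k) free_poly all_quotients)"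
    if "e \<in> arcs G" for e
    unfolding emb_mult[symmetric] by (rule emb_relation) (use that in \<open>auto simp: rel fcar_indet\<close>)
  show "emb (indet (Ghost e)) * emb (indet (Vert (tail G e))) = (emb (indet (Ghost e)) :: (_, 'k) free_poly all_quotients)"
    if "e \<in> arcs G" for e
    unfolding emb_mult[symmetric] by (rule emb_relation) (use that in \<open>auto simp: rel fcar_indet\<close>)
  show "emb (indet (Ghost e)) * emb (indet (Edge f)) = (if e = f then emb (indet (Vert (head G e))) else (0 :: (_, 'k) free_poly all_quotients))"
    if ef: "e \<in> arcs G" "f \<in> arcs G" for e f
  proof -
    have "emb (indet (Ghost e) * indet (Edge f)) = (emb (if e = f then indet (Vert (head G e)) else 0) :: (_, 'k) free_poly all_quotients)"
    proof (rule emb_relation)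
      show "indet (Ghost e) * indet (Edge f) - (if e = f then indet (Vert (head G e)) else (0 :: (_, 'k) free_poly)) \<in> lpa_relations G"
        unfolding rel Un_iff mem_Collect_eq using ef by blast
    qed (use ef in \<open>auto simp: fcar_indet\<close>)
    then show ?thesis by (simp add: emb_mult emb_zero split: if_splits)
  qed
  show "emb (indet (Vert v)) = (\<Sum>e\<in>out_arcs G v. emb (indet (Edge e)) * emb (indet (Ghost e)) :: (_, 'k) free_poly all_quotients)"
    if "regular_vertex G v" for v
    unfolding emb_mult[symmetric] emb_sum[symmetric]
  proof (rule emb_relation)
    show "indet (Vert v) - (\<Sum>e\<in>out_arcs G v. indet (Edge e) * indet (Ghost e) :: (_, 'k) free_poly) \<in> lpa_relations G"
      unfolding rel Un_iff mem_Collect_eq using that by blast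
  qed (auto intro!: fcar_sum fcar_mult fcar_indet)
qed

end

lemma poly_mapping_sum_single: "p = (\<Sum>w\<in>Poly_Mapping.keys p. Poly_Mapping.single w (Poly_Mapping.lookup p w))"
  for p :: "'a \<Rightarrow>\<^sub>0 'b::comm_monoid_add"
proof (rule poly_mapping_eqI)
  fix k
  have "(\<Sum>w\<in>Poly_Mapping.keys p. Poly_Mapping.lookup (Poly_Mapping.single w (Poly_Mapping.lookup p w)) k) =
     (\<Sum>w\<in>Poly_Mapping.keys p. if w = k then Poly_Mapping.lookup p k else 0)"
    by (intro sum.cong) (auto simp: lookup_single when_def)
  then show "Poly_Mapping.lookup p k =
    Poly_Mapping.lookup (\<Sum>w\<in>Poly_Mapping.keys p. Poly_Mapping.single w (Poly_Mapping.lookup p w)) k"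
    by (simp add: lookup_sum in_keys_iff)
qed

text \<open>The parameter K fixes the type of the scalars, which the graph does not mention.\<close>

locale lpa_emb = wf_digraph E for E :: "('v, 'e) pre_digraph" +
  fixes K :: "'k::field itself"
begin

definition \<kappa> :: "'k \<Rightarrow> (('v, 'e) lpa_gen, 'k) free_poly all_quotients" where "\<kappa> = scal"

definition vt :: "'v \<Rightarrow> (('v, 'e) lpa_gen, 'k) free_poly all_quotients" where "vt v = emb (indet (Vert v))"

definition ed :: "'e \<Rightarrow> (('v, 'e) lpa_gen, 'k) free_poly all_quotients" where "ed e = emb (indet (Edge e))"

definition gh :: "'e \<Rightarrow> (('v, 'e) lpa_gen, 'k) free_poly all_quotients" where "gh e = emb (indet (Ghost e))"

end

sublocale lpa_emb \<subseteq> leavitt_family E \<kappa> vt ed gh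
  using leavitt_family_emb unfolding \<kappa>_def vt_def[abs_def] ed_def[abs_def] gh_def[abs_def] .

section \<open>The isomorphism from \<open>alg\<close> onto \<open>lpa E\<close>\<close>

context lpa_emb
begin

abbreviation X where "X \<equiv> lpa_gens E"
abbreviation NN :: "(('v, 'e) lpa_gen, 'k) free_poly set" where "NN \<equiv> lpa_relation_ideal E"

lemma emb_word_alg: "ws \<noteq> [] \<Longrightarrow> set ws \<subseteq> X \<Longrightarrow> emb (Poly_Mapping.single (Word ws) 1) \<in> alg"
proof (induction ws)
  case (Cons a ws)
  have "emb (indet a) \<in> alg"
    using Cons.prems(2) vt_alg ed_alg gh_alg by (cases a) (auto simp: vt_def ed_def gh_def)
  moreover have "Poly_Mapping.single (Word (a # ws)) 1 = indet a * Poly_Mapping.single (Word ws) (1::'k)"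
    by (simp add: indet_def mult_single plus_free_monoid_def)
  ultimately show ?case
    using Cons by (cases "ws = []") (auto simp: emb_mult indet_def intro: alg_mult)
qed simp

lemma emb_alg: "p \<in> fcar X \<Longrightarrow> emb p \<in> alg"
proof -
  assume p: "p \<in> fcar X"
  have "emb (Poly_Mapping.single w (Poly_Mapping.lookup p w)) \<in> alg" if "w \<in> Poly_Mapping.keys p" for w
  proof -
    have "letters w \<noteq> []" "set (letters w) \<subseteq> X" using p that by (auto simp: fcar_def)
    then have "emb (Poly_Mapping.single w 1) \<in> alg" using emb_word_alg[of "letters w"] by simp
    then have "\<kappa> (Poly_Mapping.lookup p w) * emb (Poly_Mapping.single w 1) \<in> alg" by (rule alg_scale)
    then show ?thesis by (simp add: \<kappa>_def emb_scale mult_single)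
  qed
  then have "(\<Sum>w\<in>Poly_Mapping.keys p. emb (Poly_Mapping.single w (Poly_Mapping.lookup p w))) \<in> alg"
    by (rule alg_sum)
  then show ?thesis unfolding emb_sum[symmetric] poly_mapping_sum_single[symmetric] .
qed

lemma alg_emb: "q \<in> alg \<Longrightarrow> \<exists>p\<in>fcar X. emb p = q"
  unfolding alg_def
proof (induction rule: lspan.induct)
  case lspan_zero
  show ?case by (intro bexI[of _ 0]) (auto simp: emb_zero)
next
  case (lspan_step x y k)
  then obtain p where p: "p \<in> fcar X" "emb p = y" by blast
  have pe: "\<exists>q\<in>fcar X. emb q = pe u p" if "awalk u p w" for u p w
    using that
  proof (induction p arbitrary: u)
    case Nil
    then show ?case by (intro bexI[of _ "indet (Vert u)"]) (auto simp: awalk_simps vt_def[symmetric] fcar_indet)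
  next
    case (Cons e p)
    then obtain q where "q \<in> fcar X" "emb q = pe (head E e) p" by (auto simp: awalk_simps)
    then show ?case using Cons.prems
      by (intro bexI[of _ "indet (Edge e) * q"]) (auto simp: awalk_simps ed_def[symmetric] emb_mult fcar_indet intro: fcar_mult)
  qed
  have ge: "\<exists>q\<in>fcar X. emb q = ge u p" if "awalk u p w" for u p w
    using that
  proof (induction p arbitrary: u)
    case Nil
    then show ?case by (intro bexI[of _ "indet (Vert u)"]) (auto simp: awalk_simps vt_def[symmetric] fcar_indet)
  next
    case (Cons e p)
    then obtain q where "q \<in> fcar X" "emb q = ge (head E e) p" by (auto simp: awalk_simps)
    then show ?case using Cons.prems
      by (intro bexI[of _ "q * indet (Ghost e)"]) (auto simp: awalk_simps gh_def[symmetric] emb_mult fcar_indet intro: fcar_mult)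
  qed
  obtain u p' v q w where x: "x = pe u p' * ge v q" "awalk u p' w" "awalk v q w"
    using lspan_step(1) unfolding mons_def by blast
  obtain a b where ab: "a \<in> fcar X" "emb a = pe u p'" "b \<in> fcar X" "emb b = ge v q"
    using pe[OF x(2)] ge[OF x(3)] by blast
  have "emb (Poly_Mapping.single 0 k * (a * b) + p) = \<kappa> k * x + y"
    unfolding emb_add \<kappa>_def emb_scale[symmetric] by (simp add: emb_mult ab p x(1))
  moreover have "Poly_Mapping.single 0 k * (a * b) + p \<in> fcar X"
    using ab p by (intro fcar_add fcar_scale fcar_mult)
  ultimately show ?case by blast
qed

abbreviation cls :: "(('v, 'e) lpa_gen, 'k) free_poly \<Rightarrow> ('v, 'e, 'k) lpa_elem" where
  "cls p \<equiv> NN +>\<^bsub>free_algebra X\<^esub> p"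

lemma NN_ideal: "alg_ideal_of X NN"
  by (rule relation_ideal)

lemma NN_facts: "NN \<subseteq> fcar X" "0 \<in> NN" "p \<in> NN \<Longrightarrow> q \<in> NN \<Longrightarrow> p + q \<in> NN" "p \<in> NN \<Longrightarrow> - p \<in> NN"
  "p \<in> NN \<Longrightarrow> r \<in> fcar X \<Longrightarrow> r * p \<in> NN" "p \<in> NN \<Longrightarrow> r \<in> fcar X \<Longrightarrow> p * r \<in> NN"
  "p \<in> NN \<Longrightarrow> Poly_Mapping.single 0 k * p \<in> NN"
  using NN_ideal[unfolded alg_ideal_of_def] by blast+

lemma NN_diff: "p \<in> NN \<Longrightarrow> q \<in> NN \<Longrightarrow> p - q \<in> NN"
  using NN_facts(3)[of p "- q"] NN_facts(4)[of q] by simp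

lemma cls_eq: "cls p = {q. q - p \<in> NN}"
proof -
  have "cls p = {n + p | n. n \<in> NN}" by (auto simp: a_r_coset_def')
  also have "\<dots> = {q. q - p \<in> NN}"
    by (auto intro!: exI[of _ "_ - p"])
  finally show ?thesis .
qed

lemma cls_eq_iff: "cls p = cls q \<longleftrightarrow> p - q \<in> NN"
proof
  assume "cls p = cls q"
  moreover have "p \<in> cls p" using NN_facts(2) by (simp add: cls_eq)
  ultimately show "p - q \<in> NN" by (simp add: cls_eq)
next
  assume pq: "p - q \<in> NN"
  have "r - p \<in> NN \<longleftrightarrow> r - q \<in> NN" for r
    using NN_facts(3)[OF _ pq, of "r - p"] NN_diff[OF _ pq, of "r - q"] by auto
  then show "cls p = cls q" by (simp add: cls_eq)
qed

lemma lpa_carrier: "carrier (lpa E) = cls ` fcar X"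
  by (auto simp: lpa_def algebra_quotient_def ring.extend_def module.fields_def FactRing_def A_RCOSETS_def' fcar_def)

lemma lpa_zero: "\<zero>\<^bsub>lpa E\<^esub> = NN"
  by (simp add: lpa_def algebra_quotient_def ring.extend_def FactRing_def)

lemma cls_zero: "cls 0 = NN"
  by (simp add: cls_eq)

lemma lpa_add: "cls p \<oplus>\<^bsub>lpa E\<^esub> cls q = cls (p + q)"
proof -
  have "cls p \<oplus>\<^bsub>lpa E\<^esub> cls q = cls p <+>\<^bsub>free_algebra X\<^esub> cls q"
    by (simp add: lpa_def algebra_quotient_def ring.extend_def FactRing_def)
  also have "\<dots> = {a + b | a b. a \<in> cls p \<and> b \<in> cls q}" by (auto simp: set_add_def')
  also have "\<dots> = cls (p + q)"
  proof (intro equalityI subsetI)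
    fix x assume "x \<in> {a + b | a b. a \<in> cls p \<and> b \<in> cls q}"
    then obtain a b where ab: "x = a + b" "a - p \<in> NN" "b - q \<in> NN" by (auto simp: cls_eq)
    from NN_facts(3)[OF ab(2,3)] show "x \<in> cls (p + q)" by (simp add: cls_eq ab(1) algebra_simps)
  next
    fix x assume "x \<in> cls (p + q)"
    then have "(x - q) - p \<in> NN" "q - q \<in> NN" using NN_facts(2) by (auto simp: cls_eq algebra_simps)
    then have "x - q \<in> cls p" "q \<in> cls q" "x = (x - q) + q" by (auto simp: cls_eq)
    then show "x \<in> {a + b | a b. a \<in> cls p \<and> b \<in> cls q}" by blast
  qed
  finally show ?thesis .
qed

lemma lpa_mult: "p \<in> fcar X \<Longrightarrow> q \<in> fcar X \<Longrightarrow> cls p \<otimes>\<^bsub>lpa E\<^esub> cls q = cls (p * q)"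
proof -
  assume pq: "p \<in> fcar X" "q \<in> fcar X"
  have "cls p \<otimes>\<^bsub>lpa E\<^esub> cls q = (\<Union>a\<in>cls p. \<Union>b\<in>cls q. cls (a * b))"
    by (simp add: lpa_def algebra_quotient_def ring.extend_def FactRing_def rcoset_mult_def)
  moreover have "cls (a * b) = cls (p * q)" if "a \<in> cls p" "b \<in> cls q" for a b
  proof -
    have ab: "a - p \<in> NN" "b - q \<in> NN" using that by (simp_all add: cls_eq)
    have "(a - p) + p \<in> fcar X" using NN_facts(1) ab(1) pq(1) by (intro fcar_add) auto
    then have a: "a \<in> fcar X" by simp
    have "(a - p) * q + a * (b - q) \<in> NN"
      by (rule NN_facts(3)[OF NN_facts(6)[OF ab(1) pq(2)] NN_facts(5)[OF ab(2) a]])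
    then show ?thesis by (simp add: cls_eq_iff algebra_simps)
  qed
  moreover have "p \<in> cls p" "q \<in> cls q" using NN_facts(2) by (auto simp: cls_eq)
  ultimately show ?thesis by blast
qed

lemma lpa_smult: "k \<odot>\<^bsub>lpa E\<^esub> cls p = cls (Poly_Mapping.single 0 k * p)"
proof -
  have "k \<odot>\<^bsub>lpa E\<^esub> cls p = (\<Union>a\<in>cls p. cls (Poly_Mapping.single 0 k * a))"
    by (simp add: lpa_def algebra_quotient_def ring.extend_def module.fields_def)
  moreover have "cls (Poly_Mapping.single 0 k * a) = cls (Poly_Mapping.single 0 k * p)" if "a \<in> cls p" for a
    using NN_facts(7)[of "a - p" k] that by (simp add: cls_eq cls_eq_iff[unfolded cls_eq] right_diff_distrib)
  moreover have "p \<in> cls p" using NN_facts(2) by (auto simp: cls_eq)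
  ultimately show ?thesis by blast
qed

definition psi :: "(('v, 'e) lpa_gen, 'k) free_poly all_quotients \<Rightarrow> ('v, 'e, 'k) lpa_elem" where
  "psi q = cls (SOME p. p \<in> fcar X \<and> emb p = q)"

lemma psi_emb: "p \<in> fcar X \<Longrightarrow> psi (emb p) = cls p"
proof -
  assume p: "p \<in> fcar X"
  define p' where "p' = (SOME p'. p' \<in> fcar X \<and> emb p' = emb p)"
  have "p' \<in> fcar X \<and> emb p' = emb p" unfolding p'_def by (rule someI[of _ p]) (use p in simp)
  then have "cls p' = cls p" using emb_eq_iff p by (auto simp: cls_eq_iff)
  then show ?thesis by (simp add: psi_def p'_def)
qed

lemma psi_bij: "bij_betw psi alg (carrier (lpa E))"
proof (rule bij_betw_imageI)
  show "inj_on psi alg"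
  proof (rule inj_onI)
    fix x y assume xy: "x \<in> alg" "y \<in> alg" "psi x = psi y"
    obtain p q where pq: "p \<in> fcar X" "emb p = x" "q \<in> fcar X" "emb q = y"
      using alg_emb[OF xy(1)] alg_emb[OF xy(2)] by blast
    then have "cls p = cls q" using xy(3) psi_emb by auto
    then show "x = y" using pq emb_eq_iff by (auto simp: cls_eq_iff)
  qed
  show "psi ` alg = carrier (lpa E)"
    unfolding lpa_carrier
  proof (intro equalityI subsetI)
    fix y assume "y \<in> psi ` alg"
    then obtain x where x: "x \<in> alg" "y = psi x" by blast
    then obtain p where "p \<in> fcar X" "emb p = x" using alg_emb by blast
    then show "y \<in> cls ` fcar X" using psi_emb[of p] x(2) by blast
  next
    fix y assume "y \<in> cls ` fcar X"
    then obtain p where "p \<in> fcar X" "y = cls p" by blast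
    then show "y \<in> psi ` alg" using psi_emb[of p] emb_alg[of p] by blast
  qed
qed

lemma psi_zero: "psi 0 = \<zero>\<^bsub>lpa E\<^esub>"
  using psi_emb[of 0] by (simp add: emb_zero lpa_zero cls_zero)

lemma psi_add:
  assumes "x \<in> alg" "y \<in> alg"
  shows "psi (x + y) = psi x \<oplus>\<^bsub>lpa E\<^esub> psi y"
proof -
  obtain p q where pq: "p \<in> fcar X" "emb p = x" "q \<in> fcar X" "emb q = y"
    using alg_emb[OF assms(1)] alg_emb[OF assms(2)] by blast
  have "psi (x + y) = psi (emb (p + q))" by (simp only: emb_add pq)
  also have "\<dots> = cls p \<oplus>\<^bsub>lpa E\<^esub> cls q" unfolding psi_emb[OF fcar_add[OF pq(1,3)]] lpa_add ..
  also have "\<dots> = psi x \<oplus>\<^bsub>lpa E\<^esub> psi y" unfolding psi_emb[OF pq(1), symmetric] psi_emb[OF pq(3), symmetric] pq ..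
  finally show ?thesis .
qed

lemma psi_mult:
  assumes "x \<in> alg" "y \<in> alg"
  shows "psi (x * y) = psi x \<otimes>\<^bsub>lpa E\<^esub> psi y"
proof -
  obtain p q where pq: "p \<in> fcar X" "emb p = x" "q \<in> fcar X" "emb q = y"
    using alg_emb[OF assms(1)] alg_emb[OF assms(2)] by blast
  have "psi (x * y) = psi (emb (p * q))" by (simp only: emb_mult pq)
  also have "\<dots> = cls p \<otimes>\<^bsub>lpa E\<^esub> cls q" unfolding psi_emb[OF fcar_mult[OF pq(1,3)]] lpa_mult[OF pq(1,3)] ..
  also have "\<dots> = psi x \<otimes>\<^bsub>lpa E\<^esub> psi y" unfolding psi_emb[OF pq(1), symmetric] psi_emb[OF pq(3), symmetric] pq ..
  finally show ?thesis .
qed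

lemma psi_scale:
  assumes "x \<in> alg"
  shows "psi (\<kappa> k * x) = k \<odot>\<^bsub>lpa E\<^esub> psi x"
proof -
  obtain p where p: "p \<in> fcar X" "emb p = x" using alg_emb[OF assms(1)] by blast
  have "psi (\<kappa> k * x) = psi (emb (Poly_Mapping.single 0 k * p))" by (simp only: emb_scale[symmetric] \<kappa>_def p)
  also have "\<dots> = k \<odot>\<^bsub>lpa E\<^esub> cls p" unfolding psi_emb[OF fcar_scale[OF p(1)]] lpa_smult ..
  also have "\<dots> = k \<odot>\<^bsub>lpa E\<^esub> psi x" unfolding psi_emb[OF p(1), symmetric] p ..
  finally show ?thesis .
qed

lemma psi_gens:
  "v \<in> verts E \<Longrightarrow> psi (vt v) = lpa_vert E v"
  "e \<in> arcs E \<Longrightarrow> psi (ed e) = lpa_edge E e"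
  "e \<in> arcs E \<Longrightarrow> psi (gh e) = lpa_ghost E e"
  unfolding vt_def ed_def gh_def lpa_class_def by (auto intro!: psi_emb fcar_indet)

end

hide_const (open) Multiset.mult Polynomial.smult

section \<open>Primitivity in terms of maximal left ideals\<close>

locale left_module_loc =
  fixes R :: "('r, 'a) ring_scheme" and M :: "('r, 'm, 'b) module_scheme"
  assumes R: "abelian_group R" and Rm: "\<And>r s. r \<in> carrier R \<Longrightarrow> s \<in> carrier R \<Longrightarrow> r \<otimes>\<^bsub>R\<^esub> s \<in> carrier R"
    and lm: "left_module R M"
begin

sublocale R: abelian_group R by (rule R)
sublocale M: abelian_group M using lm by (simp add: left_module_def)

lemma cl: "r \<in> carrier R \<Longrightarrow> x \<in> carrier M \<Longrightarrow> r \<odot>\<^bsub>M\<^esub> x \<in> carrier M"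
  and d1: "r \<in> carrier R \<Longrightarrow> s \<in> carrier R \<Longrightarrow> x \<in> carrier M \<Longrightarrow>
        (r \<oplus>\<^bsub>R\<^esub> s) \<odot>\<^bsub>M\<^esub> x = r \<odot>\<^bsub>M\<^esub> x \<oplus>\<^bsub>M\<^esub> s \<odot>\<^bsub>M\<^esub> x"
  and d2: "r \<in> carrier R \<Longrightarrow> x \<in> carrier M \<Longrightarrow> y \<in> carrier M \<Longrightarrow>
        r \<odot>\<^bsub>M\<^esub> (x \<oplus>\<^bsub>M\<^esub> y) = r \<odot>\<^bsub>M\<^esub> x \<oplus>\<^bsub>M\<^esub> r \<odot>\<^bsub>M\<^esub> y"
  and as: "r \<in> carrier R \<Longrightarrow> s \<in> carrier R \<Longrightarrow> x \<in> carrier M \<Longrightarrow>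
        (r \<otimes>\<^bsub>R\<^esub> s) \<odot>\<^bsub>M\<^esub> x = r \<odot>\<^bsub>M\<^esub> (s \<odot>\<^bsub>M\<^esub> x)"
  using lm by (simp_all add: left_module_def)

lemma smult_zero_left: "x \<in> carrier M \<Longrightarrow> \<zero>\<^bsub>R\<^esub> \<odot>\<^bsub>M\<^esub> x = \<zero>\<^bsub>M\<^esub>"
  using d1[of "\<zero>\<^bsub>R\<^esub>" "\<zero>\<^bsub>R\<^esub>" x] cl[of "\<zero>\<^bsub>R\<^esub>" x] by (metis M.add.r_cancel_one R.add.l_one R.zero_closed)

lemma smult_zero_right: "r \<in> carrier R \<Longrightarrow> r \<odot>\<^bsub>M\<^esub> \<zero>\<^bsub>M\<^esub> = \<zero>\<^bsub>M\<^esub>"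
  using d2[of r "\<zero>\<^bsub>M\<^esub>" "\<zero>\<^bsub>M\<^esub>"] cl[of r "\<zero>\<^bsub>M\<^esub>"] by (metis M.add.r_cancel_one M.add.l_one M.zero_closed)

lemma smult_minus_left: "r \<in> carrier R \<Longrightarrow> x \<in> carrier M \<Longrightarrow> (\<ominus>\<^bsub>R\<^esub> r) \<odot>\<^bsub>M\<^esub> x = \<ominus>\<^bsub>M\<^esub> (r \<odot>\<^bsub>M\<^esub> x)"
  using d1[of "\<ominus>\<^bsub>R\<^esub> r" r x] cl by (simp add: R.l_neg smult_zero_left M.minus_equality)

lemma smult_minus_right: "r \<in> carrier R \<Longrightarrow> x \<in> carrier M \<Longrightarrow> r \<odot>\<^bsub>M\<^esub> (\<ominus>\<^bsub>M\<^esub> x) = \<ominus>\<^bsub>M\<^esub> (r \<odot>\<^bsub>M\<^esub> x)"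
  using d2[of r "\<ominus>\<^bsub>M\<^esub> x" x] cl by (simp add: M.l_neg smult_zero_right M.minus_equality)

lemma cyclic_submodule: "m \<in> carrier M \<Longrightarrow> submodule ((\<lambda>r. r \<odot>\<^bsub>M\<^esub> m) ` carrier R) R M"
proof (unfold_locales, goal_cases)
  case 1 then show ?case using cl by auto
next
  case (2 x y) then show ?case using d1[symmetric] by auto
next
  case 3 then show ?case using smult_zero_left by (auto intro!: image_eqI[of _ _ "\<zero>\<^bsub>R\<^esub>"])
next
  case (4 x) then show ?case using smult_minus_left[symmetric] by (auto simp flip: a_inv_def)
next
  case (5 a x)
  then obtain r where "r \<in> carrier R" "x = r \<odot>\<^bsub>M\<^esub> m" by auto
  then show ?case using 5 as Rm by (auto intro!: image_eqI[of _ _ "a \<otimes>\<^bsub>R\<^esub> r"])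
qed

lemma torsion_submodule: "submodule {y \<in> carrier M. \<forall>r\<in>carrier R. r \<odot>\<^bsub>M\<^esub> y = \<zero>\<^bsub>M\<^esub>} R M"
proof (unfold_locales, goal_cases)
  case (4 x) then show ?case using smult_minus_right by (auto simp flip: a_inv_def)
next
  case (5 a x) then show ?case using Rm cl smult_zero_right by (auto simp flip: as)
qed (auto simp: d2 smult_zero_right)

text \<open>The vectors killed by R form a submodule, which is 0 because RM \<noteq> 0. So Rm is a
  nonzero submodule for nonzero m. In the absence of a unit this replaces m = 1 m.\<close>

lemma simple_cyclic:
  assumes s: "simple_left_module R M" and m: "m \<in> carrier M" "m \<noteq> \<zero>\<^bsub>M\<^esub>"
  shows "(\<lambda>r. r \<odot>\<^bsub>M\<^esub> m) ` carrier R = carrier M"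
proof -
  have sub: "\<And>N. submodule N R M \<Longrightarrow> N = {\<zero>\<^bsub>M\<^esub>} \<or> N = carrier M"
    and nz: "\<exists>r\<in>carrier R. \<exists>x\<in>carrier M. r \<odot>\<^bsub>M\<^esub> x \<noteq> \<zero>\<^bsub>M\<^esub>"
    using s by (simp_all add: simple_left_module_def)
  have "m \<notin> {y \<in> carrier M. \<forall>r\<in>carrier R. r \<odot>\<^bsub>M\<^esub> y = \<zero>\<^bsub>M\<^esub>}"
    using sub[OF torsion_submodule] nz m by blast
  then have "(\<lambda>r. r \<odot>\<^bsub>M\<^esub> m) ` carrier R \<noteq> {\<zero>\<^bsub>M\<^esub>}" using m by blast
  then show ?thesis using sub[OF cyclic_submodule[OF m(1)]] by blast
qed

end

text \<open>A surjection with kernel P from a subset of a type class ring onto a record ring. It is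
  instantiated by the quotient of \<open>lpa E\<close> and, composed with the involution, by the
  opposite of this quotient.\<close>

locale ring_surj =
  fixes Q :: "('r, 'a) ring_scheme" and A :: "'q::ring set" and \<pi> :: "'q \<Rightarrow> 'r" and P :: "'q set"
  assumes Q: "abelian_group Q"
    and A: "0 \<in> A" "\<And>x y. x \<in> A \<Longrightarrow> y \<in> A \<Longrightarrow> x + y \<in> A" "\<And>x. x \<in> A \<Longrightarrow> - x \<in> A"
      "\<And>x y. x \<in> A \<Longrightarrow> y \<in> A \<Longrightarrow> x * y \<in> A"
    and \<pi>: "\<pi> ` A = carrier Q" "\<And>x y. x \<in> A \<Longrightarrow> y \<in> A \<Longrightarrow> \<pi> (x + y) = \<pi> x \<oplus>\<^bsub>Q\<^esub> \<pi> y"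
      "\<And>x y. x \<in> A \<Longrightarrow> y \<in> A \<Longrightarrow> \<pi> (x * y) = \<pi> x \<otimes>\<^bsub>Q\<^esub> \<pi> y"
    and P: "P = {x \<in> A. \<pi> x = \<zero>\<^bsub>Q\<^esub>}"
begin

sublocale Q: abelian_group Q by (rule Q)

lemma A_diff: "x \<in> A \<Longrightarrow> y \<in> A \<Longrightarrow> x - y \<in> A"
  using A(2)[of x "- y"] A(3) by simp

lemma \<pi>_car: "x \<in> A \<Longrightarrow> \<pi> x \<in> carrier Q"
  using \<pi>(1) by blast

lemma Q_mult: "r \<in> carrier Q \<Longrightarrow> s \<in> carrier Q \<Longrightarrow> r \<otimes>\<^bsub>Q\<^esub> s \<in> carrier Q"
  using \<pi>(1) \<pi>(3) A(4) \<pi>_car by (metis imageE)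

lemma \<pi>_zero: "\<pi> 0 = \<zero>\<^bsub>Q\<^esub>"
  using \<pi>(2)[OF A(1,1)] \<pi>_car[OF A(1)] by (metis Q.add.l_cancel_one add_0)

lemma \<pi>_eq: "x \<in> A \<Longrightarrow> y \<in> A \<Longrightarrow> \<pi> x = \<pi> y \<longleftrightarrow> x - y \<in> P"
proof -
  assume xy: "x \<in> A" "y \<in> A"
  have "\<pi> x = \<pi> (x - y) \<oplus>\<^bsub>Q\<^esub> \<pi> y" using \<pi>(2)[OF A_diff[OF xy] xy(2)] by simp
  then show ?thesis using xy A_diff \<pi>_car by (simp add: P)
qed

text \<open>N is the annihilator of a nonzero vector m, and u is an element with u m = m.\<close>

lemma left_prim_if_left_primitive:
  assumes "left_primitive Q"
  shows "left_prim A P"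
proof -
  obtain M :: "('r, 'r set) module" where M: "simple_left_module Q M" "left_annihilator Q M = {\<zero>\<^bsub>Q\<^esub>}"
    using assms unfolding left_primitive_def by blast
  interpret M: left_module_loc Q M
    using Q Q_mult M(1) by unfold_locales (auto simp: simple_left_module_def left_module_loc_def)
  obtain m where m: "m \<in> carrier M" "m \<noteq> \<zero>\<^bsub>M\<^esub>"
    using M(1) M.smult_zero_right unfolding simple_left_module_def by blast
  define N where "N = {x \<in> A. \<pi> x \<odot>\<^bsub>M\<^esub> m = \<zero>\<^bsub>M\<^esub>}"
  have act: "\<exists>y\<in>A. \<pi> y \<odot>\<^bsub>M\<^esub> n = z" if "n \<in> carrier M" "n \<noteq> \<zero>\<^bsub>M\<^esub>" "z \<in> carrier M" for n z
  proof -
    have "z \<in> (\<lambda>r. r \<odot>\<^bsub>M\<^esub> n) ` \<pi> ` A" using M.simple_cyclic[OF M(1) that(1,2)] that(3) \<pi>(1) by simp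
    then show ?thesis by blast
  qed
  have neg: "\<pi> (- x) = \<ominus>\<^bsub>Q\<^esub> \<pi> x" if "x \<in> A" for x
    using \<pi>(2)[of "- x" x] that A(3) \<pi>_zero \<pi>_car by (simp add: Q.minus_equality)
  have diff: "\<pi> (x - y) \<odot>\<^bsub>M\<^esub> n = \<pi> x \<odot>\<^bsub>M\<^esub> n \<oplus>\<^bsub>M\<^esub> \<ominus>\<^bsub>M\<^esub> (\<pi> y \<odot>\<^bsub>M\<^esub> n)" if "x \<in> A" "y \<in> A" "n \<in> carrier M" for x y n
  proof -
    have "\<pi> (x - y) = \<pi> x \<oplus>\<^bsub>Q\<^esub> \<ominus>\<^bsub>Q\<^esub> \<pi> y" using \<pi>(2)[of x "- y"] that A(3) neg by simp
    then show ?thesis using M.d1 M.smult_minus_left \<pi>_car that by simp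
  qed
  have diff0: "\<pi> (x - y) \<odot>\<^bsub>M\<^esub> n = \<zero>\<^bsub>M\<^esub> \<longleftrightarrow> \<pi> x \<odot>\<^bsub>M\<^esub> n = \<pi> y \<odot>\<^bsub>M\<^esub> n" if "x \<in> A" "y \<in> A" "n \<in> carrier M" for x y n
  proof -
    have c: "\<pi> x \<odot>\<^bsub>M\<^esub> n \<in> carrier M" "\<pi> y \<odot>\<^bsub>M\<^esub> n \<in> carrier M" using M.cl \<pi>_car that by blast+
    show ?thesis
    proof
      assume "\<pi> (x - y) \<odot>\<^bsub>M\<^esub> n = \<zero>\<^bsub>M\<^esub>"
      then have "\<pi> x \<odot>\<^bsub>M\<^esub> n \<oplus>\<^bsub>M\<^esub> \<ominus>\<^bsub>M\<^esub> (\<pi> y \<odot>\<^bsub>M\<^esub> n) = \<zero>\<^bsub>M\<^esub>" using diff[OF that] by simp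
      from M.M.minus_equality[OF this M.M.a_inv_closed[OF c(2)] c(1)] c(2)
      show "\<pi> x \<odot>\<^bsub>M\<^esub> n = \<pi> y \<odot>\<^bsub>M\<^esub> n" by simp
    qed (use diff[OF that] c in \<open>simp add: M.M.r_neg\<close>)
  qed
  have mult: "\<pi> (x * y) \<odot>\<^bsub>M\<^esub> n = \<pi> x \<odot>\<^bsub>M\<^esub> (\<pi> y \<odot>\<^bsub>M\<^esub> n)" if "x \<in> A" "y \<in> A" "n \<in> carrier M" for x y n
    using \<pi>(3) M.as \<pi>_car that by simp
  obtain u where u: "u \<in> A" "\<pi> u \<odot>\<^bsub>M\<^esub> m = m" using act[OF m m(1)] by blast
  show ?thesis
    unfolding left_prim_def
  proof (intro exI[of _ N] exI[of _ u] conjI ballI)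
    show "N \<subseteq> A" by (auto simp: N_def)
    show "x - y \<in> N" if "x \<in> N" "y \<in> N" for x y
      using that A_diff diff0[of x y m] m by (auto simp: N_def)
    show "a * x \<in> N" if "a \<in> A" "x \<in> N" for a x
      using that A(4) mult[of a x m] m M.smult_zero_right \<pi>_car by (auto simp: N_def)
    show "u \<in> A" by (rule u)
    show "u \<notin> N" using u m by (auto simp: N_def)
    show "x * u - x \<in> N" if "x \<in> A" for x
      using that u A(4) A_diff diff0[of "x * u" x m] mult[of x u m] m by (auto simp: N_def)
    show "\<exists>y\<in>A. y * x - z \<in> N" if xz: "x \<in> A - N" "z \<in> A" for x z
    proof -
      have x: "x \<in> A" "\<pi> x \<odot>\<^bsub>M\<^esub> m \<noteq> \<zero>\<^bsub>M\<^esub>" using xz by (auto simp: N_def)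
      obtain y where "y \<in> A" "\<pi> y \<odot>\<^bsub>M\<^esub> (\<pi> x \<odot>\<^bsub>M\<^esub> m) = \<pi> z \<odot>\<^bsub>M\<^esub> m"
        using act[OF M.cl[OF \<pi>_car[OF x(1)] m(1)] x(2) M.cl[OF \<pi>_car[OF xz(2)] m(1)]] by blast
      then show ?thesis using x(1) xz(2) m A(4) A_diff diff0[of "y * x" z m] mult[of y x m]
        by (intro bexI[of _ y]) (auto simp: N_def)
    qed
    show "P = {x \<in> A. \<forall>y\<in>A. x * y \<in> N}"
    proof (intro equalityI subsetI)
      fix x assume "x \<in> P"
      then show "x \<in> {x \<in> A. \<forall>y\<in>A. x * y \<in> N}"
        using mult m A(4) M.smult_zero_left M.cl \<pi>_car by (auto simp: P N_def)
    next
      fix x assume x: "x \<in> {x \<in> A. \<forall>y\<in>A. x * y \<in> N}"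
      have "\<pi> x \<odot>\<^bsub>M\<^esub> n = \<zero>\<^bsub>M\<^esub>" if "n \<in> carrier M" for n
      proof -
        obtain y where y: "y \<in> A" "\<pi> y \<odot>\<^bsub>M\<^esub> m = n" using act[OF m \<open>n \<in> carrier M\<close>] by blast
        then show ?thesis using x mult[of x y m] m by (auto simp: N_def)
      qed
      then have "\<pi> x \<in> left_annihilator Q M" using x \<pi>_car by (auto simp: left_annihilator_def)
      then show "x \<in> P" using M(2) x by (auto simp: P)
    qed
  qed
qed

text \<open>The module is A/N, with representatives chosen for the cosets and for the elements of Q.
  As P A \<subseteq> N and N is a left ideal, the action does not depend on them. Its type is
  adjusted by \<open>left_primitive_if_simple_faithful\<close>.\<close>

lemma left_primitive_if_left_prim:
  assumes "left_prim A P"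
  shows "left_primitive Q"
proof -
  from assms[unfolded left_prim_def] obtain N u where NA: "N \<subseteq> A"
    and N1: "\<forall>x\<in>N. \<forall>y\<in>N. x - y \<in> N" and N2: "\<forall>a\<in>A. \<forall>x\<in>N. a * x \<in> N"
    and u: "u \<in> A" "u \<notin> N" and N3: "\<forall>x\<in>A. x * u - x \<in> N"
    and N4: "\<forall>x\<in>A - N. \<forall>z\<in>A. \<exists>y\<in>A. y * x - z \<in> N" and PN: "P = {x \<in> A. \<forall>y\<in>A. x * y \<in> N}"
    by (elim exE conjE)
  have N0: "0 \<in> N" using N1 N3 u(1) by (metis diff_self)
  have Nneg: "- x \<in> N" if "x \<in> N" for x using N1 N0 that by (metis diff_0)
  have Nadd: "x + y \<in> N" if "x \<in> N" "y \<in> N" for x y using N1 Nneg that by (metis diff_minus_eq_add)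
  define co where "co x = {y \<in> A. y - x \<in> N}" for x
  have co_eq: "co x = co y \<longleftrightarrow> x - y \<in> N" if xy: "x \<in> A" "y \<in> A" for x y
  proof
    assume "co x = co y"
    moreover have "x \<in> co x" using xy N0 by (simp add: co_def)
    ultimately show "x - y \<in> N" by (simp add: co_def)
  next
    assume d: "x - y \<in> N"
    have "z - x \<in> N \<longleftrightarrow> z - y \<in> N" for z
      using Nadd[OF _ d, of "z - x"] N1[rule_format, OF _ d, of "z - y"] by auto
    then show "co x = co y" by (auto simp: co_def)
  qed
  define rep where "rep S = (SOME x. x \<in> A \<and> co x = S)" for S
  define rp where "rp r = (SOME x. x \<in> A \<and> \<pi> x = r)" for r
  have rep: "rep (co x) \<in> A \<and> co (rep (co x)) = co x" if "x \<in> A" for x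
    unfolding rep_def by (rule someI[of _ x]) (use that in simp)
  have rp: "rp (\<pi> x) \<in> A \<and> \<pi> (rp (\<pi> x)) = \<pi> x" if "x \<in> A" for x
    unfolding rp_def by (rule someI[of _ x]) (use that in simp)
  define M :: "('r, 'q set) module" where "M = \<lparr>carrier = co ` A, mult = undefined, one = undefined,
    zero = co 0, add = (\<lambda>S T. co (rep S + rep T)), smult = (\<lambda>r S. co (rp r * rep S))\<rparr>"
  have car: "carrier M = co ` A" and zero: "\<zero>\<^bsub>M\<^esub> = co 0" by (simp_all add: M_def)
  have add: "co x \<oplus>\<^bsub>M\<^esub> co y = co (x + y)" if xy: "x \<in> A" "y \<in> A" for x y
  proof -
    have "rep (co x) - x \<in> N" "rep (co y) - y \<in> N" using rep co_eq xy by blast+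
    then have "(rep (co x) - x) + (rep (co y) - y) \<in> N" by (rule Nadd)
    then have "rep (co x) + rep (co y) - (x + y) \<in> N" by (simp add: algebra_simps)
    then show ?thesis using co_eq rep xy A(2) by (simp add: M_def)
  qed
  have smult: "\<pi> x \<odot>\<^bsub>M\<^esub> co y = co (x * y)" if xy: "x \<in> A" "y \<in> A" for x y
  proof -
    have "rp (\<pi> x) - x \<in> P" using rp[OF xy(1)] \<pi>_eq xy by blast
    then have 1: "(rp (\<pi> x) - x) * y \<in> N" using PN xy by blast
    have 2: "rp (\<pi> x) * (rep (co y) - y) \<in> N" using rep[OF xy(2)] co_eq rp[OF xy(1)] xy N2 by blast
    from Nadd[OF 1 2] have "rp (\<pi> x) * rep (co y) - x * y \<in> N" by (simp add: algebra_simps)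
    then show ?thesis using co_eq rep[OF xy(2)] rp[OF xy(1)] xy A(4) by (simp add: M_def)
  qed
  have grp: "abelian_group M"
  proof (rule abelian_groupI)
    fix S assume "S \<in> carrier M"
    then obtain x where "x \<in> A" "S = co x" by (auto simp: car)
    then show "\<exists>T\<in>carrier M. T \<oplus>\<^bsub>M\<^esub> S = \<zero>\<^bsub>M\<^esub>"
      using A(3) by (intro bexI[of _ "co (- x)"]) (auto simp: car zero add)
  qed (auto simp: car zero add A add_ac)
  have lm: "left_module Q M"
    unfolding left_module_def
  proof (intro conjI ballI)
    fix r s x y assume rs: "r \<in> carrier Q" "s \<in> carrier Q" "x \<in> carrier M" "y \<in> carrier M"
    obtain a b c d where ab: "a \<in> A" "r = \<pi> a" "b \<in> A" "s = \<pi> b" "c \<in> A" "x = co c" "d \<in> A" "y = co d"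
      using rs unfolding \<pi>(1)[symmetric] car by blast
    show "r \<odot>\<^bsub>M\<^esub> x \<in> carrier M" using ab smult A(4) by (simp add: car)
    show "(r \<oplus>\<^bsub>Q\<^esub> s) \<odot>\<^bsub>M\<^esub> x = r \<odot>\<^bsub>M\<^esub> x \<oplus>\<^bsub>M\<^esub> s \<odot>\<^bsub>M\<^esub> x"
      using ab smult A add by (simp add: \<pi>(2)[symmetric] distrib_right)
    show "r \<odot>\<^bsub>M\<^esub> (x \<oplus>\<^bsub>M\<^esub> y) = r \<odot>\<^bsub>M\<^esub> x \<oplus>\<^bsub>M\<^esub> r \<odot>\<^bsub>M\<^esub> y"
      using ab smult A add by (simp add: distrib_left)
    show "(r \<otimes>\<^bsub>Q\<^esub> s) \<odot>\<^bsub>M\<^esub> x = r \<odot>\<^bsub>M\<^esub> (s \<odot>\<^bsub>M\<^esub> x)"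
      using ab smult A by (simp add: \<pi>(3)[symmetric] mult.assoc)
  qed (use grp in auto)
  have simple: "simple_left_module Q M"
    unfolding simple_left_module_def
  proof (intro conjI allI impI)
    \<comment> \<open>Since u u is u modulo N, the class of u witnesses that the action is not
      zero.\<close>
    have "u * u \<notin> N" using N3 u N1[rule_format, of "u * u" "u * u - u"] by auto
    then have "\<pi> u \<odot>\<^bsub>M\<^esub> co u \<noteq> \<zero>\<^bsub>M\<^esub>" using u A smult co_eq[of "u * u" 0] by (simp add: zero)
    then show "\<exists>r\<in>carrier Q. \<exists>x\<in>carrier M. r \<odot>\<^bsub>M\<^esub> x \<noteq> \<zero>\<^bsub>M\<^esub>" using u \<pi>_car by (auto simp: car)
    fix K assume K: "submodule K Q M"
    have Kz: "co 0 \<in> K" using subgroup.one_closed[OF submodule.axioms(1)[OF K]] by (simp add: zero)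
    have Ks: "K \<subseteq> co ` A" using subgroup.subset[OF submodule.axioms(1)[OF K]] by (simp add: car)
    show "K = {\<zero>\<^bsub>M\<^esub>} \<or> K = carrier M"
    proof (cases "K \<subseteq> {co 0}")
      case True then show ?thesis using Kz by (auto simp: zero)
    next
      case False
      then obtain x where x: "x \<in> A" "co x \<in> K" "co x \<noteq> co 0" using Ks by blast
      then have xN: "x \<in> A - N" using co_eq[of x 0] A(1) by simp
      have "co z \<in> K" if z: "z \<in> A" for z
      proof -
        obtain y where y: "y \<in> A" "y * x - z \<in> N" using N4 xN z by blast
        then have "\<pi> y \<odot>\<^bsub>M\<^esub> co x = co z" using smult x z co_eq A(4) by simp
        then show ?thesis using submodule.smult_closed[OF K \<pi>_car[OF y(1)] x(2)] by metis
      qed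
      then show ?thesis using Ks by (auto simp: car)
    qed
  qed (rule lm)
  have "left_annihilator Q M = {\<zero>\<^bsub>Q\<^esub>}"
  proof (intro equalityI subsetI)
    fix r assume "r \<in> left_annihilator Q M"
    then obtain x where x: "x \<in> A" "r = \<pi> x" "\<forall>S\<in>carrier M. \<pi> x \<odot>\<^bsub>M\<^esub> S = \<zero>\<^bsub>M\<^esub>"
      unfolding left_annihilator_def \<pi>(1)[symmetric] by blast
    have "x * y \<in> N" if "y \<in> A" for y
    proof -
      have "co (x * y) = co 0" using x smult that by (auto simp: car zero)
      then show ?thesis using co_eq[of "x * y" 0] x that A by simp
    qed
    then have "x \<in> P" using x by (simp add: PN)
    then show "r \<in> {\<zero>\<^bsub>Q\<^esub>}" using x by (simp add: P)
  next
    fix r assume "r \<in> {\<zero>\<^bsub>Q\<^esub>}"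
    then have "r = \<pi> 0" by (simp add: \<pi>_zero)
    then show "r \<in> left_annihilator Q M" using smult A \<pi>_car by (auto simp: left_annihilator_def car zero)
  qed
  from left_primitive_if_simple_faithful[OF Q Q_mult simple this] show ?thesis by simp
qed

lemma left_primitive_iff: "left_primitive Q \<longleftrightarrow> left_prim A P"
  using left_prim_if_left_primitive left_primitive_if_left_prim by blast

end

section \<open>Transport of ideals and quotients along \<open>psi\<close>\<close>

context lpa_emb
begin

lemma psi_car: "x \<in> alg \<Longrightarrow> psi x \<in> carrier (lpa E)"
  using psi_bij by (auto simp: bij_betw_def)

lemma psi_inj: "x \<in> alg \<Longrightarrow> y \<in> alg \<Longrightarrow> psi x = psi y \<longleftrightarrow> x = y"
  using psi_bij by (auto simp: bij_betw_def inj_on_def)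

lemma psi_image: "carrier (lpa E) = psi ` alg"
  using psi_bij by (auto simp: bij_betw_def)

lemma lpa_group: "abelian_group (lpa E :: ('k, ('v, 'e, 'k) lpa_elem) module)"
proof (rule abelian_groupI)
  fix S :: "('v, 'e, 'k) lpa_elem" assume "S \<in> carrier (lpa E)"
  then obtain x where x: "x \<in> alg" "S = psi x" by (auto simp: psi_image)
  have "psi (- x) \<oplus>\<^bsub>lpa E\<^esub> S = \<zero>\<^bsub>lpa E\<^esub>"
    using psi_add[OF alg_minus[OF x(1)] x(1)] x(2) by (simp add: psi_zero)
  then show "\<exists>T\<in>carrier (lpa E). T \<oplus>\<^bsub>lpa E\<^esub> S = \<zero>\<^bsub>lpa E\<^esub>"
    using psi_car[OF alg_minus[OF x(1)]] by blast
qed (auto simp: psi_image psi_zero[symmetric] psi_add[symmetric] alg_add add_ac)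

sublocale LP: abelian_group "lpa E :: ('k, ('v, 'e, 'k) lpa_elem) module"
  by (rule lpa_group)

lemma psi_minus: "x \<in> alg \<Longrightarrow> psi (- x) = \<ominus>\<^bsub>lpa E\<^esub> psi x"
proof -
  assume x: "x \<in> alg"
  have "psi (- x) \<oplus>\<^bsub>lpa E\<^esub> psi x = \<zero>\<^bsub>lpa E\<^esub>" using psi_add[OF alg_minus[OF x] x] by (simp add: psi_zero)
  then show ?thesis using LP.minus_equality psi_car x alg_minus by metis
qed

lemma psi_diff: "x \<in> alg \<Longrightarrow> y \<in> alg \<Longrightarrow> psi (x - y) = psi x \<ominus>\<^bsub>lpa E\<^esub> psi y"
  using psi_add[of x "- y"] psi_minus[of y] alg_minus[of y] by (simp add: a_minus_def)

lemma psi_sum: "finite I \<Longrightarrow> (\<And>i. i \<in> I \<Longrightarrow> f i \<in> alg) \<Longrightarrow> psi (sum f I) = (\<Oplus>\<^bsub>lpa E\<^esub>i\<in>I. psi (f i))"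
proof (induction I rule: finite_induct)
  case (insert a I)
  have "(\<Oplus>\<^bsub>lpa E\<^esub>i\<in>insert a I. psi (f i)) = psi (f a) \<oplus>\<^bsub>lpa E\<^esub> (\<Oplus>\<^bsub>lpa E\<^esub>i\<in>I. psi (f i))"
    using insert psi_car by (intro LP.finsum_insert) auto
  then show ?case using insert psi_add[of "f a" "sum f I"] alg_sum[of I f] by auto
qed (simp add: psi_zero)

lemma two_sided_psi:
  assumes J: "aideal J"
  shows "two_sided_ideal (psi ` J) (lpa E)"
  unfolding two_sided_ideal_def additive_subgroup_def
proof (intro conjI ballI)
  show "subgroup (psi ` J) (add_monoid (lpa E))"
  proof
    show "psi ` J \<subseteq> carrier (add_monoid (lpa E))" using psi_car aideal_sub[OF J] by auto
    show "S \<otimes>\<^bsub>add_monoid (lpa E)\<^esub> T \<in> psi ` J" if "S \<in> psi ` J" "T \<in> psi ` J" for S T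
      using that psi_add[symmetric] aideal_sub[OF J] aideal_add[OF J] by auto
    show "\<one>\<^bsub>add_monoid (lpa E)\<^esub> \<in> psi ` J" using J psi_zero by (auto simp: aideal_def intro!: image_eqI[of _ _ 0])
    show "inv\<^bsub>add_monoid (lpa E)\<^esub> S \<in> psi ` J" if "S \<in> psi ` J" for S
      using that psi_minus[symmetric] aideal_sub[OF J] aideal_minus[OF J] by (auto simp flip: a_inv_def)
  qed
  fix S T :: "('v, 'e, 'k) lpa_elem" assume "S \<in> psi ` J" "T \<in> carrier (lpa E)"
  then obtain x a where xa: "x \<in> J" "S = psi x" "a \<in> alg" "T = psi a" by (auto simp: psi_image)
  then show "T \<otimes>\<^bsub>lpa E\<^esub> S \<in> psi ` J" "S \<otimes>\<^bsub>lpa E\<^esub> T \<in> psi ` J"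
    using psi_mult[symmetric] aideal_sub[OF J] aideal_left[OF J] aideal_right[OF J] by auto
qed

lemma aideal_preimage:
  assumes I: "two_sided_ideal I (lpa E)"
  shows "aideal {x \<in> alg. psi x \<in> I}" "psi ` {x \<in> alg. psi x \<in> I} = I"
proof -
  have s: "subgroup I (add_monoid (lpa E))"
    and m: "\<And>a x. a \<in> I \<Longrightarrow> x \<in> carrier (lpa E) \<Longrightarrow> x \<otimes>\<^bsub>lpa E\<^esub> a \<in> I \<and> a \<otimes>\<^bsub>lpa E\<^esub> x \<in> I"
    using I by (auto simp: two_sided_ideal_def additive_subgroup_def)
  show "aideal {x \<in> alg. psi x \<in> I}"
    unfolding aideal_def
    using subgroup.one_closed[OF s] subgroup.m_closed[OF s] m psi_car
    by (auto simp: psi_zero psi_add psi_mult alg_add alg_mult)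
  show "psi ` {x \<in> alg. psi x \<in> I} = I"
    using subgroup.subset[OF s] by (auto simp: psi_image)
qed

lemma ideal_gen_psi:
  assumes "Y \<subseteq> alg"
  shows "ideal_gen (lpa E) (psi ` Y) = psi ` idl Y"
proof
  have "two_sided_ideal (psi ` idl Y) (lpa E)" by (rule two_sided_psi[OF idl_aideal[OF assms]])
  moreover have "psi ` Y \<subseteq> psi ` idl Y" using idl_base by blast
  ultimately show "ideal_gen (lpa E) (psi ` Y) \<subseteq> psi ` idl Y" unfolding ideal_gen_def by blast
  show "psi ` idl Y \<subseteq> ideal_gen (lpa E) (psi ` Y)"
    unfolding ideal_gen_def
  proof (rule Inter_greatest)
    fix I assume "I \<in> {I. two_sided_ideal I (lpa E) \<and> psi ` Y \<subseteq> I}"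
    then have I: "two_sided_ideal I (lpa E)" "psi ` Y \<subseteq> I" by auto
    have "idl Y \<subseteq> {x \<in> alg. psi x \<in> I}"
      by (rule idl_least[OF aideal_preimage(1)[OF I(1)]]) (use I(2) assms in auto)
    then show "psi ` idl Y \<subseteq> I" by auto
  qed
qed

lemma psi_bel:
  assumes "u \<in> breaking_vertices E H"
  shows "psi (bel H u) = breaking_elem E H u"
proof -
  have u: "u \<in> verts E" "finite (arcs_outside E H u)" using assms by (auto simp: breaking_vertices_def)
  have e: "ed e * gh e \<in> alg" "psi (ed e * gh e) = lpa_edge E e \<otimes>\<^bsub>lpa E\<^esub> lpa_ghost E e"
    if "e \<in> arcs_outside E H u" for e
  proof -
    have "e \<in> arcs E" using that by (auto simp: arcs_outside_def)
    then show "ed e * gh e \<in> alg" "psi (ed e * gh e) = lpa_edge E e \<otimes>\<^bsub>lpa E\<^esub> lpa_ghost E e"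
      using alg_mult ed_alg gh_alg psi_mult psi_gens by auto
  qed
  have "(\<Oplus>\<^bsub>lpa E\<^esub>e\<in>arcs_outside E H u. psi (ed e * gh e)) =
      (\<Oplus>\<^bsub>lpa E\<^esub>e\<in>arcs_outside E H u. lpa_edge E e \<otimes>\<^bsub>lpa E\<^esub> lpa_ghost E e)"
    by (rule LP.finsum_cong') (use e psi_car in \<open>auto simp flip: e(2)\<close>)
  then show ?thesis
    unfolding bel_def breaking_elem_def
    using psi_diff[OF vt_alg[OF u(1)] alg_sum[of "arcs_outside E H u"]] psi_sum[OF u(2)] e(1) psi_gens(1)[OF u(1)]
    by simp
qed

lemma graded_psi:
  assumes "H \<subseteq> verts E" "S \<subseteq> breaking_vertices E H"
  shows "graded_ideal E H S = psi ` gidl H S"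
proof -
  have "lpa_vert E ` H = psi ` vt ` H" unfolding image_image
    by (rule image_cong) (use assms psi_gens(1) in auto)
  moreover have "breaking_elem E H ` S = psi ` bel H ` S" unfolding image_image
    by (rule image_cong) (use assms psi_bel in auto)
  ultimately have "lpa_vert E ` H \<union> breaking_elem E H ` S = psi ` (vt ` H \<union> bel H ` S)" by (simp add: image_Un)
  then show ?thesis unfolding graded_ideal_def gidl_def using ideal_gen_psi[OF gidl_gens_alg[OF assms]] by simp
qed

lemma psi_cycle_word:
  assumes "awalk w p v"
  shows "foldr (\<lambda>e x. lpa_edge E e \<otimes>\<^bsub>lpa E\<^esub> x) p (lpa_vert E v) = psi (pe w p)"
  using assms
proof (induction p arbitrary: w)
  case (Cons e p)
  then have e: "e \<in> arcs E" "awalk (head E e) p v" by (auto simp: awalk_simps)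
  then show ?case using Cons.IH[OF e(2)] psi_mult[OF ed_alg[OF e(1)] pe_alg[OF e(2)]] psi_gens by simp
qed (auto simp: awalk_simps psi_gens)

lemma psi_cycle_star_word:
  assumes "awalk w p v"
  shows "foldr (\<lambda>e x. lpa_ghost E e \<otimes>\<^bsub>lpa E\<^esub> x) (rev p) (lpa_vert E w) = psi (ge w p)"
  using assms
proof (induction p arbitrary: v rule: rev_induct)
  case (snoc e p)
  then obtain x where x: "awalk w p x" "awalk x [e] v" using awalk_split by blast
  then have e: "e \<in> arcs E" by (auto simp: awalk_simps)
  have "ge w (p @ [e]) = gh e * ge w p" using ge_append[OF x] ge_single[OF e] by simp
  then show ?case using snoc.IH[OF x(1)] psi_mult[OF gh_alg[OF e] ge_alg[OF x(1)]] psi_gens e by simp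
qed (auto simp: awalk_simps psi_gens)

lemma psi_cpow:
  assumes "cycle c"
  shows "lpa_cycle_power E c n = psi (cpow c n)"
proof -
  let ?v = "tail E (hd c)"
  note c = cycle_awalk(2,1)[OF assms]
  have v: "?v \<in> verts E" using c by auto
  have cc: "lpa_cycle E c = psi (pe ?v c)" "lpa_cycle_star E c = psi (ge ?v c)"
    unfolding lpa_cycle_def lpa_cycle_star_def
    using psi_cycle_word[OF c(1)] psi_cycle_star_word[OF c(1)] by simp_all
  have 1: "((\<lambda>x. lpa_cycle E c \<otimes>\<^bsub>lpa E\<^esub> x) ^^ m) (lpa_vert E ?v) = psi (pe ?v c ^ m * vt ?v) \<and> pe ?v c ^ m * vt ?v \<in> alg" for m
  proof (induction m)
    case (Suc m)
    then show ?case using psi_mult[OF pe_alg[OF c(1)]] alg_mult[OF pe_alg[OF c(1)]] cc by (simp add: mult.assoc)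
  qed (use v psi_gens vt_alg in simp)
  have 2: "((\<lambda>x. lpa_cycle_star E c \<otimes>\<^bsub>lpa E\<^esub> x) ^^ m) (lpa_vert E ?v) = psi (ge ?v c ^ m * vt ?v) \<and> ge ?v c ^ m * vt ?v \<in> alg" for m
  proof (induction m)
    case (Suc m)
    then show ?case using psi_mult[OF ge_alg[OF c(1)]] alg_mult[OF ge_alg[OF c(1)]] cc by (simp add: mult.assoc)
  qed (use v psi_gens vt_alg in simp)
  show ?thesis unfolding lpa_cycle_power_def cpow_def using 1 2 by simp
qed

lemma psi_lev:
  assumes "cycle c"
  shows "laurent_eval E f c = psi (lev c f)"
proof -
  note c = cycle_awalk(2,1)[OF assms]
  have a: "\<kappa> k * cpow c n \<in> alg" for k n by (rule alg_scale[OF cpow_alg[OF c]])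
  have "(\<Oplus>\<^bsub>lpa E\<^esub>n\<in>Poly_Mapping.keys f. psi (\<kappa> (Poly_Mapping.lookup f n) * cpow c n)) = laurent_eval E f c"
    unfolding laurent_eval_def
    unfolding psi_cpow[OF assms] psi_scale[OF cpow_alg[OF c]] ..
  moreover have "psi (lev c f) = (\<Oplus>\<^bsub>lpa E\<^esub>n\<in>Poly_Mapping.keys f. psi (\<kappa> (Poly_Mapping.lookup f n) * cpow c n))"
    unfolding lev_def by (rule psi_sum) (simp_all add: a)
  ultimately show ?thesis by simp
qed

text \<open>Condition (a) is written as a sum of two ideals, while \<open>cidl\<close> is generated
  by all generators at once; this reconciles the two.\<close>

lemma idl_Un:
  assumes "X1 \<subseteq> alg" "X2 \<subseteq> alg"
  shows "idl (X1 \<union> X2) = {x + y | x y. x \<in> idl X1 \<and> y \<in> idl X2}"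
proof
  note J = idl_aideal[OF assms(1)] idl_aideal[OF assms(2)]
  have "aideal {x + y | x y. x \<in> idl X1 \<and> y \<in> idl X2}"
    unfolding aideal_def
  proof (intro conjI ballI)
    show "{x + y | x y. x \<in> idl X1 \<and> y \<in> idl X2} \<subseteq> alg"
      using aideal_sub[OF J(1)] aideal_sub[OF J(2)] alg_add by blast
    show "0 \<in> {x + y | x y. x \<in> idl X1 \<and> y \<in> idl X2}"
      using aideal_zero[OF J(1)] aideal_zero[OF J(2)] by force
    fix s assume "s \<in> {x + y | x y. x \<in> idl X1 \<and> y \<in> idl X2}"
    then obtain x y where s: "s = x + y" "x \<in> idl X1" "y \<in> idl X2" by blast
    {
      fix t assume "t \<in> {x + y | x y. x \<in> idl X1 \<and> y \<in> idl X2}"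
      then obtain x' y' where t: "t = x' + y'" "x' \<in> idl X1" "y' \<in> idl X2" by blast
      have "s + t = (x + x') + (y + y')" using s t by simp
      then show "s + t \<in> {x + y | x y. x \<in> idl X1 \<and> y \<in> idl X2}"
        using aideal_add[OF J(1) s(2) t(2)] aideal_add[OF J(2) s(3) t(3)] by blast
    next
      fix a assume a: "a \<in> alg"
      show "a * s \<in> {x + y | x y. x \<in> idl X1 \<and> y \<in> idl X2}"
        using aideal_left[OF J(1) a s(2)] aideal_left[OF J(2) a s(3)] s(1) by (auto simp: distrib_left)
      show "s * a \<in> {x + y | x y. x \<in> idl X1 \<and> y \<in> idl X2}"
        using aideal_right[OF J(1) a s(2)] aideal_right[OF J(2) a s(3)] s(1) by (auto simp: distrib_right)
    }
  qed
  moreover have "X1 \<union> X2 \<subseteq> {x + y | x y. x \<in> idl X1 \<and> y \<in> idl X2}"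
  proof
    fix x assume "x \<in> X1 \<union> X2"
    then consider "x \<in> idl X1" | "x \<in> idl X2" using idl_base by blast
    then show "x \<in> {x + y | x y. x \<in> idl X1 \<and> y \<in> idl X2}"
    proof cases
      case 1 then show ?thesis using aideal_zero[OF J(2)] by force
    next
      case 2 then show ?thesis using aideal_zero[OF J(1)] by force
    qed
  qed
  ultimately show "idl (X1 \<union> X2) \<subseteq> {x + y | x y. x \<in> idl X1 \<and> y \<in> idl X2}" by (rule idl_least)
  have J12: "aideal (idl (X1 \<union> X2))" using assms by (intro idl_aideal) auto
  have "idl X1 \<subseteq> idl (X1 \<union> X2)" "idl X2 \<subseteq> idl (X1 \<union> X2)"
    using idl_least[OF J12] idl_base[of "X1 \<union> X2"] by blast+
  then show "{x + y | x y. x \<in> idl X1 \<and> y \<in> idl X2} \<subseteq> idl (X1 \<union> X2)"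
    using aideal_add[OF J12] by blast
qed

lemma cidl_psi:
  assumes "H \<subseteq> verts E" "cycle c"
  shows "graded_ideal E H (breaking_vertices E H) <+>\<^bsub>lpa E\<^esub> ideal_gen (lpa E) {laurent_eval E f c} = psi ` cidl H c f"
proof -
  have l: "{lev c f} \<subseteq> alg" using lev_alg[OF cycle_awalk(2,1)[OF assms(2)]] by simp
  have g: "vt ` H \<union> bel H ` breaking_vertices E H \<subseteq> alg" by (rule gidl_gens_alg[OF assms(1)]) simp
  have "ideal_gen (lpa E) {laurent_eval E f c} = psi ` idl {lev c f}"
    using ideal_gen_psi[OF l] psi_lev[OF assms(2), of f] by simp
  moreover have "graded_ideal E H (breaking_vertices E H) = psi ` gidl H (breaking_vertices E H)"
    by (rule graded_psi[OF assms(1)]) simp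
  moreover have "psi ` cidl H c f = {psi x \<oplus>\<^bsub>lpa E\<^esub> psi y | x y. x \<in> gidl H (breaking_vertices E H) \<and> y \<in> idl {lev c f}}"
    unfolding cidl_def idl_Un[OF g l] gidl_def[symmetric]
    using psi_add aideal_sub[OF idl_aideal[OF l]] aideal_sub[OF gidl_aideal[OF assms(1) order_refl]]
    by (auto simp: image_def) (metis, metis)
  ultimately show ?thesis by (auto simp: set_add_def')
qed

lemma quot_surj:
  assumes P: "aideal P"
  shows "ring_surj (lpa E Quot (psi ` P)) alg (\<lambda>x. psi ` P +>\<^bsub>lpa E\<^esub> psi x) P"
proof -
  let ?Q = "lpa E Quot (psi ` P)"
  define co where "co x = psi ` P +>\<^bsub>lpa E\<^esub> psi x" for x
  have co: "co x = psi ` {y \<in> alg. y - x \<in> P}" if x: "x \<in> alg" for x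
  proof -
    have "co x = (\<lambda>p. psi (p + x)) ` P"
      unfolding co_def a_r_coset_def' using psi_add aideal_sub[OF P] x by auto
    also have "\<dots> = psi ` (\<lambda>p. p + x) ` P" by (simp add: image_image)
    also have "(\<lambda>p. p + x) ` P = {y \<in> alg. y - x \<in> P}"
    proof (intro equalityI subsetI)
      fix y assume "y \<in> {y \<in> alg. y - x \<in> P}"
      then show "y \<in> (\<lambda>p. p + x) ` P" by (auto intro!: image_eqI[of _ _ "y - x"])
    qed (use x alg_add aideal_sub[OF P] in auto)
    finally show ?thesis .
  qed
  have mem: "psi y \<in> co x \<longleftrightarrow> y - x \<in> P" if "x \<in> alg" "y \<in> alg" for x y
    unfolding co[OF that(1)] using that psi_inj by auto
  have co_eq: "co x = co y \<longleftrightarrow> x - y \<in> P" if xy: "x \<in> alg" "y \<in> alg" for x y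
  proof
    assume "co x = co y"
    then show "x - y \<in> P" using mem[OF xy(2,1)] mem[OF xy(1,1)] aideal_zero[OF P] by simp
  next
    assume d: "x - y \<in> P"
    have "z - x \<in> P \<longleftrightarrow> z - y \<in> P" for z
      using aideal_add[OF P _ d, of "z - x"] aideal_diff[OF P _ d, of "z - y"] by auto
    then show "co x = co y" by (simp add: co xy)
  qed
  have car: "carrier ?Q = co ` alg"
    by (auto simp: FactRing_def A_RCOSETS_def' psi_image co_def)
  have add: "co x \<oplus>\<^bsub>?Q\<^esub> co y = co (x + y)" if xy: "x \<in> alg" "y \<in> alg" for x y
  proof -
    have "co x \<oplus>\<^bsub>?Q\<^esub> co y = {a \<oplus>\<^bsub>lpa E\<^esub> b | a b. a \<in> co x \<and> b \<in> co y}"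
      by (auto simp: FactRing_def set_add_def')
    also have "\<dots> = psi ` {a + b | a b. a \<in> alg \<and> a - x \<in> P \<and> b \<in> alg \<and> b - y \<in> P}"
      unfolding co[OF xy(1)] co[OF xy(2)]
    proof (intro equalityI subsetI)
      fix S assume "S \<in> {a \<oplus>\<^bsub>lpa E\<^esub> b |a b. a \<in> psi ` {y \<in> alg. y - x \<in> P} \<and> b \<in> psi ` {x \<in> alg. x - y \<in> P}}"
      then obtain a b where "S = psi a \<oplus>\<^bsub>lpa E\<^esub> psi b" "a \<in> alg" "a - x \<in> P" "b \<in> alg" "b - y \<in> P" by blast
      then show "S \<in> psi ` {a + b |a b. a \<in> alg \<and> a - x \<in> P \<and> b \<in> alg \<and> b - y \<in> P}"
        using psi_add[of a b] by blast
    next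
      fix S assume "S \<in> psi ` {a + b |a b. a \<in> alg \<and> a - x \<in> P \<and> b \<in> alg \<and> b - y \<in> P}"
      then obtain a b where "S = psi (a + b)" "a \<in> alg" "a - x \<in> P" "b \<in> alg" "b - y \<in> P" by blast
      then show "S \<in> {a \<oplus>\<^bsub>lpa E\<^esub> b |a b. a \<in> psi ` {y \<in> alg. y - x \<in> P} \<and> b \<in> psi ` {x \<in> alg. x - y \<in> P}}"
        using psi_add[of a b] by blast
    qed
    also have "{a + b | a b. a \<in> alg \<and> a - x \<in> P \<and> b \<in> alg \<and> b - y \<in> P} = {z \<in> alg. z - (x + y) \<in> P}"
    proof (intro equalityI subsetI)
      fix z assume "z \<in> {a + b | a b. a \<in> alg \<and> a - x \<in> P \<and> b \<in> alg \<and> b - y \<in> P}"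
      then obtain a b where ab: "z = a + b" "a \<in> alg" "a - x \<in> P" "b \<in> alg" "b - y \<in> P" by blast
      have e: "z - (x + y) = (a - x) + (b - y)" using ab by simp
      have "z - (x + y) \<in> P" unfolding e by (rule aideal_add[OF P ab(3,5)])
      then show "z \<in> {z \<in> alg. z - (x + y) \<in> P}" using ab alg_add by simp
    next
      fix z assume z: "z \<in> {z \<in> alg. z - (x + y) \<in> P}"
      then have "z = (z - y) + y" "z - y \<in> alg" "(z - y) - x \<in> P" "y - y \<in> P"
        using xy alg_diff aideal_zero[OF P] by (auto simp: algebra_simps)
      then show "z \<in> {a + b | a b. a \<in> alg \<and> a - x \<in> P \<and> b \<in> alg \<and> b - y \<in> P}" using xy by blast
    qed
    finally show ?thesis by (simp add: co alg_add xy)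
  qed
  have mult: "co x \<otimes>\<^bsub>?Q\<^esub> co y = co (x * y)" if xy: "x \<in> alg" "y \<in> alg" for x y
  proof -
    have "co x \<otimes>\<^bsub>?Q\<^esub> co y = (\<Union>a\<in>co x. \<Union>b\<in>co y. psi ` P +>\<^bsub>lpa E\<^esub> (a \<otimes>\<^bsub>lpa E\<^esub> b))"
      by (simp add: FactRing_def rcoset_mult_def)
    also have "\<dots> = (\<Union>a\<in>{a \<in> alg. a - x \<in> P}. \<Union>b\<in>{b \<in> alg. b - y \<in> P}. co (a * b))"
      unfolding co[OF xy(1)] co[OF xy(2)] unfolding co_def by (simp add: psi_mult)
    also have "\<dots> = (\<Union>a\<in>{a \<in> alg. a - x \<in> P}. \<Union>b\<in>{b \<in> alg. b - y \<in> P}. co (x * y))"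
    proof (intro SUP_cong refl)
      fix a b assume ab: "a \<in> {a \<in> alg. a - x \<in> P}" "b \<in> {b \<in> alg. b - y \<in> P}"
      have "(a - x) * b + x * (b - y) \<in> P"
        using ab xy by (intro aideal_add[OF P] aideal_left[OF P] aideal_right[OF P]) auto
      then show "co (a * b) = co (x * y)" using ab xy co_eq alg_mult by (simp add: algebra_simps)
    qed
    also have "\<dots> = co (x * y)" using xy aideal_zero[OF P] by fastforce
    finally show ?thesis .
  qed
  have zero: "\<zero>\<^bsub>?Q\<^esub> = co 0"
    using aideal_sub[OF P] by (auto simp: FactRing_def co)
  have grp: "abelian_group ?Q"
  proof (rule abelian_groupI)
    fix S assume "S \<in> carrier ?Q"
    then obtain x where x: "x \<in> alg" "S = co x" by (auto simp: car)
    then show "\<exists>T\<in>carrier ?Q. T \<oplus>\<^bsub>?Q\<^esub> S = \<zero>\<^bsub>?Q\<^esub>"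
      using alg_minus[OF x(1)] by (intro bexI[of _ "co (- x)"]) (auto simp: car zero add)
  qed (auto simp: car zero add alg_add add_ac)
  show ?thesis
    unfolding co_def[symmetric]
  proof (rule ring_surj.intro)
    show "abelian_group ?Q" by (rule grp)
    show "P = {x \<in> alg. co x = \<zero>\<^bsub>?Q\<^esub>}" using co_eq[of _ 0] aideal_sub[OF P] by (auto simp: zero)
  qed (auto simp: car add mult alg_add alg_minus alg_mult)
qed

end

section \<open>The involution\<close>

fun swap_gen :: "('v, 'e) lpa_gen \<Rightarrow> ('v, 'e) lpa_gen" where
  "swap_gen (Vert v) = Vert v"
| "swap_gen (Edge e) = Ghost e"
| "swap_gen (Ghost e) = Edge e"

lemma swap_swap [simp]: "swap_gen (swap_gen a) = a"
  by (cases a) auto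

definition swap_word :: "('v, 'e) lpa_gen free_monoid \<Rightarrow> ('v, 'e) lpa_gen free_monoid" where
  "swap_word w = Word (rev (map swap_gen (letters w)))"

lemma swap_word_swap [simp]: "swap_word (swap_word w) = w"
  by (simp add: swap_word_def rev_map comp_def)

lemma swap_word_inj: "inj swap_word"
  by (metis injI swap_word_swap)

lemma swap_word_add: "swap_word (u + w) = swap_word w + swap_word u"
  by (simp add: swap_word_def plus_free_monoid_def)

definition pstar :: "(('v, 'e) lpa_gen, 'k::field) free_poly \<Rightarrow> (('v, 'e) lpa_gen, 'k) free_poly" where
  "pstar p = Poly_Mapping.map_key swap_word p"

lemma lookup_pstar: "Poly_Mapping.lookup (pstar p) w = Poly_Mapping.lookup p (swap_word w)"
  unfolding pstar_def by (simp add: map_key.rep_eq swap_word_inj)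

lemma pstar_add: "pstar (p + q) = pstar p + pstar q"
  by (rule poly_mapping_eqI) (simp add: lookup_pstar lookup_add)

lemma pstar_zero [simp]: "pstar 0 = 0"
  by (rule poly_mapping_eqI) (simp add: lookup_pstar)

lemma pstar_uminus: "pstar (- p) = - pstar p"
  by (rule poly_mapping_eqI) (simp add: lookup_pstar)

lemma pstar_diff: "pstar (p - q) = pstar p - pstar q"
  by (rule poly_mapping_eqI) (simp add: lookup_pstar lookup_minus)

lemma pstar_sum: "pstar (sum f A) = (\<Sum>i\<in>A. pstar (f i))"
  by (induction A rule: infinite_finite_induct) (auto simp: pstar_add)

lemma pstar_single: "pstar (Poly_Mapping.single w k) = Poly_Mapping.single (swap_word w) k"
  by (rule poly_mapping_eqI) (auto simp: lookup_pstar lookup_single when_def)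

lemma pstar_mult: "pstar (p * q) = pstar q * pstar p"
proof (induction p rule: poly_mapping_induct_add)
  case (single w k)
  show ?case
    by (induction q rule: poly_mapping_induct_add)
      (auto simp: pstar_single mult_single pstar_add distrib_left distrib_right swap_word_add mult.commute)
qed (auto simp: pstar_add distrib_left distrib_right)

lemma pstar_pstar [simp]: "pstar (pstar p) = p"
  by (rule poly_mapping_eqI) (simp add: lookup_pstar)

lemma pstar_indet [simp]: "pstar (indet a) = indet (swap_gen a)"
  by (simp add: indet_def pstar_single swap_word_def)

lemma pstar_scalar [simp]: "pstar (Poly_Mapping.single 0 k) = Poly_Mapping.single 0 k"
  by (simp add: pstar_single swap_word_def zero_free_monoid_def)

text \<open>The automorphism x \<mapsto> x^-1 of the Laurent ring; it appears because the involution
  exchanges c and c*.\<close>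

definition lbar :: "'k::field laurent_poly \<Rightarrow> 'k laurent_poly" where
  "lbar f = Poly_Mapping.map_key uminus f"

lemma lookup_lbar: "Poly_Mapping.lookup (lbar f) n = Poly_Mapping.lookup f (- n)"
  unfolding lbar_def by (simp add: map_key.rep_eq)

lemma lbar_add: "lbar (f + g) = lbar f + lbar g"
  by (rule poly_mapping_eqI) (simp add: lookup_lbar lookup_add)

lemma lbar_zero [simp]: "lbar 0 = 0"
  by (rule poly_mapping_eqI) (simp add: lookup_lbar)

lemma lbar_single: "lbar (Poly_Mapping.single n k) = Poly_Mapping.single (- n) k"
  by (rule poly_mapping_eqI) (auto simp: lookup_lbar lookup_single when_def)

lemma lbar_mult: "lbar (f * g) = lbar f * lbar g"
proof (induction f rule: poly_mapping_induct_add)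
  case (single w k)
  show ?case
    by (induction g rule: poly_mapping_induct_add)
      (auto simp: lbar_single mult_single lbar_add distrib_left add.commute)
qed (auto simp: lbar_add distrib_right)

lemma lbar_lbar [simp]: "lbar (lbar f) = f"
  by (rule poly_mapping_eqI) (simp add: lookup_lbar)

lemma lbar_one [simp]: "lbar 1 = 1"
  using lbar_single[of 0 1] by simp

lemma lbar_irreducible:
  assumes "Factorial_Ring.irreducible f"
  shows "Factorial_Ring.irreducible (lbar f)"
proof (rule irreducibleI)
  have unit: "lbar g dvd 1" if gu: "g dvd 1" for g :: "'a laurent_poly"
  proof -
    obtain h where "1 = g * h" using gu by (elim dvdE)
    then have "1 = lbar g * lbar h" using lbar_mult[of g h] by simp
    then show ?thesis by (rule dvdI)
  qed
  show "lbar f \<noteq> 0" using assms by (metis lbar_lbar lbar_zero not_irreducible_zero)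
  show "\<not> lbar f dvd 1" using unit[of "lbar f"] irreducible_not_unit[OF assms] by auto
  fix a b assume "lbar f = a * b"
  then have "f = lbar a * lbar b" using lbar_mult[of a b] by (metis lbar_lbar)
  then have "lbar a dvd 1 \<or> lbar b dvd 1" using irreducibleD[OF assms] by blast
  then show "a dvd 1 \<or> b dvd 1" using unit[of "lbar a"] unit[of "lbar b"] by auto
qed

section \<open>The involution on \<open>alg\<close> and right primitivity\<close>

context lpa_emb
begin

lemma pstar_fcar: "p \<in> fcar X \<Longrightarrow> pstar p \<in> fcar X"
proof -
  assume p: "p \<in> fcar X"
  have sw: "swap_gen ` X \<subseteq> X" by (auto simp: lpa_gens_def)
  have "letters w \<noteq> [] \<and> set (letters w) \<subseteq> X" if "w \<in> Poly_Mapping.keys (pstar p)" for w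
  proof -
    have "swap_word w \<in> Poly_Mapping.keys p" using that by (simp add: in_keys_iff lookup_pstar)
    then have "letters (swap_word w) \<noteq> []" "set (letters (swap_word w)) \<subseteq> X" using p by (auto simp: fcar_def)
    then have "letters w \<noteq> []" "swap_gen ` set (letters w) \<subseteq> X" by (auto simp: swap_word_def)
    moreover have "set (letters w) = swap_gen ` swap_gen ` set (letters w)" by (simp add: image_image)
    ultimately show ?thesis using sw by blast
  qed
  then show ?thesis by (auto simp: fcar_def)
qed

lemma pstar_relations: "r \<in> lpa_relations E \<Longrightarrow> pstar r \<in> (lpa_relations E :: (('v, 'e) lpa_gen, 'k) free_poly set)"
proof -
  have h1: "pstar (indet (Vert v) * indet (Vert w) - (if v = w then indet (Vert v) else 0)) =
      indet (Vert w) * indet (Vert v) - (if w = v then indet (Vert w) else (0 :: (('v, 'e) lpa_gen, 'k) free_poly))" for v w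
    by (auto simp: pstar_diff pstar_mult)
  have h2: "pstar (indet (Ghost e) * indet (Edge f) - (if e = f then indet (Vert (head E e)) else 0)) =
      indet (Ghost f) * indet (Edge e) - (if f = e then indet (Vert (head E f)) else (0 :: (('v, 'e) lpa_gen, 'k) free_poly))" for e f
    by (auto simp: pstar_diff pstar_mult)
  assume "r \<in> lpa_relations E"
  then show ?thesis
    unfolding lpa_relations_def Un_iff mem_Collect_eq
  proof (elim disjE exE conjE, goal_cases)
    case (1 v w) then show ?case unfolding 1(1) h1 by blast
  next
    case (2 e) then show ?case by (simp add: pstar_diff pstar_mult) blast
  next
    case (3 e) then show ?case by (simp add: pstar_diff pstar_mult) blast
  next
    case (4 e) then show ?case by (simp add: pstar_diff pstar_mult) blast
  next
    case (5 e) then show ?case by (simp add: pstar_diff pstar_mult) blast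
  next
    case (6 e f) then show ?case unfolding 6(1) h2 by blast
  next
    case (7 v) then show ?case by (simp add: pstar_diff pstar_mult pstar_sum) blast
  qed
qed

lemma pstar_NN: "p \<in> NN \<Longrightarrow> pstar p \<in> NN"
proof -
  let ?I = "{p \<in> fcar X. pstar p \<in> NN}"
  have "alg_ideal_of X ?I"
    unfolding alg_ideal_of_def
  proof (intro conjI ballI allI)
    show "0 \<in> ?I" using NN_facts(2) by simp
    fix p assume "p \<in> ?I"
    then have p: "p \<in> fcar X" "pstar p \<in> NN" by auto
    show "- p \<in> ?I" using fcar_minus[OF p(1)] NN_facts(4)[OF p(2)] by (simp add: pstar_uminus)
    show "p + q \<in> ?I" if "q \<in> ?I" for q
      using that fcar_add[OF p(1)] NN_facts(3)[OF p(2)] by (simp add: pstar_add)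
    show "q * p \<in> ?I" "p * q \<in> ?I" if q: "q \<in> fcar X" for q
      using fcar_mult[OF p(1) q] fcar_mult[OF q p(1)] NN_facts(5,6)[OF p(2) pstar_fcar[OF q]]
      by (simp_all add: pstar_mult)
    show "Poly_Mapping.single 0 k * p \<in> ?I" for k
      using fcar_scale[OF p(1)] NN_facts(7)[OF p(2)] by (simp add: pstar_mult free_scalar_central)
  qed blast
  moreover have "lpa_relations E \<subseteq> ?I"
    using relations_fcar pstar_relations relations_in by blast
  ultimately have "NN \<subseteq> ?I" unfolding relation_ideal_eq by blast
  then show "p \<in> NN \<Longrightarrow> pstar p \<in> NN" by blast
qed

definition star :: "(('v, 'e) lpa_gen, 'k) free_poly all_quotients \<Rightarrow> (('v, 'e) lpa_gen, 'k) free_poly all_quotients" where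
  "star q = emb (pstar (SOME p. p \<in> fcar X \<and> emb p = q))"

lemma star_emb: "p \<in> fcar X \<Longrightarrow> star (emb p) = emb (pstar p)"
proof -
  assume p: "p \<in> fcar X"
  define p' where "p' = (SOME p'. p' \<in> fcar X \<and> emb p' = emb p)"
  have p': "p' \<in> fcar X \<and> emb p' = emb p" unfolding p'_def by (rule someI[of _ p]) (use p in simp)
  then have "p' - p \<in> NN" using emb_eq_iff p by blast
  then have "pstar p' - pstar p \<in> NN" using pstar_NN[of "p' - p"] by (simp add: pstar_diff)
  then have "emb (pstar p') = emb (pstar p)" using emb_eq_iff pstar_fcar p p' by blast
  then show ?thesis by (simp add: star_def p'_def)
qed

lemma star_add: "x \<in> alg \<Longrightarrow> y \<in> alg \<Longrightarrow> star (x + y) = star x + star y"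
proof -
  assume "x \<in> alg" "y \<in> alg"
  then obtain p q where pq: "p \<in> fcar X" "emb p = x" "q \<in> fcar X" "emb q = y" using alg_emb by blast
  show ?thesis unfolding pq(2,4)[symmetric] emb_add[symmetric] star_emb[OF fcar_add[OF pq(1,3)]]
      star_emb[OF pq(1)] star_emb[OF pq(3)] pstar_add ..
qed

lemma star_mult: "x \<in> alg \<Longrightarrow> y \<in> alg \<Longrightarrow> star (x * y) = star y * star x"
proof -
  assume "x \<in> alg" "y \<in> alg"
  then obtain p q where pq: "p \<in> fcar X" "emb p = x" "q \<in> fcar X" "emb q = y" using alg_emb by blast
  show ?thesis unfolding pq(2,4)[symmetric] emb_mult[symmetric] star_emb[OF fcar_mult[OF pq(1,3)]]
      star_emb[OF pq(1)] star_emb[OF pq(3)] pstar_mult ..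
qed

lemma star_scale: "x \<in> alg \<Longrightarrow> star (\<kappa> k * x) = \<kappa> k * star x"
proof -
  assume "x \<in> alg"
  then obtain p where p: "p \<in> fcar X" "emb p = x" using alg_emb by blast
  show ?thesis unfolding p(2)[symmetric] \<kappa>_def emb_scale star_emb[OF fcar_scale[OF p(1)]] star_emb[OF p(1)]
    by (simp add: pstar_mult free_scalar_central)
qed

lemma star_alg: "x \<in> alg \<Longrightarrow> star x \<in> alg"
  and star_star: "x \<in> alg \<Longrightarrow> star (star x) = x"
proof -
  assume "x \<in> alg"
  then obtain p where p: "p \<in> fcar X" "emb p = x" using alg_emb by blast
  show "star x \<in> alg" "star (star x) = x"
    unfolding p(2)[symmetric] star_emb[OF p(1)] star_emb[OF pstar_fcar[OF p(1)]]
    using emb_alg[OF pstar_fcar[OF p(1)]] by simp_all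
qed

lemma star_vt: "v \<in> verts E \<Longrightarrow> star (vt v) = vt v"
  and star_ed: "e \<in> arcs E \<Longrightarrow> star (ed e) = gh e"
  and star_gh: "e \<in> arcs E \<Longrightarrow> star (gh e) = ed e"
  unfolding vt_def ed_def gh_def by (simp_all add: star_emb fcar_indet)

lemma star_zero: "star 0 = 0"
  using star_emb[of 0] by (simp add: emb_zero)

lemma star_minus: "x \<in> alg \<Longrightarrow> star (- x) = - star x"
  using star_scale[of x "- 1"] by (simp add: \<kappa>_minus)

lemma star_diff: "x \<in> alg \<Longrightarrow> y \<in> alg \<Longrightarrow> star (x - y) = star x - star y"
  using star_add[of x "- y"] star_minus[of y] alg_minus[of y] by simp

lemma star_sum: "(\<And>i. i \<in> I \<Longrightarrow> f i \<in> alg) \<Longrightarrow> star (sum f I) = (\<Sum>i\<in>I. star (f i))"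
  by (induction I rule: infinite_finite_induct) (auto simp: star_zero star_add alg_sum)

lemma star_pe: "awalk u p v \<Longrightarrow> star (pe u p) = ge u p"
proof (induction p arbitrary: u)
  case (Cons e p)
  then have e: "e \<in> arcs E" "awalk (head E e) p v" by (auto simp: awalk_simps)
  show ?case using Cons.IH[OF e(2)] star_mult[OF ed_alg[OF e(1)] pe_alg[OF e(2)]] star_ed[OF e(1)] by simp
qed (auto simp: awalk_simps star_vt)

lemma star_ge: "awalk u p v \<Longrightarrow> star (ge u p) = pe u p"
  using star_star[OF pe_alg] star_pe by metis

lemma star_bel:
  assumes "u \<in> breaking_vertices E H"
  shows "star (bel H u) = bel H u"
proof -
  have u: "u \<in> verts E" using assms by (auto simp: breaking_vertices_def)
  have e: "ed e * gh e \<in> alg" "star (ed e * gh e) = ed e * gh e" if "e \<in> arcs_outside E H u" for e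
  proof -
    have "e \<in> arcs E" using that by (auto simp: arcs_outside_def)
    then show "ed e * gh e \<in> alg" "star (ed e * gh e) = ed e * gh e"
      using alg_mult ed_alg gh_alg star_mult star_ed star_gh by auto
  qed
  show ?thesis unfolding bel_def
    using star_diff[OF vt_alg[OF u] alg_sum[of "arcs_outside E H u"]] star_sum[of "arcs_outside E H u"] e star_vt[OF u]
    by simp
qed

lemma star_lev:
  assumes "cycle c"
  shows "star (lev c f) = lev c (lbar f)"
proof -
  note c = cycle_awalk(2,1)[OF assms]
  have cp: "star (cpow c n) = cpow c (- n)" for n
  proof (cases "n \<ge> 0")
    case True
    then obtain m where m: "n = int m" by (metis nonneg_int_cases)
    show ?thesis unfolding m cpow_nat_pe[OF c] cpow_neg_ge[OF c] by (rule star_pe[OF awalk_power[OF c(1)]])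
  next
    case False
    then have "n = - int (nat (- n))" by simp
    then obtain m where m: "n = - int m" by blast
    show ?thesis unfolding m minus_minus cpow_nat_pe[OF c] cpow_neg_ge[OF c] by (rule star_ge[OF awalk_power[OF c(1)]])
  qed
  show ?thesis
    by (induction f rule: poly_mapping_induct_add)
      (simp_all add: lev_add lbar_add star_add lev_alg[OF c] star_zero lbar_single lev_single star_scale cpow_alg[OF c] cp)
qed

lemma star_image_star: "Y \<subseteq> alg \<Longrightarrow> star ` star ` Y = Y"
  using star_star by (force simp: image_image)

lemma star_aideal:
  assumes J: "aideal J"
  shows "aideal (star ` J)"
  unfolding aideal_def
proof (intro conjI ballI)
  show "star ` J \<subseteq> alg" using star_alg aideal_sub[OF J] by auto
  show "0 \<in> star ` J" using aideal_zero[OF J] star_zero by (auto intro!: image_eqI[of _ _ 0])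
  fix s assume "s \<in> star ` J"
  then obtain x where x: "x \<in> J" "s = star x" "x \<in> alg" using aideal_sub[OF J] by blast
  show "s + t \<in> star ` J" if "t \<in> star ` J" for t
    using that x aideal_add[OF J] star_add[symmetric] aideal_sub[OF J] by auto
  fix a assume a: "a \<in> alg"
  have "a * s = star (x * star a)" "s * a = star (star a * x)"
    using star_mult star_star star_alg a x by simp_all
  then show "a * s \<in> star ` J" "s * a \<in> star ` J"
    using aideal_left[OF J star_alg[OF a] x(1)] aideal_right[OF J star_alg[OF a] x(1)] by simp_all
qed

lemma star_idl:
  assumes "Y \<subseteq> alg"
  shows "star ` idl Y = idl (star ` Y)"
proof
  have sub: "idl (star ` Z) \<subseteq> star ` idl Z" if "Z \<subseteq> alg" for Z
    by (rule idl_least[OF star_aideal[OF idl_aideal[OF that]]]) (use idl_base[of Z] in blast)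
  show "idl (star ` Y) \<subseteq> star ` idl Y" by (rule sub[OF assms])
  have sY: "star ` Y \<subseteq> alg" using star_alg assms by auto
  have "idl Y \<subseteq> star ` idl (star ` Y)" using sub[OF sY] star_image_star[OF assms] by simp
  then have "star ` idl Y \<subseteq> star ` star ` idl (star ` Y)" by (rule image_mono)
  then show "star ` idl Y \<subseteq> idl (star ` Y)"
    using star_image_star[of "idl (star ` Y)"] idl_aideal[OF sY] by (simp add: aideal_def)
qed

lemma star_gidl: "H \<subseteq> verts E \<Longrightarrow> S \<subseteq> breaking_vertices E H \<Longrightarrow> star ` gidl H S = gidl H S"
proof -
  assume a: "H \<subseteq> verts E" "S \<subseteq> breaking_vertices E H"
  have "star ` (vt ` H \<union> bel H ` S) = vt ` H \<union> bel H ` S"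
    unfolding image_Un image_image using a star_vt star_bel by (intro arg_cong2[where f = "(\<union>)"] image_cong) auto
  then show ?thesis unfolding gidl_def star_idl[OF gidl_gens_alg[OF a]] by simp
qed

lemma star_cidl: "H \<subseteq> verts E \<Longrightarrow> cycle c \<Longrightarrow> star ` cidl H c f = cidl H c (lbar f)"
proof -
  assume a: "H \<subseteq> verts E" "cycle c"
  have g: "vt ` H \<union> bel H ` breaking_vertices E H \<subseteq> alg" by (rule gidl_gens_alg[OF a(1)]) simp
  have l: "{lev c f} \<subseteq> alg" using lev_alg[OF cycle_awalk(2,1)[OF a(2)]] by simp
  have "star ` (vt ` H \<union> bel H ` breaking_vertices E H) = vt ` H \<union> bel H ` breaking_vertices E H"
    unfolding image_Un image_image using a star_vt star_bel by (intro arg_cong2[where f = "(\<union>)"] image_cong) auto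
  then have "star ` (vt ` H \<union> bel H ` breaking_vertices E H \<union> {lev c f}) =
      vt ` H \<union> bel H ` breaking_vertices E H \<union> {lev c (lbar f)}" using star_lev[OF a(2)] by simp
  then show ?thesis unfolding cidl_def using star_idl[of "vt ` H \<union> bel H ` breaking_vertices E H \<union> {lev c f}"] g l by simp
qed

text \<open>Preceded by the involution, the quotient map becomes a homomorphism onto the opposite
  ring whose kernel is the image of P under the involution. So right primitivity for P is left
  primitivity for that image.\<close>

lemma opposite_surj:
  assumes "ring_surj Q alg \<pi> P"
  shows "ring_surj (opposite_ring Q) alg (\<lambda>x. \<pi> (star x)) (star ` P)"
proof -
  interpret ring_surj Q alg \<pi> P by fact
  have simps: "carrier (opposite_ring Q) = carrier Q" "\<zero>\<^bsub>opposite_ring Q\<^esub> = \<zero>\<^bsub>Q\<^esub>"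
    "x \<oplus>\<^bsub>opposite_ring Q\<^esub> y = x \<oplus>\<^bsub>Q\<^esub> y" "x \<otimes>\<^bsub>opposite_ring Q\<^esub> y = y \<otimes>\<^bsub>Q\<^esub> x" for x y
    by (simp_all add: opposite_ring_def)
  have sa: "star ` alg = alg" using star_alg star_star by (force simp: image_iff)
  show ?thesis
  proof (rule ring_surj.intro)
    show "abelian_group (opposite_ring Q)"
    proof (rule abelian_groupI)
      fix x assume "x \<in> carrier (opposite_ring Q)"
      then show "\<exists>y\<in>carrier (opposite_ring Q). y \<oplus>\<^bsub>opposite_ring Q\<^esub> x = \<zero>\<^bsub>opposite_ring Q\<^esub>"
        unfolding simps by (intro bexI[of _ "\<ominus>\<^bsub>Q\<^esub> x"]) (auto simp: Q.l_neg)
    qed (auto simp: simps Q.a_ac)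
    have "(\<lambda>x. \<pi> (star x)) ` alg = \<pi> ` star ` alg" by (simp add: image_image)
    then show "(\<lambda>x. \<pi> (star x)) ` alg = carrier (opposite_ring Q)" unfolding sa simps \<pi>(1) .
    show "star ` P = {x \<in> alg. \<pi> (star x) = \<zero>\<^bsub>opposite_ring Q\<^esub>}"
      unfolding simps P
    proof (intro equalityI subsetI)
      fix x assume "x \<in> {x \<in> alg. \<pi> (star x) = \<zero>\<^bsub>Q\<^esub>}"
      then have "star x \<in> {x \<in> alg. \<pi> x = \<zero>\<^bsub>Q\<^esub>}" "x = star (star x)" using star_alg star_star by auto
      then show "x \<in> star ` {x \<in> alg. \<pi> x = \<zero>\<^bsub>Q\<^esub>}" by blast
    qed (use star_alg star_star in auto)
  qed (auto simp: simps star_alg star_add star_mult \<pi> A)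
qed

lemma primitive_iff:
  assumes "aideal P"
  shows "primitive_ideal (psi ` P) (lpa E) \<longleftrightarrow> left_prim alg P \<and> left_prim alg (star ` P)"
proof -
  note s = quot_surj[OF assms]
  show ?thesis
    unfolding primitive_ideal_def primitive_ring_def right_primitive_def
    using ring_surj.left_primitive_iff[OF s] ring_surj.left_primitive_iff[OF opposite_surj[OF s]] two_sided_psi[OF assms]
    by blast
qed

end

section \<open>Modules from branching systems\<close>

definition delta :: "'b \<Rightarrow> 'r \<Rightarrow> 'b \<Rightarrow> 'r::zero" where
  "delta b r = (\<lambda>b'. if b' = b then r else 0)"

text \<open>Edges act on functions on \<open>B\<close> by translation and multiplication by the unit \<open>t e\<close> of a commutative
  ring, in which the ideal \<open>I\<close> is maximal.  The module is that of the finitely supported functions modulo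
  those with values in \<open>I\<close>; the only nontrivial choice used is \<open>K[x, x\<^sup>-\<^sup>1]\<close> with \<open>I = (f)\<close>.\<close>

locale coeffs =
  fixes t t' :: "'e \<Rightarrow> 'r::comm_ring_1" and \<iota> :: "'k::field \<Rightarrow> 'r" and I :: "'r set"
  assumes t: "t e * t' e = 1"
    and \<iota>_add: "\<iota> (k + l) = \<iota> k + \<iota> l" and \<iota>_mult: "\<iota> (k * l) = \<iota> k * \<iota> l" and \<iota>_one: "\<iota> 1 = 1"
    and I: "0 \<in> I" "x \<in> I \<Longrightarrow> y \<in> I \<Longrightarrow> x + y \<in> I" "x \<in> I \<Longrightarrow> s * x \<in> I" "1 \<notin> I"
    and I_max: "x \<notin> I \<Longrightarrow> \<exists>s. s * x - 1 \<in> I"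

text \<open>The elements of B behave like finite or infinite paths: a first edge, if there is one,
  can be removed and put back. At a regular vertex v the relation v = \<Sum> e e* forces every
  element to start with an edge, whence the last condition.\<close>

locale branch_mod = lpa_emb E K + coeffs t t' \<iota> I
  for E :: "('v, 'e) pre_digraph" and K :: "'k::field itself"
    and t t' :: "'e \<Rightarrow> 'r::comm_ring_1" and \<iota> :: "'k \<Rightarrow> 'r" and I :: "'r set" +
  fixes B :: "'b set" and src :: "'b \<Rightarrow> 'v" and first :: "'b \<Rightarrow> 'e option" and rest :: "'b \<Rightarrow> 'b"
    and cons :: "'e \<Rightarrow> 'b \<Rightarrow> 'b"
  assumes src: "b \<in> B \<Longrightarrow> src b \<in> verts E"
    and first: "b \<in> B \<Longrightarrow> first b = Some e \<Longrightarrow>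
      e \<in> arcs E \<and> tail E e = src b \<and> rest b \<in> B \<and> src (rest b) = head E e \<and> cons e (rest b) = b"
    and cons: "b \<in> B \<Longrightarrow> e \<in> arcs E \<Longrightarrow> src b = head E e \<Longrightarrow>
      cons e b \<in> B \<and> first (cons e b) = Some e \<and> rest (cons e b) = b"
    and singular: "b \<in> B \<Longrightarrow> first b = None \<Longrightarrow> \<not> regular_vertex E (src b)"
begin

lemma \<iota>_zero: "\<iota> 0 = 0"
  using \<iota>_add[of 0 0] by simp

lemma cons_src: "b \<in> B \<Longrightarrow> e \<in> arcs E \<Longrightarrow> src b = head E e \<Longrightarrow> src (cons e b) = tail E e"
  using cons[of b e] first[of "cons e b" e] by auto

text \<open>The action is written by substitution in functions; on indicators, e sends that of b to
  \<open>t e\<close> times that of \<open>cons e b\<close>.\<close>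

fun op :: "('v, 'e) lpa_gen \<Rightarrow> ('b \<Rightarrow> 'r) \<Rightarrow> 'b \<Rightarrow> 'r" where
  "op (Vert v) m = (\<lambda>b. if b \<in> B \<and> src b = v then m b else 0)"
| "op (Edge e) m = (\<lambda>b. if b \<in> B \<and> first b = Some e then t e * m (rest b) else 0)"
| "op (Ghost e) m = (\<lambda>b. if b \<in> B \<and> src b = head E e \<and> e \<in> arcs E then t' e * m (cons e b) else 0)"

lemma op_add: "op a (\<lambda>b. m b + n b) = (\<lambda>b. op a m b + op a n b)"
  by (cases a) (auto simp: distrib_left)

lemma op_scale: "op a (\<lambda>b. r * m b) = (\<lambda>b. r * op a m b)"
  by (cases a) (auto simp: algebra_simps)

definition opw :: "('v, 'e) lpa_gen list \<Rightarrow> ('b \<Rightarrow> 'r) \<Rightarrow> 'b \<Rightarrow> 'r" where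
  "opw ws m = foldr op ws m"

lemma opw_add: "opw ws (\<lambda>b. m b + n b) = (\<lambda>b. opw ws m b + opw ws n b)"
  by (induction ws) (auto simp: opw_def op_add)

lemma opw_scale: "opw ws (\<lambda>b. r * m b) = (\<lambda>b. r * opw ws m b)"
  by (induction ws) (auto simp: opw_def op_scale)

lemma opw_append: "opw (ws @ vs) m = opw ws (opw vs m)"
  by (simp add: opw_def)

definition actf :: "(('v, 'e) lpa_gen, 'k) free_poly \<Rightarrow> ('b \<Rightarrow> 'r) \<Rightarrow> 'b \<Rightarrow> 'r" where
  "actf p m = (\<lambda>b. \<Sum>w\<in>Poly_Mapping.keys p. \<iota> (Poly_Mapping.lookup p w) * opw (letters w) m b)"

lemma actf_superset:
  assumes "finite S" "Poly_Mapping.keys p \<subseteq> S"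
  shows "actf p m b = (\<Sum>w\<in>S. \<iota> (Poly_Mapping.lookup p w) * opw (letters w) m b)"
  unfolding actf_def using assms by (intro sum.mono_neutral_left) (auto simp: in_keys_iff \<iota>_zero)

lemma actf_add: "actf (p + q) m = (\<lambda>b. actf p m b + actf q m b)"
proof
  fix b
  let ?S = "Poly_Mapping.keys p \<union> Poly_Mapping.keys q"
  have "actf (p + q) m b = (\<Sum>w\<in>?S. \<iota> (Poly_Mapping.lookup (p + q) w) * opw (letters w) m b)"
    using keys_add[of p q] by (intro actf_superset) auto
  then show "actf (p + q) m b = actf p m b + actf q m b"
    using actf_superset[of ?S p m b] actf_superset[of ?S q m b]
    by (simp add: lookup_add \<iota>_add distrib_right sum.distrib)
qed

lemma actf_zero [simp]: "actf 0 m = (\<lambda>b. 0)"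
  by (simp add: actf_def)

lemma actf_single: "actf (Poly_Mapping.single w k) m = (\<lambda>b. \<iota> k * opw (letters w) m b)"
  by (cases "k = 0") (simp_all add: actf_def \<iota>_zero)

lemma actf_uminus: "actf (- p) m = (\<lambda>b. - actf p m b)"
proof
  fix b
  have "actf (p + - p) m b = 0" by (simp only: add.right_inverse actf_zero)
  then show "actf (- p) m b = - actf p m b" unfolding actf_add by (simp add: eq_neg_iff_add_eq_0 add.commute)
qed

lemma actf_diff: "actf (p - q) m = (\<lambda>b. actf p m b - actf q m b)"
  using actf_add[of p "- q" m] by (simp add: actf_uminus)

lemma actf_sum: "actf (sum f A) m = (\<lambda>b. \<Sum>i\<in>A. actf (f i) m b)"
  by (induction A rule: infinite_finite_induct) (auto simp: actf_add)

lemma actf_add_right: "actf p (\<lambda>b. m b + n b) = (\<lambda>b. actf p m b + actf p n b)"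
  by (simp add: actf_def opw_add distrib_left sum.distrib)

lemma actf_scale_right: "actf p (\<lambda>b. r * m b) = (\<lambda>b. r * actf p m b)"
  by (simp add: actf_def opw_scale sum_distrib_left mult.left_commute)

lemma actf_zero_right: "actf p (\<lambda>b. 0) = (\<lambda>b. 0)"
  using actf_scale_right[of p 0 "\<lambda>b. 0"] by simp

lemma actf_mult: "actf (p * q) m = actf p (actf q m)"
proof (induction p rule: poly_mapping_induct_add)
  case (single w k)
  show ?case
  proof (induction q rule: poly_mapping_induct_add)
    case zero
    then show ?case by (simp add: actf_zero_right)
  next
    case (single u l)
    show ?case by (simp add: mult_single actf_single opw_append opw_scale \<iota>_mult mult.assoc)
  next
    case (add f g)
    then show ?case by (simp add: distrib_left actf_add actf_add_right)
  qed
qed (simp_all add: distrib_right actf_add)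

lemma actf_indet: "actf (indet a) m = op a m"
  by (simp add: indet_def actf_single opw_def \<iota>_one)

lemma actf_relation:
  assumes "r \<in> lpa_relations E"
  shows "actf r m = (\<lambda>b. 0)"
  using assms unfolding lpa_relations_def Un_iff mem_Collect_eq
proof (elim disjE exE conjE, goal_cases)
  case (1 v w)
  then show ?case by (auto simp: actf_diff actf_mult actf_indet fun_eq_iff)
next
  case (2 e)
  then show ?case using first by (auto simp: actf_diff actf_mult actf_indet fun_eq_iff)
next
  case (3 e)
  then show ?case using first by (auto simp: actf_diff actf_mult actf_indet fun_eq_iff)
next
  case (4 e)
  then show ?case by (auto simp: actf_diff actf_mult actf_indet fun_eq_iff)
next
  case (5 e)
  then show ?case using cons cons_src by (auto simp: actf_diff actf_mult actf_indet fun_eq_iff)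
next
  case (6 e f)
  have "t' e * (t e * x) = x" for x e using t[of e] by (metis mult.assoc mult.commute mult_1)
  then show ?case using 6 cons by (auto simp: actf_diff actf_mult actf_indet fun_eq_iff)
next
  case (7 v)
  have fin: "finite (out_arcs E v)" using 7 by (simp add: regular_vertex_def)
  have "(\<Sum>e\<in>out_arcs E v. op (Edge e) (op (Ghost e) m) b) = op (Vert v) m b" for b
  proof (cases "b \<in> B \<and> src b = v")
    case True
    then obtain e where e: "first b = Some e" using singular 7(2) by (cases "first b") auto
    then have eb: "e \<in> out_arcs E v" "rest b \<in> B" "src (rest b) = head E e" "cons e (rest b) = b"
      using first[of b e] True by auto
    have "(\<Sum>f\<in>out_arcs E v. op (Edge f) (op (Ghost f) m) b) = (\<Sum>f\<in>out_arcs E v. if f = e then m b else 0)"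
    proof (rule sum.cong[OF refl])
      fix f
      have "t e * (t' e * m b) = m b" using t[of e] by (simp add: mult.assoc[symmetric])
      then show "op (Edge f) (op (Ghost f) m) b = (if f = e then m b else 0)" using True e eb by auto
    qed
    then show ?thesis using fin eb(1) True by simp
  next
    case False
    then have "op (Edge e) (op (Ghost e) m) b = 0" if "e \<in> out_arcs E v" for e
      using first[of b e] that by auto
    then show ?thesis using False by auto
  qed
  then show ?case unfolding 7(1) by (simp add: actf_diff actf_sum actf_mult actf_indet fun_eq_iff del: op.simps)
qed

lemma actf_NN: "p \<in> NN \<Longrightarrow> actf p m = (\<lambda>b. 0)"
proof -
  let ?J = "{p \<in> fcar X. \<forall>m. actf p m = (\<lambda>b. 0)}"
  have "alg_ideal_of X ?J"
    unfolding alg_ideal_of_def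
  proof (intro conjI ballI allI)
    fix p assume "p \<in> ?J"
    then have p: "p \<in> fcar X" "\<And>m. actf p m = (\<lambda>b. 0)" by auto
    show "- p \<in> ?J" using fcar_minus[OF p(1)] p(2) by (simp add: actf_uminus)
    show "p + q \<in> ?J" if "q \<in> ?J" for q using that fcar_add[OF p(1)] p(2) by (simp add: actf_add)
    show "q * p \<in> ?J" "p * q \<in> ?J" if q: "q \<in> fcar X" for q
      using fcar_mult[OF p(1) q] fcar_mult[OF q p(1)] p(2) by (simp_all add: actf_mult actf_zero_right)
    show "Poly_Mapping.single 0 k * p \<in> ?J" for k
      using fcar_scale[OF p(1)] p(2) by (simp add: actf_mult actf_zero_right)
  qed auto
  moreover have "lpa_relations E \<subseteq> ?J" using relations_fcar actf_relation by blast
  ultimately have "NN \<subseteq> ?J" unfolding relation_ideal_eq by blast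
  then show "p \<in> NN \<Longrightarrow> actf p m = (\<lambda>b. 0)" by blast
qed

definition act :: "(('v, 'e) lpa_gen, 'k) free_poly all_quotients \<Rightarrow> ('b \<Rightarrow> 'r) \<Rightarrow> 'b \<Rightarrow> 'r" where
  "act q = actf (SOME p. p \<in> fcar X \<and> emb p = q)"

lemma act_emb: "p \<in> fcar X \<Longrightarrow> act (emb p) = actf p"
proof -
  assume p: "p \<in> fcar X"
  define p' where "p' = (SOME p'. p' \<in> fcar X \<and> emb p' = emb p)"
  have p': "p' \<in> fcar X \<and> emb p' = emb p" unfolding p'_def by (rule someI[of _ p]) (use p in simp)
  then have "p' - p \<in> NN" using emb_eq_iff p by blast
  then have "actf (p' - p) m = (\<lambda>b. 0)" for m by (rule actf_NN)
  then have "actf p' = actf p" by (intro ext) (simp add: actf_diff fun_eq_iff)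
  then show ?thesis by (simp add: act_def p'_def)
qed

lemma act_add: "x \<in> alg \<Longrightarrow> y \<in> alg \<Longrightarrow> act (x + y) m = (\<lambda>b. act x m b + act y m b)"
proof -
  assume "x \<in> alg" "y \<in> alg"
  then obtain p q where pq: "p \<in> fcar X" "emb p = x" "q \<in> fcar X" "emb q = y" using alg_emb by blast
  show ?thesis unfolding pq(2,4)[symmetric] emb_add[symmetric] act_emb[OF fcar_add[OF pq(1,3)]]
      act_emb[OF pq(1)] act_emb[OF pq(3)] actf_add ..
qed

lemma act_mult: "x \<in> alg \<Longrightarrow> y \<in> alg \<Longrightarrow> act (x * y) m = act x (act y m)"
proof -
  assume "x \<in> alg" "y \<in> alg"
  then obtain p q where pq: "p \<in> fcar X" "emb p = x" "q \<in> fcar X" "emb q = y" using alg_emb by blast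
  show ?thesis unfolding pq(2,4)[symmetric] emb_mult[symmetric] act_emb[OF fcar_mult[OF pq(1,3)]]
      act_emb[OF pq(1)] act_emb[OF pq(3)] actf_mult ..
qed

lemma act_scale: "x \<in> alg \<Longrightarrow> act (\<kappa> k * x) m = (\<lambda>b. \<iota> k * act x m b)"
proof -
  assume "x \<in> alg"
  then obtain p where p: "p \<in> fcar X" "emb p = x" using alg_emb by blast
  show ?thesis unfolding p(2)[symmetric] \<kappa>_def emb_scale act_emb[OF fcar_scale[OF p(1)]] act_emb[OF p(1)]
    by (simp add: actf_mult actf_single opw_def)
qed

lemma act_zero: "act 0 m = (\<lambda>b. 0)"
  using act_emb[of 0] by (simp add: emb_zero)

lemma act_diff: "x \<in> alg \<Longrightarrow> y \<in> alg \<Longrightarrow> act (x - y) m = (\<lambda>b. act x m b - act y m b)"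
proof -
  assume xy: "x \<in> alg" "y \<in> alg"
  have "act ((x - y) + y) m = (\<lambda>b. act (x - y) m b + act y m b)" by (rule act_add[OF alg_diff[OF xy] xy(2)])
  then show ?thesis by (simp add: fun_eq_iff)
qed

lemma act_sum: "finite A \<Longrightarrow> (\<And>i. i \<in> A \<Longrightarrow> f i \<in> alg) \<Longrightarrow> act (sum f A) m = (\<lambda>b. \<Sum>i\<in>A. act (f i) m b)"
  by (induction A rule: finite_induct) (auto simp: act_zero act_add alg_sum)

lemma act_vt: "v \<in> verts E \<Longrightarrow> act (vt v) m = op (Vert v) m"
  and act_ed: "e \<in> arcs E \<Longrightarrow> act (ed e) m = op (Edge e) m"
  and act_gh: "e \<in> arcs E \<Longrightarrow> act (gh e) m = op (Ghost e) m"
  unfolding vt_def ed_def gh_def by (simp_all add: act_emb fcar_indet actf_indet del: op.simps)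

lemma act_add_right: "act x (\<lambda>b. m b + n b) = (\<lambda>b. act x m b + act x n b)"
  unfolding act_def by (rule actf_add_right)

lemma act_scale_right: "act x (\<lambda>b. r * m b) = (\<lambda>b. r * act x m b)"
  unfolding act_def by (rule actf_scale_right)

lemma act_diff_right: "act x (\<lambda>b. m b - n b) = (\<lambda>b. act x m b - act x n b)"
  using act_add_right[of x m "\<lambda>b. (- 1) * n b"] act_scale_right[of x "- 1" n] by simp

definition Xs :: "('b \<Rightarrow> 'r) set" where
  "Xs = {m. finite {b. m b \<noteq> 0} \<and> (\<forall>b. b \<notin> B \<longrightarrow> m b = 0)}"

lemma op_Xs: "m \<in> Xs \<Longrightarrow> op a m \<in> Xs"
proof -
  assume m: "m \<in> Xs"
  then have fin: "finite {b. m b \<noteq> 0}" by (simp add: Xs_def)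
  have "\<exists>f. {b. op a m b \<noteq> 0} \<subseteq> f ` {b. m b \<noteq> 0}"
  proof (cases a)
    case (Vert v)
    then show ?thesis by (intro exI[of _ id]) auto
  next
    case (Edge e)
    then have "{b. op a m b \<noteq> 0} \<subseteq> cons e ` {b. m b \<noteq> 0}"
      using first by (auto simp: image_iff) (metis mult_zero_right)
    then show ?thesis by blast
  next
    case (Ghost e)
    then have "{b. op a m b \<noteq> 0} \<subseteq> rest ` {b. m b \<noteq> 0}"
      using cons by (auto simp: image_iff) (metis mult_zero_right)
    then show ?thesis by blast
  qed
  then have "finite {b. op a m b \<noteq> 0}" using fin by (meson finite_imageI finite_subset)
  moreover have "op a m b = 0" if "b \<notin> B" for b using that by (cases a) auto
  ultimately show ?thesis by (simp add: Xs_def)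
qed

lemma op_I: "(\<And>b. m b \<in> I) \<Longrightarrow> op a m b \<in> I"
  using I by (cases a) auto

lemma Xs_add: "m \<in> Xs \<Longrightarrow> n \<in> Xs \<Longrightarrow> (\<lambda>b. m b + n b) \<in> Xs"
  unfolding Xs_def by (auto intro: finite_subset[of _ "{b. m b \<noteq> 0} \<union> {b. n b \<noteq> 0}"])

lemma Xs_scale: "m \<in> Xs \<Longrightarrow> (\<lambda>b. r * m b) \<in> Xs"
  unfolding Xs_def by (auto intro: finite_subset[of _ "{b. m b \<noteq> 0}"])

lemma act_pres:
  assumes "x \<in> alg"
  shows "m \<in> Xs \<Longrightarrow> act x m \<in> Xs" "(\<And>b. m b \<in> I) \<Longrightarrow> act x m b \<in> I"
proof -
  have pe: "(\<forall>m\<in>Xs. act (pe u p) m \<in> Xs) \<and> (\<forall>m. (\<forall>b. m b \<in> I) \<longrightarrow> (\<forall>b. act (pe u p) m b \<in> I))"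
    if "awalk u p w" for u p w
    using that
  proof (induction p arbitrary: u)
    case Nil
    then show ?case using op_Xs[of _ "Vert u"] op_I[of _ "Vert u"] act_vt by (auto simp: awalk_simps simp del: op.simps)
  next
    case (Cons e p)
    then have e: "e \<in> arcs E" "awalk (head E e) p w" by (auto simp: awalk_simps)
    have "act (pe u (e # p)) m = op (Edge e) (act (pe (head E e) p) m)" for m
      using act_mult[OF ed_alg[OF e(1)] pe_alg[OF e(2)]] act_ed[OF e(1)] by (simp del: op.simps)
    then show ?case using Cons.IH[OF e(2)] op_Xs[of _ "Edge e"] op_I[of _ "Edge e"] by (simp del: op.simps)
  qed
  have ge: "(\<forall>m\<in>Xs. act (ge u p) m \<in> Xs) \<and> (\<forall>m. (\<forall>b. m b \<in> I) \<longrightarrow> (\<forall>b. act (ge u p) m b \<in> I))"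
    if "awalk u p w" for u p w
    using that
  proof (induction p arbitrary: u)
    case Nil
    then show ?case using op_Xs[of _ "Vert u"] op_I[of _ "Vert u"] act_vt by (auto simp: awalk_simps simp del: op.simps)
  next
    case (Cons e p)
    then have e: "e \<in> arcs E" "awalk (head E e) p w" by (auto simp: awalk_simps)
    have "act (ge u (e # p)) m = act (ge (head E e) p) (op (Ghost e) m)" for m
      using act_mult[OF ge_alg[OF e(2)] gh_alg[OF e(1)]] act_gh[OF e(1)] by (simp del: op.simps)
    then show ?case using Cons.IH[OF e(2)] op_Xs[of _ "Ghost e"] op_I[of _ "Ghost e"] by (simp del: op.simps)
  qed
  have "(\<forall>m\<in>Xs. act x m \<in> Xs) \<and> (\<forall>m. (\<forall>b. m b \<in> I) \<longrightarrow> (\<forall>b. act x m b \<in> I))"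
    using assms unfolding alg_def
  proof induction
    case lspan_zero
    show ?case using I by (auto simp: act_zero Xs_def)
  next
    case (lspan_step x y k)
    obtain u p v q w where x: "x = pe u p * ge v q" "awalk u p w" "awalk v q w"
      using lspan_step(1) unfolding mons_def by blast
    have xa: "x \<in> alg" "y \<in> alg" using lspan_step(1,2) by (auto simp: alg_def intro: lspan_base)
    have "act x m = act (pe u p) (act (ge v q) m)" for m
      unfolding x(1) by (rule act_mult[OF pe_alg[OF x(2)] ge_alg[OF x(3)]])
    moreover have "act (\<kappa> k * x + y) m = (\<lambda>b. \<iota> k * act x m b + act y m b)" for m
      using act_add[OF alg_scale[OF xa(1)] xa(2)] act_scale[OF xa(1)] by simp
    ultimately show ?case using pe[OF x(2)] ge[OF x(3)] lspan_step.IH I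
      by (auto intro!: Xs_add Xs_scale)
  qed
  then show "m \<in> Xs \<Longrightarrow> act x m \<in> Xs" "(\<And>b. m b \<in> I) \<Longrightarrow> act x m b \<in> I" by auto
qed

section \<open>Action of paths on indicators\<close>

definition consl :: "'e list \<Rightarrow> 'b \<Rightarrow> 'b" where
  "consl p b = foldr cons p b"

lemma consl_simps [simp]: "consl [] b = b" "consl (e # p) b = cons e (consl p b)"
  by (simp_all add: consl_def)

lemma consl_B: "b \<in> B \<Longrightarrow> awalk v p (src b) \<Longrightarrow> consl p b \<in> B \<and> src (consl p b) = v"
proof (induction p arbitrary: v)
  case (Cons e p)
  then have "e \<in> arcs E" "tail E e = v" "consl p b \<in> B \<and> src (consl p b) = head E e" by (auto simp: awalk_simps)
  then show ?case using cons cons_src by simp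
qed (simp add: awalk_simps)

lemma consl_inj:
  "b \<in> B \<Longrightarrow> b' \<in> B \<Longrightarrow> awalk v p (src b) \<Longrightarrow> src b' = src b \<Longrightarrow> consl p b' = consl p b \<Longrightarrow> b' = b"
proof (induction p arbitrary: v)
  case (Cons e p)
  then have e: "e \<in> arcs E" "awalk (head E e) p (src b)" by (auto simp: awalk_simps)
  have "consl p b' = consl p b"
    using Cons.prems(5) cons[of "consl p b" e] cons[of "consl p b'" e] consl_B[OF Cons.prems(1) e(2)]
      consl_B[of b' "head E e" p] Cons.prems(2,4) e by (metis consl_simps(2))
  then show ?case using Cons.IH[OF Cons.prems(1,2) e(2) Cons.prems(4)] by blast
qed simp

definition tp :: "'e list \<Rightarrow> 'r" where "tp p = prod_list (map t p)"
definition tp' :: "'e list \<Rightarrow> 'r" where "tp' p = prod_list (map t' p)"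

lemma tp_tp': "tp p * tp' p = 1"
proof (induction p)
  case (Cons e p)
  have "tp (e # p) * tp' (e # p) = (t e * t' e) * (tp p * tp' p)"
    by (simp add: tp_def tp'_def mult_ac)
  then show ?case using Cons t by simp
qed (simp add: tp_def tp'_def)

lemma act_ge: "awalk v p w \<Longrightarrow> act (ge v p) m b = (if b \<in> B \<and> src b = w then tp' p * m (consl p b) else 0)"
proof (induction p arbitrary: v m)
  case Nil
  then show ?case by (auto simp: awalk_simps act_vt tp'_def)
next
  case (Cons e p)
  then have e: "e \<in> arcs E" "awalk (head E e) p w" by (auto simp: awalk_simps)
  have "act (ge v (e # p)) m b = act (ge (head E e) p) (op (Ghost e) m) b"
    using act_mult[OF ge_alg[OF e(2)] gh_alg[OF e(1)]] act_gh[OF e(1)] by (simp del: op.simps)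
  also have "\<dots> = (if b \<in> B \<and> src b = w then tp' p * op (Ghost e) m (consl p b) else 0)"
    by (rule Cons.IH[OF e(2)])
  also have "\<dots> = (if b \<in> B \<and> src b = w then tp' (e # p) * m (consl (e # p) b) else 0)"
    using consl_B[of b "head E e" p] e by (auto simp: tp'_def mult_ac)
  finally show ?case .
qed

lemma act_ge_delta:
  "b \<in> B \<Longrightarrow> awalk v p (src b) \<Longrightarrow> act (ge v p) (delta (consl p b) r) = delta b (tp' p * r)"
  using consl_inj[of b _ v p] by (auto simp: act_ge delta_def fun_eq_iff)

lemma act_pe_delta:
  "b \<in> B \<Longrightarrow> awalk v p (src b) \<Longrightarrow> act (pe v p) (delta b r) = delta (consl p b) (tp p * r)"
proof (induction p arbitrary: v)
  case Nil
  then show ?case by (auto simp: awalk_simps act_vt delta_def tp_def fun_eq_iff)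
next
  case (Cons e p)
  then have e: "e \<in> arcs E" "awalk (head E e) p (src b)" by (auto simp: awalk_simps)
  have "act (pe v (e # p)) (delta b r) = op (Edge e) (delta (consl p b) (tp p * r))"
    using act_mult[OF ed_alg[OF e(1)] pe_alg[OF e(2)]] act_ed[OF e(1)] Cons.IH[OF Cons.prems(1) e(2)]
    by (simp del: op.simps)
  also have "\<dots> = delta (consl (e # p) b) (tp (e # p) * r)"
  proof
    fix b'
    have c: "consl p b \<in> B" "src (consl p b) = head E e" using consl_B[OF Cons.prems(1) e(2)] by auto
    then show "op (Edge e) (delta (consl p b) (tp p * r)) b' = delta (consl (e # p) b) (tp (e # p) * r) b'"
      using cons[OF c(1) e(1) c(2)] first[of b' e] by (auto simp: delta_def tp_def mult.assoc)
  qed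
  finally show ?case .
qed

section \<open>The annihilator and the elements v^H in it\<close>

definition Ann :: "(('v, 'e) lpa_gen, 'k) free_poly all_quotients set" where
  "Ann = {x \<in> alg. \<forall>m\<in>Xs. \<forall>b. act x m b \<in> I}"

lemma Ann_aideal: "aideal Ann"
  unfolding aideal_def Ann_def
  using I by (auto simp: act_zero act_add act_mult alg_add alg_mult act_pres)

lemma delta_Xs: "b \<in> B \<Longrightarrow> delta b r \<in> Xs"
  by (auto simp: Xs_def delta_def)

lemma vt_Ann: "v \<in> verts E \<Longrightarrow> vt v \<in> Ann \<longleftrightarrow> (\<forall>b\<in>B. src b \<noteq> v)"
proof
  assume v: "v \<in> verts E" "vt v \<in> Ann"
  show "\<forall>b\<in>B. src b \<noteq> v"
  proof
    fix b assume b: "b \<in> B"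
    have "act (vt v) (delta b 1) b \<in> I" using v(2) delta_Xs[OF b] by (auto simp: Ann_def)
    then show "src b \<noteq> v" using I(4) b by (auto simp: act_vt[OF v(1)] delta_def)
  qed
qed (use I vt_alg act_vt in \<open>auto simp: Ann_def\<close>)

lemma act_bel:
  assumes "u \<in> verts E" "finite (arcs_outside E H u)"
  shows "act (bel H u) m b = (if b \<in> B \<and> src b = u \<and> first b \<notin> Some ` arcs_outside E H u then m b else 0)"
proof -
  have e: "ed e * gh e \<in> alg" "act (ed e * gh e) m b = op (Edge e) (op (Ghost e) m) b" if "e \<in> arcs_outside E H u" for e
  proof -
    have "e \<in> arcs E" using that by (auto simp: arcs_outside_def)
    then show "ed e * gh e \<in> alg" "act (ed e * gh e) m b = op (Edge e) (op (Ghost e) m) b"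
      using alg_mult ed_alg gh_alg act_mult act_ed act_gh by (auto simp del: op.simps)
  qed
  have "act (bel H u) m b = op (Vert u) m b - (\<Sum>e\<in>arcs_outside E H u. op (Edge e) (op (Ghost e) m) b)"
    unfolding bel_def
    using act_diff[OF vt_alg[OF assms(1)] alg_sum[of "arcs_outside E H u"]] act_sum[OF assms(2)] e act_vt[OF assms(1)]
    by (simp del: op.simps cong: sum.cong)
  also have "(\<Sum>e\<in>arcs_outside E H u. op (Edge e) (op (Ghost e) m) b) =
      (\<Sum>e\<in>arcs_outside E H u. if first b = Some e \<and> b \<in> B then m b else 0)"
  proof (rule sum.cong[OF refl])
    fix e assume "e \<in> arcs_outside E H u"
    have "t e * (t' e * x) = x" for x using t[of e] by (simp add: mult.assoc[symmetric])
    then show "op (Edge e) (op (Ghost e) m) b = (if first b = Some e \<and> b \<in> B then m b else 0)"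
      using first[of b e] by auto
  qed
  also have "\<dots> = (if b \<in> B \<and> first b \<in> Some ` arcs_outside E H u then m b else 0)"
  proof (cases "first b")
    case (Some f)
    have "(\<Sum>e\<in>arcs_outside E H u. if first b = Some e \<and> b \<in> B then m b else 0) =
        (\<Sum>e\<in>arcs_outside E H u. if f = e then if b \<in> B then m b else 0 else 0)"
      using Some by (intro sum.cong) auto
    then show ?thesis using assms(2) Some by auto
  qed auto
  finally show ?thesis using first by (auto simp: arcs_outside_def)
qed

lemma bel_Ann:
  assumes "u \<in> verts E" "finite (arcs_outside E H u)"
  shows "bel H u \<in> Ann \<longleftrightarrow> (\<forall>b\<in>B. src b = u \<longrightarrow> first b \<in> Some ` arcs_outside E H u)"
proof
  assume a: "bel H u \<in> Ann"
  show "\<forall>b\<in>B. src b = u \<longrightarrow> first b \<in> Some ` arcs_outside E H u"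
  proof (intro ballI impI)
    fix b assume b: "b \<in> B" "src b = u"
    have "act (bel H u) (delta b 1) b \<in> I" using a delta_Xs[OF b(1)] by (auto simp: Ann_def)
    then show "first b \<in> Some ` arcs_outside E H u"
      using I(4) b by (auto simp: act_bel[OF assms] delta_def split: if_splits)
  qed
qed (use I bel_alg[OF assms] in \<open>auto simp: Ann_def act_bel[OF assms]\<close>)

lemma first_outside: "b \<in> B \<Longrightarrow> first b = Some e \<Longrightarrow> e \<in> arcs_outside E (vanish Ann) (src b)"
  using first[of b e] vt_Ann[of "head E e"] by (auto simp: arcs_outside_def vanish_def)

text \<open>The range of a first edge carries the rest of the element and so lies outside of the
  vanishing vertices. Hence the element at u keeps only those members of B at u that have no first
  edge.\<close>

lemma breaking_Ann:
  assumes "u \<in> breaking_vertices E (vanish Ann)"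
  shows "bel (vanish Ann) u \<in> Ann \<longleftrightarrow> (\<forall>b\<in>B. src b = u \<longrightarrow> first b \<noteq> None)"
proof -
  have "u \<in> verts E" "finite (arcs_outside E (vanish Ann) u)" using assms by (auto simp: breaking_vertices_def)
  then show ?thesis using bel_Ann first_outside by (fastforce simp: image_iff)
qed

end

text \<open>These conditions make the module simple: by \<open>isolate\<close> a ghost path
  separates one member of a finite set from the others, by \<open>connect\<close> each member of B
  shares a remainder with \<open>b0\<close>, and by \<open>scalar\<close> every coefficient is
  realised at \<open>b0\<close>.\<close>

locale simple_branch_mod = branch_mod E K t t' \<iota> I B src first rest cons
  for E :: "('v, 'e) pre_digraph" and K :: "'k::field itself"
    and t t' :: "'e \<Rightarrow> 'r::comm_ring_1" and \<iota> I and B :: "'b set" and src first rest cons +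
  fixes b0 :: 'b
  assumes b0: "b0 \<in> B"
    and isolate: "finite F \<Longrightarrow> F \<noteq> {} \<Longrightarrow> F \<subseteq> B \<Longrightarrow>
      \<exists>p v b1. b1 \<in> B \<and> awalk v p (src b1) \<and> consl p b1 \<in> F \<and>
        (\<forall>b2\<in>B. src b2 = src b1 \<longrightarrow> consl p b2 \<in> F \<longrightarrow> b2 = b1)"
    and connect: "b \<in> B \<Longrightarrow> \<exists>p q v w b1. b1 \<in> B \<and> awalk v p (src b1) \<and> awalk w q (src b1) \<and>
        consl p b1 = b \<and> consl q b1 = b0"
    and scalar: "\<exists>a\<in>alg. \<forall>r. act a (delta b0 r) = delta b0 (s * r)"
begin

text \<open>Remove p and prepend q, or the other way round; the units collected on the two ways are
  inverse to each other.\<close>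

lemma transport:
  assumes "b \<in> B"
  obtains a1 a2 r1 r2 where "a1 \<in> alg" "a2 \<in> alg" "\<And>r. act a1 (delta b r) = delta b0 (r1 * r)"
    "\<And>r. act a2 (delta b0 r) = delta b (r2 * r)" "r1 * r2 = 1"
proof -
  obtain p q v w b1 where b1: "b1 \<in> B" "awalk v p (src b1)" "awalk w q (src b1)" "consl p b1 = b" "consl q b1 = b0"
    using connect[OF assms] by blast
  have "act (pe w q * ge v p) (delta b r) = delta b0 ((tp q * tp' p) * r)" for r
    using act_mult[OF pe_alg[OF b1(3)] ge_alg[OF b1(2)]] act_ge_delta[OF b1(1,2)] act_pe_delta[OF b1(1,3)] b1(4,5)
    by (simp add: mult.assoc)
  moreover have "act (pe v p * ge w q) (delta b0 r) = delta b ((tp p * tp' q) * r)" for r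
    using act_mult[OF pe_alg[OF b1(2)] ge_alg[OF b1(3)]] act_ge_delta[OF b1(1,3)] act_pe_delta[OF b1(1,2)] b1(4,5)
    by (simp add: mult.assoc)
  moreover have "(tp q * tp' p) * (tp p * tp' q) = 1"
  proof -
    have "(tp q * tp' p) * (tp p * tp' q) = (tp p * tp' p) * (tp q * tp' q)" by (simp only: mult_ac)
    then show ?thesis by (simp add: tp_tp')
  qed
  ultimately show ?thesis
    using that[of "pe w q * ge v p" "pe v p * ge w q"] b1 pe_alg ge_alg alg_mult by blast
qed

lemma I_diff: "x \<in> I \<Longrightarrow> y \<in> I \<Longrightarrow> x - y \<in> I"
  using I(2)[of x "(- 1) * y"] I(3)[of y "- 1"] by simp

text \<open>A ghost path isolates one coefficient outside of I. It is transported to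
  \<open>b0\<close> and inverted there modulo I, using \<open>scalar\<close> and the maximality of
  I; from \<open>b0\<close> every indicator with every coefficient is reached.\<close>

lemma simple:
  assumes m: "m \<in> Xs" "m b \<notin> I" and z: "z \<in> Xs"
  shows "\<exists>a\<in>alg. \<forall>b. act a m b - z b \<in> I"
proof -
  define U where "U = {z. \<exists>a\<in>alg. \<forall>b. act a m b - z b \<in> I}"
  have U_cong: "z' \<in> U" if zU: "z \<in> U" and zz': "\<And>b. z b - z' b \<in> I" for z z'
  proof -
    obtain a where a: "a \<in> alg" "\<And>b. act a m b - z b \<in> I" using zU by (auto simp: U_def)
    have "act a m b - z' b \<in> I" for b using I(2)[OF a(2)[of b] zz'[of b]] by simp
    then show ?thesis using a(1) by (auto simp: U_def)
  qed
  have U_add: "(\<lambda>b. z b + z' b) \<in> U" if zz: "z \<in> U" "z' \<in> U" for z z'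
  proof -
    obtain a a' where a: "a \<in> alg" "\<And>b. act a m b - z b \<in> I" "a' \<in> alg" "\<And>b. act a' m b - z' b \<in> I"
      using zz by (auto simp: U_def)
    have "act (a + a') m b - (z b + z' b) \<in> I" for b
      using I(2)[OF a(2)[of b] a(4)[of b]] unfolding act_add[OF a(1,3)] by (simp add: algebra_simps)
    then show ?thesis using alg_add[OF a(1,3)] by (auto simp: U_def)
  qed
  have U_act: "act x z \<in> U" if zx: "z \<in> U" "x \<in> alg" for x z
  proof -
    obtain a where a: "a \<in> alg" "\<And>b. act a m b - z b \<in> I" using zx(1) by (auto simp: U_def)
    have "act x (\<lambda>b. act a m b - z b) b \<in> I" for b by (rule act_pres(2)[OF zx(2) a(2)])
    then have "act (x * a) m b - act x z b \<in> I" for b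
      by (simp add: act_mult[OF zx(2) a(1)] act_diff_right)
    then show ?thesis using alg_mult[OF zx(2) a(1)] by (auto simp: U_def)
  qed
  have U_m: "act a m \<in> U" if "a \<in> alg" for a
    unfolding U_def using that I(1) by (intro CollectI bexI[of _ a]) auto
  \<comment> \<open>The support is taken modulo I, since functions with values in I are 0 in the
    module.\<close>
  define F where "F = {b. m b \<notin> I}"
  have F: "finite F" "F \<noteq> {}" "F \<subseteq> B"
    using m I(1) by (auto simp: F_def Xs_def intro: finite_subset[of _ "{b. m b \<noteq> 0}"])
  obtain p v b1 where b1: "b1 \<in> B" "awalk v p (src b1)" "consl p b1 \<in> F"
    "\<And>b2. b2 \<in> B \<Longrightarrow> src b2 = src b1 \<Longrightarrow> consl p b2 \<in> F \<Longrightarrow> b2 = b1"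
    using isolate[OF F] by blast
  define r where "r = tp' p * m (consl p b1)"
  have rI: "r \<notin> I"
  proof
    assume "r \<in> I"
    then have "tp p * r \<in> I" by (rule I(3))
    then have "m (consl p b1) \<in> I" by (simp add: r_def mult.assoc[symmetric] tp_tp')
    then show False using b1(3) by (simp add: F_def)
  qed
  have "delta b1 r \<in> U"
  proof (rule U_cong[OF U_m[OF ge_alg[OF b1(2)]]])
    fix b
    show "act (ge v p) m b - delta b1 r b \<in> I"
    proof (cases "b = b1")
      case True
      then show ?thesis using b1(1) I(1) by (simp add: act_ge[OF b1(2)] delta_def r_def)
    next
      case False
      then have "b \<in> B \<Longrightarrow> src b = src b1 \<Longrightarrow> m (consl p b) \<in> I" using b1(4)[of b] by (auto simp: F_def)
      then show ?thesis using False I(1,3) by (simp add: act_ge[OF b1(2)] delta_def)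
    qed
  qed
  moreover obtain a1 a2 r1 r2 where tr: "a1 \<in> alg" "a2 \<in> alg" "\<And>r. act a1 (delta b1 r) = delta b0 (r1 * r)"
    "\<And>r. act a2 (delta b0 r) = delta b1 (r2 * r)" "r1 * r2 = 1"
    by (rule transport[OF b1(1)]) (metis (no_types) that)
  ultimately have d0: "delta b0 (r1 * r) \<in> U" using U_act by metis
  have "r1 * r \<notin> I"
  proof
    assume "r1 * r \<in> I"
    then have "r2 * (r1 * r) \<in> I" by (rule I(3))
    then show False using tr(5) rI by (simp add: mult.assoc[symmetric] mult.commute)
  qed
  then obtain s where s: "s * (r1 * r) - 1 \<in> I" using I_max by blast
  have all0: "delta b0 s' \<in> U" for s'
  proof -
    obtain a where a: "a \<in> alg" "\<And>r. act a (delta b0 r) = delta b0 ((s' * s) * r)" using scalar by blast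
    have "delta b0 ((s' * s) * (r1 * r)) \<in> U" using U_act[OF d0 a(1)] a(2) by simp
    then show ?thesis
    proof (rule U_cong)
      fix b
      have "s' * (s * (r1 * r) - 1) \<in> I" by (rule I(3)[OF s])
      then show "delta b0 ((s' * s) * (r1 * r)) b - delta b0 s' b \<in> I"
        using I(1) by (auto simp: delta_def algebra_simps)
    qed
  qed
  have all: "delta b' s' \<in> U" if b': "b' \<in> B" for b' s'
  proof -
    obtain a1 a2 r1 r2 where tr: "a1 \<in> alg" "a2 \<in> alg" "\<And>r. act a1 (delta b' r) = delta b0 (r1 * r)"
      "\<And>r. act a2 (delta b0 r) = delta b' (r2 * r)" "r1 * r2 = 1"
      by (rule transport[OF b']) (metis (no_types) that)
    have "act a2 (delta b0 (r1 * s')) \<in> U" using U_act[OF all0 tr(2)] .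
    moreover have "r2 * (r1 * s') = s'" using tr(5) by (simp add: mult.assoc[symmetric] mult.commute)
    ultimately show ?thesis using tr(4) by simp
  qed
  have zero: "(\<lambda>b. 0) \<in> U" using U_m[OF alg_zero] by (simp add: act_zero)
  have "(\<lambda>b. \<Sum>b'\<in>A. delta b' (z b') b) \<in> U" if "finite A" "A \<subseteq> B" for A
    using that by (induction A rule: finite_induct) (auto simp: zero intro!: U_add all)
  then have "(\<lambda>b. \<Sum>b'\<in>{b. z b \<noteq> 0}. delta b' (z b') b) \<in> U" using z by (auto simp: Xs_def)
  moreover have "(\<lambda>b. \<Sum>b'\<in>{b. z b \<noteq> 0}. delta b' (z b') b) = z"
  proof
    fix b show "(\<Sum>b'\<in>{b. z b \<noteq> 0}. delta b' (z b') b) = z b"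
      using z by (cases "z b = 0") (auto simp: delta_def Xs_def sum.delta' cong: if_cong)
  qed
  ultimately show ?thesis by (auto simp: U_def)
qed

text \<open>The maximal left ideal is the annihilator, modulo I, of the indicator of
  \<open>b0\<close>; the vertex of \<open>b0\<close> fixes this vector and serves as u.\<close>

theorem left_prim_Ann: "left_prim alg Ann"
proof -
  let ?d = "delta b0 1"
  define N where "N = {x \<in> alg. \<forall>b. act x ?d b \<in> I}"
  let ?u = "vt (src b0)"
  have u: "?u \<in> alg" "act ?u ?d = ?d" using vt_alg[OF src[OF b0]] act_vt[OF src[OF b0]] b0 by (auto simp: delta_def)
  have dX: "?d \<in> Xs" by (rule delta_Xs[OF b0])
  show ?thesis
    unfolding left_prim_def
  proof (intro exI[of _ N] exI[of _ ?u] conjI ballI)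
    show "N \<subseteq> alg" by (auto simp: N_def)
    show "x - y \<in> N" if "x \<in> N" "y \<in> N" for x y
      using that alg_diff I_diff by (auto simp: N_def act_diff)
    show "a * x \<in> N" if "a \<in> alg" "x \<in> N" for a x
      using that alg_mult act_pres(2)[of a "act x ?d"] by (auto simp: N_def act_mult)
    show "?u \<in> alg" by (rule u)
    show "?u \<notin> N" using u I(4) by (auto simp: N_def delta_def)
    show "x * ?u - x \<in> N" if "x \<in> alg" for x
      using that u alg_mult alg_diff I(1) by (auto simp: N_def act_mult act_diff)
    show "\<exists>y\<in>alg. y * x - z \<in> N" if xz: "x \<in> alg - N" "z \<in> alg" for x z
    proof -
      have x: "x \<in> alg" using xz by blast
      obtain b where "act x ?d b \<notin> I" using xz by (auto simp: N_def)
      then obtain y where "y \<in> alg" "\<And>b. act y (act x ?d) b - act z ?d b \<in> I"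
        using simple[OF act_pres(1)[OF x dX] _ act_pres(1)[OF xz(2) dX]] by blast
      then show ?thesis using x xz(2) alg_mult alg_diff
        by (intro bexI[of _ y]) (auto simp: N_def act_mult act_diff)
    qed
    show "Ann = {x \<in> alg. \<forall>y\<in>alg. x * y \<in> N}"
    proof (intro equalityI subsetI)
      fix x assume "x \<in> Ann"
      then show "x \<in> {x \<in> alg. \<forall>y\<in>alg. x * y \<in> N}"
        using act_pres(1)[OF _ dX] alg_mult by (auto simp: Ann_def N_def act_mult)
    next
      fix x assume x: "x \<in> {x \<in> alg. \<forall>y\<in>alg. x * y \<in> N}"
      have "act x m b \<in> I" if m: "m \<in> Xs" for m b
      proof -
        have "?d b0 \<notin> I" using I(4) by (simp add: delta_def)
        then obtain y where y: "y \<in> alg" "\<And>b. act y ?d b - m b \<in> I" using simple[OF dX _ m] by blast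
        have xa: "x \<in> alg" using x by blast
        have "act x (\<lambda>b. act y ?d b - m b) b \<in> I" by (rule act_pres(2)[OF xa y(2)])
        then have "act (x * y) ?d b - act x m b \<in> I" by (simp add: act_diff_right act_mult[OF xa y(1)])
        moreover have "act (x * y) ?d b \<in> I" using x y(1) by (auto simp: N_def)
        ultimately have "act (x * y) ?d b - (act (x * y) ?d b - act x m b) \<in> I" by (rule I_diff[rotated])
        then show ?thesis by simp
      qed
      then show "x \<in> Ann" using x by (auto simp: Ann_def)
    qed
  qed
qed

end

section \<open>Modules of infinite paths\<close>

locale path_mod = lpa_emb E K + coeffs t t' \<iota> I
  for E :: "('v, 'e) pre_digraph" and K :: "'k::field itself"
    and t t' :: "'e \<Rightarrow> 'r::comm_ring_1" and \<iota> :: "'k \<Rightarrow> 'r" and I :: "'r set" +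
  fixes \<alpha> :: "nat \<Rightarrow> 'e"
  assumes \<alpha>: "infinite_path E \<alpha>"
begin

text \<open>The tail equivalence class of \<alpha>: initial segments of different lengths may be
  removed from the two paths. The functions on it form a Chen module, twisted by t.\<close>

definition tails :: "(nat \<Rightarrow> 'e) set" where
  "tails = {\<beta>. infinite_path E \<beta> \<and> (\<exists>n m. \<forall>i. \<beta> (n + i) = \<alpha> (m + i))}"

lemma tails_rest: "\<beta> \<in> tails \<Longrightarrow> (\<lambda>i. \<beta> (n + i)) \<in> tails"
proof -
  assume "\<beta> \<in> tails"
  then obtain k m where b: "infinite_path E \<beta>" "\<And>i. \<beta> (k + i) = \<alpha> (m + i)" by (auto simp: tails_def)
  have "\<beta> (n + (k + i)) = \<alpha> (n + m + i)" for i using b(2)[of "n + i"] by (simp add: ac_simps)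
  then show ?thesis using b(1) unfolding tails_def
    by (intro CollectI conjI exI[of _ k] exI[of _ "n + m"]) (auto simp: infinite_path_def)
qed

lemma tails_cons:
  assumes "\<beta> \<in> tails" "e \<in> arcs E" "tail E (\<beta> 0) = head E e"
  shows "case_nat e \<beta> \<in> tails"
proof -
  obtain k m where b: "infinite_path E \<beta>" "\<And>i. \<beta> (k + i) = \<alpha> (m + i)"
    using assms(1) by (auto simp: tails_def)
  then show ?thesis using assms(2,3) unfolding tails_def
    by (intro CollectI conjI exI[of _ "Suc k"] exI[of _ m]) (auto simp: infinite_path_def split: nat.split)
qed

lemma tails_arc: "\<beta> \<in> tails \<Longrightarrow> \<beta> i \<in> arcs E \<and> head E (\<beta> i) = tail E (\<beta> (Suc i))"
  by (simp add: tails_def infinite_path_def)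

sublocale branch_mod E K t t' \<iota> I tails "\<lambda>\<beta>. tail E (\<beta> 0)" "\<lambda>\<beta>. Some (\<beta> 0)" "\<lambda>\<beta> i. \<beta> (Suc i)" "\<lambda>e \<beta>. case_nat e \<beta>"
proof unfold_locales
  fix \<beta> assume b: "\<beta> \<in> tails"
  show "tail E (\<beta> 0) \<in> verts E" using tails_arc[OF b] by simp
  show "e \<in> arcs E \<and> tail E e = tail E (\<beta> 0) \<and> (\<lambda>i. \<beta> (Suc i)) \<in> tails \<and>
      tail E (\<beta> (Suc 0)) = head E e \<and> case_nat e (\<lambda>i. \<beta> (Suc i)) = \<beta>" if "Some (\<beta> 0) = Some e" for e
    using that tails_arc[OF b] tails_rest[OF b, of 1] by (auto simp: fun_eq_iff split: nat.split)
  show "case_nat e \<beta> \<in> tails \<and> Some (case_nat e \<beta> 0) = Some e \<and> (\<lambda>i. case_nat e \<beta> (Suc i)) = \<beta>"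
    if "e \<in> arcs E" "tail E (\<beta> 0) = head E e" for e
    using tails_cons[OF b that] by simp
qed auto

lemma consl_path: "consl p \<beta> = (\<lambda>i. if i < length p then p ! i else \<beta> (i - length p))"
  by (induction p) (auto simp: fun_eq_iff split: nat.split)

lemma tails_walk: "\<beta> \<in> tails \<Longrightarrow> awalk (tail E (\<beta> 0)) (map \<beta> [0..<n]) (tail E (\<beta> n))"
proof (induction n)
  case 0
  then show ?case using tails_arc by (simp add: awalk_Nil_iff)
next
  case (Suc n)
  then show ?case using tails_arc[OF Suc.prems, of n] head_in_verts[of "\<beta> n"]
    by (auto intro!: awalk_cat[OF Suc.IH[OF Suc.prems]] simp: awalk_simps)
qed

lemma consl_prefix: "consl (map \<beta> [0..<n]) (\<lambda>i. \<beta> (n + i)) = \<beta>"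
  by (auto simp: consl_path fun_eq_iff)

text \<open>Finitely many infinite paths differ pairwise before some position N, so an initial
  segment of length N belongs to only one of them.\<close>

lemma path_isolate:
  assumes F: "finite F" "F \<noteq> {}" "F \<subseteq> tails"
  shows "\<exists>p v b1. b1 \<in> tails \<and> awalk v p (tail E (b1 0)) \<and> consl p b1 \<in> F \<and>
      (\<forall>b2\<in>tails. tail E (b2 0) = tail E (b1 0) \<longrightarrow> consl p b2 \<in> F \<longrightarrow> b2 = b1)"
proof -
  define d where "d x = (LEAST i. fst x i \<noteq> snd x i)" for x :: "(nat \<Rightarrow> 'e) \<times> (nat \<Rightarrow> 'e)"
  \<comment> \<open>The sum bounds each position of a first difference; the values of d at equal
    pairs can only enlarge it.\<close>
  define N where "N = Suc (\<Sum>x\<in>F \<times> F. d x)"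
  have eq: "x = y" if xy: "x \<in> F" "y \<in> F" "\<And>i. i < N \<Longrightarrow> x i = y i" for x y
  proof (rule ccontr)
    assume "x \<noteq> y"
    then obtain i where "x i \<noteq> y i" by auto
    then have "x (d (x, y)) \<noteq> y (d (x, y))" unfolding d_def using LeastI[of "\<lambda>i. x i \<noteq> y i"] by simp
    moreover have "d (x, y) < N"
      unfolding N_def using F(1) xy member_le_sum[of "(x, y)" "F \<times> F" d] by (simp add: less_Suc_eq_le)
    ultimately show False using xy(3) by blast
  qed
  obtain \<beta> where b: "\<beta> \<in> F" using F(2) by blast
  show ?thesis
  proof (intro exI conjI ballI impI)
    show "(\<lambda>i. \<beta> (N + i)) \<in> tails" using tails_rest b F(3) by blast
    show "awalk (tail E (\<beta> 0)) (map \<beta> [0..<N]) (tail E (\<beta> (N + 0)))" using tails_walk b F(3) by auto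
    show "consl (map \<beta> [0..<N]) (\<lambda>i. \<beta> (N + i)) \<in> F" using b consl_prefix by simp
    fix b2 assume "consl (map \<beta> [0..<N]) b2 \<in> F"
    then have "consl (map \<beta> [0..<N]) b2 = \<beta>" by (intro eq b) (auto simp: consl_path)
    then have "\<beta> (N + i) = b2 i" for i using fun_cong[of _ _ "N + i"] by (fastforce simp: consl_path)
    then show "b2 = (\<lambda>i. \<beta> (N + i))" by auto
  qed
qed

lemma \<alpha>_tails: "\<alpha> \<in> tails"
  unfolding tails_def using \<alpha> by blast

lemma path_connect:
  assumes "b \<in> tails"
  shows "\<exists>p q v w b1. b1 \<in> tails \<and> awalk v p (tail E (b1 0)) \<and> awalk w q (tail E (b1 0)) \<and> consl p b1 = b \<and> consl q b1 = \<alpha>"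
proof -
  obtain n m where nm: "\<And>i. b (n + i) = \<alpha> (m + i)" using assms by (auto simp: tails_def)
  then have e: "(\<lambda>i. b (n + i)) = (\<lambda>i. \<alpha> (m + i))" "b n = \<alpha> m" using nm[of 0] by auto
  show ?thesis
  proof (intro exI conjI)
    show "(\<lambda>i. b (n + i)) \<in> tails" by (rule tails_rest[OF assms])
    show "awalk (tail E (b 0)) (map b [0..<n]) (tail E (b (n + 0)))" using tails_walk[OF assms] by simp
    show "awalk (tail E (\<alpha> 0)) (map \<alpha> [0..<m]) (tail E (b (n + 0)))" using tails_walk[OF \<alpha>_tails] e(2) by simp
    show "consl (map b [0..<n]) (\<lambda>i. b (n + i)) = b" by (rule consl_prefix)
    show "consl (map \<alpha> [0..<m]) (\<lambda>i. b (n + i)) = \<alpha>" unfolding e(1) by (rule consl_prefix)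
  qed
qed

lemma path_left_prim:
  assumes "\<And>s. \<exists>a\<in>alg. \<forall>r. act a (delta \<alpha> r) = delta \<alpha> (s * r)"
  shows "left_prim alg Ann"
proof -
  interpret simple_branch_mod E K t t' \<iota> I tails "\<lambda>\<beta>. tail E (\<beta> 0)" "\<lambda>\<beta>. Some (\<beta> 0)" "\<lambda>\<beta> i. \<beta> (Suc i)"
    "\<lambda>e \<beta>. case_nat e \<beta>" \<alpha>
    by unfold_locales (fact \<alpha>_tails path_isolate path_connect assms)+
  show ?thesis by (rule left_prim_Ann)
qed

lemma vanish_path: "vanish Ann = verts E - root_set E (infinite_path_verts E \<alpha>)"
proof -
  have "(\<exists>b\<in>tails. tail E (b 0) = v) \<longleftrightarrow> v \<in> root_set E (infinite_path_verts E \<alpha>)" if v: "v \<in> verts E" for v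
  proof
    assume "\<exists>b\<in>tails. tail E (b 0) = v"
    then obtain b where b: "b \<in> tails" "tail E (b 0) = v" by blast
    then obtain n m where "\<And>i. b (n + i) = \<alpha> (m + i)" by (auto simp: tails_def)
    from this[of 0] have "b n = \<alpha> m" by simp
    then have "path_geq E v (tail E (\<alpha> m))" using tails_walk[OF b(1), of n] b(2) by (auto simp: path_geq_def)
    then show "v \<in> root_set E (infinite_path_verts E \<alpha>)"
      using v by (auto simp: root_set_def infinite_path_verts_def)
  next
    assume "v \<in> root_set E (infinite_path_verts E \<alpha>)"
    then obtain p m where "awalk v p (tail E (\<alpha> m))"
      by (auto simp: root_set_def infinite_path_verts_def path_geq_def)
    then show "\<exists>b\<in>tails. tail E (b 0) = v"
      using consl_B[OF tails_rest[OF \<alpha>_tails, of m], of v p] by auto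
  qed
  then have "v \<in> vanish Ann \<longleftrightarrow> v \<in> verts E \<and> v \<notin> root_set E (infinite_path_verts E \<alpha>)" for v
    using vt_Ann[of v] by (auto simp: vanish_def)
  then show ?thesis by blast
qed

lemma breaking_path: "u \<in> breaking_vertices E (vanish Ann) \<Longrightarrow> bel (vanish Ann) u \<in> Ann"
  using breaking_Ann by simp

end

section \<open>Infinite path modules over the field\<close>

context lpa_emb
begin

lemma field_coeffs: "coeffs (\<lambda>e. 1) (\<lambda>e. 1) (\<lambda>k. k) {0 :: 'k}"
proof
  fix x :: 'k assume "x \<notin> {0}"
  then have "inverse x * x - 1 \<in> {0}" by simp
  then show "\<exists>s. s * x - 1 \<in> {0}" by blast
qed auto

lemma infinite_path_prim:
  assumes "infinite_path E \<alpha>"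
  obtains P where "left_prim alg P" "aideal P" "vanish P = verts E - root_set E (infinite_path_verts E \<alpha>)"
    "\<And>u. u \<in> breaking_vertices E (vanish P) \<Longrightarrow> bel (vanish P) u \<in> P"
proof -
  interpret C: coeffs "\<lambda>e. 1" "\<lambda>e. 1" "\<lambda>k. k" "{0 :: 'k}" by (rule field_coeffs)
  interpret M: path_mod E K "\<lambda>e. 1" "\<lambda>e. 1" "\<lambda>k. k" "{0 :: 'k}" \<alpha> by unfold_locales (rule assms)
  have v: "tail E (\<alpha> 0) \<in> verts E" using M.tails_arc[OF M.\<alpha>_tails] by simp
  have "\<exists>a\<in>alg. \<forall>r. M.act a (delta \<alpha> r) = delta \<alpha> (s * r)" for s
  proof (intro bexI allI)
    show "M.act (\<kappa> s * vt (tail E (\<alpha> 0))) (delta \<alpha> r) = delta \<alpha> (s * r)" for r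
      unfolding M.act_scale[OF vt_alg[OF v]] M.act_vt[OF v] using M.\<alpha>_tails by (auto simp: delta_def)
  qed (rule alg_scale[OF vt_alg[OF v]])
  then show ?thesis
    using that[OF M.path_left_prim M.Ann_aideal M.vanish_path M.breaking_path] by blast
qed

end

section \<open>Modules of paths ending in a singular vertex\<close>

locale end_mod = lpa_emb E K + coeffs "\<lambda>e :: 'e. 1 :: 'k" "\<lambda>e. 1" "\<lambda>k. k" "{0}"
  for E :: "('v, 'e) pre_digraph" and K :: "'k::field itself" +
  fixes u :: 'v
  assumes u: "u \<in> verts E" "\<not> regular_vertex E u"
begin

definition ends :: "'e list set" where "ends = {p. \<exists>w. awalk w p u}"

definition src :: "'e list \<Rightarrow> 'v" where "src p = (case p of [] \<Rightarrow> u | e # _ \<Rightarrow> tail E e)"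

definition first :: "'e list \<Rightarrow> 'e option" where "first p = (case p of [] \<Rightarrow> None | e # _ \<Rightarrow> Some e)"

lemma ends_iff: "p \<in> ends \<longleftrightarrow> awalk (src p) p u"
  by (cases p) (auto simp: ends_def src_def awalk_simps u)

sublocale branch_mod E K "\<lambda>e. 1" "\<lambda>e. 1" "\<lambda>k. k" "{0}" ends src first tl "(#)"
proof unfold_locales
  fix p assume p: "p \<in> ends"
  show "src p \<in> verts E" using p by (auto simp: ends_iff)
  show "e \<in> arcs E \<and> tail E e = src p \<and> tl p \<in> ends \<and> src (tl p) = head E e \<and> e # tl p = p"
    if "first p = Some e" for e
  proof (cases p)
    case (Cons f q)
    then have "awalk (head E e) q u" "e \<in> arcs E" "f = e"
      using p that by (auto simp: ends_iff src_def first_def awalk_simps)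
    then show ?thesis using Cons by (cases q) (auto simp: ends_def src_def awalk_simps)
  qed (use that in \<open>simp add: first_def\<close>)
  show "e # p \<in> ends \<and> first (e # p) = Some e \<and> tl (e # p) = p" if "e \<in> arcs E" "src p = head E e" for e
    using p that by (auto simp: ends_iff first_def awalk_simps src_def)
  show "\<not> regular_vertex E (src p)" if "first p = None"
    using that u(2) by (cases p) (auto simp: first_def src_def)
qed

lemma consl_end: "consl p q = p @ q"
  by (induction p) auto

lemma end_left_prim: "left_prim alg Ann"
proof -
  have nil: "[] \<in> ends" "src [] = u" using u by (auto simp: ends_iff src_def awalk_simps)
  interpret simple_branch_mod E K "\<lambda>e. 1" "\<lambda>e. 1" "\<lambda>k. k" "{0}" ends src first tl "(#)" "[]"
  proof unfold_locales
    show "[] \<in> ends" by (rule nil)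
    show "\<exists>p v b1. b1 \<in> ends \<and> awalk v p (src b1) \<and> consl p b1 \<in> F \<and>
        (\<forall>b2\<in>ends. src b2 = src b1 \<longrightarrow> consl p b2 \<in> F \<longrightarrow> b2 = b1)"
      if F: "finite F" "F \<noteq> {}" "F \<subseteq> ends" for F
    proof -
      \<comment> \<open>No member of F properly extends one of maximal length, so removing the
        latter isolates the trivial path.\<close>
      have "Max (length ` F) \<in> length ` F" using F by (intro Max_in) auto
      then obtain p where p: "p \<in> F" "Max (length ` F) = length p" by auto
      have len: "length q \<le> length p" if "q \<in> F" for q
        unfolding p(2)[symmetric] using that F(1) by simp
      have "b2 = []" if "consl p b2 \<in> F" for b2 using len[OF that] by (simp add: consl_end)
      moreover have "consl p [] \<in> F" "awalk (src p) p (src [])"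
        using p(1) F(3) nil(2) by (auto simp: consl_end ends_iff)
      ultimately show ?thesis using nil(1) by blast
    qed
    show "\<exists>p q v w b1. b1 \<in> ends \<and> awalk v p (src b1) \<and> awalk w q (src b1) \<and> consl p b1 = b \<and> consl q b1 = []"
      if "b \<in> ends" for b
      using that nil u by (intro exI[of _ b] exI[of _ "[]"] exI[of _ "src b"] exI[of _ u])
        (auto simp: consl_end ends_iff awalk_simps)
    show "\<exists>a\<in>alg. \<forall>r. act a (delta [] r) = delta [] (s * r)" for s
    proof (intro bexI allI)
      show "act (\<kappa> s * vt u) (delta [] r) = delta [] (s * r)" for r
        unfolding act_scale[OF vt_alg[OF u(1)]] act_vt[OF u(1)] using nil by (auto simp: delta_def)
    qed (rule alg_scale[OF vt_alg[OF u(1)]])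
  qed
  show ?thesis by (rule left_prim_Ann)
qed

lemma vanish_end: "vanish Ann = verts E - root_set E {u}"
proof -
  have "(\<exists>p\<in>ends. src p = w) \<longleftrightarrow> w \<in> root_set E {u}" if w: "w \<in> verts E" for w
  proof
    assume "w \<in> root_set E {u}"
    then obtain p where p: "awalk w p u" by (auto simp: root_set_def path_geq_def)
    then have "src p = w" by (cases p) (auto simp: src_def awalk_simps)
    then show "\<exists>p\<in>ends. src p = w" using p by (auto simp: ends_def)
  qed (use w in \<open>auto simp: root_set_def path_geq_def ends_iff\<close>)
  then have "v \<in> vanish Ann \<longleftrightarrow> v \<in> verts E \<and> v \<notin> root_set E {u}" for v
    using vt_Ann[of v] by (auto simp: vanish_def)
  then show ?thesis by blast
qed

lemma breaking_end:
  "w \<in> breaking_vertices E (vanish Ann) \<Longrightarrow> bel (vanish Ann) w \<in> Ann \<longleftrightarrow> w \<noteq> u"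
  using breaking_Ann[of w] u by (auto simp: first_def src_def ends_iff awalk_simps split: list.splits)

text \<open>A closed path of positive length prolongs q, so y contributes nothing to the coefficient
  at q of the image of q. This coefficient is k.\<close>

lemma loop_poly_end:
  assumes k: "k \<noteq> 0" and y: "y \<in> loops w" and P: "\<kappa> k * vt w + y \<in> Ann" and w: "w \<in> verts E - vanish Ann"
  shows False
proof -
  obtain q where q: "q \<in> ends" "src q = w" using w vt_Ann by (auto simp: vanish_def)
  have "y \<in> alg \<and> act y (delta q 1) q = 0"
    using y unfolding loops_def
  proof induction
    case lspan_zero
    show ?case by (simp add: act_zero)
  next
    case (lspan_step x y k)
    then obtain p where p: "x = pe w p" "awalk w p w" "p \<noteq> []" by blast
    have x: "x \<in> alg" using p pe_alg by simp
    have "act x (delta q 1) q = 0" using act_pe_delta[OF q(1), of w p] p q(2) by (simp add: delta_def consl_end)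
    then show ?case
      using lspan_step.IH act_add[OF alg_scale[OF x]] act_scale[OF x] alg_add[OF alg_scale[OF x]] by simp
  qed
  then have y': "y \<in> alg" "act y (delta q 1) q = 0" by auto
  have v: "w \<in> verts E" "vt w \<in> alg" using w vt_alg by auto
  have "act (\<kappa> k * vt w + y) (delta q 1) q = 0" using P delta_Xs[OF q(1)] by (auto simp: Ann_def)
  then show False
    using k q y'(2) unfolding act_add[OF alg_scale[OF v(2)] y'(1)] act_scale[OF v(2)] act_vt[OF v(1)]
    by (simp add: delta_def)
qed

end

context lpa_emb
begin

lemma singular_prim:
  assumes "u \<in> verts E" "\<not> regular_vertex E u"
  shows "\<exists>P. left_prim alg P \<and> aideal P \<and> vanish P = verts E - root_set E {u} \<and>
    (\<forall>w\<in>breaking_vertices E (vanish P). bel (vanish P) w \<in> P \<longleftrightarrow> w \<noteq> u) \<and>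
    (\<forall>w k y. w \<in> verts E - vanish P \<longrightarrow> k \<noteq> 0 \<longrightarrow> y \<in> loops w \<longrightarrow> \<kappa> k * vt w + y \<notin> P)"
proof -
  interpret C: coeffs "\<lambda>e. 1" "\<lambda>e. 1" "\<lambda>k. k" "{0 :: 'k}" by (rule field_coeffs)
  interpret M: end_mod E K u by unfold_locales (rule assms)+
  show ?thesis
    using M.end_left_prim M.Ann_aideal M.vanish_end M.breaking_end M.loop_poly_end
    by (intro exI[of _ M.Ann]) blast
qed

end

section \<open>Sufficiency of the five cases\<close>

text \<open>An irreducible f generates a maximal ideal, so modulo it the coefficients form a field,
  in which x is the unit attached to the edge a.\<close>

lemma laurent_coeffs:
  assumes f: "Factorial_Ring.irreducible (f :: 'k::field laurent_poly)"
  shows "coeffs (\<lambda>e. if e = a then Poly_Mapping.single 1 1 else 1)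
    (\<lambda>e. if e = a then Poly_Mapping.single (- 1) 1 else 1) (Poly_Mapping.single 0) {g. f dvd g}"
proof
  show "1 \<notin> {g. f dvd g}" using f by (auto simp: irreducible_def)
  show "\<exists>s. s * x - 1 \<in> {g. f dvd g}" if "x \<notin> {g. f dvd g}" for x
    using laurent_irreducible_maximal[OF f] that by blast
qed (auto simp: mult_single single_add)

context wf_digraph
begin

lemma cas_last: "cas u p v \<Longrightarrow> p \<noteq> [] \<Longrightarrow> head G (last p) = v"
  by (induction p arbitrary: u) auto

definition cinf :: "'b list \<Rightarrow> nat \<Rightarrow> 'b" where
  "cinf c = (\<lambda>i. c ! (i mod length c))"

lemma cinf_path:
  assumes c: "cycle c"
  shows "infinite_path G (cinf c)" "infinite_path_verts G (cinf c) = cycle_verts G c"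
proof -
  have ne: "c \<noteq> []" and w: "awalk (tail G (hd c)) c (tail G (hd c))" using cycle_awalk[OF c] by auto
  have cs: "cas (tail G (hd c)) c (tail G (hd c))" using w by (simp add: awalk_def)
  have "head G (cinf c i) = tail G (cinf c (Suc i))" for i
  proof (cases "Suc (i mod length c) = length c")
    case True
    have "i mod length c = length c - 1" "Suc i mod length c = 0" using True by (simp_all add: mod_Suc)
    then have "cinf c i = last c" "cinf c (Suc i) = hd c"
      by (simp_all add: cinf_def last_conv_nth[OF ne] hd_conv_nth[OF ne])
    then show ?thesis using cas_last[OF cs ne] by simp
  next
    case False
    then have "Suc (i mod length c) < length c" using ne by (metis Suc_lessI length_greater_0_conv mod_less_divisor)
    then show ?thesis using cas_nth[OF cs] False by (simp add: cinf_def mod_Suc)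
  qed
  moreover have "cinf c i \<in> arcs G" for i using cycle_arcs[OF c] ne by (auto simp: cinf_def)
  ultimately show "infinite_path G (cinf c)" by (simp add: infinite_path_def)
  have "range (cinf c) = set c"
  proof
    show "set c \<subseteq> range (cinf c)"
    proof
      fix e assume "e \<in> set c"
      then obtain i where "i < length c" "c ! i = e" by (auto simp: in_set_conv_nth)
      then have "e = cinf c i" by (simp add: cinf_def)
      then show "e \<in> range (cinf c)" by blast
    qed
  qed (use ne in \<open>auto simp: cinf_def\<close>)
  then show "infinite_path_verts G (cinf c) = cycle_verts G c"
    unfolding infinite_path_verts_def cycle_awalk(4)[OF c] by (metis image_image)
qed

lemma root_set_cycle:
  assumes "cycle c" "v \<in> cycle_verts G c"
  shows "root_set G (cycle_verts G c) = root_set G {v}"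
  unfolding root_set_def using assms cycle_connected[OF assms(1)] path_geq_trans by blast

end

context lpa_emb
begin

lemma lev_vt:
  assumes "awalk v c v" "c \<noteq> []"
  shows "lev c f * vt v = lev c f"
  by (simp add: lev_def sum_distrib_right mult.assoc cpow_vt[OF assms])

text \<open>Besides primitivity this records that H and S can be recovered from P; the exclusion of
  the cases rests on it.\<close>

definition prim_data where
  "prim_data P H S \<longleftrightarrow> left_prim alg P \<and> vanish P = H \<and> S = {u \<in> breaking_vertices E H. bel H u \<in> P}"

text \<open>The path ccc... is the only one of its class starting at the base, so the base projects
  onto one coefficient, on which c acts as x and g(c) as g. Hence f(c) annihilates the module modulo
  (f), and g(c) can do so only if f divides g; \<open>excl_ideal_eq\<close> then identifies the
  annihilator.\<close>

lemma exclusive_prim: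
  assumes H: "hereditary E H" and c: "exclusive_cycle E c"
    and root: "verts E - H = root_set E (cycle_verts E c)" and f: "Factorial_Ring.irreducible (f :: 'k laurent_poly)"
  shows "prim_data (cidl H c f) H (breaking_vertices E H)"
proof -
  have cyc: "cycle c" using c by (simp add: exclusive_cycle_def)
  note cw = cycle_awalk(2,1)[OF cyc]
  have Hv: "H \<subseteq> verts E" using H by (simp add: hereditary_def)
  have gens: "vt ` H \<union> bel H ` breaking_vertices E H \<union> {lev c f} \<subseteq> alg"
    using gidl_gens_alg[OF Hv order_refl] lev_alg[OF cw] by blast
  have J: "aideal (cidl H c f)" unfolding cidl_def by (rule idl_aideal[OF gens])
  have base_in: "vt ` H \<union> bel H ` breaking_vertices E H \<union> {lev c f} \<subseteq> cidl H c f"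
    unfolding cidl_def by (rule idl_base)
  have X: "leavitt_excl E \<kappa> vt ed gh H c (cidl H c f)"
    by unfold_locales (use H c root J base_in in auto)
  interpret X: leavitt_excl E \<kappa> vt ed gh H c "cidl H c f" by (rule X)
  let ?t = "\<lambda>e. if e = hd c then Poly_Mapping.single 1 1 else 1 :: 'k laurent_poly"
  let ?t' = "\<lambda>e. if e = hd c then Poly_Mapping.single (- 1) 1 else 1 :: 'k laurent_poly"
  interpret C: coeffs ?t ?t' "Poly_Mapping.single 0" "{g. f dvd g}" by (rule laurent_coeffs[OF f])
  interpret M: path_mod E K ?t ?t' "Poly_Mapping.single 0" "{g. f dvd g}" "cinf c"
    by unfold_locales (rule cinf_path(1)[OF cyc])
  let ?v = "tail E (hd c)"
  have vanish: "vanish M.Ann = H"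
    unfolding M.vanish_path cinf_path(2)[OF cyc] using root Hv by blast
  have v0: "tail E (cinf c 0) = ?v" using cw(2) by (simp add: cinf_def hd_conv_nth)
  \<comment> \<open>At each vertex of c one edge leads outside of H, so a path of the class that
    starts at the base is forced.\<close>
  have only: "\<beta> = cinf c" if b: "\<beta> \<in> M.tails" "tail E (\<beta> 0) = ?v" for \<beta>
  proof -
    have out: "\<beta> i \<in> arcs_outside E H (tail E (\<beta> i))" if "\<beta> \<in> M.tails" for \<beta> i
      using M.first_outside[OF M.tails_rest[OF that, of i], of "\<beta> i"] by (simp add: vanish)
    have "tail E (\<beta> i) = tail E (cinf c i) \<and> \<beta> i = cinf c i" for i
    proof (induction i)
      case 0
      have "?v \<in> cycle_verts E c" using X.base_cycle by (simp add: X.base_def)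
      from X.c_unique[OF this] show ?case using out[OF b(1), of 0] out[OF M.\<alpha>_tails, of 0] b(2) v0 by auto
    next
      case (Suc i)
      have t: "tail E (\<beta> (Suc i)) = tail E (cinf c (Suc i))"
        using Suc M.tails_arc[OF b(1), of i] M.tails_arc[OF M.\<alpha>_tails, of i] by simp
      have "tail E (cinf c (Suc i)) \<in> cycle_verts E c"
        using cinf_path(2)[OF cyc] by (auto simp: infinite_path_verts_def)
      from X.c_unique[OF this] show ?case using out[OF b(1), of "Suc i"] out[OF M.\<alpha>_tails, of "Suc i"] t by auto
    qed
    then show ?thesis by auto
  qed
  have consl: "M.consl c (cinf c) = cinf c"
  proof
    fix i show "M.consl c (cinf c) i = cinf c i"
      by (cases "i < length c") (simp_all add: M.consl_path cinf_def le_mod_geq)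
  qed
  \<comment> \<open>The twisted edge \<open>hd c\<close> occurs once in c, so one turn multiplies by
    x and not by a higher power.\<close>
  have "distinct c" using cycle_awalk(3)[OF cyc] by (simp add: distinct_map)
  moreover obtain a c' where c': "c = a # c'" using cw(2) by (cases c) auto
  ultimately have "a \<notin> set c'" by simp
  then have "map ?t c' = map (\<lambda>_. 1) c'" "map ?t' c' = map (\<lambda>_. 1) c'" unfolding c' by auto
  then have tp: "M.tp c = Poly_Mapping.single 1 1" "M.tp' c = Poly_Mapping.single (- 1) 1"
    unfolding M.tp_def M.tp'_def by (simp_all add: c' map_replicate_const)
  have w: "awalk ?v c (tail E (cinf c 0))" using cw(1) v0 by simp
  have act_pe: "M.act (pe ?v c) (delta (cinf c) r) = delta (cinf c) (Poly_Mapping.single 1 1 * r)" for r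
    using M.act_pe_delta[OF M.\<alpha>_tails w] by (simp add: consl tp)
  have act_ge: "M.act (ge ?v c) (delta (cinf c) r) = delta (cinf c) (Poly_Mapping.single (- 1) 1 * r)" for r
    using M.act_ge_delta[OF M.\<alpha>_tails w] by (simp add: consl tp)
  have vv: "?v \<in> verts E" using cw(1) by auto
  have act_cpow: "M.act (cpow c n) (delta (cinf c) r) = delta (cinf c) (Poly_Mapping.single n 1 * r)" for n r
  proof (induction n arbitrary: r rule: int_induct[of _ 0])
    case base
    show ?case unfolding cpow_0[OF cw] M.act_vt[OF vv] using M.\<alpha>_tails v0 by (auto simp: delta_def)
  next
    case (step1 n)
    show ?case
      unfolding cpow_mult_pe[OF cw, symmetric] M.act_mult[OF cpow_alg[OF cw] pe_alg[OF cw(1)]] act_pe step1.IH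
      by (simp add: mult.assoc[symmetric] mult_single)
  next
    case (step2 n)
    show ?case
      unfolding ge_mult_cpow[OF cw, symmetric] M.act_mult[OF ge_alg[OF cw(1)] cpow_alg[OF cw]] step2.IH act_ge
      by (simp add: mult.assoc[symmetric] mult_single)
  qed
  have act_lev: "M.act (lev c g) (delta (cinf c) r) = delta (cinf c) (g * r)" for g r
  proof (induction g rule: poly_mapping_induct_add)
    case zero
    show ?case by (simp add: M.act_zero delta_def fun_eq_iff)
  next
    case (single n k)
    have "Poly_Mapping.single 0 k * (Poly_Mapping.single n 1 * r) = Poly_Mapping.single n k * r"
      by (simp add: mult.assoc[symmetric] mult_single)
    then show ?case
      unfolding lev_single M.act_scale[OF cpow_alg[OF cw]] act_cpow by (auto simp: delta_def)
  next
    case (add g h)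
    then show ?case
      unfolding lev_add M.act_add[OF lev_alg[OF cw] lev_alg[OF cw]] by (auto simp: delta_def distrib_right)
  qed
  have prim: "left_prim alg M.Ann"
  proof (rule M.path_left_prim)
    show "\<exists>a\<in>alg. \<forall>r. M.act a (delta (cinf c) r) = delta (cinf c) (s * r)" for s
      by (rule bexI[of _ "lev c s"]) (simp_all add: act_lev lev_alg[OF cw])
  qed
  have "lev c f \<in> M.Ann"
    unfolding M.Ann_def
  proof (intro CollectI conjI ballI allI)
    fix m b assume "m \<in> M.Xs"
    have "M.act (vt ?v) m = delta (cinf c) (m (cinf c))"
    proof
      fix b
      have "b \<in> M.tails \<and> tail E (b 0) = ?v \<longleftrightarrow> b = cinf c" using only[of b] M.\<alpha>_tails v0 by blast
      then show "M.act (vt ?v) m b = delta (cinf c) (m (cinf c)) b"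
        unfolding M.act_vt[OF vv] by (simp add: delta_def)
    qed
    then have "M.act (lev c f) m = delta (cinf c) (f * m (cinf c))"
      using M.act_mult[OF lev_alg[OF cw] vt_alg[OF vv], of f m] by (simp only: lev_vt[OF cw] act_lev)
    then show "f dvd M.act (lev c f) m b" by (simp add: delta_def)
  qed (rule lev_alg[OF cw])
  moreover have "vt ` H \<subseteq> M.Ann" using vanish by (auto simp: vanish_def)
  moreover have "bel H ` breaking_vertices E H \<subseteq> M.Ann" using M.breaking_path by (auto simp: vanish)
  ultimately have sub: "cidl H c f \<subseteq> M.Ann" unfolding cidl_def by (intro idl_least M.Ann_aideal) blast
  have "M.Ann = cidl H c f"
  proof (rule excl_ideal_eq[OF X M.Ann_aideal sub vanish])
    fix g assume "lev c g \<in> M.Ann"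
    then have "M.act (lev c g) (delta (cinf c) 1) (cinf c) \<in> {g. f dvd g}"
      using M.delta_Xs[OF M.\<alpha>_tails] by (auto simp: M.Ann_def)
    then have "f dvd g" unfolding act_lev by (simp add: delta_def)
    then obtain h where "g = h * f" by (metis dvdE mult.commute)
    then show "lev c g \<in> cidl H c f" using lev_ideal[OF cw J] base_in by simp
  qed
  then show ?thesis using prim vanish M.breaking_path unfolding prim_data_def by auto
qed

text \<open>The annihilator of a constructed module is itself a left primitive ideal to which the
  necessity part applies, so \<open>graded_eq\<close> identifies it.\<close>

lemma left_prim_gidl:
  assumes "left_prim alg P" "vanish P = H" "S = {u \<in> breaking_vertices E H. bel H u \<in> P}"
    and "\<And>w k y. noexit E H w \<Longrightarrow> k \<noteq> 0 \<Longrightarrow> y \<in> loops w \<Longrightarrow> \<kappa> k * vt w + y \<in> P \<Longrightarrow> False"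
  shows "prim_data (gidl H S) H S"
proof -
  obtain N u where "leavitt_prim E \<kappa> vt ed gh N P u" using left_prim_leavitt_prim[OF assms(1)] by blast
  then interpret leavitt_prim E \<kappa> vt ed gh N P u .
  have "P = gidl H S" unfolding assms(2)[symmetric]
    by (rule graded_eq) (use assms(2-4) in auto)
  then show ?thesis using assms(1-3) by (simp add: prim_data_def)
qed

text \<open>The trivial path at u has no first edge, so u^H, in case u is a breaking vertex, is the
  one such element that does not annihilate the paths ending in u.\<close>

lemma singular_left_prim:
  assumes u: "u \<in> verts E" "\<not> regular_vertex E u" and H: "H = verts E - root_set E {u}"
    and S: "S = breaking_vertices E H - {u}"
  shows "prim_data (gidl H S) H S"
proof -
  obtain P where P: "left_prim alg P" "vanish P = verts E - root_set E {u}"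
    "\<forall>w\<in>breaking_vertices E (vanish P). bel (vanish P) w \<in> P \<longleftrightarrow> w \<noteq> u"
    "\<forall>w k y. w \<in> verts E - vanish P \<longrightarrow> k \<noteq> 0 \<longrightarrow> y \<in> loops w \<longrightarrow> \<kappa> k * vt w + y \<notin> P"
    using singular_prim[OF u] by (elim exE conjE)
  have v: "vanish P = H" using P(2) H by simp
  show ?thesis
  proof (rule left_prim_gidl[OF P(1) v])
    show "S = {u \<in> breaking_vertices E H. bel H u \<in> P}" using P(3) unfolding v S by blast
    show False if "noexit E H w" "k \<noteq> 0" "y \<in> loops w" "\<kappa> k * vt w + y \<in> P" for w k y
      using P(4) that noexitD(1,2)[OF that(1)] unfolding v by blast
  qed
qed

lemma case_aD:
  "case_a P \<Longrightarrow> \<exists>H c. prim_data P H (breaking_vertices E H) \<and> exclusive_cycle E c \<and>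
     verts E - H = root_set E (cycle_verts E c)"
  unfolding case_a_def using exclusive_prim by (elim exE conjE) blast

lemma path_graded_prim:
  assumes "infinite_path E \<alpha>" "H = verts E - root_set E (infinite_path_verts E \<alpha>)" "\<And>w. \<not> noexit E H w"
  shows "prim_data (gidl H (breaking_vertices E H)) H (breaking_vertices E H)"
proof (rule infinite_path_prim[OF assms(1)])
  fix P assume P: "left_prim alg P" "vanish P = verts E - root_set E (infinite_path_verts E \<alpha>)"
    "\<And>u. u \<in> breaking_vertices E (vanish P) \<Longrightarrow> bel (vanish P) u \<in> P"
  have v: "vanish P = H" using P(2) assms(2) by simp
  show ?thesis
    by (rule left_prim_gidl[OF P(1) v]) (use P(3)[unfolded v] assms(3) in auto)
qed

text \<open>A vertex satisfying \<open>noexit\<close> reaches \<alpha> and returns from all later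
  vertices of \<alpha>, so these would reach earlier ones, against strict decrease. Hence the
  annihilator of the module of \<alpha> is graded.\<close>

lemma case_b1D:
  assumes "case_b1 P"
  shows "\<exists>H. prim_data P H (breaking_vertices E H) \<and> (\<forall>v\<in>verts E - H. root_set E {v} \<subset> verts E - H)"
proof -
  obtain H \<alpha> where H: "hereditary E H" and a: "infinite_path E \<alpha>" "strictly_decreasing E \<alpha>"
    "H = verts E - root_set E (infinite_path_verts E \<alpha>)"
    and sub: "\<forall>v\<in>verts E - H. root_set E {v} \<subset> root_set E (infinite_path_verts E \<alpha>)"
    and P: "P = gidl H (breaking_vertices E H)"
    using assms unfolding case_b1_def by (elim exE conjE)
  obtain k where k: "strict_mono k" "\<And>n. path_gt E (tail E (\<alpha> (k n))) (tail E (\<alpha> (k (Suc n))))"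
    using a(2) unfolding strictly_decreasing_def by blast
  have down: "path_geq E (tail E (\<alpha> n)) (tail E (\<alpha> (n + i)))" for n i
  proof (induction i)
    case 0
    then show ?case using a(1) path_geq_refl[of "tail E (\<alpha> n)"] by (simp add: infinite_path_def)
  next
    case (Suc i)
    have "\<alpha> (n + i) \<in> arcs E" "head E (\<alpha> (n + i)) = tail E (\<alpha> (n + Suc i))"
      using a(1) by (simp_all add: infinite_path_def)
    then show ?case using path_geq_trans[OF Suc] path_geq_arc[of "\<alpha> (n + i)"] by simp
  qed
  have out: "tail E (\<alpha> n) \<notin> H" for n
    using down[of n 0] a(1,3) by (auto simp: root_set_def infinite_path_verts_def infinite_path_def)
  have "\<not> noexit E H w" for w
  proof
    assume w: "noexit E H w"
    obtain n where n: "path_geq E w (tail E (\<alpha> n))"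
      using noexitD(1,2)[OF w] a(3) by (auto simp: root_set_def infinite_path_verts_def)
    have "n \<le> k n" by (rule strict_mono_imp_increasing[OF k(1)])
    then have x: "path_geq E w (tail E (\<alpha> (k n)))" using path_geq_trans[OF n] down[of n "k n - n"] by simp
    then have "path_geq E w (tail E (\<alpha> (k (Suc n))))" using k(2)[of n] path_geq_trans by (auto simp: path_gt_def)
    then obtain q where "awalk w q (tail E (\<alpha> (k (Suc n))))" by (auto simp: path_geq_def)
    then have "path_geq E (tail E (\<alpha> (k (Suc n)))) w"
      using noexit_return[OF H w _ out] by (auto simp: path_geq_def)
    then show False using path_geq_trans[OF _ x] k(2)[of n] by (auto simp: path_gt_def)
  qed
  then have "prim_data P H (breaking_vertices E H)" unfolding P by (rule path_graded_prim[OF a(1,3)])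
  moreover have "root_set E (infinite_path_verts E \<alpha>) = verts E - H" unfolding a(3) by (auto simp: root_set_def)
  ultimately show ?thesis using sub by auto
qed

text \<open>Were v regular, saturation would put it into H, as all its edges end there. So the paths
  ending in v give a module; and v is not a breaking vertex, whence no v^H is missing.\<close>

lemma case_b2D:
  assumes "case_b2 P"
  shows "\<exists>H v. prim_data P H (breaking_vertices E H) \<and> v \<in> verts E \<and> H = verts E - root_set E {v} \<and>
    (\<forall>e\<in>out_arcs E v. head E e \<notin> verts E - H)"
proof -
  obtain H v where H: "hereditary E H" "saturated E H" and v: "v \<in> verts E" "H = verts E - root_set E {v}"
    and e: "\<forall>e\<in>out_arcs E v. head E e \<notin> verts E - H" and P: "P = gidl H (breaking_vertices E H)"
    using assms unfolding case_b2_def by (elim exE conjE)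
  have "v \<notin> H" using v path_geq_refl by (auto simp: root_set_def)
  moreover have "head E ` out_arcs E v \<subseteq> H" using e by auto
  ultimately have "\<not> regular_vertex E v" using H(2) by (auto simp: saturated_def)
  moreover have "v \<notin> breaking_vertices E H" using e by (auto simp: breaking_vertices_def arcs_outside_def)
  then have "breaking_vertices E H = breaking_vertices E H - {v}" by blast
  ultimately have "prim_data P H (breaking_vertices E H)" unfolding P using singular_left_prim[OF v(1) _ v(2)] by simp
  then show ?thesis using v e by blast
qed

lemma cycle_singular_prim:
  assumes "cycle c" "v \<in> cycle_verts E c" "H = verts E - root_set E {v}"
    and "u \<in> breaking_vertices E H" "u \<in> cycle_verts E c" "S = breaking_vertices E H - {u}"
  shows "prim_data (gidl H S) H S"
proof (rule singular_left_prim[OF _ _ _ assms(6)])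
  show "u \<in> verts E" "\<not> regular_vertex E u"
    using assms(4) by (auto simp: breaking_vertices_def infinite_emitter_def regular_vertex_def)
  show "H = verts E - root_set E {u}"
    using assms(3) root_set_cycle[OF assms(1,2)] root_set_cycle[OF assms(1,5)] by simp
qed

text \<open>If the element at u is missing, the paths ending in u are used; u is on c and has the
  same root set as v. If none is missing, the module of ccc... is used: the exit of the extreme
  cycle excludes vertices satisfying \<open>noexit\<close>, so the annihilator is graded.\<close>

lemma case_b3D:
  assumes "case_b3 P"
  shows "\<exists>H S c. prim_data P H S \<and> extreme_cycle E (verts E - H) c \<and> verts E - H = root_set E (cycle_verts E c)"
proof -
  obtain H S v c where H: "hereditary E H" "saturated E H" and v: "v \<in> verts E" "H = verts E - root_set E {v}"
    and c: "extreme_cycle E (verts E - H) c" "v \<in> cycle_verts E c"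
    and S: "S = breaking_vertices E H \<or>
      (\<exists>u\<in>breaking_vertices E H. u \<in> cycle_verts E c \<and> S = breaking_vertices E H - {u})"
    and P: "P = gidl H S"
    using assms unfolding case_b3_def by (elim exE conjE)
  have cyc: "cycle c" using c(1) by (simp add: extreme_cycle_def)
  from S have "prim_data P H S"
  proof
    assume "\<exists>u\<in>breaking_vertices E H. u \<in> cycle_verts E c \<and> S = breaking_vertices E H - {u}"
    then show "prim_data P H S" unfolding P using cycle_singular_prim[OF cyc c(2) v(2)] by blast
  next
    assume S: "S = breaking_vertices E H"
    have "\<not> noexit E H w" for w
    proof
      assume w: "noexit E H w"
      obtain e where e: "exit_of E c e" "head E e \<in> verts E - H" using c(1) unfolding extreme_cycle_def by blast
      then have et: "e \<in> arcs_outside E H (tail E e)" "tail E e \<in> cycle_verts E c" "e \<notin> set c"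
        by (auto simp: exit_of_def arcs_outside_def)
      then obtain g where g: "g \<in> set c" "tail E g = tail E e" using cycle_awalk(4)[OF cyc] by auto
      have sub: "cycle_verts E c \<subseteq> verts E - H" using c(1) by (simp add: extreme_cycle_def)
      then have "g \<in> arcs_outside E H (tail E e)"
        using g cycle_arcs[OF cyc] cycle_head_verts[OF cyc g(1)] by (auto simp: arcs_outside_def)
      moreover have "path_geq E w v" using noexitD(1,2)[OF w] v(2) by (auto simp: root_set_def)
      then have "path_geq E w (tail E e)" using path_geq_trans cycle_connected[OF cyc c(2) et(2)] by blast
      then obtain q where "awalk w q (tail E e)" by (auto simp: path_geq_def)
      then have "\<exists>!e'. e' \<in> arcs_outside E H (tail E e)" by (rule noexitD(3)[OF w]) (use sub et(2) in blast)
      ultimately show False using et(1,3) g(1) by blast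
    qed
    moreover have "H = verts E - root_set E (infinite_path_verts E (cinf c))"
      using v(2) cinf_path(2)[OF cyc] root_set_cycle[OF cyc c(2)] by simp
    ultimately show "prim_data P H S" unfolding P S by (intro path_graded_prim[OF cinf_path(1)[OF cyc]])
  qed
  moreover have "verts E - H = root_set E (cycle_verts E c)"
    unfolding root_set_cycle[OF cyc c(2)] v(2) by (auto simp: root_set_def)
  ultimately show ?thesis using c(1) by blast
qed

lemma case_b4D:
  assumes "case_b4 P"
  shows "\<exists>H S c. prim_data P H S \<and> exclusive_cycle E c \<and> verts E - H = root_set E (cycle_verts E c) \<and>
    S \<noteq> breaking_vertices E H"
proof -
  obtain H S v c where v: "v \<in> verts E" "H = verts E - root_set E {v}"
    and c: "exclusive_cycle E c" "v \<in> cycle_verts E c"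
    and S: "\<exists>u\<in>breaking_vertices E H. u \<in> cycle_verts E c \<and> S = breaking_vertices E H - {u}"
    and P: "P = gidl H S"
    using assms unfolding case_b4_def by (elim exE conjE)
  have cyc: "cycle c" using c(1) by (simp add: exclusive_cycle_def)
  have "verts E - H = root_set E (cycle_verts E c)"
    unfolding root_set_cycle[OF cyc c(2)] v(2) by (auto simp: root_set_def)
  moreover have "prim_data P H S" unfolding P using cycle_singular_prim[OF cyc c(2) v(2)] S by blast
  ultimately show ?thesis using S c(1) by blast
qed

section \<open>Left primitive ideals and their images under the involution\<close>

lemma left_prim_iff: "left_prim alg P \<longleftrightarrow> case_a P \<or> case_b1 P \<or> case_b2 P \<or> case_b3 P \<or> case_b4 P"
proof
  assume "case_a P \<or> case_b1 P \<or> case_b2 P \<or> case_b3 P \<or> case_b4 P"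
  then have "\<exists>H S. prim_data P H S" using case_aD[of P] case_b1D[of P] case_b2D[of P] case_b3D[of P] case_b4D[of P] by blast
  then show "left_prim alg P" by (auto simp: prim_data_def)
qed (rule left_prim_cases)

text \<open>The involution fixes the generators of the graded ideals. In (a) it replaces f by its
  image under x \<mapsto> x^-1, which is again irreducible.\<close>

lemma star_cases:
  "case_a P \<Longrightarrow> case_a (star ` P)" "case_b1 P \<Longrightarrow> star ` P = P" "case_b2 P \<Longrightarrow> star ` P = P"
  "case_b3 P \<Longrightarrow> star ` P = P" "case_b4 P \<Longrightarrow> star ` P = P"
proof -
  show "case_a (star ` P)" if a: "case_a P"
  proof -
    obtain H c f where H: "hereditary E H" "saturated E H" "exclusive_cycle E c"
      "verts E - H = root_set E (cycle_verts E c)" and f: "Factorial_Ring.irreducible f" and P: "P = cidl H c f"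
      using a unfolding case_a_def by (elim exE conjE)
    have "star ` P = cidl H c (lbar f)"
      unfolding P using H by (intro star_cidl) (auto simp: hereditary_def exclusive_cycle_def)
    then show ?thesis unfolding case_a_def using H lbar_irreducible[OF f] by blast
  qed
  have g: "star ` gidl H S = gidl H S" if "hereditary E H" "S \<subseteq> breaking_vertices E H" for H S
    using that by (intro star_gidl) (auto simp: hereditary_def)
  show "case_b1 P \<Longrightarrow> star ` P = P" unfolding case_b1_def using g by (elim exE conjE) simp
  show "case_b2 P \<Longrightarrow> star ` P = P" unfolding case_b2_def using g by (elim exE conjE) simp
  show "case_b3 P \<Longrightarrow> star ` P = P" unfolding case_b3_def using g by (elim exE conjE disjE bexE) auto
  show "case_b4 P \<Longrightarrow> star ` P = P" unfolding case_b4_def using g by (elim exE conjE bexE) auto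
qed

lemma primitive_cases:
  assumes "aideal P"
  shows "primitive_ideal (psi ` P) (lpa E) \<longleftrightarrow> case_a P \<or> case_b1 P \<or> case_b2 P \<or> case_b3 P \<or> case_b4 P"
proof -
  have "left_prim alg (star ` P)" if "left_prim alg P"
    using that star_cases[of P] unfolding left_prim_iff by auto
  then show ?thesis unfolding primitive_iff[OF assms] left_prim_iff[symmetric] by blast
qed

end

section \<open>The five cases exclude each other\<close>

context wf_digraph
begin

text \<open>On a walk from c whose end leads back to its start, every edge can return and so lies on
  c. An exclusive cycle is thus a full strongly connected component.\<close>

lemma exclusive_component:
  assumes c: "exclusive_cycle G c"
  shows "awalk x p z \<Longrightarrow> x \<in> cycle_verts G c \<Longrightarrow> path_geq G z x \<Longrightarrow> z \<in> cycle_verts G c"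
proof (induction p arbitrary: x)
  case Nil
  then show ?case by (simp add: awalk_Nil_iff)
next
  case (Cons e p)
  then have e: "e \<in> arcs G" "tail G e = x" "awalk (head G e) p z" by (auto simp: awalk_simps)
  have z: "path_geq G (head G e) z" using e(3) by (auto simp: path_geq_def)
  then have "path_geq G (head G e) (tail G e)" using path_geq_trans[OF z Cons.prems(3)] e(2) by simp
  then have "e \<in> set c" using exclusive_cycle_arc[OF c e(1)] e(2) Cons.prems(2) by simp
  then have "head G e \<in> cycle_verts G c" using cycle_head_verts c by (simp add: exclusive_cycle_def)
  moreover have "path_geq G z (head G e)"
    using path_geq_trans[OF Cons.prems(3)] path_geq_arc[OF e(1)] e(2) by simp
  ultimately show ?case using Cons.IH[OF e(3)] by blast
qed

text \<open>Equal root sets put d into the component of c. The exit of d into V can return, so it is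
  an edge of c, and so is the edge of d with the same source. On c these two would coincide, but an
  exit is not on d.\<close>

lemma exclusive_not_extreme:
  assumes c: "exclusive_cycle G c" and d: "extreme_cycle G V d"
    and V: "V = root_set G (cycle_verts G c)" "V = root_set G (cycle_verts G d)"
  shows False
proof -
  have cyc: "cycle c" "cycle d" using c d by (simp_all add: exclusive_cycle_def extreme_cycle_def)
  have d_c: "y \<in> cycle_verts G c" if y: "y \<in> cycle_verts G d" for y
  proof -
    have "y \<in> V" using y d by (auto simp: extreme_cycle_def)
    then obtain x where x: "x \<in> cycle_verts G c" "path_geq G y x" unfolding V(1) by (auto simp: root_set_def)
    have "x \<in> V" unfolding V(1) using x path_geq_verts(2)[OF x(2)] path_geq_refl by (auto simp: root_set_def)
    then obtain y' where y': "y' \<in> cycle_verts G d" "path_geq G x y'" unfolding V(2) by (auto simp: root_set_def)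
    then have "path_geq G x y" using path_geq_trans cycle_connected[OF cyc(2) y'(1) y] by blast
    then obtain p where "awalk x p y" by (auto simp: path_geq_def)
    then show ?thesis by (rule exclusive_component[OF c _ x])
  qed
  have in_c: "e \<in> set c" if e: "e \<in> arcs G" "tail G e \<in> cycle_verts G d" "head G e \<in> V" for e
  proof -
    obtain y where y: "y \<in> cycle_verts G d" "path_geq G (head G e) y" using e(3) V(2) by (auto simp: root_set_def)
    then have "path_geq G (head G e) (tail G e)" using path_geq_trans cycle_connected[OF cyc(2) y(1) e(2)] by blast
    then show ?thesis by (rule exclusive_cycle_arc[OF c e(1) d_c[OF e(2)]])
  qed
  obtain e where e: "exit_of G d e" "head G e \<in> V" using d unfolding extreme_cycle_def by blast
  then have e': "e \<in> arcs G" "e \<notin> set d" "tail G e \<in> cycle_verts G d" by (auto simp: exit_of_def)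
  then obtain g where g: "g \<in> set d" "tail G g = tail G e" using cycle_awalk(4)[OF cyc(2)] by auto
  have "g \<in> arcs G" "head G g \<in> V"
    using g(1) cycle_arcs[OF cyc(2)] cycle_head_verts[OF cyc(2)] d by (auto simp: extreme_cycle_def)
  then have "g \<in> set c" "e \<in> set c" using in_c e' e(2) g(2) by simp_all
  then show False using cycle_tail_inj[OF cyc(1)] g e'(2) by blast
qed

text \<open>Every vertex in the root set of a cycle emits an edge into this set, along a walk to the
  cycle or along the cycle itself.\<close>

lemma terminal_not_cycle:
  assumes v: "v \<in> verts G" "\<And>e. e \<in> out_arcs G v \<Longrightarrow> head G e \<notin> root_set G (cycle_verts G c)"
    and c: "cycle c" and r: "v \<in> root_set G (cycle_verts G c)"
  shows False
proof -
  have c_root: "cycle_verts G c \<subseteq> root_set G (cycle_verts G c)"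
  proof
    fix x assume x: "x \<in> cycle_verts G c"
    then have "path_geq G x x" by (rule cycle_connected[OF c x])
    then show "x \<in> root_set G (cycle_verts G c)" using x path_geq_verts(1) by (auto simp: root_set_def)
  qed
  obtain x p where x: "x \<in> cycle_verts G c" "awalk v p x" using r by (auto simp: root_set_def path_geq_def)
  show False
  proof (cases p)
    case Nil
    then have "v \<in> cycle_verts G c" using x by (auto simp: awalk_simps)
    then obtain g where "g \<in> set c" "tail G g = v" using cycle_awalk(4)[OF c] by auto
    then show False using v(2)[of g] cycle_arcs[OF c] cycle_head_verts[OF c] c_root by auto
  next
    case (Cons e q)
    then have e: "e \<in> out_arcs G v" "awalk (head G e) q x" using x(2) by (auto simp: awalk_simps)
    then have "head G e \<in> root_set G (cycle_verts G c)" using x(1) by (auto simp: root_set_def path_geq_def)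
    then show False using v(2) e(1) by blast
  qed
qed

text \<open>A single vertex of c already has the whole root set of c.\<close>

lemma cycle_root_proper:
  assumes "cycle c" "verts G - H = root_set G (cycle_verts G c)"
    and "\<forall>v\<in>verts G - H. root_set G {v} \<subset> verts G - H"
  shows False
proof -
  have v: "tail G (hd c) \<in> cycle_verts G c" using cycle_awalk(1,4)[OF assms(1)] by simp
  moreover have "tail G (hd c) \<in> verts G" using cycle_awalk(2)[OF assms(1)] by auto
  ultimately have "tail G (hd c) \<in> verts G - H"
    unfolding assms(2) using path_geq_refl by (auto simp: root_set_def)
  then show False using assms(2,3) root_set_cycle[OF assms(1) v] by blast
qed

end

section \<open>Exclusion through the data of the ideal\<close>

context lpa_emb
begin

lemma prim_data_unique: "prim_data P H S \<Longrightarrow> prim_data P H' S' \<Longrightarrow> H' = H \<and> S' = S"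
  by (auto simp: prim_data_def)

text \<open>The common part of (a), (b3) and (b4), which is enough to separate them from (b1) and
  (b2).\<close>

definition cyclic_data where
  "cyclic_data P H S c \<longleftrightarrow> prim_data P H S \<and> cycle c \<and> verts E - H = root_set E (cycle_verts E c)"

lemma cyclic_dataI:
  "case_a P \<Longrightarrow> \<exists>H c. cyclic_data P H (breaking_vertices E H) c \<and> exclusive_cycle E c"
  "case_b3 P \<Longrightarrow> \<exists>H S c. cyclic_data P H S c \<and> extreme_cycle E (verts E - H) c"
  "case_b4 P \<Longrightarrow> \<exists>H S c. cyclic_data P H S c \<and> exclusive_cycle E c \<and> S \<noteq> breaking_vertices E H"
proof -
  show "case_a P \<Longrightarrow> \<exists>H c. cyclic_data P H (breaking_vertices E H) c \<and> exclusive_cycle E c"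
    using case_aD[of P] unfolding cyclic_data_def exclusive_cycle_def by blast
  show "case_b3 P \<Longrightarrow> \<exists>H S c. cyclic_data P H S c \<and> extreme_cycle E (verts E - H) c"
    using case_b3D[of P] unfolding cyclic_data_def extreme_cycle_def by blast
  show "case_b4 P \<Longrightarrow> \<exists>H S c. cyclic_data P H S c \<and> exclusive_cycle E c \<and> S \<noteq> breaking_vertices E H"
    using case_b4D[of P] unfolding cyclic_data_def exclusive_cycle_def by blast
qed

lemma b1_not_cyclic: "case_b1 P \<Longrightarrow> cyclic_data P H S c \<Longrightarrow> False"
proof -
  assume "case_b1 P" and c: "cyclic_data P H S c"
  then obtain H' where "prim_data P H' (breaking_vertices E H')"
    "\<forall>v\<in>verts E - H'. root_set E {v} \<subset> verts E - H'" using case_b1D by blast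
  then show False using c prim_data_unique cycle_root_proper[of c H] unfolding cyclic_data_def by metis
qed

lemma b1_not_b2: "case_b1 P \<Longrightarrow> case_b2 P \<Longrightarrow> False"
proof -
  assume "case_b1 P" "case_b2 P"
  then obtain H H' v where H: "prim_data P H (breaking_vertices E H)"
    "\<forall>v\<in>verts E - H. root_set E {v} \<subset> verts E - H" "prim_data P H' (breaking_vertices E H')"
    "v \<in> verts E" "H' = verts E - root_set E {v}" using case_b1D case_b2D by metis
  have "H' = H" using prim_data_unique[OF H(1,3)] by blast
  then have "verts E - H = root_set E {v}" "v \<in> verts E - H"
    using H(4,5) path_geq_refl[OF H(4)] by (auto simp: root_set_def)
  then show False using H(2) by blast
qed

lemma b2_not_cyclic: "case_b2 P \<Longrightarrow> cyclic_data P H S c \<Longrightarrow> False"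
proof -
  assume "case_b2 P" and c: "cyclic_data P H S c"
  then obtain H' v where H: "prim_data P H' (breaking_vertices E H')" "v \<in> verts E"
    "H' = verts E - root_set E {v}" "\<forall>e\<in>out_arcs E v. head E e \<notin> verts E - H'" using case_b2D by metis
  have c': "prim_data P H S" "cycle c" "verts E - H = root_set E (cycle_verts E c)"
    using c by (simp_all add: cyclic_data_def)
  have e: "H = H'" using prim_data_unique[OF H(1) c'(1)] by simp
  show False
  proof (rule terminal_not_cycle[OF H(2) _ c'(2)])
    show "head E e \<notin> root_set E (cycle_verts E c)" if "e \<in> out_arcs E v" for e
      unfolding c'(3)[symmetric] e using H(4) that by blast
    show "v \<in> root_set E (cycle_verts E c)"
      unfolding c'(3)[symmetric] e H(3) using H(2) path_geq_refl by (auto simp: root_set_def)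
  qed
qed

lemma exclusive_extreme_data:
  assumes "cyclic_data P H S c" "exclusive_cycle E c" "cyclic_data P H' S' d" "extreme_cycle E (verts E - H') d"
  shows False
proof -
  have "H' = H" using assms(1,3) prim_data_unique unfolding cyclic_data_def by blast
  then show False using exclusive_not_extreme[OF assms(2,4)] assms(1,3) unfolding cyclic_data_def by blast
qed

text \<open>As P determines H and S, conditions (a) and (b4) differ in S. Both differ from (b3),
  because an exclusive and an extreme cycle never have the same root set.\<close>

lemma cases_exclusive:
  "\<not> (case_a P \<and> case_b1 P)" "\<not> (case_a P \<and> case_b2 P)" "\<not> (case_a P \<and> case_b3 P)" "\<not> (case_a P \<and> case_b4 P)"
  "\<not> (case_b1 P \<and> case_b2 P)" "\<not> (case_b1 P \<and> case_b3 P)" "\<not> (case_b1 P \<and> case_b4 P)"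
  "\<not> (case_b2 P \<and> case_b3 P)" "\<not> (case_b2 P \<and> case_b4 P)" "\<not> (case_b3 P \<and> case_b4 P)"
proof -
  show "\<not> (case_a P \<and> case_b1 P)" "\<not> (case_a P \<and> case_b2 P)"
    using cyclic_dataI(1) b1_not_cyclic b2_not_cyclic by metis+
  show "\<not> (case_b1 P \<and> case_b3 P)" "\<not> (case_b2 P \<and> case_b3 P)"
    using cyclic_dataI(2) b1_not_cyclic b2_not_cyclic by metis+
  show "\<not> (case_b1 P \<and> case_b4 P)" "\<not> (case_b2 P \<and> case_b4 P)"
    using cyclic_dataI(3) b1_not_cyclic b2_not_cyclic by metis+
  show "\<not> (case_b1 P \<and> case_b2 P)" using b1_not_b2 by blast
  show "\<not> (case_a P \<and> case_b3 P)"
    using cyclic_dataI(1)[of P] cyclic_dataI(2)[of P] exclusive_extreme_data by metis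
  show "\<not> (case_b3 P \<and> case_b4 P)"
    using cyclic_dataI(3)[of P] cyclic_dataI(2)[of P] exclusive_extreme_data by metis
  show "\<not> (case_a P \<and> case_b4 P)"
  proof
    assume "case_a P \<and> case_b4 P"
    then obtain H c H' S c' where "cyclic_data P H (breaking_vertices E H) c" "cyclic_data P H' S c'"
      "S \<noteq> breaking_vertices E H'" using cyclic_dataI(1)[of P] cyclic_dataI(3)[of P] by metis
    then show False using prim_data_unique unfolding cyclic_data_def by metis
  qed
qed

end

section \<open>The equivalence for ideals of \<open>lpa E\<close>\<close>

lemma exactly_one_nested:
  "\<not> (A \<and> B1) \<Longrightarrow> \<not> (A \<and> B2) \<Longrightarrow> \<not> (A \<and> B3) \<Longrightarrow> \<not> (A \<and> B4) \<Longrightarrow> \<not> (B1 \<and> B2) \<Longrightarrow> \<not> (B1 \<and> B3) \<Longrightarrow>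
    \<not> (B1 \<and> B4) \<Longrightarrow> \<not> (B2 \<and> B3) \<Longrightarrow> \<not> (B2 \<and> B4) \<Longrightarrow> \<not> (B3 \<and> B4) \<Longrightarrow>
    exactly_one [A, exactly_one [B1, B2, B3, B4]] \<longleftrightarrow> A \<or> B1 \<or> B2 \<or> B3 \<or> B4"
  by (cases A; cases B1; cases B2; cases B3; cases B4; simp add: exactly_one_def)

theorem corollary3p11:
  fixes E :: "('v, 'e) pre_digraph" and P :: "('v, 'e, 'k::field) lpa_elem set"
  assumes "wf_digraph E" and "two_sided_ideal P (lpa E)"
  shows "primitive_ideal P (lpa E) \<longleftrightarrow>
    exactly_one [
      \<comment> \<open>(a)\<close>
      \<exists>H c f. hereditary E H \<and> saturated E H \<and> exclusive_cycle E c \<and>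
        verts E - H = root_set E (cycle_verts E c) \<and> Factorial_Ring.irreducible (f :: 'k laurent_poly) \<and>
        P = graded_ideal E H (breaking_vertices E H)
              <+>\<^bsub>lpa E\<^esub> ideal_gen (lpa E) {laurent_eval E f c},
      \<comment> \<open>(b)\<close>
      exactly_one [
        \<comment> \<open>(b1)\<close>
        \<exists>H \<alpha>. hereditary E H \<and> saturated E H \<and>
          infinite_path E \<alpha> \<and> strictly_decreasing E \<alpha> \<and>
          H = verts E - root_set E (infinite_path_verts E \<alpha>) \<and>
          (\<forall>v\<in>verts E - H. root_set E {v} \<subset> root_set E (infinite_path_verts E \<alpha>)) \<and>
          P = graded_ideal E H (breaking_vertices E H),
        \<comment> \<open>(b2)\<close>
        \<exists>H v. hereditary E H \<and> saturated E H \<and>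
          v \<in> verts E \<and> H = verts E - root_set E {v} \<and>
          (\<forall>e\<in>out_arcs E v. head E e \<notin> verts E - H) \<and>
          P = graded_ideal E H (breaking_vertices E H),
        \<comment> \<open>(b3)\<close>
        \<exists>H S v c. hereditary E H \<and> saturated E H \<and>
          v \<in> verts E \<and> H = verts E - root_set E {v} \<and>
          extreme_cycle E (verts E - H) c \<and> v \<in> cycle_verts E c \<and>
          (S = breaking_vertices E H \<or>
           (\<exists>u\<in>breaking_vertices E H. u \<in> cycle_verts E c \<and> S = breaking_vertices E H - {u})) \<and>
          P = graded_ideal E H S,
        \<comment> \<open>(b4)\<close>
        \<exists>H S v c. hereditary E H \<and> saturated E H \<and>
          v \<in> verts E \<and> H = verts E - root_set E {v} \<and>
          exclusive_cycle E c \<and> v \<in> cycle_verts E c \<and>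
          (\<exists>u\<in>breaking_vertices E H. u \<in> cycle_verts E c \<and> S = breaking_vertices E H - {u}) \<and>
          P = graded_ideal E H S]]"
proof -
  interpret lpa_emb E "TYPE('k)" using assms(1) by (simp add: lpa_emb_def)
  \<comment> \<open>The ideal is pulled back along \<open>psi\<close>, and each condition on P
    becomes the corresponding one on Q.\<close>
  define Q where "Q = {x \<in> alg. psi x \<in> P}"
  have Q: "aideal Q" "psi ` Q = P" using aideal_preimage[OF assms(2)] by (simp_all add: Q_def)
  have sub: "aideal J \<Longrightarrow> J \<subseteq> alg" for J by (simp add: aideal_def)
  have eq: "P = psi ` J \<longleftrightarrow> Q = J" if "aideal J" for J
    unfolding Q(2)[symmetric]
    by (rule inj_on_image_eq_iff[OF bij_betw_imp_inj_on[OF psi_bij] sub[OF Q(1)] sub[OF that]])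
  have graded: "P = graded_ideal E H S \<longleftrightarrow> Q = gidl H S"
    if H: "hereditary E H" and S: "S \<subseteq> breaking_vertices E H" for H S
  proof -
    have "H \<subseteq> verts E" using H by (simp add: hereditary_def)
    then show ?thesis using graded_psi[OF _ S] eq[OF gidl_aideal[OF _ S]] by simp
  qed
  have cyclic: "P = graded_ideal E H (breaking_vertices E H) <+>\<^bsub>lpa E\<^esub> ideal_gen (lpa E) {laurent_eval E f c}
      \<longleftrightarrow> Q = cidl H c f" if H: "hereditary E H" and c: "exclusive_cycle E c" for H c f
  proof -
    have Hv: "H \<subseteq> verts E" using H by (simp add: hereditary_def)
    have cyc: "cycle c" using c by (simp add: exclusive_cycle_def)
    have "aideal (cidl H c f)"
      unfolding cidl_def using gidl_gens_alg[OF Hv order_refl] lev_alg[OF cycle_awalk(2,1)[OF cyc]]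
      by (intro idl_aideal) blast
    then show ?thesis using cidl_psi[OF Hv cyc] eq by simp
  qed
  have a: "(\<exists>H c f. hereditary E H \<and> saturated E H \<and> exclusive_cycle E c \<and>
        verts E - H = root_set E (cycle_verts E c) \<and> Factorial_Ring.irreducible (f :: 'k laurent_poly) \<and>
        P = graded_ideal E H (breaking_vertices E H)
              <+>\<^bsub>lpa E\<^esub> ideal_gen (lpa E) {laurent_eval E f c}) \<longleftrightarrow> case_a Q"
    unfolding case_a_def by (intro ex_cong1 conj_cong refl cyclic)
  have b1: "(\<exists>H \<alpha>. hereditary E H \<and> saturated E H \<and>
          infinite_path E \<alpha> \<and> strictly_decreasing E \<alpha> \<and>
          H = verts E - root_set E (infinite_path_verts E \<alpha>) \<and>
          (\<forall>v\<in>verts E - H. root_set E {v} \<subset> root_set E (infinite_path_verts E \<alpha>)) \<and>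
          P = graded_ideal E H (breaking_vertices E H)) \<longleftrightarrow> case_b1 Q"
    unfolding case_b1_def by (intro ex_cong1 conj_cong refl graded order_refl)
  have b2: "(\<exists>H v. hereditary E H \<and> saturated E H \<and>
          v \<in> verts E \<and> H = verts E - root_set E {v} \<and>
          (\<forall>e\<in>out_arcs E v. head E e \<notin> verts E - H) \<and>
          P = graded_ideal E H (breaking_vertices E H)) \<longleftrightarrow> case_b2 Q"
    unfolding case_b2_def by (intro ex_cong1 conj_cong refl graded order_refl)
  have b3: "(\<exists>H S v c. hereditary E H \<and> saturated E H \<and>
          v \<in> verts E \<and> H = verts E - root_set E {v} \<and>
          extreme_cycle E (verts E - H) c \<and> v \<in> cycle_verts E c \<and>
          (S = breaking_vertices E H \<or>
           (\<exists>u\<in>breaking_vertices E H. u \<in> cycle_verts E c \<and> S = breaking_vertices E H - {u})) \<and>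
          P = graded_ideal E H S) \<longleftrightarrow> case_b3 Q"
    unfolding case_b3_def by (intro ex_cong1 conj_cong refl graded) auto
  have b4: "(\<exists>H S v c. hereditary E H \<and> saturated E H \<and>
          v \<in> verts E \<and> H = verts E - root_set E {v} \<and>
          exclusive_cycle E c \<and> v \<in> cycle_verts E c \<and>
          (\<exists>u\<in>breaking_vertices E H. u \<in> cycle_verts E c \<and> S = breaking_vertices E H - {u}) \<and>
          P = graded_ideal E H S) \<longleftrightarrow> case_b4 Q"
    unfolding case_b4_def by (intro ex_cong1 conj_cong refl graded) auto
  show ?thesis
    unfolding a b1 b2 b3 b4 exactly_one_nested[OF cases_exclusive]
    using primitive_cases[OF Q(1)] unfolding Q(2) .
qed

end
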